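(* Let $d\geq 1$ be an integer. If $F$ is a finite subset of $GL_d(\overline{\mathbb{Q}})$, then $\widehat{h}(F)=0$ if and only if the group generated by $F$ is virtually unipotent.
   Context: A subgroup of $GL_d$ is virtually unipotent if it has a finite index subgroup all of whose elements are unipotent. Here $\overline{\mathbb{Q}}$ is the field of algebraic numbers. For a number field $K$, $V_K$ is the set of equivalence classes of nontrivial absolute values on $K$; for $v\in V_K$, $K_v$ is the completion, $\mathbb{Q}_p$ (with $\mathbb{Q}_\infty=\mathbb{R}$) is the closure of $\mathbb{Q}$ in $K_v$, $n_v=[K_v:\mathbb{Q}_p]$, and $|\cdot|_v$ is normalized to extend the standard absolute value of $\mathbb{Q}_p$ ($|p|_p=1/p$, or the usual one on $\mathbb{R}$). On $K_v^d$ the standard norm is the sup norm if $v$ is ultrametric and the Euclidean (Hermitian) norm $\sqrt{\sum_i|x_i|_v^2}$ otherwise; $\|f\|_v$ is the associated operator norm of $f\in M_d(K_v)$. For a finite set $F\subset M_d(K)$, $\|F\|_v=\max_{f\in F}\|f\|_v$ and $h(F)=\frac{1}{[K:\mathbb{Q}]}\sum_{v\in V_K}n_v\log^+\|F\|_v$, where $\log^+=\max\{0,\log\}$; this does not depend on the choice of $K$. With $F^n=F\cdots F$ the set of all products of $n$ elements of $F$, the normalized height is $\widehat{h}(F)=\lim_{n\to+\infty}\frac1n h(F^n)$ (the limit exists by subadditivity). *)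

theory Defs
  imports
    "HOL-Analysis.Infinite_Sum"
    "HOL-Computational_Algebra.Computational_Algebra"
    "HOL-Algebra.QuotRing"
    "HOL-Algebra.Embedded_Algebras"
    "Jordan_Normal_Form.VS_Connect"
begin

section \<open>Number fields and their absolute values\<close>

text \<open>
  Number fields are taken inside the complex numbers, and the field of algebraic numbers is the
  set of algebraic complex numbers. The record \<open>class_ring\<close> at type \<^typ>\<open>complex\<close> is the field of
  complex numbers in the sense of HOL-Algebra.
\<close>

abbreviation \<CC> :: "complex ring" where
  "\<CC> \<equiv> class_ring"

definition Qbar :: "complex set" where
  "Qbar = {z. algebraic z}"

definition number_field :: "complex set \<Rightarrow> bool" where
  "number_field K \<longleftrightarrow> subfield K \<CC> \<and> ring.finite_dimension \<CC> \<rat> K"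

text \<open>
  An absolute value on \<open>K\<close> is made extensional, so that it is determined by its values on \<open>K\<close>.
\<close>

definition absolute_value :: "complex set \<Rightarrow> (complex \<Rightarrow> real) \<Rightarrow> bool" where
  "absolute_value K a \<longleftrightarrow>
     a \<in> extensional K \<and>
     (\<forall>x\<in>K. 0 \<le> a x) \<and>
     (\<forall>x\<in>K. a x = 0 \<longleftrightarrow> x = 0) \<and>
     (\<forall>x\<in>K. \<forall>y\<in>K. a (x * y) = a x * a y) \<and>
     (\<forall>x\<in>K. \<forall>y\<in>K. a (x + y) \<le> a x + a y)"

definition nontrivial_abs_values :: "complex set \<Rightarrow> (complex \<Rightarrow> real) set" where
  "nontrivial_abs_values K = {a. absolute_value K a \<and> (\<exists>x\<in>K. x \<noteq> 0 \<and> a x \<noteq> 1)}"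

definition abs_equiv :: "complex set \<Rightarrow> ((complex \<Rightarrow> real) \<times> (complex \<Rightarrow> real)) set" where
  "abs_equiv K = {(a, b). a \<in> nontrivial_abs_values K \<and> b \<in> nontrivial_abs_values K \<and>
     (\<exists>s>0. \<forall>x\<in>K. b x = a x powr s)}"

definition places :: "complex set \<Rightarrow> (complex \<Rightarrow> real) set set" where
  "places K = nontrivial_abs_values K // abs_equiv K"

definition padic_abs :: "nat \<Rightarrow> rat \<Rightarrow> real" where
  "padic_abs p q = (if q = 0 then 0 else
     (case quotient_of q of (m, n) \<Rightarrow>
        real p powi (int (multiplicity (int p) n) - int (multiplicity (int p) m))))"

definition extends_standard :: "(complex \<Rightarrow> real) \<Rightarrow> bool" where
  "extends_standard a \<longleftrightarrow>
     (\<forall>q::rat. a (of_rat q) = \<bar>of_rat q\<bar>) \<or>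
     (\<exists>p. prime p \<and> (\<forall>q::rat. a (of_rat q) = padic_abs p q))"

text \<open>
  Each place of a number field contains exactly one absolute value that extends a standard one
  of the rationals.
\<close>

definition place_abs :: "(complex \<Rightarrow> real) set \<Rightarrow> complex \<Rightarrow> real" where
  "place_abs v = (THE a. a \<in> v \<and> extends_standard a)"

definition ultrametric :: "complex set \<Rightarrow> (complex \<Rightarrow> real) \<Rightarrow> bool" where
  "ultrametric K a \<longleftrightarrow> (\<forall>x\<in>K. \<forall>y\<in>K. a (x + y) \<le> max (a x) (a y))"


section \<open>Completions\<close>

text \<open>
  The completion of \<open>K\<close> is the ring of Cauchy sequences modulo the ideal of null sequences.
\<close>

definition cauchy_ring :: "complex set \<Rightarrow> (complex \<Rightarrow> real) \<Rightarrow> (nat \<Rightarrow> complex) ring" where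
  "cauchy_ring K a =
     \<lparr> carrier = {X. (\<forall>n. X n \<in> K) \<and>
         (\<forall>e>0. \<exists>N. \<forall>m\<ge>N. \<forall>n\<ge>N. a (X m - X n) < e)},
       mult = (\<lambda>X Y n. X n * Y n),
       one = (\<lambda>_. 1),
       zero = (\<lambda>_. 0),
       add = (\<lambda>X Y n. X n + Y n) \<rparr>"

definition null_seqs :: "complex set \<Rightarrow> (complex \<Rightarrow> real) \<Rightarrow> (nat \<Rightarrow> complex) set" where
  "null_seqs K a = {X. (\<forall>n. X n \<in> K) \<and> (\<lambda>n. a (X n)) \<longlonglongrightarrow> 0}"

definition completion ::
    "complex set \<Rightarrow> (complex \<Rightarrow> real) \<Rightarrow> (nat \<Rightarrow> complex) set ring" where
  "completion K a = cauchy_ring K a Quot null_seqs K a"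

definition to_completion ::
    "complex set \<Rightarrow> (complex \<Rightarrow> real) \<Rightarrow> complex \<Rightarrow> (nat \<Rightarrow> complex) set" where
  "to_completion K a x = null_seqs K a +>\<^bsub>cauchy_ring K a\<^esub> (\<lambda>_. x)"

definition completion_abs :: "(complex \<Rightarrow> real) \<Rightarrow> (nat \<Rightarrow> complex) set \<Rightarrow> real" where
  "completion_abs a \<xi> = (THE r. \<forall>X\<in>\<xi>. (\<lambda>n. a (X n)) \<longlonglongrightarrow> r)"

definition rat_closure ::
    "complex set \<Rightarrow> (complex \<Rightarrow> real) \<Rightarrow> (nat \<Rightarrow> complex) set set" where
  "rat_closure K a = {\<xi> \<in> carrier (completion K a).
     \<forall>e>0. \<exists>q\<in>\<rat>. completion_abs a (\<xi> \<ominus>\<^bsub>completion K a\<^esub> to_completion K a q) < e}"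

definition local_degree :: "complex set \<Rightarrow> (complex \<Rightarrow> real) \<Rightarrow> nat" where
  "local_degree K a =
     ring.dim (completion K a) (rat_closure K a) (carrier (completion K a))"


section \<open>Norms and heights\<close>

definition completion_vecs ::
    "complex set \<Rightarrow> (complex \<Rightarrow> real) \<Rightarrow> nat \<Rightarrow> (nat \<Rightarrow> complex) set vec set" where
  "completion_vecs K a d = {x \<in> carrier_vec d. \<forall>i<d. x $ i \<in> carrier (completion K a)}"

definition vec_norm :: "complex set \<Rightarrow> (complex \<Rightarrow> real) \<Rightarrow> (nat \<Rightarrow> complex) set vec \<Rightarrow> real" where
  "vec_norm K a x =
     (if ultrametric K a then Max ((\<lambda>i. completion_abs a (x $ i)) ` {..<dim_vec x})
      else sqrt (\<Sum>i<dim_vec x. (completion_abs a (x $ i))\<^sup>2))"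

definition ring_mult_mat_vec :: "('r, 'm) ring_scheme \<Rightarrow> 'r mat \<Rightarrow> 'r vec \<Rightarrow> 'r vec" where
  "ring_mult_mat_vec R f x =
     vec (dim_row f) (\<lambda>i. \<Oplus>\<^bsub>R\<^esub>j\<in>{..<dim_vec x}. f $$ (i, j) \<otimes>\<^bsub>R\<^esub> x $ j)"

text \<open>
  The quotient is \<open>0 / 0 = 0\<close> at the zero vector, which does not affect the supremum.
\<close>

definition op_norm ::
    "complex set \<Rightarrow> (complex \<Rightarrow> real) \<Rightarrow> nat \<Rightarrow> (nat \<Rightarrow> complex) set mat \<Rightarrow> real" where
  "op_norm K a d f =
     (SUP x \<in> completion_vecs K a d.
        vec_norm K a (ring_mult_mat_vec (completion K a) f x) / vec_norm K a x)"

text \<open>The inserted 0 only matters for the empty set of matrices.\<close>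

definition set_norm ::
    "complex set \<Rightarrow> (complex \<Rightarrow> real) \<Rightarrow> nat \<Rightarrow> complex mat set \<Rightarrow> real" where
  "set_norm K a d F =
     Max (insert 0 ((\<lambda>f. op_norm K a d (map_mat (to_completion K a) f)) ` F))"

text \<open>Here \<^term>\<open>ln (0::real) = 0\<close>, so that the value at 0 is 0, as it should be.\<close>

definition log_plus :: "real \<Rightarrow> real" where
  "log_plus x = max 0 (ln x)"

definition height :: "complex set \<Rightarrow> nat \<Rightarrow> complex mat set \<Rightarrow> real" where
  "height K d F = 1 / real (ring.dim \<CC> \<rat> K) *
     (\<Sum>\<^sub>\<infinity>v\<in>places K. real (local_degree K (place_abs v)) *
        log_plus (set_norm K (place_abs v) d F))"

primrec set_power :: "nat \<Rightarrow> complex mat set \<Rightarrow> nat \<Rightarrow> complex mat set" where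
  "set_power d F 0 = {1\<^sub>m d}"
| "set_power d F (Suc n) = {A * B | A B. A \<in> F \<and> B \<in> set_power d F n}"

definition normalized_height :: "complex set \<Rightarrow> nat \<Rightarrow> complex mat set \<Rightarrow> real" where
  "normalized_height K d F = lim (\<lambda>n. height K d (set_power d F n) / real n)"


section \<open>Linear groups\<close>

definition mats :: "nat \<Rightarrow> complex set \<Rightarrow> complex mat set" where
  "mats d K = {A \<in> carrier_mat d d. elements_mat A \<subseteq> K}"

definition GL :: "nat \<Rightarrow> complex set \<Rightarrow> complex mat monoid" where
  "GL d K = units_of \<lparr> carrier = mats d K, mult = (*), one = 1\<^sub>m d \<rparr>"

definition unipotent :: "nat \<Rightarrow> complex mat \<Rightarrow> bool" where
  "unipotent d A \<longleftrightarrow> (\<exists>k. (A - 1\<^sub>m d) ^\<^sub>m k = 0\<^sub>m d d)"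

definition virtually_unipotent :: "nat \<Rightarrow> complex set \<Rightarrow> complex mat set \<Rightarrow> bool" where
  "virtually_unipotent d K \<Gamma> \<longleftrightarrow>
     (\<exists>H. subgroup H (GL d K \<lparr> carrier := \<Gamma> \<rparr>) \<and>
          finite (rcosets\<^bsub>GL d K \<lparr> carrier := \<Gamma> \<rparr>\<^esub> H) \<and>
          (\<forall>h\<in>H. unipotent d h))"

end

theory Submission
  imports
    Defs
    "Jordan_Normal_Form.Schur_Decomposition"
    "HOL-Real_Asymp.Real_Asymp"
    "HOL-Analysis.L2_Norm"
begin

text \<open>
  At each absolute value \<open>a\<close> of \<open>K\<close> the numbers \<open>log\<^sup>+ \<parallel>F\<^sup>n\<parallel> / n\<close> converge to some \<open>L\<^sub>a \<ge> 0\<close>, and \<open>L\<^sub>a = 0\<close> for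
  all but finitely many \<open>a\<close>; hence the normalized height vanishes if and only if all \<open>L\<^sub>a\<close> do.

  If all \<open>L\<^sub>a\<close> vanish, the eigenvalues of the elements of \<open>F\<^sup>n\<close> are algebraic integers, all of whose
  conjugates have absolute value at most 1. By Northcott's theorem the traces of the semigroup generated
  by \<open>F\<close> form a finite set \<open>T\<close>. Let \<open>A\<close> be the linear span of this semigroup, which contains the group
  \<open>\<Gamma>\<close> generated by \<open>F\<close>, and let \<open>R\<close> be the radical of the trace form on \<open>A\<close>. A basis of \<open>A\<close> consisting
  of elements of the semigroup separates \<open>A / R\<close> by traces, so finiteness of \<open>T\<close> shows that
  \<open>\<Gamma> \<inter> (1 + R)\<close> has finite index in \<open>\<Gamma>\<close>, and it is unipotent because the powers of elements of \<open>R\<close>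
  have trace 0.

  Conversely, if \<open>\<Gamma>\<close> has a unipotent subgroup \<open>H\<close> of finite index, the elements of \<open>F\<^sup>n\<close> are products of
  \<open>n\<close> elements of a finite subset of \<open>H\<close> and of a coset representative. All products of \<open>d\<close> elements
  of the form \<open>h - 1\<close> with \<open>h \<in> H\<close> vanish, and so, for a suitable norm, multiplication by these elements \<open>h\<close>
  increases norms by a factor of at most \<open>1 + \<delta>\<close>, for any \<open>\<delta> > 0\<close>.
\<close>

hide_const (open) up_ring.coeff up_ring.monom
no_notation fps_nth (infixl \<open>$\<close> 75)

section \<open>Matrices over the complex numbers\<close>

lemma linear_dependence:
  fixes f :: "nat \<Rightarrow> nat \<Rightarrow> 'a :: field"
  shows "\<exists>c. (\<exists>i\<le>n. c i \<noteq> 0) \<and> (\<forall>j<n. (\<Sum>i\<le>n. c i * f i j) = 0)"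
proof -
  define A where "A = mat (Suc n) (Suc n) (\<lambda>(j, i). if j < n then f i j else 0)"
  have A: "A \<in> carrier_mat (Suc n) (Suc n)"
    by (simp add: A_def)
  have "A = mat\<^sub>r (Suc n) (Suc n) (\<lambda>j. if j = n then 0\<^sub>v (Suc n) else vec (Suc n) (\<lambda>i. f i j))"
    by (intro eq_matI) (simp_all add: A_def)
  then have "det A = 0"
    using det_row_0[of n "Suc n" "\<lambda>j. vec (Suc n) (\<lambda>i. f i j)"] by simp
  then obtain v where v: "v \<in> carrier_vec (Suc n)" "v \<noteq> 0\<^sub>v (Suc n)" "A *\<^sub>v v = 0\<^sub>v (Suc n)"
    using det_0_iff_vec_prod_zero_field[OF A] by blast
  have "\<exists>i\<le>n. v $ i \<noteq> 0"
    using v(1,2) by (metis carrier_vecD eq_vecI index_zero_vec less_Suc_eq_le)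
  moreover have "(\<Sum>i\<le>n. v $ i * f i j) = 0" if "j < n" for j
  proof -
    have "0 = (A *\<^sub>v v) $ j"
      using v(3) that by simp
    also have "\<dots> = (\<Sum>i\<in>{0..<Suc n}. f i j * v $ i)"
      using that A v(1) by (auto simp: A_def scalar_prod_def intro!: sum.cong)
    also have "\<dots> = (\<Sum>i\<le>n. v $ i * f i j)"
      by (rule sum.cong) (auto simp: atLeast0LessThan lessThan_Suc_atMost)
    finally show ?thesis by simp
  qed
  ultimately show ?thesis by blast
qed

definition mat_trace :: "'a :: comm_monoid_add mat \<Rightarrow> 'a" where
  "mat_trace A = (\<Sum>i<dim_row A. A $$ (i, i))"

lemma mat_trace_add:
  "A \<in> carrier_mat n n \<Longrightarrow> B \<in> carrier_mat n n \<Longrightarrow> mat_trace (A + B) = mat_trace A + mat_trace B"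
  by (auto simp: mat_trace_def sum.distrib)

lemma mat_trace_minus:
  fixes A :: "'a :: ab_group_add mat"
  shows "A \<in> carrier_mat n n \<Longrightarrow> B \<in> carrier_mat n n \<Longrightarrow> mat_trace (A - B) = mat_trace A - mat_trace B"
  by (auto simp: mat_trace_def sum_subtractf)

lemma mat_trace_smult:
  fixes A :: "'a :: comm_semiring_0 mat"
  shows "A \<in> carrier_mat n n \<Longrightarrow> mat_trace (c \<cdot>\<^sub>m A) = c * mat_trace A"
  by (auto simp: mat_trace_def sum_distrib_left)

lemma mat_trace_zero [simp]: "mat_trace (0\<^sub>m n n) = 0"
  by (simp add: mat_trace_def)

lemma mat_trace_one [simp]: "mat_trace (1\<^sub>m n :: 'a :: semiring_1 mat) = of_nat n"
  by (simp add: mat_trace_def)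

lemma mat_trace_mult_commute:
  fixes A :: "'a :: comm_semiring_0 mat"
  assumes "A \<in> carrier_mat n n" "B \<in> carrier_mat n n"
  shows "mat_trace (A * B) = mat_trace (B * A)"
proof -
  have "mat_trace (A * B) = (\<Sum>i<n. \<Sum>j<n. A $$ (i, j) * B $$ (j, i))"
    using assms by (auto simp: mat_trace_def scalar_prod_def atLeast0LessThan intro!: sum.cong)
  also have "\<dots> = (\<Sum>j<n. \<Sum>i<n. B $$ (j, i) * A $$ (i, j))"
    by (subst sum.swap) (simp add: mult.commute)
  also have "\<dots> = mat_trace (B * A)"
    using assms by (auto simp: mat_trace_def scalar_prod_def atLeast0LessThan intro!: sum.cong)
  finally show ?thesis .
qed

lemma upper_triangular_mult_diag:
  fixes A B :: "'a :: semiring_0 mat"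
  assumes A: "A \<in> carrier_mat n n" "upper_triangular A" and B: "B \<in> carrier_mat n n" "upper_triangular B"
  shows "upper_triangular (A * B)" and "i < n \<Longrightarrow> (A * B) $$ (i, i) = A $$ (i, i) * B $$ (i, i)"
proof -
  have entry: "(A * B) $$ (i, j) = (\<Sum>k\<in>{i..j}. A $$ (i, k) * B $$ (k, j))" if "i < n" "j < n" for i j
  proof -
    have "(A * B) $$ (i, j) = (\<Sum>k<n. A $$ (i, k) * B $$ (k, j))"
      using that A(1) B(1) by (auto simp: scalar_prod_def atLeast0LessThan intro!: sum.cong)
    also have "\<dots> = (\<Sum>k\<in>{i..j}. A $$ (i, k) * B $$ (k, j))"
      using that upper_triangularD[OF A(2)] upper_triangularD[OF B(2)] A(1) B(1)
      by (intro sum.mono_neutral_right) (auto simp: not_le)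
    finally show ?thesis .
  qed
  show "upper_triangular (A * B)"
    using entry A(1) B(1) by (intro upper_triangularI) auto
  show "i < n \<Longrightarrow> (A * B) $$ (i, i) = A $$ (i, i) * B $$ (i, i)"
    using entry by simp
qed

lemma upper_triangular_pow_diag:
  fixes A :: "'a :: semiring_1 mat"
  assumes A: "A \<in> carrier_mat n n" "upper_triangular A"
  shows "upper_triangular (A ^\<^sub>m k) \<and> (\<forall>i<n. (A ^\<^sub>m k) $$ (i, i) = A $$ (i, i) ^ k)"
proof (induction k)
  case 0
  show ?case using A by auto
next
  case (Suc k)
  then show ?case
    using upper_triangular_mult_diag[of "A ^\<^sub>m k" n A] A by (auto simp: power_commutes)
qed

lemma mat_trace_pow_eigenvalues:
  fixes A :: "complex mat"
  assumes A: "A \<in> carrier_mat n n"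
  obtains es where "length es = n" and "char_poly A = (\<Prod>a\<leftarrow>es. [:- a, 1:])"
    and "\<And>e. e \<in> set es \<longleftrightarrow> eigenvalue A e"
    and "\<And>k. mat_trace (A ^\<^sub>m k) = (\<Sum>e\<leftarrow>es. e ^ k)"
proof -
  obtain es where es: "char_poly A = (\<Prod>a\<leftarrow>es. [:- a, 1:])" "length es = n"
    using char_poly_factorized[OF A] by blast
  obtain B P Q where BPQ: "schur_decomposition A es = (B, P, Q)"
    by (metis prod_cases3)
  have schur: "similar_mat_wit A B P Q" "upper_triangular B" "diag_mat B = es"
    using schur_decomposition[OF A es(1) BPQ] by auto
  note wit = similar_mat_witD2[OF A schur(1)]
  have dim: "B \<in> carrier_mat n n" "P \<in> carrier_mat n n" "Q \<in> carrier_mat n n"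
    using wit by auto
  have tr: "mat_trace (A ^\<^sub>m k) = (\<Sum>e\<leftarrow>es. e ^ k)" for k
  proof -
    have "similar_mat_wit (A ^\<^sub>m k) (B ^\<^sub>m k) P Q"
      using similar_mat_wit_pow[OF schur(1)] .
    then have "A ^\<^sub>m k = P * B ^\<^sub>m k * Q" "Q * P = 1\<^sub>m n"
      using similar_mat_witD2[of "A ^\<^sub>m k" n n "B ^\<^sub>m k" P Q] A by auto
    then have "mat_trace (A ^\<^sub>m k) = mat_trace (Q * (P * B ^\<^sub>m k))"
      using mat_trace_mult_commute[of "P * B ^\<^sub>m k" n Q] dim by simp
    also have "Q * (P * B ^\<^sub>m k) = (Q * P) * B ^\<^sub>m k"
      using dim by (metis assoc_mult_mat pow_carrier_mat)
    also have "\<dots> = B ^\<^sub>m k"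
      using \<open>Q * P = 1\<^sub>m n\<close> dim by simp
    also have "mat_trace (B ^\<^sub>m k) = (\<Sum>i<n. B $$ (i, i) ^ k)"
      using upper_triangular_pow_diag[OF dim(1) schur(2), of k] dim by (simp add: mat_trace_def)
    also have "\<dots> = (\<Sum>e\<leftarrow>es. e ^ k)"
      using dim(1) by (simp add: schur(3)[symmetric] diag_mat_def sum_list_distinct_conv_sum_set o_def
          atLeast0LessThan interv_sum_list_conv_sum_set_nat)
    finally show ?thesis .
  qed
  have "e \<in> set es \<longleftrightarrow> eigenvalue A e" for e
    unfolding eigenvalue_root_char_poly[OF A] es(1) linear_poly_root
    by (auto simp: poly_prod_list prod_list_zero_iff)
  then show ?thesis using that es tr by blast
qed

lemma trace_powers_zero_imp_no_eigenvalue: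
  fixes A :: "complex mat"
  assumes A: "A \<in> carrier_mat n n" and tr: "\<And>k. 1 \<le> k \<Longrightarrow> mat_trace (A ^\<^sub>m k) = 0"
    and "eigenvalue A e"
  shows "e = 0"
proof (rule ccontr)
  assume "e \<noteq> 0"
  obtain es where es: "length es = n" "\<And>e. e \<in> set es \<longleftrightarrow> eigenvalue A e"
    "\<And>k. mat_trace (A ^\<^sub>m k) = (\<Sum>e\<leftarrow>es. e ^ k)"
    using mat_trace_pow_eigenvalues[OF A] by metis
  have zero: "(\<Sum>x\<leftarrow>es. poly ([:0, 1:] * p) x) = 0" for p :: "complex poly"
  proof -
    have "(\<Sum>x\<leftarrow>es. poly ([:0, 1:] * p) x) = (\<Sum>x\<leftarrow>es. \<Sum>i\<le>degree p. coeff p i * x ^ Suc i)"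
      unfolding poly_mult by (simp add: poly_altdef sum_distrib_left mult.left_commute)
    also have "\<dots> = (\<Sum>i\<le>degree p. coeff p i * (\<Sum>x\<leftarrow>es. x ^ Suc i))"
      by (induction es) (simp_all add: sum.distrib distrib_left)
    also have "\<dots> = 0"
      using es(3)[of "Suc _"] tr[of "Suc _"] by simp
    finally show ?thesis .
  qed
  define p where "p = (\<Prod>x\<in>set es - {0, e}. [:- x, 1:])"
  have p0: "poly p x = 0" if "x \<in> set es" "x \<noteq> 0" "x \<noteq> e" for x
    using that by (auto simp: p_def poly_prod)
  have pe: "poly p e \<noteq> 0"
    by (auto simp: p_def poly_prod)
  have "(\<Sum>x\<leftarrow>es. poly ([:0, 1:] * p) x) = (\<Sum>x\<leftarrow>es. if x = e then e * poly p e else 0)"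
    using p0 by (intro arg_cong[where f = sum_list] map_cong) auto
  also have "\<dots> = of_nat (count_list es e) * (e * poly p e)"
    by (induction es) (auto simp: algebra_simps)
  finally have "count_list es e = 0"
    using zero[of p] pe \<open>e \<noteq> 0\<close> by simp
  then show False
    using es(2) \<open>eigenvalue A e\<close> by (simp add: count_list_0_iff)
qed

definition mat_prod :: "nat \<Rightarrow> complex mat list \<Rightarrow> complex mat" where
  "mat_prod n xs = foldr (*) xs (1\<^sub>m n)"

lemma mat_prod_Nil [simp]: "mat_prod n [] = 1\<^sub>m n"
  and mat_prod_Cons [simp]: "mat_prod n (x # xs) = x * mat_prod n xs"
  by (simp_all add: mat_prod_def)

lemma mat_prod_carrier [simp]:
  "set xs \<subseteq> carrier_mat n n \<Longrightarrow> mat_prod n xs \<in> carrier_mat n n"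
  by (induction xs) auto

lemma mat_prod_replicate: "x \<in> carrier_mat n n \<Longrightarrow> mat_prod n (replicate k x) = x ^\<^sub>m k"
proof (induction k)
  case 0
  then show ?case by auto
next
  case (Suc k)
  have "x * x ^\<^sub>m k = x ^\<^sub>m k * x"
    using Suc.prems by (induction k) (auto simp flip: assoc_mult_mat[of _ n n _ n _ n])
  then show ?case using Suc by simp
qed

lemma mat_prod_mult_vec:
  "set xs \<subseteq> carrier_mat n n \<Longrightarrow> u \<in> carrier_vec n \<Longrightarrow> mat_prod n xs *\<^sub>v u = foldr (*\<^sub>v) xs u"
  by (induction xs) (auto simp: assoc_mult_mat_vec[of _ n n _ n])

lemma mat_eq_zeroI:
  fixes A :: "'a :: semiring_1 mat"
  assumes "A \<in> carrier_mat n n" and "\<And>u. u \<in> carrier_vec n \<Longrightarrow> A *\<^sub>v u = 0\<^sub>v n"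
  shows "A = 0\<^sub>m n n"
proof (rule eq_matI)
  fix i j assume ij: "i < dim_row (0\<^sub>m n n :: 'a mat)" "j < dim_col (0\<^sub>m n n :: 'a mat)"
  then have "(A *\<^sub>v unit_vec n j) $ i = A $$ (i, j)"
    using assms(1) by (simp add: scalar_prod_right_unit)
  then show "A $$ (i, j) = 0\<^sub>m n n $$ (i, j)"
    using assms(2)[of "unit_vec n j"] ij by simp
qed (use assms in auto)

locale nil_mat_algebra =
  fixes n :: nat and R :: "complex mat set"
  assumes carrier: "R \<subseteq> carrier_mat n n"
    and zero: "0\<^sub>m n n \<in> R"
    and add: "\<And>x y. x \<in> R \<Longrightarrow> y \<in> R \<Longrightarrow> x + y \<in> R"
    and smult: "\<And>c x. x \<in> R \<Longrightarrow> c \<cdot>\<^sub>m x \<in> R"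
    and mult: "\<And>x y. x \<in> R \<Longrightarrow> y \<in> R \<Longrightarrow> x * y \<in> R"
    and no_eigenvalue: "\<And>x. x \<in> R \<Longrightarrow> \<not> eigenvalue x 1"
begin

text \<open>
  If the last of the vectors \<open>w 0, \<dots>, w n\<close> is nonzero, a linear dependence between them writes some
  \<open>w k\<close> as a combination of later ones, hence as \<open>r *\<^sub>v w k\<close> with \<open>r \<in> R\<close>.
\<close>

lemma orbit_zero:
  assumes x: "\<And>k. k < n \<Longrightarrow> x k \<in> R"
    and w: "\<And>k. k < n \<Longrightarrow> w (Suc k) = x k *\<^sub>v w k" and w0: "w 0 \<in> carrier_vec n"
  shows "w n = 0\<^sub>v n"
proof (rule ccontr)
  assume nz: "w n \<noteq> 0\<^sub>v n"
  have later: "\<exists>m\<in>R. w i = m *\<^sub>v w k" if "k < i" "i \<le> n" "w k \<in> carrier_vec n" for i k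
    using that(1,2)
  proof (induction i)
    case (Suc i)
    show ?case
    proof (cases "i = k")
      case True
      then show ?thesis using w[of k] x[of k] Suc.prems by auto
    next
      case False
      then obtain m where m: "m \<in> R" "w i = m *\<^sub>v w k"
        using Suc by auto
      have "x i \<in> carrier_mat n n" "m \<in> carrier_mat n n"
        using x[of i] m(1) Suc.prems carrier by auto
      then have "w (Suc i) = (x i * m) *\<^sub>v w k"
        using w[of i] m Suc.prems that(3) by simp
      then show ?thesis
        using mult[OF x[of i] m(1)] Suc.prems by auto
    qed
  qed simp
  have wc: "w k \<in> carrier_vec n" if "k \<le> n" for k
    using that
  proof (induction k)
    case (Suc k)
    then show ?case using w[of k] x[of k] carrier by (auto intro!: mult_mat_vec_carrier)
  qed (rule w0)
  obtain c where c: "\<exists>i\<le>n. c i \<noteq> 0" "\<forall>j<n. (\<Sum>i\<le>n. c i * (w i $ j)) = 0"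
    using linear_dependence[of n "\<lambda>i j. w i $ j"] by blast
  define k where "k = (LEAST i. c i \<noteq> 0)"
  have k: "c k \<noteq> 0" "\<And>i. i < k \<Longrightarrow> c i = 0"
    unfolding k_def using c(1) LeastI[of "\<lambda>i. c i \<noteq> 0"] not_less_Least[of _ "\<lambda>i. c i \<noteq> 0"] by blast+
  have "k \<le> n"
    using c(1) k by (meson le_trans not_le)
  have part: "\<exists>r\<in>R. \<forall>j<n. (r *\<^sub>v w k) $ j = (\<Sum>i\<in>{k<..N}. c i * (w i $ j))" if "N \<le> n" for N
    using that
  proof (induction N)
    case 0
    show ?case using zero wc[OF \<open>k \<le> n\<close>] by (intro bexI[of _ "0\<^sub>m n n"]) auto
  next
    case (Suc N)
    then obtain r where r: "r \<in> R" "\<forall>j<n. (r *\<^sub>v w k) $ j = (\<Sum>i\<in>{k<..N}. c i * (w i $ j))"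
      by auto
    show ?case
    proof (cases "k < Suc N")
      case False
      then show ?thesis using r by auto
    next
      case True
      then obtain m where m: "m \<in> R" "w (Suc N) = m *\<^sub>v w k"
        using later[OF True Suc.prems wc[OF \<open>k \<le> n\<close>]] by auto
      have dims: "r \<in> carrier_mat n n" "m \<in> carrier_mat n n"
        using r(1) m(1) carrier by auto
      have "((r + c (Suc N) \<cdot>\<^sub>m m) *\<^sub>v w k) $ j = (\<Sum>i\<in>{k<..Suc N}. c i * (w i $ j))" if "j < n" for j
      proof -
        have "{k<..Suc N} = insert (Suc N) {k<..N}"
          using True by auto
        moreover have "(r + c (Suc N) \<cdot>\<^sub>m m) *\<^sub>v w k = r *\<^sub>v w k + (c (Suc N) \<cdot>\<^sub>m m) *\<^sub>v w k"
          using dims wc[OF \<open>k \<le> n\<close>] by (intro add_mult_distrib_mat_vec) auto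
        moreover have "((c (Suc N) \<cdot>\<^sub>m m) *\<^sub>v w k) $ j = c (Suc N) * ((m *\<^sub>v w k) $ j)"
          using dims wc[OF \<open>k \<le> n\<close>] that by simp
        ultimately show ?thesis
          using r(2) m(2) that dims wc[OF \<open>k \<le> n\<close>] by simp
      qed
      then show ?thesis
        using add[OF r(1) smult[OF m(1)]] by blast
    qed
  qed
  obtain r where r: "r \<in> R" "\<forall>j<n. (r *\<^sub>v w k) $ j = (\<Sum>i\<in>{k<..n}. c i * (w i $ j))"
    using part[of n] by auto
  define q where "q = (- inverse (c k)) \<cdot>\<^sub>m r"
  have q: "q \<in> R" "q \<in> carrier_mat n n"
    using smult[OF r(1)] carrier by (auto simp: q_def)
  have "q *\<^sub>v w k = w k"
  proof (rule eq_vecI)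
    fix j assume "j < dim_vec (w k)"
    then have j: "j < n" using wc[OF \<open>k \<le> n\<close>] by simp
    have "0 = (\<Sum>i\<le>n. c i * (w i $ j))"
      using c(2) j by simp
    also have "\<dots> = (\<Sum>i\<in>{k..n}. c i * (w i $ j))"
      using k(2) by (intro sum.mono_neutral_right) (auto simp: not_le)
    also have "{k..n} = insert k {k<..n}"
      using \<open>k \<le> n\<close> by auto
    finally have "0 = c k * (w k $ j) + (r *\<^sub>v w k) $ j"
      using r(2) j by simp
    then have "(r *\<^sub>v w k) $ j = - c k * (w k $ j)"
      by (simp add: eq_neg_iff_add_eq_0 add.commute)
    moreover have "(q *\<^sub>v w k) $ j = - inverse (c k) * ((r *\<^sub>v w k) $ j)"
      using j r(1) carrier wc[OF \<open>k \<le> n\<close>] by (auto simp: q_def)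
    ultimately show "(q *\<^sub>v w k) $ j = w k $ j"
      using k(1) by simp
  qed (use q wc[OF \<open>k \<le> n\<close>] in auto)
  moreover have "w k \<noteq> 0\<^sub>v n"
  proof
    assume 0: "w k = 0\<^sub>v n"
    then have "k < n" using nz \<open>k \<le> n\<close> by (cases "k = n") auto
    then obtain m where "m \<in> R" "w n = m *\<^sub>v w k"
      using later[of k n] wc[OF \<open>k \<le> n\<close>] by auto
    moreover have "m *\<^sub>v 0\<^sub>v n = 0\<^sub>v n"
      using \<open>m \<in> R\<close> carrier by (intro eq_vecI) auto
    ultimately show False
      using nz 0 by simp
  qed
  ultimately have "eigenvalue q 1"
    using q wc[OF \<open>k \<le> n\<close>] by (auto simp: eigenvalue_def eigenvector_def intro!: exI[of _ "w k"])
  then show False using no_eigenvalue[OF q(1)] by blast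
qed

theorem prod_zero:
  assumes "set xs \<subseteq> R" and "length xs = n"
  shows "mat_prod n xs = 0\<^sub>m n n"
proof (rule mat_eq_zeroI)
  have xs: "set xs \<subseteq> carrier_mat n n" using assms(1) carrier by blast
  then show "mat_prod n xs \<in> carrier_mat n n" by simp
  fix u :: "complex vec" assume u: "u \<in> carrier_vec n"
  define w where "w k = foldr (*\<^sub>v) (drop (n - k) xs) u" for k
  have "w n = 0\<^sub>v n"
  proof (rule orbit_zero[where x = "\<lambda>k. xs ! (n - Suc k)"])
    fix k assume k: "k < n"
    then show "xs ! (n - Suc k) \<in> R"
      using assms by (auto simp: subset_iff)
    have "drop (n - Suc k) xs = xs ! (n - Suc k) # drop (n - k) xs"
      using k assms(2) by (metis Cons_nth_drop_Suc Suc_diff_Suc diff_less less_Suc_eq_0_disj less_imp_Suc_add zero_less_Suc)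
    then show "w (Suc k) = xs ! (n - Suc k) *\<^sub>v w k"
      by (simp add: w_def)
  qed (use assms(2) u in \<open>simp add: w_def\<close>)
  then show "mat_prod n xs *\<^sub>v u = 0\<^sub>v n"
    using xs u by (simp add: w_def mat_prod_mult_vec)
qed

end

inductive_set mat_span :: "nat \<Rightarrow> complex mat set \<Rightarrow> complex mat set" for n :: nat and S :: "complex mat set" where
  zero: "0\<^sub>m n n \<in> mat_span n S"
| step: "s \<in> S \<Longrightarrow> x \<in> mat_span n S \<Longrightarrow> c \<cdot>\<^sub>m s + x \<in> mat_span n S"

context
  fixes n :: nat and S :: "complex mat set"
  assumes S: "S \<subseteq> carrier_mat n n"
begin

lemma mat_span_carrier: "x \<in> mat_span n S \<Longrightarrow> x \<in> carrier_mat n n"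
  by (induction rule: mat_span.induct) (use S in auto)

lemma mat_span_base:
  assumes "s \<in> S" shows "s \<in> mat_span n S"
proof -
  have "1 \<cdot>\<^sub>m s + 0\<^sub>m n n = s"
    using S assms by (intro eq_matI) auto
  then show ?thesis using mat_span.step[OF assms mat_span.zero, of 1 n] by simp
qed

lemma mat_span_add: "x \<in> mat_span n S \<Longrightarrow> y \<in> mat_span n S \<Longrightarrow> x + y \<in> mat_span n S"
proof (induction rule: mat_span.induct)
  case zero
  then show ?case using mat_span_carrier by simp
next
  case (step s x c)
  then have "c \<cdot>\<^sub>m s + x + y = c \<cdot>\<^sub>m s + (x + y)"
    using S mat_span_carrier by (intro assoc_add_mat[of _ n n]) auto
  then show ?case using step mat_span.step by auto
qed

lemma mat_span_smult: "x \<in> mat_span n S \<Longrightarrow> a \<cdot>\<^sub>m x \<in> mat_span n S"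
proof (induction rule: mat_span.induct)
  case zero
  then show ?case by (simp add: mat_span.zero)
next
  case (step s x c)
  then have "a \<cdot>\<^sub>m (c \<cdot>\<^sub>m s + x) = (a * c) \<cdot>\<^sub>m s + a \<cdot>\<^sub>m x"
    using S mat_span_carrier[of x] by (intro eq_matI) (auto simp: algebra_simps)
  then show ?case using step mat_span.step by auto
qed

lemma mat_span_minus:
  assumes "x \<in> mat_span n S" "y \<in> mat_span n S"
  shows "x - y \<in> mat_span n S"
proof -
  have "x - y = x + (- 1) \<cdot>\<^sub>m y"
    using assms mat_span_carrier by (intro eq_matI) auto
  then show ?thesis using assms mat_span_add mat_span_smult by simp
qed

lemma mat_span_mult_left:
  assumes "y \<in> carrier_mat n n" and "\<And>s. s \<in> S \<Longrightarrow> y * s \<in> mat_span n S" and "x \<in> mat_span n S"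
  shows "y * x \<in> mat_span n S"
  using assms(3)
proof (induction rule: mat_span.induct)
  case zero
  then show ?case using assms(1) by (simp add: mat_span.zero)
next
  case (step s x c)
  then have "y * (c \<cdot>\<^sub>m s + x) = c \<cdot>\<^sub>m (y * s) + y * x"
    using S mat_span_carrier[of x] assms(1)
    by (subst mult_add_distrib_mat[of _ n n]) (auto simp: mult_smult_distrib[of _ n n])
  then show ?case using step assms(2) mat_span_add mat_span_smult by simp
qed

lemma mat_span_mult:
  assumes "\<And>s t. s \<in> S \<Longrightarrow> t \<in> S \<Longrightarrow> s * t \<in> mat_span n S"
    and "x \<in> mat_span n S" and "y \<in> mat_span n S"
  shows "x * y \<in> mat_span n S"
  using assms(2)
proof (induction rule: mat_span.induct)
  case zero
  have "0\<^sub>m n n * y = 0\<^sub>m n n"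
    using mat_span_carrier[OF assms(3)] by simp
  then show ?case by (simp add: mat_span.zero)
next
  case (step s x c)
  then have "(c \<cdot>\<^sub>m s + x) * y = c \<cdot>\<^sub>m (s * y) + x * y"
    using S mat_span_carrier[of x] mat_span_carrier[of y] assms(3)
    by (subst add_mult_distrib_mat[of _ n n]) (auto simp: mult_smult_assoc_mat[of _ n n])
  moreover have "s * y \<in> mat_span n S"
    using mat_span_mult_left[of s y] step(1) S assms(1)[OF step(1)] assms(3) by blast
  ultimately show ?case using step mat_span_add mat_span_smult by simp
qed

lemma mat_span_trace_zero:
  assumes "\<And>s. s \<in> S \<Longrightarrow> mat_trace (y * s) = 0" "y \<in> carrier_mat n n" "x \<in> mat_span n S"
  shows "mat_trace (y * x) = 0"
  using assms(3)
proof (induction rule: mat_span.induct)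
  case zero
  then show ?case using assms(2) by simp
next
  case (step s x c)
  then have "y * (c \<cdot>\<^sub>m s + x) = c \<cdot>\<^sub>m (y * s) + y * x"
    using S mat_span_carrier[of x] assms(2)
    by (subst mult_add_distrib_mat[of _ n n]) (auto simp: mult_smult_distrib[of _ n n])
  moreover have "y * s \<in> carrier_mat n n" "y * x \<in> carrier_mat n n"
    using step S assms(2) mat_span_carrier[of x] by auto
  ultimately show ?case
    using step assms(1) by (simp add: mat_trace_add[of _ n] mat_trace_smult[of _ n])
qed

end

lemma mat_trace_unipotent:
  assumes "unipotent n h" "h \<in> carrier_mat n n"
  shows "mat_trace h = of_nat n"
proof -
  let ?N = "h - 1\<^sub>m n"
  have N: "?N \<in> carrier_mat n n" using assms(2) by auto
  obtain k where k: "?N ^\<^sub>m k = 0\<^sub>m n n"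
    using assms(1) by (auto simp: unipotent_def)
  have ev: "e = 0" if e: "eigenvalue ?N e" for e
  proof -
    obtain v where v: "eigenvector ?N v e"
      using e by (auto simp: eigenvalue_def)
    have vc: "v \<in> carrier_vec n" "v \<noteq> 0\<^sub>v n"
      using v N unfolding eigenvector_def by auto
    have "e ^ k \<cdot>\<^sub>v v = 0\<^sub>v n"
    proof -
      have "0\<^sub>m n n *\<^sub>v v = 0\<^sub>v n"
        using vc by (intro eq_vecI) auto
      then show ?thesis using eigenvector_pow[OF N v, of k] k by simp
    qed
    then have "e ^ k * (v $ i) = 0" if "i < n" for i
      using that vc(1) by (metis carrier_vecD index_smult_vec(1) index_zero_vec(1))
    moreover obtain i where "i < n" "v $ i \<noteq> 0"
      using vc by (metis carrier_vecD eq_vecI index_zero_vec)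
    ultimately show "e = 0" by fastforce
  qed
  obtain es where es: "\<And>e. e \<in> set es \<longleftrightarrow> eigenvalue ?N e" "\<And>k. mat_trace (?N ^\<^sub>m k) = (\<Sum>e\<leftarrow>es. e ^ k)"
    using mat_trace_pow_eigenvalues[OF N] by metis
  have "mat_trace ?N = (\<Sum>e\<leftarrow>es. e)"
    using es(2)[of 1] N by simp
  also have "\<dots> = (\<Sum>e\<leftarrow>es. 0)"
    using es(1) ev by (intro arg_cong[where f = sum_list] map_cong) auto
  finally show ?thesis
    using mat_trace_minus[OF assms(2), of "1\<^sub>m n"] by simp
qed

lemma trace_zero_nil_mat_algebra:
  assumes "R \<subseteq> carrier_mat n n" "0\<^sub>m n n \<in> R" "\<And>x y. x \<in> R \<Longrightarrow> y \<in> R \<Longrightarrow> x + y \<in> R"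
    "\<And>c x. x \<in> R \<Longrightarrow> c \<cdot>\<^sub>m x \<in> R" and mult: "\<And>x y. x \<in> R \<Longrightarrow> y \<in> R \<Longrightarrow> x * y \<in> R"
    and tr: "\<And>x. x \<in> R \<Longrightarrow> mat_trace x = 0"
  shows "nil_mat_algebra n R"
proof
  fix x assume x: "x \<in> R"
  have "x ^\<^sub>m Suc k \<in> R" for k
  proof (induction k)
    case 0
    then show ?case using x assms(1) by auto
  next
    case (Suc k)
    then show ?case using mult x by (metis pow_mat.simps(2))
  qed
  then have "mat_trace (x ^\<^sub>m k) = 0" if "1 \<le> k" for k
    using tr that by (metis Suc_le_D One_nat_def)
  then show "\<not> eigenvalue x 1"
    using trace_powers_zero_imp_no_eigenvalue[of x n 1] x assms(1) by auto
qed (use assms in auto)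

lemma unipotent_semigroup_prod_zero:
  assumes H: "H \<subseteq> carrier_mat n n" and mult: "\<And>g h. g \<in> H \<Longrightarrow> h \<in> H \<Longrightarrow> g * h \<in> H"
    and unip: "\<And>h. h \<in> H \<Longrightarrow> unipotent n h"
    and xs: "set xs \<subseteq> (\<lambda>h. h - 1\<^sub>m n) ` H" "length xs = n"
  shows "mat_prod n xs = 0\<^sub>m n n"
proof -
  let ?S = "(\<lambda>h. h - 1\<^sub>m n) ` H"
  have S: "?S \<subseteq> carrier_mat n n" using H by auto
  interpret nil_mat_algebra n "mat_span n ?S"
  proof (rule trace_zero_nil_mat_algebra)
    have prod: "s * t \<in> mat_span n ?S" if st: "s \<in> ?S" "t \<in> ?S" for s t
    proof -
      obtain g h where gh: "s = g - 1\<^sub>m n" "t = h - 1\<^sub>m n" "g \<in> H" "h \<in> H"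
        using st by auto
      then have gc: "g \<in> carrier_mat n n" "h \<in> carrier_mat n n" using H by auto
      have "s * t = (g * h - 1\<^sub>m n) - (g - 1\<^sub>m n) - (h - 1\<^sub>m n)"
      proof -
        have "(g - 1\<^sub>m n) * (h - 1\<^sub>m n) = g * (h - 1\<^sub>m n) - 1\<^sub>m n * (h - 1\<^sub>m n)"
          using gc by (intro minus_mult_distrib_mat[of _ n n]) auto
        also have "g * (h - 1\<^sub>m n) = g * h - g * 1\<^sub>m n"
          using gc by (intro mult_minus_distrib_mat[of _ n n]) auto
        finally show ?thesis
          unfolding gh using gc by (intro eq_matI) auto
      qed
      moreover have "g * h \<in> H" using mult gh by blast
      ultimately show ?thesis
        using gh mat_span_minus[OF S] mat_span_base[OF S] by simp
    qed
    show "mat_span n ?S \<subseteq> carrier_mat n n"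
      using mat_span_carrier[OF S] by blast
    show "x * y \<in> mat_span n ?S" if "x \<in> mat_span n ?S" "y \<in> mat_span n ?S" for x y
      using mat_span_mult[OF S prod that] .
    show "mat_trace x = 0" if "x \<in> mat_span n ?S" for x
    proof -
      have "mat_trace (1\<^sub>m n * s) = 0" if "s \<in> ?S" for s
        using that H mat_trace_unipotent[OF unip] by (auto simp: mat_trace_minus[of _ n "1\<^sub>m n"])
      then show ?thesis
        using mat_span_trace_zero[OF S _ _ that, of "1\<^sub>m n"] mat_span_carrier[OF S that] by simp
    qed
  qed (use mat_span.zero mat_span_add[OF S] mat_span_smult[OF S] in auto)
  show ?thesis
    using xs mat_span_base[OF S] by (intro prod_zero) auto
qed

lemma index_pair_less:
  fixes a b n :: nat
  assumes "a < n" "b < n"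
  shows "a * n + b < n * n"
proof -
  have "a * n + b < Suc a * n" using assms(2) by simp
  also have "\<dots> \<le> n * n" using assms(1) by (intro mult_le_mono1) simp
  finally show ?thesis .
qed

lemma finite_trace_test:
  fixes S :: "complex mat set"
  assumes S: "S \<subseteq> carrier_mat n n"
  obtains S0 where "finite S0" "S0 \<subseteq> S"
    "\<And>x. x \<in> carrier_mat n n \<Longrightarrow> \<forall>s\<in>S0. mat_trace (x * s) = 0 \<Longrightarrow>
      \<forall>s\<in>S. mat_trace (x * s) = 0"
proof (rule ccontr)
  assume "\<not> thesis"
  then have "\<forall>S0. \<exists>x s. finite S0 \<and> S0 \<subseteq> S \<longrightarrow> x \<in> carrier_mat n n \<and> s \<in> S \<and>
      (\<forall>t\<in>S0. mat_trace (x * t) = 0) \<and> mat_trace (x * s) \<noteq> 0"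
    using that by metis
  then obtain X Y where XY: "\<And>S0. finite S0 \<Longrightarrow> S0 \<subseteq> S \<Longrightarrow> X S0 \<in> carrier_mat n n \<and> Y S0 \<in> S \<and>
      (\<forall>t\<in>S0. mat_trace (X S0 * t) = 0) \<and> mat_trace (X S0 * Y S0) \<noteq> 0"
    by metis
  define Q where "Q = rec_nat {} (\<lambda>_ A. insert (Y A) A)"
  have Q: "Q 0 = {}" "Q (Suc k) = insert (Y (Q k)) (Q k)" for k
    by (simp_all add: Q_def)
  have fin: "finite (Q k) \<and> Q k \<subseteq> S" for k
    by (induction k) (use Q XY in auto)
  have mem: "Y (Q i) \<in> Q k" if "i < k" for i k
    using that by (induction k) (auto simp: Q less_Suc_eq)
  note P = XY[OF conjunct1[OF fin] conjunct2[OF fin]]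
  have dimY: "Y (Q k) \<in> carrier_mat n n" for k
    using P S by blast
  let ?f = "\<lambda>i j. Y (Q i) $$ (j div n, j mod n)"
  obtain c where c: "\<exists>i\<le>n * n. c i \<noteq> 0" "\<forall>j<n * n. (\<Sum>i\<le>n * n. c i * ?f i j) = 0"
    using linear_dependence[of "n * n" ?f] by blast
  have c': "(\<Sum>i\<le>n * n. c i * Y (Q i) $$ (a, b)) = 0" if "a < n" "b < n" for a b
  proof -
    have "a * n + b < n * n"
      using that by (rule index_pair_less)
    then show ?thesis
      using c(2)[rule_format, of "a * n + b"] that by simp
  qed
  define k where "k = (GREATEST i. i \<le> n * n \<and> c i \<noteq> 0)"
  have k: "k \<le> n * n" "c k \<noteq> 0"
    using GreatestI_ex_nat[of "\<lambda>i. i \<le> n * n \<and> c i \<noteq> 0" "n * n"] c(1) by (auto simp: k_def)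
  have kmax: "c i = 0" if "k < i" "i \<le> n * n" for i
    using Greatest_le_nat[of "\<lambda>i. i \<le> n * n \<and> c i \<noteq> 0" i "n * n"] that by (auto simp: k_def)
  have trace: "mat_trace (X (Q k) * Y (Q i)) = (\<Sum>a<n. \<Sum>b<n. X (Q k) $$ (b, a) * Y (Q i) $$ (a, b))" for i
    using P[of k] dimY[of i]
    by (subst sum.swap) (auto simp: mat_trace_def scalar_prod_def atLeast0LessThan intro!: sum.cong)
  have "(\<Sum>i\<le>n * n. c i * mat_trace (X (Q k) * Y (Q i))) =
      (\<Sum>i\<le>n * n. \<Sum>a<n. \<Sum>b<n. X (Q k) $$ (b, a) * (c i * Y (Q i) $$ (a, b)))"
    unfolding trace sum_distrib_left by (simp add: mult.left_commute)
  also have "\<dots> = (\<Sum>a<n. \<Sum>i\<le>n * n. \<Sum>b<n. X (Q k) $$ (b, a) * (c i * Y (Q i) $$ (a, b)))"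
    by (rule sum.swap)
  also have "\<dots> = (\<Sum>a<n. \<Sum>b<n. \<Sum>i\<le>n * n. X (Q k) $$ (b, a) * (c i * Y (Q i) $$ (a, b)))"
    by (intro sum.cong refl sum.swap)
  also have "\<dots> = (\<Sum>a<n. \<Sum>b<n. X (Q k) $$ (b, a) * (\<Sum>i\<le>n * n. c i * Y (Q i) $$ (a, b)))"
    by (simp add: sum_distrib_left)
  also have "\<dots> = 0"
    using c' by simp
  finally have "0 = (\<Sum>i\<le>n * n. c i * mat_trace (X (Q k) * Y (Q i)))" by simp
  also have "\<dots> = (\<Sum>i\<in>{k}. c i * mat_trace (X (Q k) * Y (Q i)))"
    using k(1) kmax P[of k] mem[of _ k]
    by (intro sum.mono_neutral_right) (auto, metis linorder_neqE_nat)
  finally show False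
    using k(2) P[of k] by simp
qed

lemma mat_trace_mult_rotate:
  fixes a b x :: "complex mat"
  assumes "x \<in> carrier_mat n n" "a \<in> carrier_mat n n" "b \<in> carrier_mat n n"
  shows "mat_trace (a * x * b) = mat_trace (x * (b * a))"
  using mat_trace_mult_commute[of a n "x * b"] assms
  by (simp add: assoc_mult_mat[of _ n n _ n _ n])

lemma pow_mat_Suc_left:
  fixes x :: "complex mat"
  shows "x \<in> carrier_mat n n \<Longrightarrow> x ^\<^sub>m Suc k = x * x ^\<^sub>m k"
  using mat_prod_replicate[of x n "Suc k"] mat_prod_replicate[of x n k] by simp

lemma pow_mat_inverse_cancel:
  assumes "x \<in> carrier_mat n n" "y \<in> carrier_mat n n" "y * x = 1\<^sub>m n"
  shows "y ^\<^sub>m k * x ^\<^sub>m (k + i) = (x :: complex mat) ^\<^sub>m i"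
proof (induction k)
  case 0
  then show ?case using assms by simp
next
  case (Suc k)
  have dims: "y ^\<^sub>m k \<in> carrier_mat n n" "x ^\<^sub>m (k + i) \<in> carrier_mat n n"
    using assms by auto
  have "y ^\<^sub>m Suc k * x ^\<^sub>m (Suc k + i) = (y ^\<^sub>m k * y) * (x * x ^\<^sub>m (k + i))"
    using pow_mat_Suc_left[OF assms(1), of "k + i"] by simp
  also have "\<dots> = y ^\<^sub>m k * (y * (x * x ^\<^sub>m (k + i)))"
    using dims assms by (intro assoc_mult_mat[of _ n n _ n _ n]) auto
  also have "y * (x * x ^\<^sub>m (k + i)) = (y * x) * x ^\<^sub>m (k + i)"
    using dims assms by (intro assoc_mult_mat[of _ n n _ n _ n, symmetric]) auto
  finally have "y ^\<^sub>m Suc k * x ^\<^sub>m (Suc k + i) = y ^\<^sub>m k * x ^\<^sub>m (k + i)"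
    using assms dims by simp
  then show ?case using Suc assms by simp
qed

lemma inverse_in_mat_span_powers:
  fixes x y :: "complex mat"
  assumes x: "x \<in> carrier_mat n n" and y: "y \<in> carrier_mat n n" and yx: "y * x = 1\<^sub>m n"
  shows "y \<in> mat_span n (range ((^\<^sub>m) x))"
proof -
  let ?f = "\<lambda>i j. (x ^\<^sub>m i) $$ (j div n, j mod n)"
  let ?P = "\<lambda>k. (^\<^sub>m) x ` {k<..}"
  have P: "?P k \<subseteq> carrier_mat n n" for k using x by auto
  obtain c where c: "\<exists>i\<le>n * n. c i \<noteq> 0" "\<forall>j<n * n. (\<Sum>i\<le>n * n. c i * ?f i j) = 0"
    using linear_dependence[of "n * n" ?f] by blast
  define k where "k = (LEAST i. c i \<noteq> 0)"
  have k: "c k \<noteq> 0" "\<And>i. i < k \<Longrightarrow> c i = 0"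
    unfolding k_def using c(1) LeastI[of "\<lambda>i. c i \<noteq> 0"] not_less_Least[of _ "\<lambda>i. c i \<noteq> 0"] by blast+
  have "k \<le> n * n"
    using c(1) k by (meson le_trans not_le)
  have part: "\<exists>m\<in>mat_span n (?P k). \<forall>a<n. \<forall>b<n. m $$ (a, b) = (\<Sum>i\<in>{k<..N}. c i * (x ^\<^sub>m i) $$ (a, b))" for N
  proof (induction N)
    case 0
    show ?case using mat_span.zero by (intro bexI[of _ "0\<^sub>m n n"]) auto
  next
    case (Suc N)
    then obtain m where m: "m \<in> mat_span n (?P k)" "\<forall>a<n. \<forall>b<n. m $$ (a, b) = (\<Sum>i\<in>{k<..N}. c i * (x ^\<^sub>m i) $$ (a, b))"
      by auto
    show ?case
    proof (cases "k < Suc N")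
      case True
      have eq: "{k<..Suc N} = insert (Suc N) {k<..N}" using True by auto
      have "m \<in> carrier_mat n n" using m(1) mat_span_carrier[OF P] by blast
      moreover have "x ^\<^sub>m Suc N \<in> carrier_mat n n" using x by (rule pow_carrier_mat)
      ultimately have "\<forall>a<n. \<forall>b<n. (c (Suc N) \<cdot>\<^sub>m x ^\<^sub>m Suc N + m) $$ (a, b) = (\<Sum>i\<in>{k<..Suc N}. c i * (x ^\<^sub>m i) $$ (a, b))"
        using m(2) unfolding eq by (simp del: pow_mat.simps add: carrier_matD[OF x])
      moreover have "c (Suc N) \<cdot>\<^sub>m x ^\<^sub>m Suc N + m \<in> mat_span n (?P k)"
        using True m(1) by (intro mat_span.step) (auto simp del: pow_mat.simps)
      ultimately show ?thesis by blast
    qed (use m in auto)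
  qed
  obtain m where m: "m \<in> mat_span n (?P k)" "\<forall>a<n. \<forall>b<n. m $$ (a, b) = (\<Sum>i\<in>{k<..n * n}. c i * (x ^\<^sub>m i) $$ (a, b))"
    using part[of "n * n"] by blast
  have mc: "m \<in> carrier_mat n n" using m(1) mat_span_carrier[OF P] by blast
  have "x ^\<^sub>m k = (- inverse (c k)) \<cdot>\<^sub>m m"
  proof (rule eq_matI)
    fix a b assume "a < dim_row ((- inverse (c k)) \<cdot>\<^sub>m m)" "b < dim_col ((- inverse (c k)) \<cdot>\<^sub>m m)"
    then have ab: "a < n" "b < n" using mc by auto
    have "a * n + b < n * n"
      using ab by (rule index_pair_less)
    then have "0 = (\<Sum>i\<le>n * n. c i * (x ^\<^sub>m i) $$ (a, b))"
      using c(2)[rule_format, of "a * n + b"] ab by simp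
    also have "\<dots> = (\<Sum>i\<in>{k..n * n}. c i * (x ^\<^sub>m i) $$ (a, b))"
      using k(2) by (intro sum.mono_neutral_right) (auto simp: not_le)
    also have "{k..n * n} = insert k {k<..n * n}"
      using \<open>k \<le> n * n\<close> by auto
    finally have "0 = c k * (x ^\<^sub>m k) $$ (a, b) + m $$ (a, b)"
      using m(2) ab by simp
    then have "m $$ (a, b) = - c k * (x ^\<^sub>m k) $$ (a, b)"
      by (simp add: eq_neg_iff_add_eq_0 add.commute)
    then show "(x ^\<^sub>m k) $$ (a, b) = ((- inverse (c k)) \<cdot>\<^sub>m m) $$ (a, b)"
      using ab mc k(1) by simp
  qed (use mc x in auto)
  then have xk: "x ^\<^sub>m k \<in> mat_span n (?P k)"
    using mat_span_smult[OF P m(1)] by simp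
  have R: "range ((^\<^sub>m) x) \<subseteq> carrier_mat n n" using x by auto
  have shift: "y ^\<^sub>m Suc k * z \<in> mat_span n (range ((^\<^sub>m) x))" if "z \<in> mat_span n (?P k)" for z
    using that
  proof (induction rule: mat_span.induct)
    case zero
    have "y ^\<^sub>m Suc k * 0\<^sub>m n n = 0\<^sub>m n n" using y by simp
    then show ?case using mat_span.zero by metis
  next
    case (step s z e)
    then obtain i where i: "s = x ^\<^sub>m (Suc k + i)"
      by (metis Suc_leI greaterThan_iff imageE le_iff_add)
    have yk: "y ^\<^sub>m Suc k \<in> carrier_mat n n" using y by (rule pow_carrier_mat)
    have sc: "s \<in> carrier_mat n n" unfolding i using x by (rule pow_carrier_mat)
    have "y ^\<^sub>m Suc k * (e \<cdot>\<^sub>m s + z) = e \<cdot>\<^sub>m (y ^\<^sub>m Suc k * s) + y ^\<^sub>m Suc k * z"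
      using yk sc mat_span_carrier[OF P step(2)]
      by (subst mult_add_distrib_mat[of _ n n]) (auto simp: mult_smult_distrib[of _ n n] simp del: pow_mat.simps)
    also have "y ^\<^sub>m Suc k * s = x ^\<^sub>m i"
      unfolding i using pow_mat_inverse_cancel[OF x y yx, of "Suc k" i] .
    finally show ?case
      using step(3) mat_span.step[of "x ^\<^sub>m i" "range ((^\<^sub>m) x)"] by auto
  qed
  have "y ^\<^sub>m Suc k * x ^\<^sub>m k = y"
  proof -
    have "y ^\<^sub>m Suc k * x ^\<^sub>m k = y * (y ^\<^sub>m k * x ^\<^sub>m (k + 0))"
      using pow_mat_Suc_left[OF y, of k] x y by (simp add: assoc_mult_mat[of _ n n _ n _ n] del: pow_mat.simps)
    also have "\<dots> = y"
      unfolding pow_mat_inverse_cancel[OF x y yx] using x y by simp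
    finally show ?thesis .
  qed
  then show ?thesis using shift[OF xk] by simp
qed

lemma mem_mats_UNIV [simp]: "A \<in> mats d UNIV \<longleftrightarrow> A \<in> carrier_mat d d"
  by (simp add: mats_def)

lemma monoid_mats_UNIV: "monoid \<lparr>carrier = mats d UNIV, mult = (*), one = 1\<^sub>m d\<rparr>"
  by (rule monoidI) (auto simp: assoc_mult_mat[of _ d d _ d _ d])

lemma group_GL_UNIV: "group (GL d UNIV)"
  unfolding GL_def by (rule monoid.units_group[OF monoid_mats_UNIV])

lemma GL_mult [simp]: "mult (GL d K) = (*)"
  and GL_one [simp]: "one (GL d K) = 1\<^sub>m d"
  by (simp_all add: GL_def units_of_def)

lemma mem_carrier_GL:
  "A \<in> carrier (GL d K) \<longleftrightarrow> A \<in> mats d K \<and> (\<exists>B\<in>mats d K. B * A = 1\<^sub>m d \<and> A * B = 1\<^sub>m d)"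
  by (auto simp: GL_def units_of_def Units_def)

lemma mats_subset_carrier: "A \<in> mats d K \<Longrightarrow> A \<in> carrier_mat d d"
  by (simp add: mats_def)

lemma carrier_GL_mono: "K \<subseteq> L \<Longrightarrow> carrier (GL d K) \<subseteq> carrier (GL d L)"
  by (auto simp: mem_carrier_GL mats_def subset_iff)

lemma GL_inv:
  assumes "A \<in> carrier (GL d K)" "B \<in> mats d K" "B * A = 1\<^sub>m d" "A * B = 1\<^sub>m d"
  shows "inv\<^bsub>GL d K\<^esub> A = B"
  unfolding m_inv_def
proof (rule the_equality)
  show "B \<in> carrier (GL d K) \<and> A \<otimes>\<^bsub>GL d K\<^esub> B = \<one>\<^bsub>GL d K\<^esub> \<and> B \<otimes>\<^bsub>GL d K\<^esub> A = \<one>\<^bsub>GL d K\<^esub>"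
    using assms by (auto simp: mem_carrier_GL)
next
  fix C assume C: "C \<in> carrier (GL d K) \<and> A \<otimes>\<^bsub>GL d K\<^esub> C = \<one>\<^bsub>GL d K\<^esub> \<and> C \<otimes>\<^bsub>GL d K\<^esub> A = \<one>\<^bsub>GL d K\<^esub>"
  then have dims: "A \<in> carrier_mat d d" "B \<in> carrier_mat d d" "C \<in> carrier_mat d d"
    using assms by (auto simp: mem_carrier_GL dest: mats_subset_carrier)
  have "C = (B * A) * C" using assms dims by simp
  also have "\<dots> = B * (A * C)" using dims by (simp add: assoc_mult_mat[of _ d d _ d _ d])
  also have "\<dots> = B" using C dims by simp
  finally show "C = B" .
qed

lemma generate_GL_UNIV:
  assumes "F \<subseteq> carrier (GL d K)"
  shows "generate (GL d K) F = generate (GL d UNIV) F"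
proof -
  have inv_eq: "inv\<^bsub>GL d K\<^esub> h = inv\<^bsub>GL d UNIV\<^esub> h" if "h \<in> F" for h
  proof -
    have h: "h \<in> carrier (GL d K)" using assms that by auto
    then obtain B where B: "B \<in> mats d K" "B * h = 1\<^sub>m d" "h * B = 1\<^sub>m d"
      by (auto simp: mem_carrier_GL)
    have "h \<in> carrier (GL d UNIV)" using h carrier_GL_mono[of K UNIV d] by auto
    then show ?thesis
      using GL_inv[OF h B] GL_inv[of h d UNIV B] B mats_subset_carrier[OF B(1)] by simp
  qed
  have "x \<in> generate (GL d UNIV) F" if "x \<in> generate (GL d K) F" for x
    using that
  proof (induction rule: generate.induct)
    case one
    then show ?case using generate.one[of "GL d UNIV" F] by simp
  next
    case (eng g h)
    then show ?case using generate.eng[of g "GL d UNIV" F h] by simp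
  qed (auto intro: generate.incl simp: inv_eq generate.inv)
  moreover have "x \<in> generate (GL d K) F" if "x \<in> generate (GL d UNIV) F" for x
    using that
  proof (induction rule: generate.induct)
    case one
    then show ?case using generate.one[of "GL d K" F] by simp
  next
    case (eng g h)
    then show ?case using generate.eng[of g "GL d K" F h] by simp
  next
    case (inv h)
    then show ?case using generate.inv[of h F "GL d K"] inv_eq by simp
  qed (auto intro: generate.incl)
  ultimately show ?thesis by blast
qed

lemma virtually_unipotent_UNIV:
  "virtually_unipotent d K \<Gamma> \<longleftrightarrow> virtually_unipotent d UNIV \<Gamma>"
proof -
  have "GL d K\<lparr>carrier := \<Gamma>\<rparr> = GL d UNIV\<lparr>carrier := \<Gamma>\<rparr>"
    by (simp add: GL_def units_of_def)
  then show ?thesis by (simp only: virtually_unipotent_def)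
qed

lemma set_power_add:
  assumes "F \<subseteq> carrier_mat d d"
  shows "set_power d F n \<subseteq> carrier_mat d d"
    and "set_power d F (m + n) = {A * B | A B. A \<in> set_power d F m \<and> B \<in> set_power d F n}"
proof -
  have carr: "set_power d F n \<subseteq> carrier_mat d d" for n
  proof (induction n)
    case (Suc n)
    then show ?case using assms by (force intro: mult_carrier_mat)
  qed simp
  then show "set_power d F n \<subseteq> carrier_mat d d" .
  show "set_power d F (m + n) = {A * B | A B. A \<in> set_power d F m \<and> B \<in> set_power d F n}"
  proof (induction m)
    case 0
    show ?case using carr[of n] by force
  next
    case (Suc m)
    show ?case
    proof (intro subset_antisym subsetI)
      fix x assume "x \<in> set_power d F (Suc m + n)"
      then obtain A B C where x: "x = A * (B * C)" "A \<in> F" "B \<in> set_power d F m" "C \<in> set_power d F n"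
        using Suc by auto
      then have "x = (A * B) * C"
        using assms carr by (simp add: assoc_mult_mat[of _ d d _ d _ d] subset_iff)
      then show "x \<in> {A * B | A B. A \<in> set_power d F (Suc m) \<and> B \<in> set_power d F n}"
        using x by auto
    next
      fix x assume "x \<in> {A * B | A B. A \<in> set_power d F (Suc m) \<and> B \<in> set_power d F n}"
      then obtain A B C where x: "x = (A * B) * C" "A \<in> F" "B \<in> set_power d F m" "C \<in> set_power d F n"
        by auto
      then have "x = A * (B * C)"
        using assms carr by (simp add: assoc_mult_mat[of _ d d _ d _ d] subset_iff)
      then show "x \<in> set_power d F (Suc m + n)"
        using x Suc by auto
    qed
  qed
qed

lemma finite_set_power: "finite F \<Longrightarrow> finite (set_power d F n)"
proof (induction n)
  case (Suc n)
  have "set_power d F (Suc n) = (\<lambda>(A, B). A * B) ` (F \<times> set_power d F n)" by auto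
  then show ?case using Suc by simp
qed simp

lemma pow_in_set_power:
  assumes "F \<subseteq> carrier_mat d d" "s \<in> set_power d F n"
  shows "s ^\<^sub>m k \<in> set_power d F (n * k)"
proof (induction k)
  case 0
  have "s \<in> carrier_mat d d" using set_power_add(1)[OF assms(1)] assms(2) by blast
  then show ?case by simp
next
  case (Suc k)
  have "set_power d F (n * k + n) = {A * B | A B. A \<in> set_power d F (n * k) \<and> B \<in> set_power d F n}"
    by (rule set_power_add(2)[OF assms(1)])
  then show ?case using Suc assms(2) by (auto simp: add.commute)
qed

lemma mat_distribs:
  fixes a b c :: "complex mat"
  assumes "a \<in> carrier_mat n n" "b \<in> carrier_mat n n" "c \<in> carrier_mat n n"
  shows "(a - b) * c = a * c - b * c" "c * (a - b) = c * a - c * b"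
  using assms by (auto intro: minus_mult_distrib_mat[of _ n n] mult_minus_distrib_mat[of _ n n])

lemma mem_GL_UNIV:
  "A \<in> carrier (GL d UNIV) \<longleftrightarrow> A \<in> carrier_mat d d \<and> (\<exists>B\<in>carrier_mat d d. B * A = 1\<^sub>m d \<and> A * B = 1\<^sub>m d)"
  by (auto simp: mem_carrier_GL)

theorem finite_traces_imp_virtually_unipotent:
  assumes F: "F \<subseteq> carrier (GL d UNIV)"
    and fin: "finite (mat_trace ` (\<Union>n. set_power d F n))"
  shows "virtually_unipotent d UNIV (generate (GL d UNIV) F)"
proof -
  interpret G: group "GL d UNIV" by (rule group_GL_UNIV)
  define S where "S = (\<Union>n. set_power d F n)"
  define \<Gamma> where "\<Gamma> = generate (GL d UNIV) F"
  have Fc: "F \<subseteq> carrier_mat d d" using F by (auto simp: mem_GL_UNIV)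
  have S: "S \<subseteq> carrier_mat d d"
    using set_power_add(1)[OF Fc] by (auto simp: S_def)
  have one_S: "1\<^sub>m d \<in> S"
    unfolding S_def by (rule UN_I[of 0]) auto
  have F_S: "F \<subseteq> S"
  proof
    fix f assume "f \<in> F"
    then have "f * 1\<^sub>m d \<in> set_power d F (Suc 0)" by auto
    moreover have "f * 1\<^sub>m d = f" using Fc \<open>f \<in> F\<close> by auto
    ultimately show "f \<in> S" unfolding S_def by (metis UN_I UNIV_I)
  qed
  have S_mult: "s * t \<in> S" if "s \<in> S" "t \<in> S" for s t
  proof -
    obtain m n where "s \<in> set_power d F m" "t \<in> set_power d F n"
      using \<open>s \<in> S\<close> \<open>t \<in> S\<close> by (auto simp: S_def)
    then have "s * t \<in> set_power d F (m + n)"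
      using set_power_add(2)[OF Fc, of m n] by auto
    then show ?thesis by (auto simp: S_def)
  qed
  have S_pow: "s ^\<^sub>m k \<in> S" if "s \<in> S" for s k
  proof (induction k)
    case 0
    have "s \<in> carrier_mat d d" using that S by auto
    then show ?case using one_S by simp
  qed (use that S_mult in auto)
  have \<Gamma>_sub: "subgroup \<Gamma> (GL d UNIV)"
    unfolding \<Gamma>_def by (rule G.generate_is_subgroup[OF F])
  have \<Gamma>c: "g \<in> carrier_mat d d" if "g \<in> \<Gamma>" for g
    using subgroup.mem_carrier[OF \<Gamma>_sub that] by (simp add: mem_GL_UNIV)
  have \<Gamma>_mult: "g * h \<in> \<Gamma>" if "g \<in> \<Gamma>" "h \<in> \<Gamma>" for g h
    using subgroup.m_closed[OF \<Gamma>_sub that] by simp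
  have \<Gamma>_one: "1\<^sub>m d \<in> \<Gamma>"
    using subgroup.one_closed[OF \<Gamma>_sub] by simp
  define A where "A = mat_span d S"
  note A_add = mat_span_add[OF S, folded A_def] and A_smult = mat_span_smult[OF S, folded A_def]
    and A_minus = mat_span_minus[OF S, folded A_def] and A_base = mat_span_base[OF S, folded A_def]
  have A_mult: "x * y \<in> A" if "x \<in> A" "y \<in> A" for x y
    using mat_span_mult[OF S mat_span_base[OF S S_mult]] that unfolding A_def by blast
  have Ac: "x \<in> carrier_mat d d" if "x \<in> A" for x
    using mat_span_carrier[OF S] that by (simp add: A_def)
  define R where "R = {x \<in> A. \<forall>b\<in>A. mat_trace (x * b) = 0}"
  have RA: "x \<in> A" and R_tr: "b \<in> A \<Longrightarrow> mat_trace (x * b) = 0" if "x \<in> R" for x b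
    using that by (simp_all add: R_def)
  have RI: "x \<in> R" if "x \<in> A" "\<And>b. b \<in> A \<Longrightarrow> mat_trace (x * b) = 0" for x
    using that by (simp add: R_def)
  have Rc: "x \<in> carrier_mat d d" if "x \<in> R" for x using Ac[OF RA[OF that]] .
  have R_zero: "0\<^sub>m d d \<in> R"
  proof (rule RI)
    show "0\<^sub>m d d \<in> A" unfolding A_def by (rule mat_span.zero)
    show "mat_trace (0\<^sub>m d d * b) = 0" if "b \<in> A" for b
      using left_mult_zero_mat[OF Ac[OF that], of d] by simp
  qed
  have R_add: "x + y \<in> R" if x: "x \<in> R" and y: "y \<in> R" for x y
  proof (rule RI)
    show "x + y \<in> A" using A_add[OF RA[OF x] RA[OF y]] .
    fix b assume b: "b \<in> A"
    have "(x + y) * b = x * b + y * b"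
      by (rule add_mult_distrib_mat[OF Rc[OF x] Rc[OF y] Ac[OF b]])
    then show "mat_trace ((x + y) * b) = 0"
      using mat_trace_add[of "x * b" d "y * b"] mult_carrier_mat[OF Rc[OF x] Ac[OF b]]
        mult_carrier_mat[OF Rc[OF y] Ac[OF b]] R_tr[OF x b] R_tr[OF y b] by simp
  qed
  have R_smult: "c \<cdot>\<^sub>m x \<in> R" if x: "x \<in> R" for c x
  proof (rule RI)
    show "c \<cdot>\<^sub>m x \<in> A" using A_smult[OF RA[OF x]] .
    fix b assume b: "b \<in> A"
    have "(c \<cdot>\<^sub>m x) * b = c \<cdot>\<^sub>m (x * b)"
      by (rule mult_smult_assoc_mat[OF Rc[OF x] Ac[OF b]])
    then show "mat_trace ((c \<cdot>\<^sub>m x) * b) = 0"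
      using mat_trace_smult[OF mult_carrier_mat[OF Rc[OF x] Ac[OF b]]] R_tr[OF x b] by simp
  qed
  have R_right: "x * b \<in> R" if x: "x \<in> R" and b: "b \<in> A" for x b
  proof (rule RI)
    show "x * b \<in> A" using A_mult[OF RA[OF x] b] .
    fix c assume c: "c \<in> A"
    show "mat_trace (x * b * c) = 0"
      using assoc_mult_mat[OF Rc[OF x] Ac[OF b] Ac[OF c]] R_tr[OF x A_mult[OF b c]] by simp
  qed
  have R_left: "b * x \<in> R" if x: "x \<in> R" and b: "b \<in> A" for x b
  proof (rule RI)
    show "b * x \<in> A" using A_mult[OF b RA[OF x]] .
    fix c assume c: "c \<in> A"
    show "mat_trace (b * x * c) = 0"
      using mat_trace_mult_rotate[OF Rc[OF x] Ac[OF b] Ac[OF c]] R_tr[OF x A_mult[OF c b]] by simp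
  qed
  have one_A: "1\<^sub>m d \<in> A" using A_base one_S by blast
  interpret R: nil_mat_algebra d R
  proof (rule trace_zero_nil_mat_algebra)
    show "mat_trace x = 0" if "x \<in> R" for x
      using R_tr[OF that one_A] right_mult_one_mat[OF Rc[OF that]] by simp
    show "R \<subseteq> carrier_mat d d" using Rc by blast
    show "x * y \<in> R" if "x \<in> R" "y \<in> R" for x y using R_right[OF that(1) RA[OF that(2)]] .
  qed (fact R_zero R_add R_smult)+
  obtain S0 where S0: "finite S0" "S0 \<subseteq> S"
    "\<And>x. x \<in> carrier_mat d d \<Longrightarrow> \<forall>s\<in>S0. mat_trace (x * s) = 0 \<Longrightarrow>
      \<forall>s\<in>S. mat_trace (x * s) = 0"
    using finite_trace_test[OF S] by blast
  define \<phi> where "\<phi> x = restrict (\<lambda>s. mat_trace (x * s)) S0" for x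
  have \<phi>_eq: "\<phi> x = \<phi> y \<longleftrightarrow> x - y \<in> R" if xy: "x \<in> A" "y \<in> A" for x y
  proof -
    have dist: "mat_trace ((x - y) * s) = mat_trace (x * s) - mat_trace (y * s)" if "s \<in> A" for s
    proof -
      have "x * s \<in> carrier_mat d d" "y * s \<in> carrier_mat d d"
        using Ac[OF A_mult[OF xy(1) that]] Ac[OF A_mult[OF xy(2) that]] .
      moreover have "(x - y) * s = x * s - y * s"
        using mat_distribs(1)[OF Ac[OF xy(1)] Ac[OF xy(2)] Ac[OF that]] .
      ultimately show ?thesis by (simp add: mat_trace_minus[of _ d])
    qed
    show ?thesis
    proof
      assume xyR: "x - y \<in> R"
      have "mat_trace (x * s) = mat_trace (y * s)" if "s \<in> S0" for s
      proof -
        have "s \<in> A" using that S0(2) A_base by blast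
        then show ?thesis using R_tr[OF xyR] dist[of s] by simp
      qed
      then show "\<phi> x = \<phi> y" unfolding \<phi>_def by (rule restrict_ext)
    next
      assume eq: "\<phi> x = \<phi> y"
      have "mat_trace ((x - y) * s) = 0" if "s \<in> S0" for s
      proof -
        have "s \<in> A" using that S0(2) A_base by blast
        then show ?thesis using fun_cong[OF eq, of s] dist[of s] that by (simp add: \<phi>_def)
      qed
      then have "mat_trace ((x - y) * s) = 0" if "s \<in> S" for s
        using S0(3)[of "x - y"] that Ac[OF A_minus[OF xy]] by blast
      then have "mat_trace ((x - y) * b) = 0" if "b \<in> A" for b
        using mat_span_trace_zero[OF S, of "x - y" b] that Ac[OF A_minus[OF xy]] by (simp add: A_def)
      then show "x - y \<in> R" by (rule RI[OF A_minus[OF xy]])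
    qed
  qed
  have fin_\<phi>: "finite (\<phi> ` S)"
  proof (rule finite_subset)
    show "\<phi> ` S \<subseteq> PiE S0 (\<lambda>_. mat_trace ` S)"
      using S_mult S0(2) by (auto simp: \<phi>_def)
    show "finite (PiE S0 (\<lambda>_. mat_trace ` S))"
      using fin S0(1) by (intro finite_PiE) (auto simp: S_def)
  qed
  have class_ex: "g \<in> A \<and> (\<exists>s\<in>S. g - s \<in> R)" if "g \<in> \<Gamma>" for g
    using that unfolding \<Gamma>_def
  proof (induction rule: generate.induct)
    case one
    have "1\<^sub>m d - 1\<^sub>m d = (0\<^sub>m d d :: complex mat)" by auto
    then show ?case using one_A one_S R_zero GL_one by metis
  next
    case (incl h)
    then have "h - h = 0\<^sub>m d d" using Fc by auto
    then show ?case using incl F_S A_base R_zero by (auto intro!: bexI[of _ h])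
  next
    case (inv h)
    have hS: "h \<in> S" using inv F_S by auto
    have hc: "h \<in> carrier_mat d d" using inv Fc by auto
    obtain y where y: "y \<in> carrier_mat d d" "y * h = 1\<^sub>m d" "h * y = 1\<^sub>m d"
    proof -
      have "h \<in> carrier (GL d UNIV)" using inv F by blast
      then show ?thesis using that unfolding mem_GL_UNIV by blast
    qed
    have invh: "inv\<^bsub>GL d UNIV\<^esub> h = y"
      using inv F y by (intro GL_inv) auto
    have "mat_span d (range ((^\<^sub>m) h)) \<subseteq> A"
    proof
      fix z assume "z \<in> mat_span d (range ((^\<^sub>m) h))"
      then show "z \<in> A"
        unfolding A_def by (induction rule: mat_span.induct) (auto intro!: mat_span.intros S_pow[OF hS])
    qed
    then have yA: "y \<in> A" using inverse_in_mat_span_powers[OF hc y(1,2)] by blast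
    then have yA': "y ^\<^sub>m k \<in> A" for k
    proof (induction k)
      case 0
      then show ?case using one_A y(1) by simp
    qed (use A_mult in auto)
    have "\<not> inj (\<lambda>i. \<phi> (h ^\<^sub>m i))"
    proof
      assume "inj (\<lambda>i. \<phi> (h ^\<^sub>m i))"
      then have "infinite (range (\<lambda>i. \<phi> (h ^\<^sub>m i)))"
        using finite_imageD infinite_UNIV_nat by blast
      moreover have "range (\<lambda>i. \<phi> (h ^\<^sub>m i)) \<subseteq> \<phi> ` S"
        using S_pow[OF hS] by auto
      ultimately show False using fin_\<phi> finite_subset by blast
    qed
    then obtain i j where ij: "i < j" "\<phi> (h ^\<^sub>m i) = \<phi> (h ^\<^sub>m j)"
      unfolding inj_on_def by (metis UNIV_I linorder_neqE_nat)
    define m where "m = j - Suc i"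
    have j: "j = Suc i + m" using ij(1) by (simp add: m_def)
    have pc: "h ^\<^sub>m k \<in> carrier_mat d d" "y ^\<^sub>m k \<in> carrier_mat d d" for k
      using hc y(1) by auto
    have "h ^\<^sub>m i - h ^\<^sub>m j \<in> R"
      using ij(2) \<phi>_eq A_base S_pow[OF hS] by blast
    then have "y ^\<^sub>m Suc i * (h ^\<^sub>m i - h ^\<^sub>m j) \<in> R"
      using R_left yA' by blast
    also have "y ^\<^sub>m Suc i * (h ^\<^sub>m i - h ^\<^sub>m j) = y ^\<^sub>m Suc i * h ^\<^sub>m i - y ^\<^sub>m Suc i * h ^\<^sub>m (Suc i + m)"
      unfolding j using pc by (intro mat_distribs(2)[of _ d]) blast+
    also have "y ^\<^sub>m Suc i * h ^\<^sub>m (Suc i + m) = h ^\<^sub>m m"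
      by (rule pow_mat_inverse_cancel[OF hc y(1,2)])
    also have "y ^\<^sub>m Suc i * h ^\<^sub>m i = y * (y ^\<^sub>m i * h ^\<^sub>m (i + 0))"
      unfolding pow_mat_Suc_left[OF y(1)] using pc y(1) by (simp add: assoc_mult_mat[of _ d d _ d _ d])
    also have "\<dots> = y"
      unfolding pow_mat_inverse_cancel[OF hc y(1,2)] using y(1) hc by simp
    finally show ?case
      unfolding invh using yA S_pow[OF hS] by blast
  next
    case (eng g h)
    then obtain s t where st: "s \<in> S" "t \<in> S" "g - s \<in> R" "h - t \<in> R" "g \<in> A" "h \<in> A" by auto
    have c: "g \<in> carrier_mat d d" "h \<in> carrier_mat d d" "s \<in> carrier_mat d d" "t \<in> carrier_mat d d"
      using st Ac S by auto
    have "g * h - s * t = (g - s) * h + s * (h - t)"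
    proof -
      have "(g - s) * h = g * h - s * h" "s * (h - t) = s * h - s * t"
        using c by (auto intro!: mat_distribs)
      then show ?thesis using c by (intro eq_matI) auto
    qed
    moreover have "(g - s) * h + s * (h - t) \<in> R"
      by (rule R_add[OF R_right[OF st(3,6)] R_left[OF st(4) A_base[OF st(1)]]])
    ultimately have "g * h - s * t \<in> R" by simp
    then show ?case
      using A_mult[OF st(5,6)] S_mult[OF st(1,2)] unfolding GL_mult by blast
  qed
  define H where "H = {g \<in> \<Gamma>. g - 1\<^sub>m d \<in> R}"
  let ?G = "GL d UNIV\<lparr>carrier := \<Gamma>\<rparr>"
  interpret \<Gamma>: group ?G
    by (rule G.subgroup_imp_group[OF \<Gamma>_sub])
  have \<Gamma>_inv: "\<exists>k\<in>\<Gamma>. k * g = 1\<^sub>m d \<and> g * k = 1\<^sub>m d \<and> inv\<^bsub>?G\<^esub> g = k" if "g \<in> \<Gamma>" for g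
    using \<Gamma>.inv_closed[of g] \<Gamma>.l_inv[of g] \<Gamma>.r_inv[of g] that by auto
  have H_sub: "subgroup H ?G"
  proof (rule \<Gamma>.subgroupI)
    show "H \<subseteq> carrier ?G" by (auto simp: H_def)
    have "1\<^sub>m d - 1\<^sub>m d = (0\<^sub>m d d :: complex mat)" by auto
    then have "1\<^sub>m d \<in> H" unfolding H_def using R_zero \<Gamma>_one by (metis (mono_tags, lifting) mem_Collect_eq)
    then show "H \<noteq> {}" by blast
  next
    fix g assume g: "g \<in> H"
    then obtain k where k: "k \<in> \<Gamma>" "k * g = 1\<^sub>m d" "g * k = 1\<^sub>m d" "inv\<^bsub>?G\<^esub> g = k"
      using \<Gamma>_inv[of g] by (auto simp: H_def)
    have c: "g \<in> carrier_mat d d" "k \<in> carrier_mat d d"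
      using g k \<Gamma>c by (auto simp: H_def)
    have "k * (g - 1\<^sub>m d) = 1\<^sub>m d - k"
      using mat_distribs(2)[of g d "1\<^sub>m d" k] c k by simp
    then have "1\<^sub>m d - k \<in> R"
      using R_left[of "g - 1\<^sub>m d" k] class_ex[OF k(1)] g by (simp add: H_def)
    then have "(- 1) \<cdot>\<^sub>m (1\<^sub>m d - k) \<in> R" by (rule R_smult)
    moreover have "(- 1) \<cdot>\<^sub>m (1\<^sub>m d - k) = k - 1\<^sub>m d"
      using c by (intro eq_matI) auto
    ultimately show "inv\<^bsub>?G\<^esub> g \<in> H" using k by (simp add: H_def)
  next
    fix g h assume gh: "g \<in> H" "h \<in> H"
    then have c: "g \<in> carrier_mat d d" "h \<in> carrier_mat d d"
      using \<Gamma>c by (auto simp: H_def)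
    have "g * h - 1\<^sub>m d = (g - 1\<^sub>m d) * h + (h - 1\<^sub>m d)"
      using mat_distribs(1)[of g d "1\<^sub>m d" h] c by (intro eq_matI) auto
    moreover have "(g - 1\<^sub>m d) * h + (h - 1\<^sub>m d) \<in> R"
      using gh R_add R_right class_ex by (simp add: H_def)
    ultimately show "g \<otimes>\<^bsub>?G\<^esub> h \<in> H"
      using gh \<Gamma>_mult by (simp add: H_def)
  qed
  have coset_eq: "H #>\<^bsub>?G\<^esub> g = H #>\<^bsub>?G\<^esub> g'" if gg: "g \<in> \<Gamma>" "g' \<in> \<Gamma>" "\<phi> g = \<phi> g'" for g g'
  proof -
    obtain k where k: "k \<in> \<Gamma>" "k * g' = 1\<^sub>m d" "g' * k = 1\<^sub>m d"
      using \<Gamma>_inv[OF gg(2)] by auto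
    have c: "g \<in> carrier_mat d d" "g' \<in> carrier_mat d d" "k \<in> carrier_mat d d"
      using gg k \<Gamma>c by auto
    have "g - g' \<in> R" using gg class_ex \<phi>_eq by blast
    then have "(g - g') * k \<in> R" using R_right class_ex k by blast
    moreover have "(g - g') * k = g * k - 1\<^sub>m d"
      using mat_distribs(1)[of g d g' k] c k by simp
    ultimately have "g * k \<in> H" using \<Gamma>_mult gg k by (simp add: H_def)
    moreover have "g = (g * k) * g'"
      using c k by (simp add: assoc_mult_mat[of g d d k d g' d])
    ultimately have "g \<in> H #>\<^bsub>?G\<^esub> g'"
      unfolding r_coset_def by auto
    then show ?thesis
      using \<Gamma>.repr_independence[of g H g'] gg H_sub by simp
  qed
  have "finite (\<phi> ` \<Gamma>)"
  proof (rule finite_subset[OF _ fin_\<phi>])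
    show "\<phi> ` \<Gamma> \<subseteq> \<phi> ` S"
    proof safe
      fix g assume "g \<in> \<Gamma>"
      then obtain s where "s \<in> S" "g - s \<in> R" "g \<in> A" using class_ex by blast
      then have "\<phi> g = \<phi> s" using \<phi>_eq A_base by blast
      then show "\<phi> g \<in> \<phi> ` S" using \<open>s \<in> S\<close> by blast
    qed
  qed
  moreover have "rcosets\<^bsub>?G\<^esub> H \<subseteq> (\<lambda>v. H #>\<^bsub>?G\<^esub> (SOME g. g \<in> \<Gamma> \<and> \<phi> g = v)) ` \<phi> ` \<Gamma>"
  proof
    fix D assume "D \<in> rcosets\<^bsub>?G\<^esub> H"
    then obtain g where g: "g \<in> \<Gamma>" "D = H #>\<^bsub>?G\<^esub> g"
      by (auto simp: RCOSETS_def)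
    let ?g = "SOME g'. g' \<in> \<Gamma> \<and> \<phi> g' = \<phi> g"
    have "?g \<in> \<Gamma> \<and> \<phi> ?g = \<phi> g"
      using g(1) by (intro someI[of "\<lambda>g'. g' \<in> \<Gamma> \<and> \<phi> g' = \<phi> g" g]) simp
    then have "H #>\<^bsub>?G\<^esub> ?g = D"
      unfolding g(2) by (intro coset_eq) (use g(1) in blast)+
    then show "D \<in> (\<lambda>v. H #>\<^bsub>?G\<^esub> (SOME g. g \<in> \<Gamma> \<and> \<phi> g = v)) ` \<phi> ` \<Gamma>"
      using g(1) by (intro image_eqI[of _ _ "\<phi> g"]) auto
  qed
  ultimately have "finite (rcosets\<^bsub>?G\<^esub> H)"
    by (meson finite_imageI finite_subset)
  moreover have "unipotent d h" if "h \<in> H" for h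
  proof -
    have R: "h - 1\<^sub>m d \<in> R" using that by (simp add: H_def)
    then have "mat_prod d (replicate d (h - 1\<^sub>m d)) = 0\<^sub>m d d"
      by (intro R.prod_zero) auto
    then show ?thesis
      using mat_prod_replicate[OF Ac[OF RA[OF R]], of d] by (auto simp: unipotent_def)
  qed
  ultimately show ?thesis
    using H_sub unfolding virtually_unipotent_def \<Gamma>_def by blast
qed

theorem virtually_unipotent_factorization:
  assumes F: "F \<subseteq> carrier (GL d UNIV)" "finite F"
    and vu: "virtually_unipotent d UNIV (generate (GL d UNIV) F)"
  obtains C E where "finite C" "finite E" "C \<subseteq> generate (GL d UNIV) F" "E \<subseteq> generate (GL d UNIV) F"
    and "\<And>xs. set xs \<subseteq> (\<lambda>h. h - 1\<^sub>m d) ` E \<Longrightarrow> length xs = d \<Longrightarrow> mat_prod d xs = 0\<^sub>m d d"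
    and "\<And>n g. g \<in> set_power d F n \<Longrightarrow>
      \<exists>hs c. length hs = n \<and> set hs \<subseteq> E \<and> c \<in> C \<and> g = mat_prod d hs * c"
proof -
  interpret G: group "GL d UNIV" by (rule group_GL_UNIV)
  define \<Gamma> where "\<Gamma> = generate (GL d UNIV) F"
  let ?G = "GL d UNIV\<lparr>carrier := \<Gamma>\<rparr>"
  have Fc: "F \<subseteq> carrier_mat d d" using F by (auto simp: mem_GL_UNIV)
  have \<Gamma>_sub: "subgroup \<Gamma> (GL d UNIV)"
    unfolding \<Gamma>_def by (rule G.generate_is_subgroup[OF F(1)])
  interpret \<Gamma>: group ?G
    by (rule G.subgroup_imp_group[OF \<Gamma>_sub])
  have \<Gamma>c: "g \<in> carrier_mat d d" if "g \<in> \<Gamma>" for g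
    using subgroup.mem_carrier[OF \<Gamma>_sub that] by (simp add: mem_GL_UNIV)
  have F\<Gamma>: "f \<in> \<Gamma>" if "f \<in> F" for f
    unfolding \<Gamma>_def using that by (rule generate.incl)
  obtain H where H: "subgroup H ?G" "finite (rcosets\<^bsub>?G\<^esub> H)" "\<And>h. h \<in> H \<Longrightarrow> unipotent d h"
    using vu unfolding virtually_unipotent_def \<Gamma>_def by blast
  have H\<Gamma>: "h \<in> \<Gamma>" if "h \<in> H" for h
    using subgroup.mem_carrier[OF H(1) that] by simp
  define r where "r D = (if D = H then 1\<^sub>m d else (SOME g. g \<in> D))" for D
  have r: "r D \<in> D \<and> r D \<in> \<Gamma>" if "D \<in> rcosets\<^bsub>?G\<^esub> H" for D
  proof -
    have "D \<noteq> {}" using subgroup.rcosets_non_empty[OF H(1) that] .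
    then have "r D \<in> D"
      using subgroup.one_closed[OF H(1)] by (auto simp: r_def some_in_eq)
    moreover have "D \<subseteq> \<Gamma>"
      using subgroup.rcosets_carrier[OF H(1) \<Gamma>.is_group that] by simp
    ultimately show ?thesis by blast
  qed
  define C where "C = r ` (rcosets\<^bsub>?G\<^esub> H)"
  define q where "q g = r (H #>\<^bsub>?G\<^esub> g)" for g
  define E where "E = (\<lambda>(c, f). (c * f) * inv\<^bsub>?G\<^esub> (q (c * f))) ` (C \<times> F)"
  have q: "q g \<in> C" "q g \<in> \<Gamma>" "g * inv\<^bsub>?G\<^esub> (q g) \<in> H" "g = (g * inv\<^bsub>?G\<^esub> (q g)) * q g" if g: "g \<in> \<Gamma>" for g
  proof -
    have D: "H #>\<^bsub>?G\<^esub> g \<in> rcosets\<^bsub>?G\<^esub> H"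
      using g H\<Gamma> by (intro \<Gamma>.rcosetsI) auto
    then show "q g \<in> C" by (auto simp: q_def C_def)
    show qG: "q g \<in> \<Gamma>" using r[OF D] by (simp add: q_def)
    have "q g \<in> H #>\<^bsub>?G\<^esub> g" using r[OF D] by (simp add: q_def)
    then obtain h where h: "h \<in> H" "q g = h * g"
      by (auto simp: r_coset_def)
    have "inv\<^bsub>?G\<^esub> (q g) = inv\<^bsub>?G\<^esub> g \<otimes>\<^bsub>?G\<^esub> inv\<^bsub>?G\<^esub> h"
      using h g H\<Gamma> \<Gamma>.inv_mult_group[of h g] by simp
    then have "g \<otimes>\<^bsub>?G\<^esub> inv\<^bsub>?G\<^esub> (q g) = inv\<^bsub>?G\<^esub> h"
      using h g H\<Gamma> \<Gamma>.m_assoc[of g "inv\<^bsub>?G\<^esub> g" "inv\<^bsub>?G\<^esub> h"] \<Gamma>.r_inv[of g] \<Gamma>.l_one[of "inv\<^bsub>?G\<^esub> h"]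
        \<Gamma>.inv_closed[of g] \<Gamma>.inv_closed[of h] by simp
    then show "g * inv\<^bsub>?G\<^esub> (q g) \<in> H"
      using subgroup.m_inv_closed[OF H(1) h(1)] by simp
    show "g = (g * inv\<^bsub>?G\<^esub> (q g)) * q g"
      using \<Gamma>.m_assoc[of g "inv\<^bsub>?G\<^esub> (q g)" "q g"] \<Gamma>.l_inv[of "q g"] \<Gamma>.r_one[of g] \<Gamma>.inv_closed[of "q g"] qG g
      by simp
  qed
  have C\<Gamma>: "C \<subseteq> \<Gamma>" using r by (auto simp: C_def)
  have mult\<Gamma>: "g * h \<in> \<Gamma>" if "g \<in> \<Gamma>" "h \<in> \<Gamma>" for g h
    using subgroup.m_closed[OF \<Gamma>_sub that] by simp
  have EH: "E \<subseteq> H"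
    using q(3) mult\<Gamma> C\<Gamma> F\<Gamma> by (auto simp: E_def)
  have one_C: "1\<^sub>m d \<in> C"
  proof -
    have "H \<in> rcosets\<^bsub>?G\<^esub> H"
      using subgroup.subgroup_in_rcosets[OF H(1) \<Gamma>.is_group] .
    then show ?thesis unfolding C_def by (intro image_eqI[of _ _ H]) (auto simp: r_def)
  qed
  have fact: "\<exists>hs c'. length hs = n \<and> set hs \<subseteq> E \<and> c' \<in> C \<and> c * g = mat_prod d hs * c'"
    if "g \<in> set_power d F n" "c \<in> C" for n g c
    using that
  proof (induction n arbitrary: g c)
    case 0
    have "c \<in> carrier_mat d d" using 0 C\<Gamma> \<Gamma>c by auto
    then show ?case using 0 by (intro exI[of _ "[]"] exI[of _ c]) auto
  next
    case (Suc n)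
    then obtain f g' where g: "g = f * g'" "f \<in> F" "g' \<in> set_power d F n" by auto
    define h where "h = (c * f) * inv\<^bsub>?G\<^esub> (q (c * f))"
    have cf: "c * f \<in> \<Gamma>" using Suc.prems(2) C\<Gamma> F\<Gamma> g mult\<Gamma> by auto
    obtain hs c' where IH: "length hs = n" "set hs \<subseteq> E" "c' \<in> C" "q (c * f) * g' = mat_prod d hs * c'"
      using Suc.IH[OF g(3) q(1)[OF cf]] by blast
    have h: "h \<in> E" unfolding h_def E_def using Suc.prems(2) g(2) by auto
    have dims: "c \<in> carrier_mat d d" "f \<in> carrier_mat d d" "g' \<in> carrier_mat d d" "h \<in> carrier_mat d d"
      "q (c * f) \<in> carrier_mat d d" "c' \<in> carrier_mat d d" "mat_prod d hs \<in> carrier_mat d d"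
      using Suc.prems(2) C\<Gamma> \<Gamma>c F\<Gamma> g set_power_add(1)[OF Fc, of n] h EH H\<Gamma> q(2)[OF cf] IH
      by (auto intro!: mat_prod_carrier)
    have "c * g = (c * f) * g'"
      using dims g by (simp add: assoc_mult_mat[of _ d d _ d _ d])
    also have "c * f = h * q (c * f)"
      using q(4)[OF cf] by (simp add: h_def)
    also have "h * q (c * f) * g' = mat_prod d (h # hs) * c'"
      using dims IH(4) by (simp add: assoc_mult_mat[of _ d d _ d _ d])
    finally show ?case
      using h IH by (intro exI[of _ "h # hs"] exI[of _ c']) auto
  qed
  show ?thesis
  proof (rule that[of C E])
    show "finite C" using H(2) by (simp add: C_def)
    then show "finite E" using F(2) by (simp add: E_def)
    show "C \<subseteq> generate (GL d UNIV) F" using C\<Gamma> by (simp add: \<Gamma>_def)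
    show "E \<subseteq> generate (GL d UNIV) F" using EH H\<Gamma> by (auto simp: \<Gamma>_def)
    show "mat_prod d xs = 0\<^sub>m d d" if "set xs \<subseteq> (\<lambda>h. h - 1\<^sub>m d) ` E" "length xs = d" for xs
    proof (rule unipotent_semigroup_prod_zero[where H = H])
      show "g * h \<in> H" if "g \<in> H" "h \<in> H" for g h
        using subgroup.m_closed[OF H(1) that] by simp
    qed (use that EH H\<Gamma> \<Gamma>c H(3) in auto)
    show "\<exists>hs c. length hs = n \<and> set hs \<subseteq> E \<and> c \<in> C \<and> g = mat_prod d hs * c"
      if "g \<in> set_power d F n" for n g
    proof -
      have "g \<in> carrier_mat d d" using set_power_add(1)[OF Fc] that by auto
      then show ?thesis using fact[OF that one_C] by simp
    qed
  qed
qed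

section \<open>Subfields of the complex numbers\<close>

locale complex_subfield =
  fixes K :: "complex set"
  assumes zero [simp]: "0 \<in> K" and one [simp]: "1 \<in> K"
    and add [simp]: "x \<in> K \<Longrightarrow> y \<in> K \<Longrightarrow> x + y \<in> K"
    and mult [simp]: "x \<in> K \<Longrightarrow> y \<in> K \<Longrightarrow> x * y \<in> K"
    and uminus [simp]: "x \<in> K \<Longrightarrow> - x \<in> K"
    and inverse [simp]: "x \<in> K \<Longrightarrow> inverse x \<in> K"
begin

lemma diff [simp]: "x \<in> K \<Longrightarrow> y \<in> K \<Longrightarrow> x - y \<in> K"
  using add[of x "- y"] by simp

lemma divide [simp]: "x \<in> K \<Longrightarrow> y \<in> K \<Longrightarrow> x / y \<in> K"
  by (simp add: divide_inverse)

lemma power [simp]: "x \<in> K \<Longrightarrow> x ^ n \<in> K"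
  by (induction n) auto

lemma sum [simp]: "(\<And>i. i \<in> I \<Longrightarrow> f i \<in> K) \<Longrightarrow> (\<Sum>i\<in>I. f i) \<in> K"
  by (induction I rule: infinite_finite_induct) auto

lemma prod [simp]: "(\<And>i. i \<in> I \<Longrightarrow> f i \<in> K) \<Longrightarrow> (\<Prod>i\<in>I. f i) \<in> K"
  by (induction I rule: infinite_finite_induct) auto

lemma of_nat [simp]: "of_nat n \<in> K"
  by (induction n) auto

lemma of_int [simp]: "of_int n \<in> K"
  by (cases n) auto

lemma of_rat [simp]: "of_rat q \<in> K"
  by (cases q) (simp add: of_rat_rat)

lemma Rats_subset: "\<rat> \<subseteq> K"
  by (auto elim: Rats_cases)

end

lemma complex_subfieldI:
  assumes "subfield K \<CC>"
  shows "complex_subfield K"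
proof -
  interpret subfield K \<CC> by (rule assms)
  have sr: "subring K \<CC>" by (rule subfieldE(1)[OF assms])
  note E = subringE[OF sr, unfolded class_ring_simps, simplified]
  have uminus: "- x \<in> K" if "x \<in> K" for x
    using E(5)[of x] that by (simp add: class_ring_simps)
  have inverse: "inverse x \<in> K" if "x \<in> K" for x
  proof (cases "x = 0")
    case False
    then have "x \<in> Units (\<CC>\<lparr>carrier := K\<rparr>)"
      using that subfield_Units by simp
    then obtain y where "y \<in> K" "x * y = 1" by (auto simp: Units_def)
    then have "inverse x = y" by (metis inverse_unique)
    then show ?thesis using \<open>y \<in> K\<close> by simp
  qed (use that in simp)
  show ?thesis
    using E uminus inverse by unfold_locales auto
qed

lemma number_field_basis:
  assumes "number_field K"
  obtains b :: "nat \<Rightarrow> complex" and n :: nat where "n > 0" and "n = ring.dim \<CC> \<rat> K"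
    and "\<And>i. i < n \<Longrightarrow> b i \<in> K"
    and "\<And>x. x \<in> K \<Longrightarrow> \<exists>c. x = (\<Sum>i<n. of_rat (c i) * b i)"
    and "\<And>c. (\<Sum>i<n. of_rat (c i) * b i) = 0 \<Longrightarrow> \<forall>i<n. c i = 0"
proof -
  interpret complex_subfield K
    using assms by (auto simp: number_field_def intro: complex_subfieldI)
  define CC :: "complex ring" where "CC = \<CC>"
  have CC [simp]: "carrier CC = UNIV" "mult CC = (*)" "add CC = (+)" "\<one>\<^bsub>CC\<^esub> = 1" "\<zero>\<^bsub>CC\<^esub> = 0"
    by (simp_all add: CC_def)
  interpret R: field CC unfolding CC_def by (rule class_field)
  have Q: "subfield \<rat> CC"
  proof (rule R.subfieldI')
    have um: "\<ominus>\<^bsub>CC\<^esub> x = - x" for x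
      by (rule R.minus_equality) auto
    show "subring \<rat> CC"
      by (rule R.subringI) (auto simp: um)
    fix k :: complex assume k: "k \<in> \<rat> - {\<zero>\<^bsub>CC\<^esub>}"
    then have "inv\<^bsub>CC\<^esub> k = inverse k"
      by (intro R.comm_inv_char) auto
    then show "inv\<^bsub>CC\<^esub> k \<in> \<rat>" using k by simp
  qed
  have fd: "R.finite_dimension \<rat> K"
    using assms by (simp add: number_field_def CC_def)
  define n where "n = R.dim \<rat> K"
  have "R.dimension n \<rat> K"
    using R.finite_dimensionE[OF Q fd] by (simp add: over_def n_def)
  then obtain Vs where Vs: "R.independent \<rat> Vs" "length Vs = n" "R.Span \<rat> Vs = K"
    using R.exists_base[OF Q] by blast
  have comb: "R.combine (map c [0..<length Us]) Us = (\<Sum>i<length Us. c i * Us ! i)" for c Us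
  proof (induction Us arbitrary: c)
    case (Cons u Us)
    have "map c [0..<length (u # Us)] = c 0 # map (\<lambda>i. c (Suc i)) [0..<length Us]"
      by (simp add: upt_conv_Cons map_Suc_upt[symmetric] del: upt_Suc)
    then show ?case
      using Cons[of "\<lambda>i. c (Suc i)"] by (simp add: sum.lessThan_Suc_shift del: upt_Suc sum.lessThan_Suc)
  qed simp
  have inK: "Vs ! i \<in> K" if "i < n" for i
    using R.Span_base_incl[OF Q, of Vs] Vs that by (auto simp: subset_iff)
  show thesis
  proof (rule that[of n "\<lambda>i. Vs ! i"])
    show "n > 0"
    proof (rule ccontr)
      assume "\<not> n > 0"
      then have "K = {0}" using Vs by simp
      then show False using one by auto
    qed
    show "n = ring.dim \<CC> \<rat> K" by (simp add: n_def CC_def)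
    fix x assume "x \<in> K"
    then obtain Ks where Ks: "set Ks \<subseteq> \<rat>" "length Ks = n" "x = R.combine Ks Vs"
      using R.Span_mem_iff_length_version[OF Q, of Vs x] Vs by auto
    then have "\<forall>i. \<exists>q. i < n \<longrightarrow> Ks ! i = of_rat q"
      by (metis Rats_cases nth_mem subset_eq)
    then obtain c where c: "\<And>i. i < n \<Longrightarrow> Ks ! i = of_rat (c i)" by metis
    have "Ks = map (\<lambda>i. of_rat (c i)) [0..<length Vs]"
      using c Ks(2) Vs(2) by (intro nth_equalityI) auto
    then show "\<exists>c. x = (\<Sum>i<n. of_rat (c i) * Vs ! i)"
      using comb[of "\<lambda>i. of_rat (c i)" Vs] Ks(3) Vs(2) by auto
  next
    fix c :: "nat \<Rightarrow> rat" assume "(\<Sum>i<n. of_rat (c i) * Vs ! i) = 0"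
    then have "R.combine (map (\<lambda>i. of_rat (c i)) [0..<length Vs]) Vs = \<zero>\<^bsub>CC\<^esub>"
      using comb[of "\<lambda>i. of_rat (c i)" Vs] Vs(2) by simp
    moreover have "set (map (\<lambda>i. of_rat (c i) :: complex) [0..<length Vs]) \<subseteq> \<rat>"
      by auto
    ultimately have "set (take (length Vs) (map (\<lambda>i. of_rat (c i) :: complex) [0..<length Vs])) \<subseteq> {\<zero>\<^bsub>CC\<^esub>}"
      using R.independent_imp_trivial_combine[OF Q Vs(1)] by blast
    then show "\<forall>i<n. c i = 0"
      using Vs(2) by (auto simp: image_subset_iff)
  qed (use inK in auto)
qed

lemma number_field_dependence:
  assumes "number_field K"
  obtains n :: nat where "\<And>y :: nat \<Rightarrow> complex. (\<And>i. i \<le> n \<Longrightarrow> y i \<in> K) \<Longrightarrow>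
    \<exists>c. (\<exists>i\<le>n. c i \<noteq> 0) \<and> (\<Sum>i\<le>n. of_rat (c i) * y i) = 0"
proof -
  obtain b :: "nat \<Rightarrow> complex" and n :: nat where b: "\<And>x. x \<in> K \<Longrightarrow> \<exists>c. x = (\<Sum>i<n. of_rat (c i) * b i)"
    by (rule number_field_basis[OF assms]) (rule that)
  show thesis
  proof (rule that[of n])
    fix y :: "nat \<Rightarrow> complex" assume "\<And>i. i \<le> n \<Longrightarrow> y i \<in> K"
    then have "\<forall>i. \<exists>c. i \<le> n \<longrightarrow> y i = (\<Sum>j<n. of_rat (c j) * b j)"
      using b by blast
    then obtain M where M: "\<And>i. i \<le> n \<Longrightarrow> y i = (\<Sum>j<n. of_rat (M i j) * b j)"
      by metis
    obtain c where c: "\<exists>i\<le>n. c i \<noteq> 0" "\<forall>j<n. (\<Sum>i\<le>n. c i * M i j) = 0"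
      using linear_dependence[of n M] by blast
    have "(\<Sum>i\<le>n. of_rat (c i) * y i) = (\<Sum>i\<le>n. \<Sum>j<n. of_rat (c i * M i j) * b j)"
      using M by (simp add: sum_distrib_left of_rat_mult mult.assoc)
    also have "\<dots> = (\<Sum>j<n. of_rat (\<Sum>i\<le>n. c i * M i j) * b j)"
      by (subst sum.swap) (simp add: of_rat_sum sum_distrib_right)
    also have "\<dots> = 0" using c(2) by simp
    finally show "\<exists>c. (\<exists>i\<le>n. c i \<noteq> 0) \<and> (\<Sum>i\<le>n. of_rat (c i) * y i) = 0"
      using c(1) by blast
  qed
qed

lemma number_field_algebraic:
  assumes "number_field K" "x \<in> K"
  shows "algebraic x"
proof -
  interpret complex_subfield K
    using assms by (auto simp: number_field_def intro: complex_subfieldI)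
  obtain n :: nat where n: "\<And>y. (\<And>i. i \<le> n \<Longrightarrow> y i \<in> K) \<Longrightarrow>
      \<exists>c. (\<exists>i\<le>n. c i \<noteq> 0) \<and> (\<Sum>i\<le>n. of_rat (c i) * y i) = (0 :: complex)"
    using number_field_dependence[OF assms(1)] by metis
  obtain c :: "nat \<Rightarrow> rat" where c: "\<exists>i\<le>n. c i \<noteq> 0" "(\<Sum>i\<le>n. of_rat (c i) * x ^ i) = 0"
    using n[of "\<lambda>i. x ^ i"] assms(2) by auto
  define p :: "complex poly" where "p = Poly (map (\<lambda>i. of_rat (c i)) [0..<Suc n])"
  have coeff: "coeff p i = (if i \<le> n then of_rat (c i) else 0)" for i
    by (simp add: p_def nth_default_def del: upt_Suc)
  have "degree p \<le> n"
    by (rule degree_le) (simp add: coeff)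
  then have "poly p x = (\<Sum>i\<le>n. coeff p i * x ^ i)"
    unfolding poly_altdef by (intro sum.mono_neutral_left) (auto simp: coeff_eq_0)
  also have "\<dots> = 0" using c(2) by (simp add: coeff)
  finally have "poly p x = 0" .
  moreover have "p \<noteq> 0" using c(1) coeff by (metis coeff_0 of_rat_eq_0_iff)
  ultimately show ?thesis
    by (intro algebraicI'[of p]) (auto simp: coeff)
qed

section \<open>Absolute values\<close>

lemma power_le_linear_imp_le_one:
  fixes t :: real
  assumes "\<And>n. t ^ n \<le> c * (real n + 1)"
  shows "t \<le> 1"
proof (rule ccontr)
  assume "\<not> t \<le> 1"
  then have t: "t > 1" by simp
  then have "(\<lambda>n. c * (real n + 1) / t ^ n) \<longlonglongrightarrow> 0" by real_asymp
  then have "eventually (\<lambda>n. c * (real n + 1) / t ^ n < 1) sequentially"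
    by (rule order_tendstoD) simp
  then obtain n where "c * (real n + 1) / t ^ n < 1"
    by (auto simp: eventually_sequentially)
  then have "c * (real n + 1) < t ^ n" using t by (simp add: divide_simps)
  then show False using assms[of n] by simp
qed

locale valued_subfield = complex_subfield +
  fixes a :: "complex \<Rightarrow> real"
  assumes abs_val: "absolute_value K a"
begin

lemma nonneg [simp]: "x \<in> K \<Longrightarrow> 0 \<le> a x"
  and eq_0_iff: "x \<in> K \<Longrightarrow> a x = 0 \<longleftrightarrow> x = 0"
  and abs_mult: "x \<in> K \<Longrightarrow> y \<in> K \<Longrightarrow> a (x * y) = a x * a y"
  and abs_add: "x \<in> K \<Longrightarrow> y \<in> K \<Longrightarrow> a (x + y) \<le> a x + a y"
  and extensional: "a \<in> extensional K"
  using abs_val by (auto simp: absolute_value_def)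

lemma abs_0 [simp]: "a 0 = 0" by (simp add: eq_0_iff)

lemma pos: "x \<in> K \<Longrightarrow> x \<noteq> 0 \<Longrightarrow> 0 < a x"
  using nonneg[of x] eq_0_iff[of x] by linarith

lemma abs_1 [simp]: "a 1 = 1"
  using abs_mult[of 1 1] pos[of 1] by simp

lemma abs_uminus [simp]: "x \<in> K \<Longrightarrow> a (- x) = a x"
proof -
  assume x: "x \<in> K"
  have "a (- 1) * a (- 1) = 1" using abs_mult[of "- 1" "- 1"] by simp
  then have "a (- 1) = 1 \<or> a (- 1) = - 1" by (simp add: square_eq_1_iff)
  moreover have "0 \<le> a (- 1)" by simp
  ultimately have "a (- 1) = 1" by linarith
  then show ?thesis using abs_mult[of "- 1" x] x by simp
qed

lemma abs_minus_commute: "x \<in> K \<Longrightarrow> y \<in> K \<Longrightarrow> a (x - y) = a (y - x)"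
  using abs_uminus[of "x - y"] by simp

lemma abs_diff: "x \<in> K \<Longrightarrow> y \<in> K \<Longrightarrow> a (x - y) \<le> a x + a y"
  using abs_add[of x "- y"] by simp

lemma abs_diff_ge: "x \<in> K \<Longrightarrow> y \<in> K \<Longrightarrow> \<bar>a x - a y\<bar> \<le> a (x - y)"
  using abs_add[of "x - y" y] abs_add[of "y - x" x] abs_minus_commute[of x y] by auto

lemma abs_power: "x \<in> K \<Longrightarrow> a (x ^ n) = a x ^ n"
  by (induction n) (auto simp: abs_mult)

lemma abs_inverse: "x \<in> K \<Longrightarrow> a (inverse x) = inverse (a x)"
proof (cases "x = 0")
  case False
  assume x: "x \<in> K"
  have "a (inverse x) * a x = 1"
    using abs_mult[of "inverse x" x] x False by simp
  then show ?thesis by (metis inverse_unique mult.commute)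
qed simp

lemma abs_divide: "x \<in> K \<Longrightarrow> y \<in> K \<Longrightarrow> a (x / y) = a x / a y"
  by (simp add: divide_inverse abs_mult abs_inverse)

lemma abs_sum: "(\<And>i. i \<in> I \<Longrightarrow> f i \<in> K) \<Longrightarrow> a (\<Sum>i\<in>I. f i) \<le> (\<Sum>i\<in>I. a (f i))"
proof (induction I rule: infinite_finite_induct)
  case (insert i I)
  then have "a (f i + (\<Sum>i\<in>I. f i)) \<le> a (f i) + a (\<Sum>i\<in>I. f i)"
    by (intro abs_add) auto
  then show ?case using insert by auto
qed auto

lemma abs_of_nat_le: "a (of_nat n) \<le> real n"
proof (induction n)
  case (Suc n)
  then show ?case using abs_add[of 1 "of_nat n"] by simp
qed simp

lemma binomial_bound:
  assumes x: "x \<in> K" "y \<in> K" and B: "\<And>i. i \<le> n \<Longrightarrow> a (of_nat (n choose i)) * a x ^ i * a y ^ (n - i) \<le> B"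
  shows "a (x + y) ^ n \<le> real (Suc n) * B"
proof -
  have "a (x + y) ^ n = a ((x + y) ^ n)" using x by (simp add: abs_power)
  also have "(x + y) ^ n = (\<Sum>i\<le>n. of_nat (n choose i) * x ^ i * y ^ (n - i))"
    by (rule binomial_ring)
  also have "a \<dots> \<le> (\<Sum>i\<le>n. a (of_nat (n choose i) * x ^ i * y ^ (n - i)))"
    using x by (intro abs_sum) auto
  also have "\<dots> \<le> (\<Sum>i\<le>n. B)"
    using x B by (intro sum_mono) (simp add: abs_mult abs_power)
  also have "\<dots> = real (Suc n) * B" by simp
  finally show ?thesis .
qed

lemma ultrametricI:
  assumes le1: "\<And>n. a (of_nat n) \<le> 1"
  shows "ultrametric K a"
  unfolding ultrametric_def
proof (intro ballI)
  fix x y assume xy: "x \<in> K" "y \<in> K"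
  define M where "M = max (a x) (a y)"
  have M: "0 \<le> M" "a x \<le> M" "a y \<le> M" using xy by (auto simp: M_def le_max_iff_disj)
  have bd: "a (x + y) ^ n \<le> real (Suc n) * M ^ n" for n
  proof (rule binomial_bound[OF xy])
    fix i assume "i \<le> n"
    have "a (of_nat (n choose i)) * a x ^ i * a y ^ (n - i) \<le> 1 * M ^ i * M ^ (n - i)"
      using M xy le1 by (intro mult_mono power_mono) (auto intro!: mult_nonneg_nonneg)
    also have "\<dots> = M ^ n" using \<open>i \<le> n\<close> by (simp add: power_add[symmetric])
    finally show "a (of_nat (n choose i)) * a x ^ i * a y ^ (n - i) \<le> M ^ n" .
  qed
  show "a (x + y) \<le> max (a x) (a y)"
  proof (cases "M = 0")
    case True
    then show ?thesis using bd[of 1] by (simp add: M_def)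
  next
    case False
    then have "M > 0" using M by simp
    have "(a (x + y) / M) ^ n \<le> 1 * (real n + 1)" for n
      using bd[of n] \<open>M > 0\<close> by (simp add: divide_simps power_divide algebra_simps)
    then have "a (x + y) / M \<le> 1" by (rule power_le_linear_imp_le_one)
    then show ?thesis using \<open>M > 0\<close> by (simp add: M_def divide_simps)
  qed
qed

lemma ultrametric_sum:
  assumes u: "ultrametric K a" and f: "\<And>i. i \<in> I \<Longrightarrow> f i \<in> K" "\<And>i. i \<in> I \<Longrightarrow> a (f i) \<le> B" and "0 \<le> B"
  shows "a (\<Sum>i\<in>I. f i) \<le> B"
  using f
proof (induction I rule: infinite_finite_induct)
  case (insert i I)
  then have "a (f i + (\<Sum>i\<in>I. f i)) \<le> max (a (f i)) (a (\<Sum>i\<in>I. f i))"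
    using u by (auto simp: ultrametric_def)
  also have "\<dots> \<le> B" using insert by auto
  finally show ?case using insert by simp
qed (use \<open>0 \<le> B\<close> in auto)

lemma ultrametric_of_nat: "ultrametric K a \<Longrightarrow> a (of_nat n) \<le> 1"
proof (induction n)
  case (Suc n)
  have "a (1 + of_nat n) \<le> max (a 1) (a (of_nat n))"
    using Suc.prems one of_nat[of n] unfolding ultrametric_def by blast
  then show ?case using Suc by simp
qed simp

lemma ultrametric_of_int: "ultrametric K a \<Longrightarrow> a (of_int n) \<le> 1"
  using ultrametric_of_nat by (cases n rule: int_cases2) auto

end

section \<open>Ostrowski's theorem and places\<close>

definition standard_abs :: "complex set \<Rightarrow> (complex \<Rightarrow> real) set" where
  "standard_abs K = {a. absolute_value K a \<and> extends_standard a}"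

lemma padic_abs_of_int:
  "n \<noteq> 0 \<Longrightarrow> padic_abs p (of_int n) = real p powi (- int (multiplicity (int p) n))"
  by (simp add: padic_abs_def)

lemma padic_abs_self: "prime p \<Longrightarrow> padic_abs p (of_nat p) = 1 / real p"
proof -
  assume p: "prime p"
  then have "prime (int p)" by simp
  then have "multiplicity (int p) (int p) = 1"
    by (intro multiplicity_self) auto
  then show ?thesis
    using padic_abs_of_int[of "int p" p] prime_gt_0_nat[OF p] by (simp add: power_int_minus_divide)
qed

lemma padic_abs_of_nat_le: "prime p \<Longrightarrow> padic_abs p (of_nat n) \<le> 1"
proof (cases "n = 0")
  case False
  assume "prime p"
  then have "real p \<ge> 1" using prime_gt_0_nat[of p] by simp
  then show ?thesis
    using False padic_abs_of_int[of "int n" p]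
    by (simp add: power_int_minus_divide)
qed (simp add: padic_abs_def)

lemma padic_abs_of_int_coprime:
  assumes "\<not> int p dvd n"
  shows "padic_abs p (of_int n) = 1"
  using assms padic_abs_of_int[of n p] by (cases "n = 0") (auto simp: not_dvd_imp_multiplicity_0)

lemma padic_abs_other:
  assumes "prime p" "prime q" "p \<noteq> q"
  shows "padic_abs p (of_nat q) = 1"
proof -
  have "\<not> int p dvd int q" using assms primes_dvd_imp_eq by auto
  then show ?thesis using padic_abs_of_int_coprime[of p "int q"] by simp
qed

lemma powr_power_real:
  fixes x :: real
  shows "0 \<le> x \<Longrightarrow> (x powr s) ^ n = (x ^ n) powr s"
  by (induction n) (auto simp: powr_mult)

context valued_subfield
begin

lemma powr_absolute_value:
  assumes "s > 0"
    and add: "\<And>x y. x \<in> K \<Longrightarrow> y \<in> K \<Longrightarrow> a (x + y) powr s \<le> a x powr s + a y powr s"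
  shows "absolute_value K (restrict (\<lambda>x. a x powr s) K)"
  using assms eq_0_iff unfolding absolute_value_def by (auto simp: abs_mult powr_mult)

lemma powr_absolute_value_ultrametric:
  assumes "s > 0" and u: "ultrametric K a"
  shows "absolute_value K (restrict (\<lambda>x. a x powr s) K)"
proof (rule powr_absolute_value[OF \<open>s > 0\<close>])
  fix x y assume xy: "x \<in> K" "y \<in> K"
  then have "a (x + y) \<le> max (a x) (a y)" using u by (auto simp: ultrametric_def)
  then have "a (x + y) powr s \<le> max (a x) (a y) powr s"
    using xy \<open>s > 0\<close> by (intro powr_mono2) auto
  also have "\<dots> \<le> a x powr s + a y powr s" by (auto simp: max_def)
  finally show "a (x + y) powr s \<le> a x powr s + a y powr s" .
qed

text \<open>
  If \<open>a\<close> restricts to a power of the usual absolute value, the corresponding root of \<open>a\<close> satisfies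
  the triangle inequality up to a factor \<open>n + 1\<close> for \<open>n\<close>-th powers, which disappears in the limit.
\<close>

lemma powr_absolute_value_archimedean:
  assumes "s > 0" and nat: "\<And>n. a (of_nat n) powr s = real n"
  shows "absolute_value K (restrict (\<lambda>x. a x powr s) K)"
proof (rule powr_absolute_value[OF \<open>s > 0\<close>])
  fix x y assume xy: "x \<in> K" "y \<in> K"
  define u v w where "u = a x powr s" and "v = a y powr s" and "w = a (x + y) powr s"
  have nn: "0 \<le> u" "0 \<le> v" "0 \<le> w" by (simp_all add: u_def v_def w_def)
  have s': "real k powr s \<le> real k ^ nat \<lceil>s\<rceil>" if "k \<ge> 1" for k
  proof -
    have "real k powr s \<le> real k powr real (nat \<lceil>s\<rceil>)"
      using that by (intro powr_mono) linarith+
    then show ?thesis using that by (simp add: powr_realpow)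
  qed
  have bd: "w ^ n \<le> (real n + 1) ^ nat \<lceil>s\<rceil> * (u + v) ^ n" for n
  proof -
    define B where "B = Max ((\<lambda>i. a (of_nat (n choose i)) * a x ^ i * a y ^ (n - i)) ` {..n})"
    have "B \<in> (\<lambda>i. a (of_nat (n choose i)) * a x ^ i * a y ^ (n - i)) ` {..n}"
      unfolding B_def by (intro Max_in) auto
    then obtain i where i: "i \<le> n" "B = a (of_nat (n choose i)) * a x ^ i * a y ^ (n - i)" by auto
    have "a (x + y) ^ n \<le> real (Suc n) * B"
      by (rule binomial_bound[OF xy]) (auto simp: B_def intro!: Max_ge)
    then have "(a (x + y) ^ n) powr s \<le> (real (Suc n) * B) powr s"
      using xy \<open>s > 0\<close> by (intro powr_mono2) auto
    also have "\<dots> = real (Suc n) powr s * B powr s"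
      using i xy by (simp add: powr_mult)
    also have "B powr s = real (n choose i) * u ^ i * v ^ (n - i)"
      using xy nat[of "n choose i"] by (simp add: i powr_mult u_def v_def powr_power_real)
    also have "\<dots> \<le> (\<Sum>i\<le>n. real (n choose i) * u ^ i * v ^ (n - i))"
      using i nn by (intro member_le_sum) auto
    also have "\<dots> = (u + v) ^ n" by (simp add: binomial_ring)
    also have "real (Suc n) powr s * (u + v) ^ n \<le> real (Suc n) ^ nat \<lceil>s\<rceil> * (u + v) ^ n"
      using s'[of "Suc n"] nn by (intro mult_right_mono) auto
    finally show ?thesis
      using xy by (simp add: w_def powr_power_real mult_left_mono add.commute)
  qed
  show "a (x + y) powr s \<le> a x powr s + a y powr s"
  proof (cases "u + v = 0")
    case True
    then show ?thesis using bd[of 1] by (simp add: u_def v_def w_def)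
  next
    case False
    then have pos: "u + v > 0" using nn by linarith
    define t where "t = w / (u + v)"
    have "t \<le> 1"
    proof (rule ccontr)
      assume "\<not> t \<le> 1"
      then have t: "t > 1" by simp
      then have "(\<lambda>n. (real n + 1) ^ nat \<lceil>s\<rceil> / t ^ n) \<longlonglongrightarrow> 0" by real_asymp
      then have "eventually (\<lambda>n. (real n + 1) ^ nat \<lceil>s\<rceil> / t ^ n < 1) sequentially"
        by (rule order_tendstoD) simp
      then obtain n where "(real n + 1) ^ nat \<lceil>s\<rceil> / t ^ n < 1"
        by (auto simp: eventually_sequentially)
      then have "(real n + 1) ^ nat \<lceil>s\<rceil> < t ^ n" using t by (simp add: divide_simps)
      moreover have "t ^ n \<le> (real n + 1) ^ nat \<lceil>s\<rceil>"
        using bd[of n] pos by (simp add: t_def power_divide divide_simps)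
      ultimately show False by simp
    qed
    then show ?thesis using pos by (simp add: t_def u_def v_def w_def divide_simps)
  qed
qed

lemma abs_le_digits:
  assumes "n \<ge> 2" "m < n ^ e" and M: "M = max 1 (a (of_nat n))"
  shows "a (of_nat m) \<le> real e * real n * M ^ e"
  using assms(2)
proof (induction e arbitrary: m)
  case (Suc e)
  have "m div n < n ^ e" using Suc.prems assms(1) by (simp add: less_mult_imp_div_less mult.commute)
  then have IH: "a (of_nat (m div n)) \<le> real e * real n * M ^ e" by (rule Suc.IH)
  have M1: "M \<ge> 1" "a (of_nat n) \<le> M" using M by auto
  have "of_nat m = of_nat n * of_nat (m div n) + (of_nat (m mod n) :: complex)"
    by (metis mult_div_mod_eq of_nat_add of_nat_mult)
  then have "a (of_nat m) \<le> a (of_nat n * of_nat (m div n)) + a (of_nat (m mod n))"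
    using abs_add[of "of_nat n * of_nat (m div n)" "of_nat (m mod n)"] by simp
  also have "\<dots> \<le> M * (real e * real n * M ^ e) + real n"
  proof (intro add_mono)
    show "a (of_nat n * of_nat (m div n)) \<le> M * (real e * real n * M ^ e)"
      using IH M1 by (simp add: abs_mult mult_mono)
    have "m mod n < n" using assms(1) by simp
    then show "a (of_nat (m mod n)) \<le> real n"
      using abs_of_nat_le[of "m mod n"] by linarith
  qed
  also have "\<dots> \<le> M * (real e * real n * M ^ e) + real n * M ^ Suc e"
    using M1 one_le_power[of M "Suc e"] by (simp add: mult_le_cancel_left1 del: power_Suc)
  finally show ?case by (simp add: algebra_simps)
qed simp

lemma abs_le_powr_log:
  assumes "n \<ge> 2" "m \<ge> 1"
  shows "a (of_nat m) \<le> max 1 (a (of_nat n)) powr (ln m / ln n)"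
proof -
  define M L where "M = max 1 (a (of_nat n))" and "L = ln m / ln n"
  have M: "M \<ge> 1" by (simp add: M_def)
  have L: "L \<ge> 0" using assms by (simp add: L_def)
  have "(a (of_nat m) / M powr L) ^ k \<le> (real n * M * (L + 1)) * (real k + 1)" for k
  proof -
    define e where "e = Suc (nat \<lfloor>real k * L\<rfloor>)"
    have e: "real k * L < real e" "real e \<le> real k * L + 1"
      using L by (simp_all add: e_def) linarith+
    have "real m ^ k = real n powr (real k * L)"
    proof -
      have "real n powr (real k * L) = exp (real k * ln m)"
        using assms by (simp add: powr_def L_def)
      also have "\<dots> = real m ^ k" using assms by (simp add: exp_of_nat_mult)
      finally show ?thesis by simp
    qed
    also have "\<dots> < real n powr real e"
      using e(1) assms by (intro powr_less_mono) auto
    also have "\<dots> = real n ^ e" using assms by (simp add: powr_realpow)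
    finally have "m ^ k < n ^ e" by (metis of_nat_less_iff of_nat_power)
    then have "a (of_nat (m ^ k)) \<le> real e * real n * M ^ e"
      using abs_le_digits[OF assms(1) _ M_def] by blast
    also have "real e * real n * M ^ e \<le> ((L + 1) * (real k + 1)) * real n * (M * (M powr L) ^ k)"
    proof (intro mult_mono)
      have "M ^ e = M powr real e" using M by (simp add: powr_realpow)
      also have "\<dots> \<le> M powr (real k * L + 1)" using e(2) M by (intro powr_mono) auto
      also have "\<dots> = M * (M powr L) ^ k"
        using M by (simp add: powr_add powr_power mult.commute)
      finally show "M ^ e \<le> M * (M powr L) ^ k" .
      show "real e \<le> (L + 1) * (real k + 1)"
        using e(2) L by (auto simp: algebra_simps)
    qed (use M L in auto)
    finally show ?thesis
      using M by (simp add: abs_power power_divide divide_simps mult_ac mult_left_mono)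
  qed
  then have "a (of_nat m) / M powr L \<le> 1" by (rule power_le_linear_imp_le_one)
  then show ?thesis using M by (simp add: M_def L_def divide_simps split: if_splits)
qed

lemma le_one_if_lead_coeff_unit:
  assumes u: "ultrametric K a" and p: "\<And>i. coeff p i \<in> \<int>" "p \<noteq> 0" "poly p x = 0"
    and x: "x \<in> K" and lc: "a (lead_coeff p) = 1"
  shows "a x \<le> 1"
proof (rule ccontr)
  assume "\<not> a x \<le> 1"
  then have x1: "a x > 1" by simp
  have co: "coeff p i \<in> K" "a (coeff p i) \<le> 1" for i
    using p(1)[of i] ultrametric_of_int[OF u] by (auto elim: Ints_cases)
  define n where "n = degree p"
  have n: "n > 0"
  proof (rule ccontr)
    assume "\<not> n > 0"
    then have "degree p = 0" by (simp add: n_def)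
    then show False using p(2,3) by (metis degree_eq_zeroE pCons_eq_0_iff poly_const_conv mult_zero_right add.right_neutral poly_pCons poly_0)
  qed
  have "poly p x = (\<Sum>i<n. coeff p i * x ^ i) + coeff p n * x ^ n"
    by (simp add: poly_altdef n_def lessThan_Suc_atMost[symmetric])
  then have "coeff p n * x ^ n = - (\<Sum>i<n. coeff p i * x ^ i)"
    using p(3) by (simp add: eq_neg_iff_add_eq_0 add.commute)
  then have "a (coeff p n * x ^ n) = a (\<Sum>i<n. coeff p i * x ^ i)"
    using co x by simp
  also have "\<dots> \<le> a x ^ (n - 1)"
  proof (rule ultrametric_sum[OF u])
    fix i assume i: "i \<in> {..<n}"
    show "coeff p i * x ^ i \<in> K" using co x by simp
    have "a (coeff p i * x ^ i) \<le> 1 * a x ^ i"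
      unfolding abs_mult[OF co(1)[of i] power[OF x]] abs_power[OF x] using co(2) x
      by (intro mult_right_mono) auto
    also have "\<dots> \<le> a x ^ (n - 1)" using i x1 by (auto intro: power_increasing)
    finally show "a (coeff p i * x ^ i) \<le> a x ^ (n - 1)" .
  qed (use x in auto)
  finally have "a x ^ n \<le> a x ^ (n - 1)"
    using lc x co by (simp add: abs_mult abs_power n_def)
  then show False using x1 n by (simp add: power_le_imp_le_exp)
qed

lemma nontrivial_on_nat:
  assumes alg: "\<And>x. x \<in> K \<Longrightarrow> algebraic x" and nt: "x \<in> K" "x \<noteq> 0" "a x \<noteq> 1"
    and u: "ultrametric K a"
  shows "\<exists>n>0. a (of_nat n) < 1"
proof (rule ccontr)
  assume "\<not> ?thesis"
  then have nat: "a (of_nat n) = 1" if "n > 0" for n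
    using ultrametric_of_nat[OF u, of n] that by (meson antisym not_le)
  have int: "a (of_int n) = 1" if "n \<noteq> 0" for n
    using nat[of "nat \<bar>n\<bar>"] that abs_uminus[of "of_int n"] by (cases "n \<ge> 0") auto
  have le1: "a y \<le> 1" if y: "y \<in> K" for y
  proof (rule ccontr)
    assume "\<not> a y \<le> 1"
    then have y1: "a y > 1" by simp
    obtain p where p: "\<And>i. coeff p i \<in> \<int>" "p \<noteq> 0" "poly p y = 0"
      using algebraicE[OF alg[OF y]] by blast
    have lc: "a (lead_coeff p) = 1"
    proof -
      obtain z where z: "lead_coeff p = of_int z" using p(1)[of "degree p"] by (auto elim: Ints_cases)
      then have "z \<noteq> 0" using p(2) by auto
      then show ?thesis using int z by simp
    qed
    show False
      using le_one_if_lead_coeff_unit[OF u p y lc] y1 by simp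
  qed
  have "a x \<le> 1" "inverse (a x) \<le> 1"
    using le1[of x] le1[of "inverse x"] nt by (simp_all add: abs_inverse)
  then show False using nt pos[of x] by (simp add: field_simps)
qed

lemma ostrowski_padic:
  assumes u: "ultrametric K a" and n0: "\<exists>n>0. a (of_nat n) < 1"
  shows "\<exists>p s. prime p \<and> s > 0 \<and> (\<forall>q. a (of_rat q) powr s = padic_abs p q)"
proof -
  define p where "p = (LEAST n. n > 0 \<and> a (of_nat n) < 1)"
  have p: "p > 0" "a (of_nat p) < 1"
    unfolding p_def using n0 LeastI_ex[of "\<lambda>n. n > 0 \<and> a (of_nat n) < 1"] by auto
  have least: "a (of_nat n) = 1" if "0 < n" "n < p" for n
    using not_less_Least[of n "\<lambda>n. n > 0 \<and> a (of_nat n) < 1"] that ultrametric_of_nat[OF u, of n]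
    by (fastforce simp: p_def)
  have "p > 1" using p by (cases "p = 1") auto
  have prime: "prime p"
    unfolding prime_nat_iff
  proof (intro conjI allI impI)
    show "1 < p" by fact
    fix m assume m: "m dvd p" 
    then obtain k where k: "p = m * k" by auto
    show "m = 1 \<or> m = p"
    proof (rule ccontr)
      assume "\<not> ?thesis"
      then have "0 < m" "m < p" "0 < k" "k < p"
        using k p(1) by (auto intro: Nat.gr0I simp: nat_dvd_not_less) 
      then have "a (of_nat m) = 1" "a (of_nat k) = 1" using least by auto
      then show False using p(2) k by (simp add: abs_mult)
    qed
  qed
  have cop: "a (of_int m) = 1" if m: "\<not> int p dvd m" for m
  proof (rule ccontr)
    assume "a (of_int m) \<noteq> 1"
    then have lt: "a (of_int m) < 1" using ultrametric_of_int[OF u, of m] by simp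
    have "prime (int p)" using prime by simp
    then have "coprime (int p) m" using m by (simp add: prime_imp_coprime)
    then obtain x y where xy: "x * int p + y * m = 1"
      by (metis bezout_int coprime_imp_gcd_eq_1)
    have "a (of_int (x * int p)) \<le> a (of_nat p)" "a (of_int (y * m)) \<le> a (of_int m)"
      using mult_right_mono[OF ultrametric_of_int[OF u, of x], of "a (of_nat p)"]
        mult_right_mono[OF ultrametric_of_int[OF u, of y], of "a (of_int m)"]
      by (simp_all add: abs_mult)
    moreover have "a (of_int (x * int p) + of_int (y * m)) \<le> max (a (of_int (x * int p))) (a (of_int (y * m)))"
      using u of_int by (auto simp: ultrametric_def simp del: of_int_mult)
    moreover have "of_int (x * int p) + of_int (y * m) = (1 :: complex)"
      using xy by (metis of_int_1 of_int_add)
    ultimately show False using lt p(2) by simp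
  qed
  define s where "s = - ln (real p) / ln (a (of_nat p))"
  have ap: "0 < a (of_nat p)" using p(1) by (intro pos) auto
  have s: "s > 0"
    using p ap \<open>p > 1\<close> by (simp add: s_def divide_pos_neg)
  have aps: "a (of_nat p) powr s = 1 / real p"
    using ap p by (simp add: s_def powr_def exp_minus inverse_eq_divide)
  have int: "a (of_int m) powr s = real p powi (- int (multiplicity (int p) m))" if m: "m \<noteq> 0" for m
  proof -
    obtain k where k: "m = int p ^ multiplicity (int p) m * k" "\<not> int p dvd k"
      using multiplicity_decompose'[of m "int p"] m \<open>p > 1\<close> by auto
    then have "of_int m = (of_nat p :: complex) ^ multiplicity (int p) m * of_int k"
      by (metis of_int_mult of_int_of_nat_eq of_int_power)
    then have "a (of_int m) = a (of_nat p) ^ multiplicity (int p) m"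
      using cop[OF k(2)] by (simp add: abs_mult abs_power)
    then show ?thesis
      using ap aps by (simp add: powr_power_real[symmetric] power_int_minus_divide power_one_over)
  qed
  have "a (of_rat q) powr s = padic_abs p q" for q
  proof (cases "q = 0")
    case False
    obtain m n where mn: "quotient_of q = (m, n)" by fastforce
    then have q: "q = of_int m / of_int n" "n > 0"
      by (auto simp: quotient_of_div quotient_of_denom_pos)
    then have m: "m \<noteq> 0" using False by auto
    have "of_rat q = (of_int m / of_int n :: complex)"
      by (simp add: q of_rat_divide)
    then have "a (of_rat q) powr s = a (of_int m) powr s / a (of_int n) powr s"
      by (simp add: abs_divide powr_divide)
    also have "\<dots> = real p powi (int (multiplicity (int p) n) - int (multiplicity (int p) m))"
      using int[OF m] int[of n] q(2) p(1)
      by (simp add: power_int_diff power_int_minus_divide)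
    finally show ?thesis
      using False mn by (simp add: padic_abs_def)
  qed (simp add: padic_abs_def)
  then show ?thesis using prime s by blast
qed

lemma ostrowski_archimedean:
  assumes "a (of_nat n0) > 1"
  shows "\<exists>s>0. (\<forall>q. a (of_rat q) powr s = \<bar>of_rat q\<bar>)"
proof -
  have n02: "n0 \<ge> 2"
  proof (rule ccontr)
    assume "\<not> n0 \<ge> 2"
    then have "n0 = 0 \<or> n0 = 1" by auto
    then show False using assms by auto
  qed
  have gt1: "a (of_nat m) > 1" if "m \<ge> 2" for m
  proof (rule ccontr)
    assume "\<not> a (of_nat m) > 1"
    then have "max 1 (a (of_nat m)) = 1" by simp
    then show False using abs_le_powr_log[of m n0] that n02 assms by simp
  qed
  define s where "s = ln (real n0) / ln (a (of_nat n0))"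
  have s: "s > 0" using n02 assms by (simp add: s_def)
  have nat: "a (of_nat m) powr s = real m" for m
  proof -
    consider "m = 0" | "m = 1" | "m \<ge> 2" by linarith
    then show ?thesis
    proof cases
      case 3
      have am: "a (of_nat m) > 1" using gt1[OF 3] .
      have "a (of_nat m) \<le> a (of_nat n0) powr (ln m / ln n0)"
        using abs_le_powr_log[of n0 m] n02 3 assms by simp
      then have "ln (a (of_nat m)) \<le> ln (a (of_nat n0) powr (ln m / ln n0))"
        using am assms by (subst ln_le_cancel_iff) auto
      then have 1: "ln (a (of_nat m)) \<le> ln m / ln n0 * ln (a (of_nat n0))"
        using assms by (simp add: ln_powr)
      have "a (of_nat n0) \<le> a (of_nat m) powr (ln n0 / ln m)"
        using abs_le_powr_log[of m n0] n02 3 am by simp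
      then have "ln (a (of_nat n0)) \<le> ln (a (of_nat m) powr (ln n0 / ln m))"
        using am assms by (subst ln_le_cancel_iff) auto
      then have 2: "ln (a (of_nat n0)) \<le> ln n0 / ln m * ln (a (of_nat m))"
        using am by (simp add: ln_powr)
      have p: "ln (real n0) > 0" "ln (real m) > 0" "ln (a (of_nat n0)) > 0"
        using n02 3 assms by auto
      have "ln (a (of_nat m)) * ln n0 = ln m * ln (a (of_nat n0))"
        using 1 2 p by (simp add: field_simps)
      then have "s * ln (a (of_nat m)) = ln m"
        using p by (simp add: s_def field_simps)
      then show ?thesis using am 3 by (simp add: powr_def)
    qed auto
  qed
  have int: "a (of_int m) powr s = \<bar>real_of_int m\<bar>" for m
    using nat[of "nat \<bar>m\<bar>"] abs_uminus[of "of_int m"] by (cases "m \<ge> 0") auto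
  have "a (of_rat q) powr s = \<bar>of_rat q\<bar>" for q
  proof -
    obtain m n where q: "q = of_int m / of_int n" "n > 0"
      by (metis quotient_of_denom_pos quotient_of_div surj_pair)
    have "of_rat q = (of_int m / of_int n :: complex)"
      by (simp add: q of_rat_divide)
    then have "a (of_rat q) powr s = a (of_int m) powr s / a (of_int n) powr s"
      by (simp add: abs_divide powr_divide)
    then show ?thesis
      by (simp add: int q of_rat_divide)
  qed
  then show ?thesis using s by blast
qed

theorem exists_standard_power:
  assumes alg: "\<And>x. x \<in> K \<Longrightarrow> algebraic x" and nt: "x \<in> K" "x \<noteq> 0" "a x \<noteq> 1"
  shows "\<exists>s>0. restrict (\<lambda>x. a x powr s) K \<in> standard_abs K"
proof (cases "\<forall>n. a (of_nat n) \<le> 1")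
  case True
  then have u: "ultrametric K a" by (intro ultrametricI) auto
  obtain p s where ps: "prime p" "s > 0" "\<And>q. a (of_rat q) powr s = padic_abs p q"
    using ostrowski_padic[OF u nontrivial_on_nat[OF alg nt u]] by blast
  then have "extends_standard (restrict (\<lambda>x. a x powr s) K)"
    unfolding extends_standard_def by (intro disjI2 exI[of _ p]) auto
  then show ?thesis
    using ps powr_absolute_value_ultrametric[OF ps(2) u] by (auto simp: standard_abs_def)
next
  case False
  then obtain n0 where "a (of_nat n0) > 1" by (auto simp: not_le)
  then obtain s where s: "s > 0" "\<And>q. a (of_rat q) powr s = \<bar>of_rat q\<bar>"
    using ostrowski_archimedean by blast
  then have "a (of_nat n) powr s = real n" for n
    using s(2)[of "of_nat n"] by simp
  then show ?thesis
    using s powr_absolute_value_archimedean[OF s(1)]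
    by (auto simp: standard_abs_def extends_standard_def intro!: exI[of _ s])
qed

end

lemma abs_equivI:
  assumes "a \<in> nontrivial_abs_values K" "b \<in> nontrivial_abs_values K" "s > 0" "\<And>x. x \<in> K \<Longrightarrow> b x = a x powr s"
  shows "(a, b) \<in> abs_equiv K"
  using assms by (auto simp: abs_equiv_def)

lemma equiv_abs_equiv: "equiv (nontrivial_abs_values K) (abs_equiv K)"
proof (rule equivI)
  have nn: "0 \<le> a x" if "a \<in> nontrivial_abs_values K" "x \<in> K" for a x
    using that by (auto simp: nontrivial_abs_values_def absolute_value_def)
  show "abs_equiv K \<subseteq> nontrivial_abs_values K \<times> nontrivial_abs_values K"
    by (auto simp: abs_equiv_def)
  show "refl_on (nontrivial_abs_values K) (abs_equiv K)"
    using nn by (auto simp: refl_on_def abs_equiv_def intro!: exI[of _ 1])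
  show "sym (abs_equiv K)"
  proof (rule symI)
    fix a b assume "(a, b) \<in> abs_equiv K"
    then obtain s where ab: "a \<in> nontrivial_abs_values K" "b \<in> nontrivial_abs_values K"
      and s: "s > 0" "\<forall>x\<in>K. b x = a x powr s"
      by (auto simp: abs_equiv_def)
    then show "(b, a) \<in> abs_equiv K"
      using nn[OF ab(1)] by (intro abs_equivI[of _ _ _ "1 / s"]) (auto simp: powr_powr)
  qed
  show "trans (abs_equiv K)"
  proof (rule transI)
    fix a b c assume "(a, b) \<in> abs_equiv K" "(b, c) \<in> abs_equiv K"
    then obtain s t where ab: "a \<in> nontrivial_abs_values K" "c \<in> nontrivial_abs_values K"
      and s: "s > 0" "\<forall>x\<in>K. b x = a x powr s" and t: "t > 0" "\<forall>x\<in>K. c x = b x powr t"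
      by (auto simp: abs_equiv_def)
    then show "(a, c) \<in> abs_equiv K"
      by (intro abs_equivI[of _ _ _ "s * t"]) (auto simp: powr_powr)
  qed
qed

lemma extends_standard_cases:
  assumes "extends_standard a"
  obtains (arch) "\<And>q. a (of_rat q) = \<bar>of_rat q\<bar>"
    | (padic) p where "prime p" "\<And>q. a (of_rat q) = padic_abs p q"
  using assms unfolding extends_standard_def by blast

lemma extends_standard_nontrivial:
  assumes "extends_standard a"
  obtains q :: rat where "q \<noteq> 0" "a (of_rat q) < 1"
  using assms
proof (cases rule: extends_standard_cases)
  case arch
  then show thesis using arch[of "1 / 2"] that[of "1 / 2"] by (simp add: of_rat_divide)
next
  case (padic p)
  have "padic_abs p (of_nat p) < 1"
    using padic(1) padic_abs_self[OF padic(1)] prime_gt_1_nat[of p] by simp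
  then show thesis
    using padic(1) padic(2)[of "of_nat p"] that[of "of_nat p"] prime_gt_0_nat[of p] by simp
qed

lemma padic_abs_prime_eq:
  assumes "prime p" "prime p'" "padic_abs p' (of_nat p) < 1"
  shows "p = p'"
  using assms padic_abs_other[of p' p] by fastforce

lemma standard_power_eq:
  assumes b: "extends_standard b" and c: "extends_standard c" and s: "s > 0"
    and bc: "\<And>q. c (of_rat q) = b (of_rat q) powr s"
  shows "s = 1"
  using b
proof (cases rule: extends_standard_cases)
  case arch
  have c2: "c (of_rat 2) = 2 powr s" using bc[of 2] arch[of 2] by simp
  then have gt: "c (of_rat 2) > 1" using s by simp
  from c have "c (of_rat 2) = 2"
  proof (cases rule: extends_standard_cases)
    case arch
    then show ?thesis using arch[of 2] by simp
  next
    case (padic p)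
    then show ?thesis using gt padic(2)[of 2] padic_abs_of_nat_le[OF padic(1), of 2] by simp
  qed
  then have "2 powr s = 2 powr 1" using c2 by simp
  then show ?thesis by (simp only: powr_inj)
next
  case (padic p)
  have p: "real p > 1" using prime_gt_1_nat[OF padic(1)] by simp
  have cp: "c (of_rat (of_nat p)) = (1 / real p) powr s"
    using bc[of "of_nat p"] padic(2)[of "of_nat p"] padic_abs_self[OF padic(1)] by simp
  also have "\<dots> < 1" using p s by (simp add: powr_divide)
  finally have lt: "c (of_rat (of_nat p)) < 1" .
  from c have "c (of_rat (of_nat p)) = 1 / real p"
  proof (cases rule: extends_standard_cases)
    case arch
    then show ?thesis using lt p arch[of "of_nat p"] by simp
  next
    case (padic p')
    then have "p = p'"
      using lt \<open>prime p\<close> padic(2)[of "of_nat p"] by (intro padic_abs_prime_eq) auto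
    then show ?thesis using padic(2)[of "of_nat p"] padic_abs_self[OF padic(1)] by simp
  qed
  then have "(1 / real p) powr s = (1 / real p) powr 1" using cp by simp
  then have "real p powr s = real p powr 1" using p by (simp add: powr_divide)
  then show ?thesis using p by (simp only: powr_inj)
qed

context complex_subfield
begin

lemma standard_abs_nontrivial:
  assumes "a \<in> standard_abs K" shows "a \<in> nontrivial_abs_values K"
proof -
  obtain q :: rat where q: "q \<noteq> 0" "a (of_rat q) < 1"
    using assms extends_standard_nontrivial by (auto simp: standard_abs_def)
  then have "of_rat q \<in> K \<and> (of_rat q :: complex) \<noteq> 0 \<and> a (of_rat q) \<noteq> 1" by simp
  then show ?thesis
    using assms unfolding nontrivial_abs_values_def standard_abs_def by blast
qed

lemma standard_abs_equiv_eq: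
  assumes "a \<in> standard_abs K" "b \<in> standard_abs K" "(a, b) \<in> abs_equiv K"
  shows "a = b"
proof -
  obtain s where s: "s > 0" "\<And>x. x \<in> K \<Longrightarrow> b x = a x powr s"
    using assms(3) by (auto simp: abs_equiv_def)
  interpret a: valued_subfield K a using assms by unfold_locales (simp add: standard_abs_def)
  interpret b: valued_subfield K b using assms by unfold_locales (simp add: standard_abs_def)
  have "s = 1"
    using assms s by (intro standard_power_eq[of a b s]) (auto simp: standard_abs_def)
  then have "\<And>x. x \<in> K \<Longrightarrow> a x = b x" using s by simp
  then show ?thesis by (rule extensionalityI[OF a.extensional b.extensional])
qed

lemma place_abs_class:
  assumes a: "a \<in> standard_abs K"
  shows "abs_equiv K `` {a} \<in> places K" and "place_abs (abs_equiv K `` {a}) = a"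
proof -
  have nt: "a \<in> nontrivial_abs_values K" using standard_abs_nontrivial[OF a] .
  show "abs_equiv K `` {a} \<in> places K"
    unfolding places_def using nt by (rule quotientI)
  show "place_abs (abs_equiv K `` {a}) = a"
    unfolding place_abs_def
  proof (rule the_equality)
    show "a \<in> abs_equiv K `` {a} \<and> extends_standard a"
      using equiv_class_self[OF equiv_abs_equiv nt] a by (simp add: standard_abs_def)
    fix b assume b: "b \<in> abs_equiv K `` {a} \<and> extends_standard b"
    then have "b \<in> standard_abs K"
      by (auto simp: standard_abs_def abs_equiv_def nontrivial_abs_values_def)
    then show "b = a" using standard_abs_equiv_eq[OF a, of b] b by auto
  qed
qed

lemma bij_betw_place_abs:
  assumes alg: "\<And>x. x \<in> K \<Longrightarrow> algebraic x"
  shows "bij_betw place_abs (places K) (standard_abs K)"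
proof (rule bij_betw_imageI)
  have ex: "\<exists>b\<in>standard_abs K. v = abs_equiv K `` {b}" if v: "v \<in> places K" for v
  proof -
    obtain a where a: "a \<in> nontrivial_abs_values K" "v = abs_equiv K `` {a}"
      using v by (auto simp: places_def elim: quotientE)
    then obtain x where x: "x \<in> K" "x \<noteq> 0" "a x \<noteq> 1" and "absolute_value K a"
      by (auto simp: nontrivial_abs_values_def)
    interpret valued_subfield K a by unfold_locales fact
    obtain s where s: "s > 0" "restrict (\<lambda>x. a x powr s) K \<in> standard_abs K"
      using exists_standard_power[OF alg x] by blast
    have "(a, restrict (\<lambda>x. a x powr s) K) \<in> abs_equiv K"
      using a(1) standard_abs_nontrivial[OF s(2)] s(1) by (rule abs_equivI) simp
    then have "v = abs_equiv K `` {restrict (\<lambda>x. a x powr s) K}"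
      unfolding a(2) by (rule equiv_class_eq[OF equiv_abs_equiv])
    then show ?thesis using s(2) by blast
  qed
  show "inj_on place_abs (places K)"
    using ex place_abs_class(2) by (intro inj_onI) metis
  show "place_abs ` places K = standard_abs K"
    using ex place_abs_class by (force intro: rev_image_eqI)
qed

end

section \<open>Weak approximation\<close>

locale valued_pair = A: valued_subfield K a + B: valued_subfield K b for K a b +
  fixes w :: "rat \<Rightarrow> real"
  assumes a_w: "\<And>q. a (of_rat q) = w q" and b_w: "\<And>q. b (of_rat q) = w q"
    and w_lt: "\<exists>q. q \<noteq> 0 \<and> w q < 1"
begin

lemma le_if_small_imp_small:
  assumes small: "\<And>x. x \<in> K \<Longrightarrow> a x < 1 \<Longrightarrow> b x < 1" and x: "x \<in> K"
  shows "b x \<le> a x"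
proof (cases "x = 0")
  case False
  obtain q where q: "q \<noteq> 0" "w q < 1" using w_lt by blast
  define u r where "u = (of_rat q :: complex)" and "r = w q"
  have u: "u \<in> K" "u \<noteq> 0" "a u = r" "b u = r"
    using q by (simp_all add: u_def r_def a_w b_w)
  have r: "0 < r" "r < 1" using A.pos[of u] u q by (simp_all add: r_def)
  have ab: "0 < a x" "0 < b x" using A.pos B.pos x False by auto
  show "b x \<le> a x"
  proof (rule ccontr)
    assume "\<not> b x \<le> a x"
    then have "ln (a x) < ln (b x)" using ab by simp
    then have "ln (b x) / ln r < ln (a x) / ln r"
      using r by (simp add: divide_strict_right_mono_neg)
    then obtain t where t: "t \<in> \<rat>" "ln (b x) / ln r < t" "t < ln (a x) / ln r"
      using Rats_dense_in_real by blast
    then obtain m n :: int where n: "n > 0" and tmn: "t = of_int m / of_int n"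
      by (metis Rats_cases' of_int_0_less_iff)
    define N where "N = nat n"
    have N: "N > 0" "real_of_int n = real N" using n by (simp_all add: N_def)
    have ri: "a (u powi m) = r powi m" "b (u powi m) = r powi m" "u powi m \<in> K" "u powi m \<noteq> 0" for m
      using u r by (auto simp: power_int_def A.abs_power B.abs_power A.abs_inverse B.abs_inverse)
    have ln_r: "ln (r powi m) = of_int m * ln r"
      using r by (simp add: power_int_def ln_realpow ln_inverse)
    have "real N * ln (b x) > of_int m * ln r"
      using t(2) r N by (simp add: tmn field_simps)
    then have "ln (b x ^ N) > ln (r powi m)"
      using ab ln_r by (simp add: ln_realpow)
    then have 1: "b x ^ N > r powi m" using ab r by (subst (asm) ln_less_cancel_iff) auto
    have "real N * ln (a x) < of_int m * ln r"
      using t(3) r N by (simp add: tmn field_simps)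
    then have "ln (a x ^ N) < ln (r powi m)"
      using ab ln_r by (simp add: ln_realpow)
    then have 2: "a x ^ N < r powi m" using ab r by (subst (asm) ln_less_cancel_iff) auto
    have rm: "r powi m > 0" using r by simp
    have "a (x ^ N / u powi m) < 1"
      using 2 rm x ri[of m] by (simp add: A.abs_divide A.abs_power)
    then have "b (x ^ N / u powi m) < 1"
      using x ri[of m] by (intro small) auto
    then show False
      using 1 rm x ri[of m] by (simp add: B.abs_divide B.abs_power)
  qed
qed simp

lemma separating_element:
  assumes "a \<noteq> b"
  shows "\<exists>x\<in>K. a x < 1 \<and> 1 \<le> b x"
proof (rule ccontr)
  assume "\<not> ?thesis"
  then have le: "b x \<le> a x" if "x \<in> K" for x
    using le_if_small_imp_small that by (meson not_le)
  have "a x = b x" if x: "x \<in> K" for x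
  proof (cases "x = 0")
    case False
    have "inverse (b x) \<le> inverse (a x)"
      using le[of "inverse x"] x by (simp add: A.abs_inverse B.abs_inverse)
    then show ?thesis
      using le[OF x] A.pos[OF x False] B.pos[OF x False] by simp
  qed simp
  then have "a = b" by (rule extensionalityI[OF A.extensional B.extensional])
  then show False using assms by simp
qed

end

locale standard_family = complex_subfield +
  fixes w :: "rat \<Rightarrow> real" and W :: "(complex \<Rightarrow> real) set"
  assumes w_lt: "\<exists>q. q \<noteq> 0 \<and> w q < 1"
    and W: "\<And>a. a \<in> W \<Longrightarrow> absolute_value K a" "\<And>a q. a \<in> W \<Longrightarrow> a (of_rat q) = w q"
begin

lemma valued: "a \<in> W \<Longrightarrow> valued_subfield K a"
  by unfold_locales (rule W)

lemma separate_two: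
  assumes "a \<in> W" "b \<in> W" "a \<noteq> b"
  shows "\<exists>z\<in>K. a z > 1 \<and> b z < 1"
proof -
  interpret A: valued_subfield K a using assms valued by blast
  interpret B: valued_subfield K b using assms valued by blast
  interpret AB: valued_pair K a b w
    using w_lt W(1) W(2)[OF assms(1)] W(2)[OF assms(2)] assms(1,2) by unfold_locales auto
  interpret BA: valued_pair K b a w
    using w_lt W(1) W(2)[OF assms(1)] W(2)[OF assms(2)] assms(1,2) by unfold_locales auto
  obtain x where x: "x \<in> K" "a x < 1" "1 \<le> b x"
    using AB.separating_element assms by blast
  obtain y where y: "y \<in> K" "b y < 1" "1 \<le> a y"
    using BA.separating_element assms by blast
  have "x \<noteq> 0" using x by auto
  then have "a (y / x) > 1" "b (y / x) < 1"
    using x y A.pos[of x] by (simp_all add: A.abs_divide B.abs_divide divide_simps)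
  then show ?thesis using x y by (intro bexI[of _ "y / x"]) auto
qed

lemma separate_many:
  assumes "finite B" "B \<subseteq> W" "a \<in> W" "a \<notin> B"
  shows "\<exists>x\<in>K. a x > 1 \<and> (\<forall>b\<in>B. b x < 1)"
  using assms
proof (induction B rule: finite_induct)
  case empty
  interpret valued_subfield K a using empty valued by blast
  obtain q where q: "q \<noteq> 0" "w q < 1" using w_lt by blast
  then have "a (of_rat q) < 1" "0 < a (of_rat q)"
    using empty W(2)[of a q] pos[of "of_rat q"] by auto
  then have "a (inverse (of_rat q)) > 1"
    by (simp add: abs_inverse one_less_inverse)
  then show ?case by (intro bexI[of _ "inverse (of_rat q)"]) auto
next
  case (insert b B)
  interpret A: valued_subfield K a using insert valued by blast
  interpret b: valued_subfield K b using insert valued by blast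
  obtain x where x: "x \<in> K" "a x > 1" "\<And>c. c \<in> B \<Longrightarrow> c x < 1"
    using insert by auto
  obtain y where y: "y \<in> K" "a y > 1" "b y < 1"
    using separate_two[of a b] insert by auto
  have x0: "0 \<le> c x" "0 \<le> c y" if "c \<in> B" for c
  proof -
    interpret c: valued_subfield K c using insert valued that by blast
    show "0 \<le> c x" "0 \<le> c y" using x y by auto
  qed
  consider "b x < 1" | "b x = 1" | "b x > 1" by linarith
  then show ?case
  proof cases
    case 1
    then show ?thesis using x by auto
  next
    case 2
    have ev: "eventually (\<lambda>k. c x ^ k * c y < 1) sequentially" if "c \<in> B" for c
    proof -
      have "(\<lambda>k. c x ^ k * c y) \<longlonglongrightarrow> 0 * c y"
        using x(3)[OF that] x0[OF that] by (intro tendsto_intros LIMSEQ_power_zero) auto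
      then show ?thesis by (intro order_tendstoD) auto
    qed
    have "eventually (\<lambda>k. \<forall>c\<in>B. c x ^ k * c y < 1) sequentially"
      using ev insert by (simp add: eventually_ball_finite_distrib)
    then obtain k where k: "\<forall>c\<in>B. c x ^ k * c y < 1"
      by (auto simp: eventually_sequentially)
    have "c (x ^ k * y) < 1" if "c \<in> B" for c
    proof -
      interpret c: valued_subfield K c using insert valued that by blast
      show ?thesis using k that x y by (simp add: c.abs_mult c.abs_power)
    qed
    moreover have "b (x ^ k * y) < 1"
      using 2 x y by (simp add: b.abs_mult b.abs_power)
    moreover have "a (x ^ k * y) > 1"
    proof -
      have "1 \<le> a x ^ k" using x by (simp add: one_le_power)
      then have "1 * a y \<le> a x ^ k * a y" using y by (intro mult_right_mono) auto
      moreover have "a (x ^ k * y) = a x ^ k * a y" using x y by (simp add: A.abs_mult A.abs_power)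
      ultimately show ?thesis using y by linarith
    qed
    ultimately show ?thesis using x y by (intro bexI[of _ "x ^ k * y"]) auto
  next
    case 3
    define z where "z k = x ^ k / (1 + x ^ k) * y" for k
    have zK: "z k \<in> K" for k using x y by (simp add: z_def)
    have evc: "eventually (\<lambda>k. c (z k) < 1) sequentially" if c: "c \<in> B" for c
    proof -
      interpret c: valued_subfield K c using insert valued c by blast
      have "(\<lambda>k. c x ^ k / (1 - c x ^ k) * c y) \<longlonglongrightarrow> 0 / (1 - 0) * c y"
        using x(3)[OF c] x0[OF c] by (intro tendsto_intros LIMSEQ_power_zero) auto
      then have e: "eventually (\<lambda>k. c x ^ k / (1 - c x ^ k) * c y < 1) sequentially"
        by (intro order_tendstoD) auto
      have "c (z k) < 1" if k: "c x ^ k / (1 - c x ^ k) * c y < 1" "k \<ge> 1" for k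
      proof -
        have lt: "c x ^ k < 1" using x(3)[OF c] x0[OF c] k(2) by (simp add: power_less_one_iff)
        have "1 - c x ^ k \<le> c (1 + x ^ k)"
          using c.abs_diff[of "1 + x ^ k" "x ^ k"] x by (simp add: c.abs_power)
        then have "c (z k) \<le> c x ^ k / (1 - c x ^ k) * c y"
          unfolding z_def using lt x y x0[OF c]
          by (auto simp: c.abs_mult c.abs_divide c.abs_power intro!: mult_right_mono divide_left_mono mult_pos_pos)
        then show ?thesis using k(1) by linarith
      qed
      then show ?thesis
        by (intro eventually_elim2[OF e eventually_ge_at_top[of "1 :: nat"]])
    qed
    have evb: "eventually (\<lambda>k. b (z k) < 1) sequentially"
    proof -
      have "(\<lambda>k. b x ^ k / (b x ^ k - 1) * b y) \<longlonglongrightarrow> 1 * b y"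
        using 3 by (intro tendsto_intros) real_asymp
      then have e: "eventually (\<lambda>k. b x ^ k / (b x ^ k - 1) * b y < 1) sequentially"
        using y by (intro order_tendstoD) auto
      have "b (z k) < 1" if k: "b x ^ k / (b x ^ k - 1) * b y < 1" "k \<ge> 1" for k
      proof -
        have gt: "b x ^ k > 1" using 3 k(2) by (simp add: one_less_power)
        have "b x ^ k - 1 \<le> b (1 + x ^ k)"
          using b.abs_diff[of "1 + x ^ k" 1] x by (simp add: b.abs_power)
        then have "b (z k) \<le> b x ^ k / (b x ^ k - 1) * b y"
          unfolding z_def using gt x y
          by (auto simp: b.abs_mult b.abs_divide b.abs_power intro!: mult_right_mono divide_left_mono mult_pos_pos)
        then show ?thesis using k(1) by linarith
      qed
      then show ?thesis
        by (intro eventually_elim2[OF e eventually_ge_at_top[of "1 :: nat"]])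
    qed
    have eva: "eventually (\<lambda>k. a (z k) > 1) sequentially"
    proof -
      have "(\<lambda>k. a x ^ k / (1 + a x ^ k) * a y) \<longlonglongrightarrow> 1 * a y"
        using x(2) by (intro tendsto_intros) real_asymp
      then have e: "eventually (\<lambda>k. a x ^ k / (1 + a x ^ k) * a y > 1) sequentially"
        using y by (intro order_tendstoD) auto
      have "a (z k) > 1" if k: "a x ^ k / (1 + a x ^ k) * a y > 1" "k \<ge> 1" for k
      proof -
        have gt: "a x ^ k > 1" using x(2) k(2) by (simp add: one_less_power)
        have "a x ^ k - 1 \<le> a (1 + x ^ k)"
          using A.abs_diff[of "1 + x ^ k" 1] x by (simp add: A.abs_power)
        then have p: "a (1 + x ^ k) > 0" using gt by linarith
        have "a (1 + x ^ k) \<le> 1 + a x ^ k"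
          using A.abs_add[of 1 "x ^ k"] x by (simp add: A.abs_power)
        then have "a x ^ k / (1 + a x ^ k) * a y \<le> a (z k)"
          unfolding z_def using gt p x y
          by (auto simp: A.abs_mult A.abs_divide A.abs_power intro!: mult_right_mono divide_left_mono mult_pos_pos)
        then show ?thesis using k(1) by linarith
      qed
      then show ?thesis
        by (intro eventually_elim2[OF e eventually_ge_at_top[of "1 :: nat"]])
    qed
    have "eventually (\<lambda>k. \<forall>c\<in>B. c (z k) < 1) sequentially"
      using evc insert by (simp add: eventually_ball_finite_distrib)
    then have "eventually (\<lambda>k. a (z k) > 1 \<and> b (z k) < 1 \<and> (\<forall>c\<in>B. c (z k) < 1)) sequentially"
      using eva evb by (auto intro: eventually_conj)
    then obtain k where "a (z k) > 1 \<and> b (z k) < 1 \<and> (\<forall>c\<in>B. c (z k) < 1)"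
      by (auto simp: eventually_sequentially)
    then show ?thesis using zK by auto
  qed
qed

text \<open>
  High powers of elements separating \<open>n + 1\<close> absolute values are linearly independent over the
  rationals: in a relation, look at the absolute value belonging to the largest coefficient.
\<close>

lemma finite_if_dependent:
  assumes dep: "\<And>y :: nat \<Rightarrow> complex. (\<And>i. i \<le> n \<Longrightarrow> y i \<in> K) \<Longrightarrow>
    \<exists>c. (\<exists>i\<le>n. c i \<noteq> 0) \<and> (\<Sum>i\<le>n. of_rat (c i) * y i) = 0"
  shows "finite W"
proof (rule ccontr)
  assume "infinite W"
  then obtain g :: "nat \<Rightarrow> complex \<Rightarrow> real" where g: "inj g" "range g \<subseteq> W"
    using infinite_countable_subset by blast
  have gv: "valued_subfield K (g i)" for i using g valued by blast
  have "\<exists>x\<in>K. g i x > 1 \<and> (\<forall>j\<le>n. j \<noteq> i \<longrightarrow> g j x < 1)" for i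
  proof -
    have "g i \<notin> g ` ({..n} - {i})" using g(1) by (auto dest: injD)
    then obtain x where "x \<in> K" "g i x > 1" "\<forall>b\<in>g ` ({..n} - {i}). b x < 1"
      using separate_many[of "g ` ({..n} - {i})" "g i"] g(2) by blast
    then show ?thesis by auto
  qed
  then obtain x where x: "\<And>i. x i \<in> K" "\<And>i. g i (x i) > 1" "\<And>i j. j \<le> n \<Longrightarrow> j \<noteq> i \<Longrightarrow> g j (x i) < 1"
    by metis
  have "eventually (\<lambda>k. (\<Sum>j\<in>{..n} - {i}. g i (x j) ^ k) < 1) sequentially" if "i \<le> n" for i
  proof -
    interpret valued_subfield K "g i" by (rule gv)
    have "(\<lambda>k. \<Sum>j\<in>{..n} - {i}. g i (x j) ^ k) \<longlonglongrightarrow> (\<Sum>j\<in>{..n} - {i}. 0)"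
      using x(1,3) that by (intro tendsto_sum LIMSEQ_power_zero) auto
    then show ?thesis by (intro order_tendstoD) auto
  qed
  then have "eventually (\<lambda>k. \<forall>i\<in>{..n}. (\<Sum>j\<in>{..n} - {i}. g i (x j) ^ k) < 1) sequentially"
    by (simp add: eventually_ball_finite_distrib)
  then obtain k where k: "\<And>i. i \<le> n \<Longrightarrow> (\<Sum>j\<in>{..n} - {i}. g i (x j) ^ k) < 1"
    by (auto simp: eventually_sequentially)
  obtain c where c: "\<exists>i\<le>n. c i \<noteq> 0" "(\<Sum>i\<le>n. of_rat (c i) * x i ^ k) = 0"
    using dep[of "\<lambda>i. x i ^ k"] x(1) by auto
  have w_eq: "g i (of_rat q) = w q" for i q using g(2) W(2) by blast
  define m where "m = Max ((\<lambda>i. w (c i)) ` {..n})"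
  have "m \<in> (\<lambda>i. w (c i)) ` {..n}" unfolding m_def by (intro Max_in) auto
  then obtain i where i: "i \<le> n" "m = w (c i)" by auto
  have mx: "w (c j) \<le> m" if "j \<le> n" for j
    unfolding m_def using that by (intro Max_ge) auto
  interpret valued_subfield K "g i" by (rule gv)
  have w_nn: "w q \<ge> 0" for q using w_eq[of i q, symmetric] by simp
  have w_pos: "w q > 0" if "q \<noteq> 0" for q using w_eq[of i q, symmetric] pos[of "of_rat q"] that by simp
  have m0: "m > 0" using c(1) mx w_pos by force
  have "{..n} = insert i ({..n} - {i})" using i(1) by auto
  then have "(\<Sum>j\<le>n. of_rat (c j) * x j ^ k) = of_rat (c i) * x i ^ k + (\<Sum>j\<in>{..n} - {i}. of_rat (c j) * x j ^ k)"
    by (metis (no_types, lifting) Diff_iff finite_Diff finite_atMost insertI1 sum.insert)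
  then have "of_rat (c i) * x i ^ k = - (\<Sum>j\<in>{..n} - {i}. of_rat (c j) * x j ^ k)"
    using c(2) by (simp add: eq_neg_iff_add_eq_0)
  then have "g i (of_rat (c i) * x i ^ k) = g i (\<Sum>j\<in>{..n} - {i}. of_rat (c j) * x j ^ k)"
    using x(1) by simp
  also have "\<dots> \<le> (\<Sum>j\<in>{..n} - {i}. g i (of_rat (c j) * x j ^ k))"
    using x(1) by (intro abs_sum) auto
  also have "\<dots> \<le> (\<Sum>j\<in>{..n} - {i}. m * g i (x j) ^ k)"
  proof (rule sum_mono)
    fix j assume "j \<in> {..n} - {i}"
    then show "g i (of_rat (c j) * x j ^ k) \<le> m * g i (x j) ^ k"
      using x(1) mx[of j] by (simp add: abs_mult abs_power w_eq mult_right_mono)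
  qed
  also have "\<dots> = m * (\<Sum>j\<in>{..n} - {i}. g i (x j) ^ k)" by (simp add: sum_distrib_left)
  also have "\<dots> < m * 1" using k[OF i(1)] m0 by (intro mult_strict_left_mono)
  also have "\<dots> \<le> m * g i (x i) ^ k"
    using x(2)[of i] m0 by (intro mult_left_mono one_le_power) auto
  also have "\<dots> = g i (of_rat (c i) * x i ^ k)"
    using x(1) i(2) by (simp add: abs_mult abs_power w_eq)
  finally show False by simp
qed

end

lemma finite_standard_abs_over:
  assumes K: "number_field K" and w: "\<exists>q. q \<noteq> 0 \<and> w q < 1"
  shows "finite {a \<in> standard_abs K. \<forall>q. a (of_rat q) = w q}"
proof -
  interpret complex_subfield K
    using K by (auto simp: number_field_def intro: complex_subfieldI)
  interpret standard_family K w "{a \<in> standard_abs K. \<forall>q. a (of_rat q) = w q}"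
    using w by unfold_locales (auto simp: standard_abs_def)
  obtain n :: nat where "\<And>y :: nat \<Rightarrow> complex. (\<And>i. i \<le> n \<Longrightarrow> y i \<in> K) \<Longrightarrow>
    \<exists>c. (\<exists>i\<le>n. c i \<noteq> 0) \<and> (\<Sum>i\<le>n. of_rat (c i) * y i) = 0"
    using number_field_dependence[OF K] by blast
  then show ?thesis by (rule finite_if_dependent)
qed

lemma finite_archimedean:
  assumes K: "number_field K"
  shows "finite {a \<in> standard_abs K. \<forall>q. a (of_rat q) = \<bar>of_rat q\<bar>}"
  by (rule finite_standard_abs_over[OF K]) (intro exI[of _ "1 / 2"], simp add: of_rat_divide)

lemma finite_padic:
  assumes K: "number_field K" and p: "prime p"
  shows "finite {a \<in> standard_abs K. \<forall>q. a (of_rat q) = padic_abs p q}"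
proof (rule finite_standard_abs_over[OF K])
  show "\<exists>q. q \<noteq> 0 \<and> padic_abs p q < 1"
    using padic_abs_self[OF p] prime_gt_1_nat[OF p] by (intro exI[of _ "of_nat p"]) auto
qed

context valued_subfield
begin

lemma standard_padic_ultrametric:
  assumes "prime p" "\<And>q. a (of_rat q) = padic_abs p q"
  shows "ultrametric K a"
proof (rule ultrametricI)
  fix n show "a (of_nat n) \<le> 1"
    using assms(2)[of "of_nat n"] padic_abs_of_nat_le[OF assms(1), of n] by simp
qed

end

lemma standard_abs_cases:
  assumes "a \<in> standard_abs K"
  obtains (arch) "\<forall>q. a (of_rat q) = \<bar>of_rat q\<bar>" | (padic) p where "prime p" "\<forall>q. a (of_rat q) = padic_abs p q"
  using assms unfolding standard_abs_def extends_standard_def by blast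

lemma finite_standard_abs_gt_one:
  assumes K: "number_field K" and x: "x \<in> K"
  shows "finite {a \<in> standard_abs K. a x > 1}"
proof -
  interpret complex_subfield K
    using K by (auto simp: number_field_def intro: complex_subfieldI)
  obtain P where P: "\<And>i. coeff P i \<in> \<int>" "P \<noteq> 0" "poly P x = 0"
    using algebraicE[OF number_field_algebraic[OF K x]] by blast
  obtain l where l: "lead_coeff P = of_int l" "l \<noteq> 0"
    using P(1)[of "degree P"] P(2) by (metis Ints_cases leading_coeff_0_iff of_int_0)
  define Ps where "Ps = {p. prime p \<and> int p dvd l}"
  have "finite Ps"
  proof (rule finite_subset)
    show "Ps \<subseteq> {..nat \<bar>l\<bar>}"
    proof
      fix p assume "p \<in> Ps"
      then have "int p \<le> \<bar>l\<bar>" using dvd_imp_le_int[OF l(2), of "int p"] by (simp add: Ps_def)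
      then show "p \<in> {..nat \<bar>l\<bar>}" by simp
    qed
  qed simp
  moreover have "{a \<in> standard_abs K. a x > 1} \<subseteq> {a \<in> standard_abs K. \<forall>q. a (of_rat q) = \<bar>of_rat q\<bar>} \<union>
      (\<Union>p\<in>Ps. {a \<in> standard_abs K. \<forall>q. a (of_rat q) = padic_abs p q})"
  proof
    fix a assume a: "a \<in> {a \<in> standard_abs K. a x > 1}"
    interpret valued_subfield K a using a by unfold_locales (simp add: standard_abs_def)
    from a have "a \<in> standard_abs K" by simp
    then show "a \<in> {a \<in> standard_abs K. \<forall>q. a (of_rat q) = \<bar>of_rat q\<bar>} \<union>
      (\<Union>p\<in>Ps. {a \<in> standard_abs K. \<forall>q. a (of_rat q) = padic_abs p q})"
    proof (cases rule: standard_abs_cases)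
      case (padic p)
      have "p \<in> Ps"
      proof (rule ccontr)
        assume "p \<notin> Ps"
        then have "padic_abs p (of_int l) = 1"
          using padic(1) by (intro padic_abs_of_int_coprime) (simp add: Ps_def)
        then have "a (lead_coeff P) = 1"
          using padic(2)[rule_format, of "of_int l"] l by simp
        then show False
          using le_one_if_lead_coeff_unit[OF standard_padic_ultrametric[OF padic(1)] P x] padic a by auto
      qed
      moreover have "a \<in> {a \<in> standard_abs K. \<forall>q. a (of_rat q) = padic_abs p q}"
        using padic(2) a by simp
      ultimately show ?thesis by blast
    qed (use a in simp)
  qed
  moreover have "finite (\<Union>p\<in>Ps. {a \<in> standard_abs K. \<forall>q. a (of_rat q) = padic_abs p q})"
    using \<open>finite Ps\<close> finite_padic[OF K] by (auto simp: Ps_def)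
  ultimately show ?thesis
    using finite_archimedean[OF K] by (meson finite_UnI finite_subset)
qed

section \<open>Completions\<close>

lemma mats_entry: "f \<in> mats d K \<Longrightarrow> i < d \<Longrightarrow> j < d \<Longrightarrow> f $$ (i, j) \<in> K"
  by (force simp: mats_def elements_mat_def)

lemma matsI: "f \<in> carrier_mat d d \<Longrightarrow> (\<And>i j. i < d \<Longrightarrow> j < d \<Longrightarrow> f $$ (i, j) \<in> K) \<Longrightarrow> f \<in> mats d K"
  by (auto simp: mats_def elements_mat_def)

context valued_subfield
begin

abbreviation "cauchy X \<equiv> X \<in> carrier (cauchy_ring K a)"
abbreviation "null X \<equiv> X \<in> null_seqs K a"

lemma cauchy_iff:
  "cauchy X \<longleftrightarrow> (\<forall>n. X n \<in> K) \<and> (\<forall>e>0. \<exists>N. \<forall>m\<ge>N. \<forall>n\<ge>N. a (X m - X n) < e)"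
  by (simp add: cauchy_ring_def)

lemma cauchy_in: "cauchy X \<Longrightarrow> X n \<in> K"
  by (simp add: cauchy_iff)

lemma cauchyD: "cauchy X \<Longrightarrow> 0 < e \<Longrightarrow> \<exists>N. \<forall>m\<ge>N. \<forall>n\<ge>N. a (X m - X n) < e"
  by (simp add: cauchy_iff)

lemma null_iff: "null X \<longleftrightarrow> (\<forall>n. X n \<in> K) \<and> (\<forall>e>0. \<exists>N. \<forall>n\<ge>N. a (X n) < e)"
  by (auto simp: null_seqs_def LIMSEQ_iff)

lemma cauchy_ring_simps [simp]:
  "mult (cauchy_ring K a) = (\<lambda>X Y n. X n * Y n)" "\<one>\<^bsub>cauchy_ring K a\<^esub> = (\<lambda>_. 1)"
  "\<zero>\<^bsub>cauchy_ring K a\<^esub> = (\<lambda>_. 0)" "add (cauchy_ring K a) = (\<lambda>X Y n. X n + Y n)"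
  by (simp_all add: cauchy_ring_def)

lemma cauchy_const [simp]: "x \<in> K \<Longrightarrow> cauchy (\<lambda>_. x)"
  by (auto simp: cauchy_iff)

lemma cauchy_add:
  assumes "cauchy X" "cauchy Y" shows "cauchy (\<lambda>n. X n + Y n)"
  unfolding cauchy_iff
proof (intro conjI allI impI)
  fix e :: real assume "e > 0"
  then have "e / 2 > 0" by simp
  obtain M N where M: "\<And>m n. m \<ge> M \<Longrightarrow> n \<ge> M \<Longrightarrow> a (X m - X n) < e / 2"
    and N: "\<And>m n. m \<ge> N \<Longrightarrow> n \<ge> N \<Longrightarrow> a (Y m - Y n) < e / 2"
    using cauchyD[OF assms(1) \<open>e / 2 > 0\<close>] cauchyD[OF assms(2) \<open>e / 2 > 0\<close>] by blast
  have "a ((X m + Y m) - (X n + Y n)) < e" if "m \<ge> max M N" "n \<ge> max M N" for m n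
  proof -
    have "a ((X m - X n) + (Y m - Y n)) \<le> a (X m - X n) + a (Y m - Y n)"
      using assms cauchy_in by (intro abs_add) auto
    also have "\<dots> < e" using M[of m n] N[of m n] that by auto
    finally show ?thesis by (simp add: algebra_simps)
  qed
  then show "\<exists>N. \<forall>m\<ge>N. \<forall>n\<ge>N. a ((X m + Y m) - (X n + Y n)) < e" by blast
qed (use assms cauchy_in in auto)

lemma cauchy_bounded:
  assumes "cauchy X" obtains B where "B > 0" "\<And>n. a (X n) \<le> B"
proof -
  obtain N where N: "\<And>m n. m \<ge> N \<Longrightarrow> n \<ge> N \<Longrightarrow> a (X m - X n) < 1"
    using cauchyD[OF assms, of 1] by auto
  define B where "B = Max ((\<lambda>n. a (X n)) ` {..N}) + 1"
  have le: "a (X n) \<le> B - 1" if "n \<le> N" for n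
    unfolding B_def using that by (auto intro!: Max_ge)
  show thesis
  proof (rule that[of B])
    show "B > 0" using le[of 0] nonneg[OF cauchy_in[OF assms, of 0]] by linarith
    fix n
    show "a (X n) \<le> B"
    proof (cases "n \<le> N")
      case False
      have "a (X n) \<le> a (X n - X N) + a (X N)"
        using abs_add[of "X n - X N" "X N"] cauchy_in[OF assms] by simp
      then show ?thesis using N[of n N] le[of N] False by simp
    qed (use le in force)
  qed
qed

lemma null_mult:
  assumes "cauchy X" "null Y" shows "null (\<lambda>n. X n * Y n)"
  unfolding null_iff
proof (intro conjI allI impI)
  fix e :: real assume "e > 0"
  obtain B where B: "B > 0" "\<And>n. a (X n) \<le> B" using cauchy_bounded[OF assms(1)] by blast
  have "e / B > 0" using \<open>e > 0\<close> B by simp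
  then obtain N where N: "\<And>n. n \<ge> N \<Longrightarrow> a (Y n) < e / B"
    using assms(2) unfolding null_iff by blast
  have "a (X n * Y n) < e" if "n \<ge> N" for n
  proof -
    have "a (X n * Y n) \<le> B * a (Y n)"
      using B assms cauchy_in null_iff by (simp add: abs_mult mult_right_mono)
    also have "\<dots> < e" using N[OF that] B(1) by (simp add: field_simps)
    finally show ?thesis .
  qed
  then show "\<exists>N. \<forall>n\<ge>N. a (X n * Y n) < e" by blast
qed (use assms cauchy_in null_iff in auto)

lemma cauchy_mult:
  assumes "cauchy X" "cauchy Y" shows "cauchy (\<lambda>n. X n * Y n)"
  unfolding cauchy_iff
proof (intro conjI allI impI)
  fix e :: real assume "e > 0"
  obtain B where B: "B > 0" "\<And>n. a (X n) \<le> B" using cauchy_bounded[OF assms(1)] by blast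
  obtain C where C: "C > 0" "\<And>n. a (Y n) \<le> C" using cauchy_bounded[OF assms(2)] by blast
  have pos: "e / (2 * C) > 0" "e / (2 * B) > 0" using \<open>e > 0\<close> B C by auto
  obtain M N where M: "\<And>m n. m \<ge> M \<Longrightarrow> n \<ge> M \<Longrightarrow> a (X m - X n) < e / (2 * C)"
    and N: "\<And>m n. m \<ge> N \<Longrightarrow> n \<ge> N \<Longrightarrow> a (Y m - Y n) < e / (2 * B)"
    using cauchyD[OF assms(1) pos(1)] cauchyD[OF assms(2) pos(2)] by blast
  have "a (X m * Y m - X n * Y n) < e" if "m \<ge> max M N" "n \<ge> max M N" for m n
  proof -
    note X = cauchy_in[OF assms(1)] and Y = cauchy_in[OF assms(2)]
    have "X m * Y m - X n * Y n = (X m - X n) * Y m + X n * (Y m - Y n)" by (simp add: algebra_simps)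
    also have "a \<dots> \<le> a (X m - X n) * a (Y m) + a (X n) * a (Y m - Y n)"
      using abs_add[of "(X m - X n) * Y m" "X n * (Y m - Y n)"] X Y by (simp add: abs_mult)
    also have "\<dots> \<le> a (X m - X n) * C + B * a (Y m - Y n)"
      using B C X Y by (intro add_mono mult_left_mono mult_right_mono) auto
    also have "\<dots> < e / 2 + e / 2"
    proof (rule add_strict_mono)
      show "a (X m - X n) * C < e / 2" using M[of m n] that C(1) by (simp add: field_simps)
      show "B * a (Y m - Y n) < e / 2" using N[of m n] that B(1) by (simp add: field_simps)
    qed
    finally show ?thesis by simp
  qed
  then show "\<exists>N. \<forall>m\<ge>N. \<forall>n\<ge>N. a (X m * Y m - X n * Y n) < e" by blast
qed (use assms cauchy_in in auto)

lemma cauchy_uminus: "cauchy X \<Longrightarrow> cauchy (\<lambda>n. - X n)"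
  using cauchy_mult[of "\<lambda>_. - 1" X] by simp

lemma cauchy_diff: "cauchy X \<Longrightarrow> cauchy Y \<Longrightarrow> cauchy (\<lambda>n. X n - Y n)"
  using cauchy_add[OF _ cauchy_uminus, of X Y] by simp

lemma null_add:
  assumes "null X" "null Y" shows "null (\<lambda>n. X n + Y n)"
  unfolding null_iff
proof (intro conjI allI impI)
  fix e :: real assume "e > 0"
  then have "e / 2 > 0" by simp
  then obtain M N where M: "\<And>n. n \<ge> M \<Longrightarrow> a (X n) < e / 2" and N: "\<And>n. n \<ge> N \<Longrightarrow> a (Y n) < e / 2"
    using assms unfolding null_iff by blast
  have "a (X n + Y n) < e" if "n \<ge> max M N" for n
  proof -
    have "a (X n + Y n) \<le> a (X n) + a (Y n)"
      using assms null_iff by (intro abs_add) auto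
    then show ?thesis using M[of n] N[of n] that by auto
  qed
  then show "\<exists>N. \<forall>n\<ge>N. a (X n + Y n) < e" by blast
qed (use assms null_iff in auto)

lemma null_imp_cauchy:
  assumes "null X" shows "cauchy X"
  unfolding cauchy_iff
proof (intro conjI allI impI)
  fix e :: real assume "e > 0"
  then have "e / 2 > 0" by simp
  then obtain N where N: "\<And>n. n \<ge> N \<Longrightarrow> a (X n) < e / 2"
    using assms unfolding null_iff by blast
  have "a (X m - X n) < e" if "m \<ge> N" "n \<ge> N" for m n
    using abs_diff[of "X m" "X n"] N[of m] N[of n] that assms null_iff by fastforce
  then show "\<exists>N. \<forall>m\<ge>N. \<forall>n\<ge>N. a (X m - X n) < e" by blast
qed (use assms null_iff in auto)

lemma null_zero [simp]: "null (\<lambda>_. 0)"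
  by (auto simp: null_iff)

lemma null_uminus: "null X \<Longrightarrow> null (\<lambda>n. - X n)"
  by (auto simp: null_iff)

lemma null_diff: "null X \<Longrightarrow> null Y \<Longrightarrow> null (\<lambda>n. X n - Y n)"
  using null_add[OF _ null_uminus, of X Y] by simp

lemma cring_cauchy_ring: "cring (cauchy_ring K a)"
proof (rule cringI)
  show "abelian_group (cauchy_ring K a)"
  proof (rule abelian_groupI)
    fix X assume X: "cauchy X"
    show "\<exists>Y\<in>carrier (cauchy_ring K a). Y \<oplus>\<^bsub>cauchy_ring K a\<^esub> X = \<zero>\<^bsub>cauchy_ring K a\<^esub>"
      by (rule bexI[OF _ cauchy_uminus[OF X]]) simp
  qed (auto simp: cauchy_add algebra_simps)
  show "comm_monoid (cauchy_ring K a)"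
    by (rule comm_monoidI) (auto simp: cauchy_mult algebra_simps)
qed (auto simp: algebra_simps)

sublocale R: cring "cauchy_ring K a"
  by (rule cring_cauchy_ring)

lemma R_a_inv: "cauchy X \<Longrightarrow> \<ominus>\<^bsub>cauchy_ring K a\<^esub> X = (\<lambda>n. - X n)"
  by (rule R.minus_equality) (auto simp: cauchy_uminus)

lemma ideal_null: "ideal (null_seqs K a) (cauchy_ring K a)"
proof (rule idealI)
  show "ring (cauchy_ring K a)" by (rule R.ring_axioms)
  show "subgroup (null_seqs K a) (add_monoid (cauchy_ring K a))"
  proof (rule group.subgroupI[OF R.a_group])
    show "null_seqs K a \<noteq> {}" using null_zero by blast
    show "inv\<^bsub>add_monoid (cauchy_ring K a)\<^esub> X \<in> null_seqs K a" if "null X" for X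
      using R_a_inv[OF null_imp_cauchy[OF that]] null_uminus[OF that] by (simp add: a_inv_def)
  qed (auto simp: null_imp_cauchy null_add)
  show "X \<otimes>\<^bsub>cauchy_ring K a\<^esub> Y \<in> null_seqs K a" if "null Y" "cauchy X" for X Y
    using null_mult[OF that(2,1)] by simp
  show "Y \<otimes>\<^bsub>cauchy_ring K a\<^esub> X \<in> null_seqs K a" if "null Y" "cauchy X" for X Y
    using null_mult[OF that(2,1)] by (simp add: mult.commute)
qed

sublocale I: ideal "null_seqs K a" "cauchy_ring K a"
  by (rule ideal_null)

definition cls :: "(nat \<Rightarrow> complex) \<Rightarrow> (nat \<Rightarrow> complex) set" where
  "cls X = null_seqs K a +>\<^bsub>cauchy_ring K a\<^esub> X"

abbreviation "C \<equiv> completion K a"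

sublocale C: cring "completion K a"
  unfolding completion_def by (rule I.quotient_is_cring[OF cring_cauchy_ring])

lemma hom_cls: "ring_hom_ring (cauchy_ring K a) (completion K a) cls"
  using I.rcos_ring_hom_ring unfolding completion_def cls_def[abs_def] .

lemma mem_cls: "Y \<in> cls X \<longleftrightarrow> null (\<lambda>n. Y n - X n)"
proof
  assume "null (\<lambda>n. Y n - X n)"
  then show "Y \<in> cls X"
    unfolding cls_def a_r_coset_def r_coset_def by (auto intro!: bexI[of _ "\<lambda>n. Y n - X n"])
next
  assume "Y \<in> cls X"
  then obtain h where "null h" "Y = (\<lambda>n. h n + X n)"
    unfolding cls_def a_r_coset_def r_coset_def by auto
  then show "null (\<lambda>n. Y n - X n)" by simp
qed

lemma cls_self: "X \<in> cls X"
  by (simp add: mem_cls)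

lemma cls_eq_iff: "cauchy X \<Longrightarrow> cauchy Y \<Longrightarrow> cls X = cls Y \<longleftrightarrow> null (\<lambda>n. X n - Y n)"
proof
  assume "cls X = cls Y"
  then show "null (\<lambda>n. X n - Y n)" using cls_self[of X] by (simp add: mem_cls)
next
  assume XY: "null (\<lambda>n. X n - Y n)"
  have "null (\<lambda>n. Z n - X n) \<longleftrightarrow> null (\<lambda>n. Z n - Y n)" for Z
    using null_add[OF _ XY, of "\<lambda>n. Z n - X n"] null_diff[OF _ XY, of "\<lambda>n. Z n - Y n"]
    by (auto simp: algebra_simps)
  then show "cls X = cls Y" by (auto simp: mem_cls)
qed

lemma carrier_C: "carrier C = cls ` carrier (cauchy_ring K a)"
  by (auto simp: completion_def FactRing_def A_RCOSETS_def RCOSETS_def cls_def a_r_coset_def)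

lemma cls_carrier [simp]: "cauchy X \<Longrightarrow> cls X \<in> carrier C"
  by (simp add: carrier_C)

lemma cls_add: "cauchy X \<Longrightarrow> cauchy Y \<Longrightarrow> cls X \<oplus>\<^bsub>C\<^esub> cls Y = cls (\<lambda>n. X n + Y n)"
  and cls_mult: "cauchy X \<Longrightarrow> cauchy Y \<Longrightarrow> cls X \<otimes>\<^bsub>C\<^esub> cls Y = cls (\<lambda>n. X n * Y n)"
  and cls_one: "\<one>\<^bsub>C\<^esub> = cls (\<lambda>_. 1)" and cls_zero: "\<zero>\<^bsub>C\<^esub> = cls (\<lambda>_. 0)"
  using ring_hom_ring.axioms(3)[OF hom_cls] ring_hom_cring.hom_zero
proof -
  interpret h: ring_hom_ring "cauchy_ring K a" C cls by (rule hom_cls)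
  show "cauchy X \<Longrightarrow> cauchy Y \<Longrightarrow> cls X \<oplus>\<^bsub>C\<^esub> cls Y = cls (\<lambda>n. X n + Y n)" using h.hom_add by simp
  show "cauchy X \<Longrightarrow> cauchy Y \<Longrightarrow> cls X \<otimes>\<^bsub>C\<^esub> cls Y = cls (\<lambda>n. X n * Y n)" using h.hom_mult by simp
  show "\<one>\<^bsub>C\<^esub> = cls (\<lambda>_. 1)" using h.hom_one by simp
  show "\<zero>\<^bsub>C\<^esub> = cls (\<lambda>_. 0)" using h.hom_zero by simp
qed

lemma cls_uminus: "cauchy X \<Longrightarrow> \<ominus>\<^bsub>C\<^esub> cls X = cls (\<lambda>n. - X n)"
  by (rule C.minus_equality) (auto simp: cls_add cls_zero cauchy_uminus)

lemma cls_minus: "cauchy X \<Longrightarrow> cauchy Y \<Longrightarrow> cls X \<ominus>\<^bsub>C\<^esub> cls Y = cls (\<lambda>n. X n - Y n)"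
  by (simp add: a_minus_def cls_uminus cls_add cauchy_uminus)

lemma to_completion_eq: "to_completion K a x = cls (\<lambda>_. x)"
  by (simp add: to_completion_def cls_def)

lemma abs_cauchy_tendsto:
  assumes "cauchy X"
  shows "(\<lambda>n. a (X n)) \<longlonglongrightarrow> completion_abs a (cls X)"
proof -
  have "Cauchy (\<lambda>n. a (X n))"
  proof (rule metric_CauchyI)
    fix e :: real assume "e > 0"
    then obtain N where "\<And>m n. m \<ge> N \<Longrightarrow> n \<ge> N \<Longrightarrow> a (X m - X n) < e"
      using cauchyD[OF assms] by blast
    then show "\<exists>M. \<forall>m\<ge>M. \<forall>n\<ge>M. dist (a (X m)) (a (X n)) < e"
      using abs_diff_ge cauchy_in[OF assms] unfolding dist_real_def by (meson le_less_trans)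
  qed
  then obtain r where r: "(\<lambda>n. a (X n)) \<longlonglongrightarrow> r"
    using Cauchy_convergent convergent_def by blast
  have all: "(\<lambda>n. a (Y n)) \<longlonglongrightarrow> r" if "Y \<in> cls X" for Y
  proof -
    have nl: "null (\<lambda>n. Y n - X n)" using that by (simp add: mem_cls)
    then have inK: "Y n - X n \<in> K" for n by (simp add: null_iff)
    then have YK: "Y n \<in> K" for n using add[OF inK[of n] cauchy_in[OF assms, of n]] by simp
    have "(\<lambda>n. a (Y n) - a (X n)) \<longlonglongrightarrow> 0"
    proof (rule tendsto_0_le)
      show "eventually (\<lambda>n. norm (a (Y n) - a (X n)) \<le> norm (a (Y n - X n)) * 1) sequentially"
        using abs_diff_ge[OF YK cauchy_in[OF assms]] inK by simp
      show "(\<lambda>n. a (Y n - X n)) \<longlonglongrightarrow> 0" using nl by (simp add: null_seqs_def)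
    qed
    from tendsto_add[OF this r] show ?thesis by simp
  qed
  have "completion_abs a (cls X) = r"
    unfolding completion_abs_def
  proof (rule the_equality)
    show "\<forall>Y\<in>cls X. (\<lambda>n. a (Y n)) \<longlonglongrightarrow> r" using all by blast
    show "r' = r" if "\<forall>Y\<in>cls X. (\<lambda>n. a (Y n)) \<longlonglongrightarrow> r'" for r'
      using that cls_self[of X] r LIMSEQ_unique by blast
  qed
  then show ?thesis using r by simp
qed

lemma completion_abs_eqI: "cauchy X \<Longrightarrow> (\<lambda>n. a (X n)) \<longlonglongrightarrow> r \<Longrightarrow> completion_abs a (cls X) = r"
  using abs_cauchy_tendsto LIMSEQ_unique by blast

lemma completion_abs_const: "x \<in> K \<Longrightarrow> completion_abs a (cls (\<lambda>_. x)) = a x"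
  by (rule completion_abs_eqI) auto

lemma completion_abs_nonneg: "x \<in> carrier C \<Longrightarrow> 0 \<le> completion_abs a x"
  unfolding carrier_C using abs_cauchy_tendsto by (auto intro!: LIMSEQ_le_const nonneg cauchy_in)

subsection \<open>Operator norms\<close>

lemma finsum_cls:
  assumes "finite J" "\<And>j. j \<in> J \<Longrightarrow> cauchy (X j)"
  shows "cauchy (\<lambda>n. \<Sum>j\<in>J. X j n)" "(\<Oplus>\<^bsub>C\<^esub>j\<in>J. cls (X j)) = cls (\<lambda>n. \<Sum>j\<in>J. X j n)"
proof -
  have "cauchy (\<lambda>n. \<Sum>j\<in>J. X j n) \<and> (\<Oplus>\<^bsub>C\<^esub>j\<in>J. cls (X j)) = cls (\<lambda>n. \<Sum>j\<in>J. X j n)"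
    using assms
  proof (induction J rule: finite_induct)
    case (insert j J)
    have "(\<Oplus>\<^bsub>C\<^esub>i\<in>insert j J. cls (X i)) = cls (X j) \<oplus>\<^bsub>C\<^esub> (\<Oplus>\<^bsub>C\<^esub>i\<in>J. cls (X i))"
      using insert by (intro C.finsum_insert) auto
    then show ?case using insert by (simp add: cauchy_add cls_add)
  qed (simp_all add: cls_zero)
  then show "cauchy (\<lambda>n. \<Sum>j\<in>J. X j n)" "(\<Oplus>\<^bsub>C\<^esub>j\<in>J. cls (X j)) = cls (\<lambda>n. \<Sum>j\<in>J. X j n)"
    by auto
qed

lemma mult_mat_vec_completion:
  assumes f: "f \<in> mats d K" and x: "x \<in> completion_vecs K a d" and i: "i < d"
  obtains X where "\<And>j. j < d \<Longrightarrow> cauchy (X j)" "\<And>j. j < d \<Longrightarrow> x $ j = cls (X j)"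
    "ring_mult_mat_vec C (map_mat (to_completion K a) f) x $ i = cls (\<lambda>n. \<Sum>j<d. f $$ (i, j) * X j n)"
    "cauchy (\<lambda>n. \<Sum>j<d. f $$ (i, j) * X j n)"
proof -
  have fc: "f \<in> carrier_mat d d" and fK: "\<And>j. j < d \<Longrightarrow> f $$ (i, j) \<in> K"
    using f i by (auto simp: mats_def intro: mats_entry)
  have xc: "dim_vec x = d" using x by (auto simp: completion_vecs_def)
  have "\<forall>j. \<exists>X. j < d \<longrightarrow> cauchy X \<and> x $ j = cls X"
    using x by (auto simp: completion_vecs_def carrier_C)
  then obtain X where X: "\<And>j. j < d \<Longrightarrow> cauchy (X j)" "\<And>j. j < d \<Longrightarrow> x $ j = cls (X j)" by metis
  have tm: "map_mat (to_completion K a) f $$ (i, j) \<otimes>\<^bsub>C\<^esub> x $ j = cls (\<lambda>n. f $$ (i, j) * X j n)"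
    "cauchy (\<lambda>n. f $$ (i, j) * X j n)" if "j < d" for j
    using X[OF that] fK[OF that] fc i that cauchy_mult[OF cauchy_const[OF fK[OF that]] X(1)[OF that]]
    by (simp_all add: to_completion_eq cls_mult)
  have "ring_mult_mat_vec C (map_mat (to_completion K a) f) x $ i =
      (\<Oplus>\<^bsub>C\<^esub>j\<in>{..<d}. map_mat (to_completion K a) f $$ (i, j) \<otimes>\<^bsub>C\<^esub> x $ j)"
    using fc i xc by (simp add: ring_mult_mat_vec_def)
  also have "\<dots> = (\<Oplus>\<^bsub>C\<^esub>j\<in>{..<d}. cls (\<lambda>n. f $$ (i, j) * X j n))"
    using tm by (intro C.finsum_cong') auto
  also have "\<dots> = cls (\<lambda>n. \<Sum>j<d. f $$ (i, j) * X j n)"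
    using tm by (intro finsum_cls) auto
  finally show thesis
    using that[of X] X finsum_cls(1)[of "{..<d}" "\<lambda>j n. f $$ (i, j) * X j n"] tm by auto
qed

definition norm_const :: "nat \<Rightarrow> real" where
  "norm_const d = (if ultrametric K a then 1 else real d * real d)"

lemma vec_norm_mult_le:
  assumes d: "d \<ge> 1" and f: "f \<in> mats d K" and x: "x \<in> completion_vecs K a d"
    and E: "\<And>i j. i < d \<Longrightarrow> j < d \<Longrightarrow> a (f $$ (i, j)) \<le> E"
  shows "vec_norm K a (ring_mult_mat_vec C (map_mat (to_completion K a) f) x) \<le> norm_const d * E * vec_norm K a x"
    and "0 \<le> vec_norm K a x"
proof -
  let ?y = "ring_mult_mat_vec C (map_mat (to_completion K a) f) x"
  have fK: "f $$ (i, j) \<in> K" if "i < d" "j < d" for i j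
    using f that by (rule mats_entry)
  have dim: "dim_vec ?y = d" "dim_vec x = d"
    using f x by (auto simp: ring_mult_mat_vec_def completion_vecs_def mats_def)
  have E0: "0 \<le> E" using E[of 0 0] nonneg[OF fK, of 0 0] d by fastforce
  define c where "c j = completion_abs a (x $ j)" for j
  have c0: "0 \<le> c j" if "j < d" for j
    using x that completion_abs_nonneg by (auto simp: c_def completion_vecs_def)
  have ne: "{..<d} \<noteq> {}" using d by (auto simp: lessThan_empty_iff)
  have "vec_norm K a ?y \<le> norm_const d * E * vec_norm K a x \<and> 0 \<le> vec_norm K a x"
  proof (cases "ultrametric K a")
    case True
    have vx: "vec_norm K a x = Max (c ` {..<d})" using True dim by (simp add: vec_norm_def c_def)
    have cM: "c j \<le> vec_norm K a x" if "j < d" for j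
      unfolding vx using that by (intro Max_ge) auto
    have v0: "0 \<le> vec_norm K a x" using cM[of 0] c0[of 0] d by simp
    have "completion_abs a (?y $ i) \<le> E * vec_norm K a x" if i: "i < d" for i
    proof -
      obtain X where X: "\<And>j. j < d \<Longrightarrow> cauchy (X j)" "\<And>j. j < d \<Longrightarrow> x $ j = cls (X j)"
        "?y $ i = cls (\<lambda>n. \<Sum>j<d. f $$ (i, j) * X j n)" "cauchy (\<lambda>n. \<Sum>j<d. f $$ (i, j) * X j n)"
        using mult_mat_vec_completion[OF f x i] by blast
      have lim: "(\<lambda>n. a (\<Sum>j<d. f $$ (i, j) * X j n)) \<longlonglongrightarrow> completion_abs a (?y $ i)"
        unfolding X(3) by (rule abs_cauchy_tendsto[OF X(4)])
      have limX: "(\<lambda>n. a (X j n)) \<longlonglongrightarrow> c j" if "j < d" for j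
        using abs_cauchy_tendsto[OF X(1)[OF that]] X(2)[OF that] by (simp add: c_def)
      show ?thesis
      proof (rule field_le_epsilon)
        fix e :: real assume "e > 0"
        define e' where "e' = e / (E + 1)"
        have e': "e' > 0" "E * e' \<le> e" using \<open>e > 0\<close> E0 by (auto simp: e'_def field_simps)
        have "eventually (\<lambda>n. \<forall>j\<in>{..<d}. a (X j n) < vec_norm K a x + e') sequentially"
        proof (intro eventually_ball_finite ballI)
          fix j assume "j \<in> {..<d}"
          then have "j < d" "c j < vec_norm K a x + e'" using cM[of j] e'(1) by auto
          then show "eventually (\<lambda>n. a (X j n) < vec_norm K a x + e') sequentially"
            using order_tendstoD(2)[OF limX] by blast
        qed simp
        then have "eventually (\<lambda>n. a (\<Sum>j<d. f $$ (i, j) * X j n) \<le> E * (vec_norm K a x + e')) sequentially"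
        proof (rule eventually_mono)
          fix n assume n: "\<forall>j\<in>{..<d}. a (X j n) < vec_norm K a x + e'"
          show "a (\<Sum>j<d. f $$ (i, j) * X j n) \<le> E * (vec_norm K a x + e')"
          proof (rule ultrametric_sum[OF True])
            fix j assume j: "j \<in> {..<d}"
            then show "f $$ (i, j) * X j n \<in> K" using fK i cauchy_in[OF X(1)] by auto
            show "a (f $$ (i, j) * X j n) \<le> E * (vec_norm K a x + e')"
              using j n fK[OF i] cauchy_in[OF X(1)] E[OF i] E0 by (auto simp: abs_mult intro!: mult_mono dest!: bspec)
          qed (use E0 v0 e' in auto)
        qed
        then have "completion_abs a (?y $ i) \<le> E * (vec_norm K a x + e')"
          using lim by (intro tendsto_upperbound[OF lim]) auto
        then show "completion_abs a (?y $ i) \<le> E * vec_norm K a x + e"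
          using e'(2) by (simp add: distrib_left)
      qed
    qed
    moreover have "vec_norm K a ?y = Max ((\<lambda>i. completion_abs a (?y $ i)) ` {..<d})"
      using True dim by (simp add: vec_norm_def)
    ultimately show ?thesis
      using v0 True ne by (simp add: norm_const_def)
  next
    case False
    have vx: "vec_norm K a x = L2_set c {..<d}"
      using False dim by (simp add: vec_norm_def c_def L2_set_def)
    have v0: "0 \<le> vec_norm K a x" unfolding vx by (rule L2_set_nonneg)
    have cM: "c j \<le> vec_norm K a x" if "j < d" for j
      unfolding vx using that by (intro member_le_L2_set) auto
    have "completion_abs a (?y $ i) \<le> real d * E * vec_norm K a x" if i: "i < d" for i
    proof -
      obtain X where X: "\<And>j. j < d \<Longrightarrow> cauchy (X j)" "\<And>j. j < d \<Longrightarrow> x $ j = cls (X j)"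
        "?y $ i = cls (\<lambda>n. \<Sum>j<d. f $$ (i, j) * X j n)" "cauchy (\<lambda>n. \<Sum>j<d. f $$ (i, j) * X j n)"
        using mult_mat_vec_completion[OF f x i] by blast
      have lim: "(\<lambda>n. a (\<Sum>j<d. f $$ (i, j) * X j n)) \<longlonglongrightarrow> completion_abs a (?y $ i)"
        unfolding X(3) by (rule abs_cauchy_tendsto[OF X(4)])
      have limX: "(\<lambda>n. \<Sum>j<d. E * a (X j n)) \<longlonglongrightarrow> (\<Sum>j<d. E * c j)"
        using abs_cauchy_tendsto[OF X(1)] X(2) by (intro tendsto_intros) (auto simp: c_def)
      have "completion_abs a (?y $ i) \<le> (\<Sum>j<d. E * c j)"
      proof (rule LIMSEQ_le[OF lim limX], intro exI allI impI)
        fix n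
        have "a (\<Sum>j<d. f $$ (i, j) * X j n) \<le> (\<Sum>j<d. a (f $$ (i, j) * X j n))"
          using fK[OF i] cauchy_in[OF X(1)] by (intro abs_sum) auto
        also have "\<dots> \<le> (\<Sum>j<d. E * a (X j n))"
          using fK[OF i] cauchy_in[OF X(1)] E[OF i] by (intro sum_mono) (auto simp: abs_mult intro!: mult_right_mono)
        finally show "a (\<Sum>j<d. f $$ (i, j) * X j n) \<le> (\<Sum>j<d. E * a (X j n))" .
      qed
      also have "\<dots> \<le> (\<Sum>j<d. E * vec_norm K a x)"
        using cM E0 by (intro sum_mono mult_left_mono) auto
      finally show ?thesis by simp
    qed
    moreover have y0: "0 \<le> completion_abs a (?y $ i)" if i: "i < d" for i
    proof -
      obtain X where "?y $ i = cls (\<lambda>n. \<Sum>j<d. f $$ (i, j) * X j n)" "cauchy (\<lambda>n. \<Sum>j<d. f $$ (i, j) * X j n)"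
        by (rule mult_mat_vec_completion[OF f x i]) (rule that)
      then show ?thesis using completion_abs_nonneg[OF cls_carrier] by simp
    qed
    ultimately have "(\<Sum>i<d. completion_abs a (?y $ i)) \<le> (\<Sum>i<d. real d * E * vec_norm K a x)"
      by (intro sum_mono) auto
    moreover have "vec_norm K a ?y \<le> (\<Sum>i<d. completion_abs a (?y $ i))"
    proof -
      have "vec_norm K a ?y = L2_set (\<lambda>i. completion_abs a (?y $ i)) {..<d}"
        by (simp add: vec_norm_def L2_set_def dim(1) False)
      also have "\<dots> \<le> (\<Sum>i<d. completion_abs a (?y $ i))"
        using y0 by (intro L2_set_le_sum) simp
      finally show ?thesis .
    qed
    ultimately show ?thesis
      using v0 False by (simp add: norm_const_def mult.assoc)
  qed
  then show "vec_norm K a ?y \<le> norm_const d * E * vec_norm K a x" "0 \<le> vec_norm K a x" by auto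
qed

lemma op_norm_bounds:
  assumes d: "d \<ge> 1" and f: "f \<in> mats d K"
    and E: "\<And>i j. i < d \<Longrightarrow> j < d \<Longrightarrow> a (f $$ (i, j)) \<le> E"
  shows "op_norm K a d (map_mat (to_completion K a) f) \<le> norm_const d * E"
    and "i < d \<Longrightarrow> j < d \<Longrightarrow> a (f $$ (i, j)) \<le> op_norm K a d (map_mat (to_completion K a) f)"
proof -
  let ?q = "\<lambda>x. vec_norm K a (ring_mult_mat_vec C (map_mat (to_completion K a) f) x) / vec_norm K a x"
  have fK: "f $$ (i, j) \<in> K" if "i < d" "j < d" for i j
    using f that by (rule mats_entry)
  have "0 \<le> E" using E[of 0 0] nonneg[OF fK, of 0 0] d by fastforce
  moreover have "0 \<le> norm_const d" by (simp add: norm_const_def)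
  ultimately have q: "?q x \<le> norm_const d * E" if "x \<in> completion_vecs K a d" for x
    using vec_norm_mult_le[OF d f that E]
    by (cases "vec_norm K a x = 0") (auto simp: divide_simps mult_nonneg_nonneg)
  have unit: "vec d (\<lambda>k. if k = j then cls (\<lambda>_. 1) else cls (\<lambda>_. 0)) \<in> completion_vecs K a d" for j
    by (auto simp: completion_vecs_def)
  show "op_norm K a d (map_mat (to_completion K a) f) \<le> norm_const d * E"
    unfolding op_norm_def using unit q by (intro cSUP_least) blast+
  assume ij: "i < d" "j < d"
  let ?e = "vec d (\<lambda>k. if k = j then cls (\<lambda>_. 1) else cls (\<lambda>_. 0))"
  let ?y = "ring_mult_mat_vec C (map_mat (to_completion K a) f) ?e"
  have y: "?y $ k = cls (\<lambda>_. f $$ (k, j))" if k: "k < d" for k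
  proof -
    have fc: "f \<in> carrier_mat d d" using f by (simp add: mats_def)
    have "?y $ k = (\<Oplus>\<^bsub>C\<^esub>l\<in>{..<d}. map_mat (to_completion K a) f $$ (k, l) \<otimes>\<^bsub>C\<^esub> ?e $ l)"
      using fc k by (simp add: ring_mult_mat_vec_def)
    also have "\<dots> = (\<Oplus>\<^bsub>C\<^esub>l\<in>{..<d}. cls (\<lambda>_. if l = j then f $$ (k, j) else 0))"
      using fc fK k by (intro C.finsum_cong') (auto simp: to_completion_eq cls_mult)
    also have "\<dots> = cls (\<lambda>_. \<Sum>l<d. if l = j then f $$ (k, j) else 0)"
      using fK k ij by (intro finsum_cls) auto
    also have "(\<Sum>l<d. if l = j then f $$ (k, j) else 0) = f $$ (k, j)"
      using ij by simp
    finally show ?thesis .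
  qed
  have cabs: "completion_abs a (?y $ k) = a (f $$ (k, j))" if "k < d" for k
    using y[OF that] fK[OF that ij(2)] by (simp add: completion_abs_const)
  have dim: "dim_vec ?y = d" using f by (auto simp: ring_mult_mat_vec_def mats_def)
  have ce: "completion_abs a (?e $ k) = (if k = j then 1 else 0)" if "k < d" for k
    using that by (simp add: completion_abs_const)
  have ne: "vec_norm K a ?e = 1"
  proof (cases "ultrametric K a")
    case True
    have "Max ((\<lambda>k. completion_abs a (?e $ k)) ` {..<d}) = 1"
    proof (rule Max_eqI)
      show "1 \<in> (\<lambda>k. completion_abs a (?e $ k)) ` {..<d}"
        using ij ce[of j] by (intro image_eqI[of _ _ j]) auto
    qed (use ce in auto)
    then show ?thesis using True by (simp add: vec_norm_def)
  next
    case False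
    have "(\<Sum>k<d. (completion_abs a (?e $ k))\<^sup>2) = (\<Sum>k<d. if k = j then 1 else 0)"
      using ce by (intro sum.cong) auto
    also have "\<dots> = 1" using ij by simp
    finally show ?thesis using False by (simp add: vec_norm_def)
  qed
  have "a (f $$ (i, j)) \<le> vec_norm K a ?y"
  proof (cases "ultrametric K a")
    case True
    have "a (f $$ (i, j)) \<le> Max ((\<lambda>k. completion_abs a (?y $ k)) ` {..<d})"
      using ij cabs[OF ij(1)] by (intro Max_ge image_eqI[of _ _ i]) auto
    then show ?thesis using True dim by (simp add: vec_norm_def)
  next
    case False
    have "a (f $$ (i, j)) \<le> L2_set (\<lambda>k. completion_abs a (?y $ k)) {..<d}"
      using member_le_L2_set[of "{..<d}" i "\<lambda>k. completion_abs a (?y $ k)"] ij cabs[OF ij(1)] by simp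
    then show ?thesis using False dim by (simp add: vec_norm_def L2_set_def)
  qed
  then have "a (f $$ (i, j)) \<le> ?q ?e" using ne by simp
  also have "\<dots> \<le> op_norm K a d (map_mat (to_completion K a) f)"
    unfolding op_norm_def using q unit[of j] by (intro cSUP_upper bdd_aboveI2) auto
  finally show "a (f $$ (i, j)) \<le> op_norm K a d (map_mat (to_completion K a) f)" .
qed

subsection \<open>Local degrees\<close>

lemma cls_nonzero_imp_bounded_below:
  assumes X: "cauchy X" and nz: "cls X \<noteq> cls (\<lambda>_. 0)"
  obtains \<delta> N where "\<delta> > 0" "\<And>n. n \<ge> N \<Longrightarrow> \<delta> \<le> a (X n)"
proof -
  have "\<not> null X" using nz cls_eq_iff[OF X cauchy_const[OF zero]] by simp
  then obtain e where e: "e > 0" "\<And>N. \<exists>n\<ge>N. a (X n) \<ge> e"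
    using cauchy_in[OF X] unfolding null_iff by (meson not_le)
  obtain N where N: "\<And>m n. m \<ge> N \<Longrightarrow> n \<ge> N \<Longrightarrow> a (X m - X n) < e / 2"
    using cauchyD[OF X, of "e / 2"] e(1) by auto
  obtain m where m: "m \<ge> N" "a (X m) \<ge> e" using e(2) by blast
  have "e / 2 \<le> a (X n)" if "n \<ge> N" for n
    using abs_diff_ge[of "X m" "X n"] N[of m n] m that cauchy_in[OF X] by fastforce
  then show thesis using that[of "e / 2" N] e(1) by auto
qed

lemma cauchy_inverse:
  assumes X: "cauchy X" and nz: "cls X \<noteq> cls (\<lambda>_. 0)"
  shows "cauchy (\<lambda>n. inverse (X n))" and "cls X \<otimes>\<^bsub>C\<^esub> cls (\<lambda>n. inverse (X n)) = \<one>\<^bsub>C\<^esub>"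
proof -
  obtain \<delta> N where d: "\<delta> > 0" "\<And>n. n \<ge> N \<Longrightarrow> \<delta> \<le> a (X n)"
    using cls_nonzero_imp_bounded_below[OF assms] by blast
  note XK = cauchy_in[OF X]
  have X0: "X n \<noteq> 0" if "n \<ge> N" for n using d(1) d(2)[OF that] by auto
  show inv: "cauchy (\<lambda>n. inverse (X n))"
    unfolding cauchy_iff
  proof (intro conjI allI impI)
    fix e :: real assume "e > 0"
    then have "e * \<delta> * \<delta> > 0" using d by simp
    then obtain M where M: "\<And>m n. m \<ge> M \<Longrightarrow> n \<ge> M \<Longrightarrow> a (X m - X n) < e * \<delta> * \<delta>"
      using cauchyD[OF X] by blast
    have "a (inverse (X m) - inverse (X n)) < e" if "m \<ge> max M N" "n \<ge> max M N" for m n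
    proof -
      have nz: "X m \<noteq> 0" "X n \<noteq> 0" using X0 that by auto
      have "inverse (X m) - inverse (X n) = (X n - X m) / (X m * X n)"
        using nz by (simp add: field_simps)
      then have "a (inverse (X m) - inverse (X n)) = a (X n - X m) / (a (X m) * a (X n))"
        using XK by (simp add: abs_divide abs_mult)
      also have "\<dots> \<le> a (X n - X m) / (\<delta> * \<delta>)"
        using d that XK by (intro divide_left_mono mult_mono mult_pos_pos) (auto intro: less_le_trans)
      also have "\<dots> < e" using M[of n m] that d(1) by (simp add: field_simps)
      finally show ?thesis .
    qed
    then show "\<exists>N. \<forall>m\<ge>N. \<forall>n\<ge>N. a (inverse (X m) - inverse (X n)) < e" by blast
  qed (use XK in auto)
  have "null (\<lambda>n. X n * inverse (X n) - 1)"
    unfolding null_iff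
  proof (intro conjI allI impI)
    fix e :: real assume "e > 0"
    then show "\<exists>N. \<forall>n\<ge>N. a (X n * inverse (X n) - 1) < e"
      using X0 by (intro exI[of _ N]) auto
  qed (use XK in auto)
  then show "cls X \<otimes>\<^bsub>C\<^esub> cls (\<lambda>n. inverse (X n)) = \<one>\<^bsub>C\<^esub>"
    using X inv cauchy_mult[OF X inv] by (simp add: cls_mult cls_one cls_eq_iff)
qed

lemma one_neq_zero_C: "\<one>\<^bsub>C\<^esub> \<noteq> \<zero>\<^bsub>C\<^esub>"
proof
  assume "\<one>\<^bsub>C\<^esub> = \<zero>\<^bsub>C\<^esub>"
  then have "null (\<lambda>_. 1)" by (simp add: cls_one cls_zero cls_eq_iff)
  then show False by (auto simp: null_iff dest: spec[of _ 1])
qed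

lemma field_C: "field (completion K a)"
proof (rule cring.cring_fieldI2[OF C.cring_axioms])
  show "\<zero>\<^bsub>C\<^esub> \<noteq> \<one>\<^bsub>C\<^esub>" using one_neq_zero_C by simp
  fix x assume "x \<in> carrier C" "x \<noteq> \<zero>\<^bsub>C\<^esub>"
  then obtain X where X: "cauchy X" "x = cls X" by (auto simp: carrier_C)
  then show "\<exists>y\<in>carrier C. x \<otimes>\<^bsub>C\<^esub> y = \<one>\<^bsub>C\<^esub>"
    using cauchy_inverse[OF X(1)] \<open>x \<noteq> \<zero>\<^bsub>C\<^esub>\<close> by (auto simp: cls_zero)
qed

lemma rat_closure_eq:
  "rat_closure K a = {cls q | q. cauchy q \<and> (\<forall>n. q n \<in> \<rat>)}"
proof (intro subset_antisym subsetI)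
  fix \<xi> assume \<xi>: "\<xi> \<in> rat_closure K a"
  then obtain X where X: "cauchy X" "\<xi> = cls X" by (auto simp: rat_closure_def carrier_C)
  have "\<exists>q\<in>\<rat>. completion_abs a (cls (\<lambda>m. X m - q)) < 1 / real (Suc n)" for n
  proof -
    have "\<exists>q\<in>\<rat>. completion_abs a (\<xi> \<ominus>\<^bsub>C\<^esub> to_completion K a q) < 1 / real (Suc n)"
      using \<xi> by (auto simp: rat_closure_def)
    then show ?thesis
      using X Rats_subset by (auto simp: to_completion_eq cls_minus subset_iff)
  qed
  then obtain q where q: "\<And>n. q n \<in> \<rat>" "\<And>n. completion_abs a (cls (\<lambda>m. X m - q n)) < 1 / real (Suc n)"
    by metis
  have qK: "q n \<in> K" for n using q(1) Rats_subset by blast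
  have nl: "null (\<lambda>n. X n - q n)"
    unfolding null_iff
  proof (intro conjI allI impI)
    fix e :: real assume "e > 0"
    then have e2: "e / 2 > 0" by simp
    obtain M where M: "\<And>m n. m \<ge> M \<Longrightarrow> n \<ge> M \<Longrightarrow> a (X m - X n) < e / 2"
      using cauchyD[OF X(1) e2] by blast
    obtain N where N: "1 / real (Suc N) < e / 2"
      using nat_approx_posE[OF e2] by auto
    have "a (X n - q n) < e" if n: "n \<ge> max M N" for n
    proof -
      have "(\<lambda>m. a (X m - q n)) \<longlonglongrightarrow> completion_abs a (cls (\<lambda>m. X m - q n))"
        using X(1) qK by (intro abs_cauchy_tendsto cauchy_diff) auto
      then have "eventually (\<lambda>m. a (X m - q n) < 1 / real (Suc n)) sequentially"
        using q(2) by (rule order_tendstoD)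
      from eventually_conj[OF this eventually_ge_at_top[of M]]
      obtain m where m: "m \<ge> M" "a (X m - q n) < 1 / real (Suc n)"
        unfolding eventually_sequentially by blast
      have "1 / real (Suc n) \<le> 1 / real (Suc N)"
        using n by (simp add: divide_simps)
      moreover have "a (X n - q n) \<le> a (X n - X m) + a (X m - q n)"
        using abs_add[of "X n - X m" "X m - q n"] cauchy_in[OF X(1)] qK by simp
      ultimately show ?thesis using m M[of n m] N n by simp
    qed
    then show "\<exists>N. \<forall>n\<ge>N. a (X n - q n) < e" by blast
  qed (use qK cauchy_in[OF X(1)] in auto)
  have cq: "cauchy q"
    using cauchy_diff[OF X(1) null_imp_cauchy[OF nl]] by simp
  then have "\<xi> = cls q" using X nl cls_eq_iff by simp
  then show "\<xi> \<in> {cls q | q. cauchy q \<and> (\<forall>n. q n \<in> \<rat>)}" using cq q(1) by blast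
next
  fix \<xi> assume "\<xi> \<in> {cls q | q. cauchy q \<and> (\<forall>n. q n \<in> \<rat>)}"
  then obtain q where q: "\<xi> = cls q" "cauchy q" "\<And>n. q n \<in> \<rat>" by blast
  have "\<exists>r\<in>\<rat>. completion_abs a (\<xi> \<ominus>\<^bsub>C\<^esub> to_completion K a r) < e" if "e > 0" for e
  proof -
    have "e / 2 > 0" using that by simp
    then obtain N where N: "\<And>m n. m \<ge> N \<Longrightarrow> n \<ge> N \<Longrightarrow> a (q m - q n) < e / 2"
      using cauchyD[OF q(2)] by blast
    have qN: "q N \<in> K" using cauchy_in[OF q(2)] .
    have lim: "(\<lambda>m. a (q m - q N)) \<longlonglongrightarrow> completion_abs a (cls (\<lambda>m. q m - q N))"
      using q(2) qN by (intro abs_cauchy_tendsto cauchy_diff) auto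
    have "eventually (\<lambda>m. a (q m - q N) \<le> e / 2) sequentially"
      using N[of _ N] unfolding eventually_sequentially by (intro exI[of _ N]) (auto intro: less_imp_le)
    then have "completion_abs a (cls (\<lambda>m. q m - q N)) \<le> e / 2"
      using lim by (intro tendsto_upperbound[OF lim]) auto
    then have "completion_abs a (\<xi> \<ominus>\<^bsub>C\<^esub> to_completion K a (q N)) < e"
      using q qN that by (simp add: to_completion_eq cls_minus)
    then show ?thesis using q(3) by blast
  qed
  then show "\<xi> \<in> rat_closure K a" using q by (simp add: rat_closure_def)
qed

lemma subfield_rat_closure: "subfield (rat_closure K a) (completion K a)"
proof -
  interpret F: field "completion K a" by (rule field_C)
  show ?thesis
  proof (rule F.subfieldI')
    show "subring (rat_closure K a) (completion K a)"
    proof (rule C.subringI)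
      show "rat_closure K a \<subseteq> carrier C" by (auto simp: rat_closure_def)
      show "\<one>\<^bsub>C\<^esub> \<in> rat_closure K a"
        unfolding rat_closure_eq cls_one using cauchy_const[OF one] by force
      fix x assume "x \<in> rat_closure K a"
      then obtain X where X: "cauchy X" "\<And>n. X n \<in> \<rat>" "x = cls X" by (auto simp: rat_closure_eq)
      show "\<ominus>\<^bsub>C\<^esub> x \<in> rat_closure K a"
        unfolding rat_closure_eq X(3) cls_uminus[OF X(1)] using X cauchy_uminus by force
      fix y assume "y \<in> rat_closure K a"
      then obtain Y where Y: "cauchy Y" "\<And>n. Y n \<in> \<rat>" "y = cls Y" by (auto simp: rat_closure_eq)
      show "x \<otimes>\<^bsub>C\<^esub> y \<in> rat_closure K a"
        unfolding rat_closure_eq X(3) Y(3) cls_mult[OF X(1) Y(1)]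
        using X(2) Y(2) cauchy_mult[OF X(1) Y(1)] by (intro CollectI exI[of _ "\<lambda>n. X n * Y n"]) simp
      show "x \<oplus>\<^bsub>C\<^esub> y \<in> rat_closure K a"
        unfolding rat_closure_eq X(3) Y(3) cls_add[OF X(1) Y(1)]
        using X(2) Y(2) cauchy_add[OF X(1) Y(1)] by (intro CollectI exI[of _ "\<lambda>n. X n + Y n"]) simp
    qed
    fix x assume "x \<in> rat_closure K a - {\<zero>\<^bsub>C\<^esub>}"
    then obtain X where X: "cauchy X" "\<And>n. X n \<in> \<rat>" "x = cls X" "cls X \<noteq> cls (\<lambda>_. 0)"
      by (auto simp: rat_closure_eq cls_zero)
    note inv = cauchy_inverse[OF X(1,4)]
    have "inv\<^bsub>C\<^esub> x = cls (\<lambda>n. inverse (X n))"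
      using inv X by (intro C.comm_inv_char) auto
    then show "inv\<^bsub>C\<^esub> x \<in> rat_closure K a"
      unfolding rat_closure_eq using inv(1) X(2) by force
  qed
qed

text \<open>
  Let \<open>X = Y + q b\<^sub>j\<close> be a Cauchy sequence in the rational span of \<open>b\<^sub>0, \<dots>, b\<^sub>j\<close>. If the coefficients
  \<open>q\<close> are a Cauchy sequence, they converge in the closure of the rationals. Otherwise, dividing
  differences of \<open>X\<close> by differences of \<open>q\<close> shows that \<open>b\<^sub>j\<close> is a limit of elements of the span of
  \<open>b\<^sub>0, \<dots>, b\<^sub>j\<^sub>-\<^sub>1\<close>, and it can be replaced by these.
\<close>

lemma cls_in_Span:
  assumes b: "\<And>i. i < j \<Longrightarrow> b i \<in> K" and X: "cauchy X"
    and c: "\<And>n. X n = (\<Sum>i<j. of_rat (c n i) * b i)"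
  shows "cls X \<in> C.Span (rat_closure K a) (map (\<lambda>i. cls (\<lambda>_. b i)) (rev [0..<j]))"
  using assms
proof (induction j arbitrary: X c)
  case 0
  then have "X = (\<lambda>_. 0)" by auto
  then show ?case by (simp add: cls_zero)
next
  case (Suc j)
  define Q where "Q = rat_closure K a"
  define Us where "Us = map (\<lambda>i. cls (\<lambda>_. b i)) (rev [0..<j])"
  have Us: "set Us \<subseteq> carrier C" using Suc.prems(1) by (auto simp: Us_def)
  have Span_Suc: "C.Span Q (map (\<lambda>i. cls (\<lambda>_. b i)) (rev [0..<Suc j])) = C.line_extension Q (cls (\<lambda>_. b j)) (C.Span Q Us)"
    by (simp add: Us_def)
  define Y where "Y n = (\<Sum>i<j. of_rat (c n i) * b i)" for n
  define q where "q n = (of_rat (c n j) :: complex)" for n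
  have XY: "X n = Y n + q n * b j" for n
    using Suc.prems(3)[of n] by (simp add: Y_def q_def)
  have YK: "Y n \<in> K" for n unfolding Y_def using Suc.prems(1) by (intro sum mult of_rat) auto
  have qK: "q n \<in> K" for n by (simp add: q_def)
  have bj: "b j \<in> K" using Suc.prems(1) by simp
  show ?case
  proof (cases "cauchy q")
    case True
    have Yeq: "Y = (\<lambda>n. X n - q n * b j)" using XY by auto
    have cY: "cauchy Y"
      unfolding Yeq using cauchy_diff[OF Suc.prems(2) cauchy_mult[OF True cauchy_const[OF bj]]] .
    have "cls Y \<in> C.Span Q Us"
      unfolding Us_def Q_def
    proof (rule Suc.IH)
      show "b i \<in> K" if "i < j" for i using Suc.prems(1) that by simp
      show "cauchy Y" by fact
      show "Y n = (\<Sum>i<j. of_rat (c n i) * b i)" for n by (simp add: Y_def)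
    qed
    moreover have "cls q \<in> Q"
      unfolding Q_def rat_closure_eq using True by (auto simp: q_def)
    moreover have "cls X = cls q \<otimes>\<^bsub>C\<^esub> cls (\<lambda>_. b j) \<oplus>\<^bsub>C\<^esub> cls Y"
      using True cY bj cauchy_mult[OF True cauchy_const[OF bj]] XY[abs_def]
      by (simp add: cls_mult cls_add add.commute)
    ultimately show ?thesis
      unfolding Q_def[symmetric] Span_Suc C.line_extension_mem_iff by blast
  next
    case False
    then obtain e where e: "e > 0" "\<And>N. \<exists>m\<ge>N. \<exists>n\<ge>N. e \<le> a (q m - q n)"
      using qK unfolding cauchy_iff by (meson not_le)
    obtain \<mu> \<nu> where mn: "\<And>N. \<mu> N \<ge> N" "\<And>N. \<nu> N \<ge> N" "\<And>N. e \<le> a (q (\<mu> N) - q (\<nu> N))"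
      using e(2) by metis
    define Z where "Z N = - ((Y (\<mu> N) - Y (\<nu> N)) / (q (\<mu> N) - q (\<nu> N)))" for N
    define z where "z N i = - ((c (\<mu> N) i - c (\<nu> N) i) / (c (\<mu> N) j - c (\<nu> N) j))" for N i
    have ZK: "Z N \<in> K" for N using YK qK by (simp add: Z_def)
    have Zz: "Z N = (\<Sum>i<j. of_rat (z N i) * b i)" for N
      by (simp add: Z_def z_def Y_def q_def of_rat_minus of_rat_divide of_rat_diff sum_subtractf[symmetric]
          sum_divide_distrib sum_negf[symmetric] algebra_simps diff_divide_distrib)
    have Zb: "a (Z N - b j) \<le> a (X (\<mu> N) - X (\<nu> N)) / e" for N
    proof -
      let ?D = "q (\<mu> N) - q (\<nu> N)"
      have D0: "?D \<noteq> 0" using mn(3)[of N] e(1) by auto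
      have "Z N - b j = - ((X (\<mu> N) - X (\<nu> N)) / ?D)"
        using D0 unfolding Z_def XY by (simp add: field_simps)
      then have "a (Z N - b j) = a (X (\<mu> N) - X (\<nu> N)) / a ?D"
        using cauchy_in[OF Suc.prems(2)] qK by (simp add: abs_divide)
      also have "\<dots> \<le> a (X (\<mu> N) - X (\<nu> N)) / e"
        using mn(3)[of N] e(1) cauchy_in[OF Suc.prems(2)] by (intro divide_left_mono mult_pos_pos) auto
      finally show ?thesis .
    qed
    have small: "\<exists>N. a (Z N - b j) < \<epsilon>" if "\<epsilon> > 0" for \<epsilon>
    proof -
      have "\<epsilon> * e > 0" using that e(1) by simp
      then obtain N where "\<And>m n. m \<ge> N \<Longrightarrow> n \<ge> N \<Longrightarrow> a (X m - X n) < \<epsilon> * e"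
        using cauchyD[OF Suc.prems(2)] by blast
      then have "a (X (\<mu> N) - X (\<nu> N)) / e < \<epsilon>" using mn(1,2)[of N] e(1) by (simp add: divide_simps)
      then show ?thesis using Zb[of N] by (intro exI[of _ N]) linarith
    qed
    have "\<exists>N. a (q n) * a (Z N - b j) < 1 / real (Suc n)" for n
    proof -
      obtain N where N: "a (Z N - b j) < 1 / (real (Suc n) * (a (q n) + 1))"
        using small[of "1 / (real (Suc n) * (a (q n) + 1))"] nonneg[OF qK[of n]]
        by (auto simp: zero_less_mult_iff add_nonneg_pos)
      have "a (q n) * a (Z N - b j) \<le> (a (q n) + 1) * a (Z N - b j)"
        using ZK bj by (intro mult_right_mono) auto
      also have "\<dots> < (a (q n) + 1) * (1 / (real (Suc n) * (a (q n) + 1)))"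
        using N nonneg[OF qK[of n]] by (intro mult_strict_left_mono) (auto simp: add_nonneg_pos)
      also have "\<dots> = 1 / real (Suc n)"
      proof -
        have "a (q n) + 1 \<noteq> 0" using nonneg[OF qK[of n]] by linarith
        then show ?thesis by simp
      qed
      finally show ?thesis by blast
    qed
    then obtain \<phi> where \<phi>: "\<And>n. a (q n) * a (Z (\<phi> n) - b j) < 1 / real (Suc n)" by metis
    define X' where "X' n = Y n + q n * Z (\<phi> n)" for n
    have diff: "X' n - X n = q n * (Z (\<phi> n) - b j)" for n
      by (simp add: X'_def XY algebra_simps)
    have nl: "null (\<lambda>n. X' n - X n)"
      unfolding null_iff
    proof (intro conjI allI impI)
      fix \<epsilon> :: real assume "\<epsilon> > 0"
      then obtain N where N: "1 / real (Suc N) < \<epsilon>" using nat_approx_posE by auto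
      have "a (X' n - X n) < \<epsilon>" if "n \<ge> N" for n
      proof -
        have "1 / real (Suc n) \<le> 1 / real (Suc N)"
          using that by (simp add: divide_simps)
        then show ?thesis using \<phi>[of n] N qK ZK bj unfolding diff by (simp add: abs_mult)
      qed
      then show "\<exists>N. \<forall>n\<ge>N. a (X' n - X n) < \<epsilon>" by blast
    qed (use qK ZK bj in \<open>simp add: diff\<close>)
    have cX': "cauchy X'"
      using cauchy_add[OF Suc.prems(2) null_imp_cauchy[OF nl]] by simp
    have "cls X' \<in> C.Span Q Us"
      unfolding Us_def Q_def
    proof (rule Suc.IH)
      show "b i \<in> K" if "i < j" for i using Suc.prems(1) that by simp
      show "cauchy X'" by fact
      show "X' n = (\<Sum>i<j. of_rat (c n i + c n j * z (\<phi> n) i) * b i)" for n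
        by (simp add: X'_def Zz Y_def q_def of_rat_add of_rat_mult sum.distrib sum_distrib_left algebra_simps)
    qed
    moreover have "cls X = cls X'"
      using cls_eq_iff[OF cX' Suc.prems(2)] nl by simp
    ultimately have inS: "cls X \<in> C.Span Q Us" by simp
    have "\<zero>\<^bsub>C\<^esub> \<in> Q"
      unfolding Q_def using subringE(2)[OF subfieldE(1)[OF subfield_rat_closure]] .
    moreover have "cls X = \<zero>\<^bsub>C\<^esub> \<otimes>\<^bsub>C\<^esub> cls (\<lambda>_. b j) \<oplus>\<^bsub>C\<^esub> cls X"
      using Suc.prems(2) bj by simp
    ultimately show ?thesis
      unfolding Q_def[symmetric] Span_Suc C.line_extension_mem_iff using inS by blast
  qed
qed

theorem local_degree_pos:
  assumes "number_field K"
  shows "local_degree K a > 0"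
proof -
  obtain b :: "nat \<Rightarrow> complex" and n :: nat where b: "\<And>i. i < n \<Longrightarrow> b i \<in> K"
    and span: "\<And>x. x \<in> K \<Longrightarrow> \<exists>c. x = (\<Sum>i<n. of_rat (c i) * b i)"
    by (rule number_field_basis[OF assms]) (rule that)
  define Us where "Us = map (\<lambda>i. cls (\<lambda>_. b i)) (rev [0..<n])"
  have Us: "set Us \<subseteq> carrier C" using b by (auto simp: Us_def)
  have "carrier C \<subseteq> C.Span (rat_closure K a) Us"
  proof
    fix \<xi> assume "\<xi> \<in> carrier C"
    then obtain X where X: "cauchy X" "\<xi> = cls X" by (auto simp: carrier_C)
    have "\<forall>m. \<exists>c. X m = (\<Sum>i<n. of_rat (c i) * b i)" using span cauchy_in[OF X(1)] by blast
    then obtain c where "\<And>m. X m = (\<Sum>i<n. of_rat (c m i) * b i)" by metis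
    then show "\<xi> \<in> C.Span (rat_closure K a) Us"
      unfolding X(2) Us_def using cls_in_Span[where j = n and b = b and c = c, OF b X(1)] by blast
  qed
  then have "C.Span (rat_closure K a) Us = carrier C"
    using C.Span_in_carrier[OF subringE(1)[OF subfieldE(1)[OF subfield_rat_closure]] Us] by blast
  then have "C.finite_dimension (rat_closure K a) (carrier C)"
    using C.Span_finite_dimension[OF subfield_rat_closure Us] by simp
  then have dim: "C.dimension (local_degree K a) (rat_closure K a) (carrier C)"
    using C.finite_dimensionE[OF subfield_rat_closure] by (simp add: local_degree_def over_def)
  show ?thesis
  proof (rule ccontr)
    assume "\<not> local_degree K a > 0"
    then have "carrier C = {\<zero>\<^bsub>C\<^esub>}" using dim C.dimension_zero[OF subfield_rat_closure] by simp
    then show False using C.one_closed one_neq_zero_C by blast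
  qed
qed

end

section \<open>Valuation rings\<close>

lemma power_mult_inverse_power:
  fixes u :: "'a :: field"
  shows "u \<noteq> 0 \<Longrightarrow> 0 < n \<Longrightarrow> u ^ n * inverse u ^ (n - 1) = u"
  by (cases n) (simp_all add: power_inverse)

locale complex_subring =
  fixes V :: "complex set"
  assumes zero [simp]: "0 \<in> V" and one [simp]: "1 \<in> V"
    and add [simp]: "x \<in> V \<Longrightarrow> y \<in> V \<Longrightarrow> x + y \<in> V"
    and mult [simp]: "x \<in> V \<Longrightarrow> y \<in> V \<Longrightarrow> x * y \<in> V"
    and uminus [simp]: "x \<in> V \<Longrightarrow> - x \<in> V"
begin

lemma diff [simp]: "x \<in> V \<Longrightarrow> y \<in> V \<Longrightarrow> x - y \<in> V"
  using add[of x "- y"] by simp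

lemma power [simp]: "x \<in> V \<Longrightarrow> x ^ n \<in> V"
  by (induction n) auto

lemma sum [simp]: "(\<And>i. i \<in> I \<Longrightarrow> f i \<in> V) \<Longrightarrow> (\<Sum>i\<in>I. f i) \<in> V"
  by (induction I rule: infinite_finite_induct) auto

lemma of_nat [simp]: "of_nat n \<in> V"
  by (induction n) auto

lemma of_int [simp]: "of_int n \<in> V"
  by (cases n rule: int_cases2) auto

lemma Ints_subset: "x \<in> \<int> \<Longrightarrow> x \<in> V"
  by (auto elim: Ints_cases)

definition polys :: "complex poly set" where
  "polys = {p. \<forall>i. coeff p i \<in> V}"

lemma polys_add: "p \<in> polys \<Longrightarrow> q \<in> polys \<Longrightarrow> p + q \<in> polys"
  and polys_uminus: "p \<in> polys \<Longrightarrow> - p \<in> polys"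
  and polys_mult: "p \<in> polys \<Longrightarrow> q \<in> polys \<Longrightarrow> p * q \<in> polys"
  by (auto simp: polys_def coeff_mult)

lemma polys_const: "c \<in> V \<Longrightarrow> [:c:] \<in> polys"
  by (auto simp: polys_def coeff_pCons split: nat.splits)

lemma polys_one: "1 \<in> polys" and polys_zero: "0 \<in> polys"
  by (auto simp: polys_def)

lemma polys_X: "[:0, 1:] \<in> polys"
  by (auto simp: polys_def coeff_pCons split: nat.splits)

lemma polys_sum: "(\<And>i. i \<in> I \<Longrightarrow> f i \<in> polys) \<Longrightarrow> (\<Sum>i\<in>I. f i) \<in> polys"
  by (induction I rule: infinite_finite_induct) (auto simp: polys_add polys_zero)

lemma polys_prod: "(\<And>i. i \<in> I \<Longrightarrow> f i \<in> polys) \<Longrightarrow> (\<Prod>i\<in>I. f i) \<in> polys"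
  by (induction I rule: infinite_finite_induct) (auto simp: polys_mult polys_one)

lemma char_poly_in_polys:
  assumes A: "A \<in> carrier_mat n n" "\<And>i j. i < n \<Longrightarrow> j < n \<Longrightarrow> A $$ (i, j) \<in> V"
  shows "char_poly A \<in> polys"
proof -
  have entry: "char_poly_matrix A $$ (i, j) \<in> polys" if "i < n" "j < n" for i j
  proof -
    have "[:- A $$ (i, j):] \<in> polys" using A(2)[OF that] by (intro polys_const) simp
    moreover have "char_poly_matrix A $$ (i, j) = [:0, 1:] * (if i = j then 1 else 0) + [:- A $$ (i, j):]"
      using A(1) that by (simp add: char_poly_matrix_def)
    ultimately show ?thesis
      by (simp only:) (intro polys_add polys_mult polys_X, simp_all add: polys_one polys_zero)
  qed
  have sgn: "signof p \<in> polys" for p :: "nat \<Rightarrow> nat"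
    using polys_uminus[OF polys_one] polys_one by (auto simp: sign_def)
  have "char_poly A = (\<Sum>p\<in>{p. p permutes {0..<n}}. signof p * (\<Prod>i = 0..<n. char_poly_matrix A $$ (i, p i)))"
    unfolding char_poly_def by (rule det_def') (use A in simp)
  also have "\<dots> \<in> polys"
    by (intro polys_sum polys_mult polys_prod sgn entry) (auto simp: permutes_in_image)
  finally show ?thesis .
qed

definition adjoin :: "complex \<Rightarrow> complex set" where
  "adjoin z = (\<lambda>p. poly p z) ` polys"

lemma adjoin: "complex_subring (adjoin z)" "V \<subseteq> adjoin z" "z \<in> adjoin z"
proof -
  show "complex_subring (adjoin z)"
  proof
    show "0 \<in> adjoin z" unfolding adjoin_def by (rule image_eqI[OF _ polys_zero]) simp
    show "1 \<in> adjoin z" unfolding adjoin_def by (rule image_eqI[OF _ polys_one]) simp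
    show "x + y \<in> adjoin z" if "x \<in> adjoin z" "y \<in> adjoin z" for x y
      using that polys_add unfolding adjoin_def by (force simp flip: poly_add)
    show "x * y \<in> adjoin z" if "x \<in> adjoin z" "y \<in> adjoin z" for x y
      using that polys_mult unfolding adjoin_def by (force simp flip: poly_mult)
    show "- x \<in> adjoin z" if "x \<in> adjoin z" for x
      using that polys_uminus unfolding adjoin_def by (force simp flip: poly_minus)
  qed
  show "V \<subseteq> adjoin z"
    unfolding adjoin_def using polys_const by (force intro: image_eqI[of _ _ "[:_:]"])
  show "z \<in> adjoin z" unfolding adjoin_def by (rule image_eqI[OF _ polys_X]) simp
qed

end

locale complex_valuation_ring = complex_subring +
  assumes valuation: "x \<in> V \<or> inverse x \<in> V"
begin

lemma integrally_closed:
  assumes p: "p \<in> polys" "lead_coeff p = 1" "poly p u = 0"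
  shows "u \<in> V"
proof (rule ccontr)
  assume u: "u \<notin> V"
  then have iu: "inverse u \<in> V" "u \<noteq> 0" using valuation[of u] zero by auto
  define n where "n = degree p"
  have n: "n > 0"
  proof (rule ccontr)
    assume "\<not> n > 0"
    then have "p = 1" using p(2) by (metis degree_eq_zeroE gr0I lead_coeff_pCons(2) n_def one_pCons)
    then show False using p(3) by simp
  qed
  have "poly p u = (\<Sum>i<n. coeff p i * u ^ i) + u ^ n"
    using p(2) by (simp add: poly_altdef n_def lessThan_Suc_atMost[symmetric])
  then have "u ^ n = - (\<Sum>i<n. coeff p i * u ^ i)"
    using p(3) by (simp add: eq_neg_iff_add_eq_0 add.commute)
  moreover have "u ^ n = u * u ^ (n - 1)" using n by (simp add: power_eq_if)
  ultimately have "u = - (\<Sum>i<n. coeff p i * u ^ i) / u ^ (n - 1)"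
    using iu by (simp add: field_simps)
  also have "\<dots> = - (\<Sum>i<n. coeff p i * inverse u ^ (n - 1 - i))"
  proof -
    have "u ^ i / u ^ (n - 1) = inverse u ^ (n - 1 - i)" if "i < n" for i
      using that iu(2) by (simp add: power_inverse power_diff field_simps)
    then show ?thesis
      by (simp add: sum_divide_distrib flip: times_divide_eq_right)
  qed
  also have "\<dots> \<in> V" using p(1) iu(1) by (intro uminus sum mult power) (auto simp: polys_def)
  finally show False using u by simp
qed

lemma algebraic_int_in: "algebraic_int x \<Longrightarrow> x \<in> V"
  by (erule algebraic_int.cases) (auto intro!: integrally_closed simp: polys_def Ints_subset)

lemma eigenvalue_in:
  assumes A: "A \<in> carrier_mat n n" "\<And>i j. i < n \<Longrightarrow> j < n \<Longrightarrow> A $$ (i, j) \<in> V" and e: "eigenvalue A e"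
  shows "e \<in> V"
proof (rule integrally_closed)
  show "char_poly A \<in> polys" using A by (rule char_poly_in_polys)
  show "lead_coeff (char_poly A) = 1" using degree_monic_char_poly[OF A(1)] by simp
  show "poly (char_poly A) e = 0" using eigenvalue_root_char_poly[OF A(1)] e by simp
qed

definition val_unit :: "complex \<Rightarrow> bool" where
  "val_unit x \<longleftrightarrow> x \<in> V \<and> inverse x \<in> V \<and> x \<noteq> 0"

lemma val_unit_mult: "val_unit x \<Longrightarrow> val_unit y \<Longrightarrow> val_unit (x * y)"
  by (auto simp: val_unit_def)

lemma val_unit_inverse: "val_unit x \<Longrightarrow> val_unit (inverse x)"
  by (auto simp: val_unit_def)

lemma val_unit_divide: "val_unit x \<Longrightarrow> val_unit y \<Longrightarrow> val_unit (x / y)"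
  by (simp add: divide_inverse val_unit_mult val_unit_inverse)

lemma val_unit_power: "val_unit x \<Longrightarrow> val_unit (x ^ n)"
  by (auto simp: val_unit_def power_inverse[symmetric])

lemma val_unit_1 [simp]: "val_unit 1" by (simp add: val_unit_def)

lemma nonunit_add:
  assumes "x \<in> V" "y \<in> V" "\<not> val_unit x" "\<not> val_unit y"
  shows "\<not> val_unit (x + y)"
proof
  assume u: "val_unit (x + y)"
  consider "x = 0" | "y = 0" | "x \<noteq> 0" "y \<noteq> 0" by blast
  then show False
  proof cases
    case 3
    then have nz: "x + y \<noteq> 0" using u by (auto simp: val_unit_def)
    have "y / x \<in> V \<or> x / y \<in> V" using valuation[of "y / x"] by simp
    then show False
    proof
      assume "y / x \<in> V"
      then have "(1 + y / x) * inverse (x + y) \<in> V" using u by (simp add: val_unit_def)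
      moreover have "(1 + y / x) * inverse (x + y) = inverse x" using 3 nz by (simp add: field_simps)
      ultimately show False using assms 3 by (simp add: val_unit_def)
    next
      assume "x / y \<in> V"
      then have "(1 + x / y) * inverse (x + y) \<in> V" using u by (simp add: val_unit_def)
      moreover have "(1 + x / y) * inverse (x + y) = inverse y" using 3 nz by (simp add: field_simps)
      ultimately show False using assms 3 by (simp add: val_unit_def)
    qed
  qed (use u assms in auto)
qed

lemma nonunit_sum:
  assumes "finite I" "\<And>i. i \<in> I \<Longrightarrow> f i \<in> V" "\<And>i. i \<in> I \<Longrightarrow> \<not> val_unit (f i)"
  shows "\<not> val_unit (\<Sum>i\<in>I. f i)"
  using assms by (induction I rule: finite_induct) (auto simp: nonunit_add val_unit_def[of 0])

text \<open>In a vanishing sum, two of the terms of largest absolute value differ by a unit.\<close>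

lemma vanishing_sum_units:
  assumes I: "finite I" "I \<noteq> {}" and nz: "\<And>i. i \<in> I \<Longrightarrow> t i \<noteq> 0" and sum0: "(\<Sum>i\<in>I. t i) = 0"
  shows "\<exists>i\<in>I. \<exists>j\<in>I. i \<noteq> j \<and> val_unit (t i / t j)"
proof -
  have "\<exists>k\<in>I. \<forall>i\<in>I. t i / t k \<in> V"
    using I nz
  proof (induction I rule: finite_ne_induct)
    case (insert x F)
    then obtain k where k: "k \<in> F" "\<forall>i\<in>F. t i / t k \<in> V" by auto
    show ?case
    proof (cases "t x / t k \<in> V")
      case False
      then have kx: "t k / t x \<in> V" using valuation[of "t x / t k"] by simp
      have "t i / t x \<in> V" if "i \<in> F" for i
      proof -
        have "t k \<noteq> 0" using insert.prems k(1) by blast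
        then have "t i / t x = (t i / t k) * (t k / t x)" by simp
        moreover have "(t i / t k) * (t k / t x) \<in> V" using k that kx by (intro mult) auto
        ultimately show ?thesis by (simp only:)
      qed
      then show ?thesis using insert.prems[of x] by (intro bexI[of _ x]) auto
    qed (use k in auto)
  qed simp
  then obtain k where k: "k \<in> I" "\<And>i. i \<in> I \<Longrightarrow> t i / t k \<in> V" by blast
  have "\<exists>i\<in>I - {k}. val_unit (t i / t k)"
  proof (rule ccontr)
    assume "\<not> ?thesis"
    then have "\<not> val_unit (\<Sum>i\<in>I - {k}. t i / t k)"
      using k I by (intro nonunit_sum) auto
    moreover have "(\<Sum>i\<in>I - {k}. t i / t k) = - 1"
    proof -
      have "(\<Sum>i\<in>I. t i) = t k + (\<Sum>i\<in>I - {k}. t i)" using I k(1) by (simp add: sum.remove)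
      then have "(\<Sum>i\<in>I - {k}. t i) = - t k" using sum0 by (simp add: eq_neg_iff_add_eq_0 add.commute)
      then show ?thesis using nz[OF k(1)] by (simp add: sum_divide_distrib[symmetric])
    qed
    ultimately show False by (simp add: val_unit_def)
  qed
  then show ?thesis using k(1) by auto
qed

lemma root_commensurable:
  assumes L: "complex_subfield L" and p: "\<And>i. coeff p i \<in> L" "p \<noteq> 0" "poly p u = 0" and u: "u \<noteq> 0"
  shows "\<exists>n>0. \<exists>c\<in>L. c \<noteq> 0 \<and> val_unit (u ^ n / c)"
proof -
  interpret L: complex_subfield L by (rule L)
  define I where "I = {i. i \<le> degree p \<and> coeff p i \<noteq> 0}"
  have "degree p \<in> I" using p(2) by (simp add: I_def)
  moreover have "(\<Sum>i\<in>I. coeff p i * u ^ i) = poly p u"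
    unfolding poly_altdef I_def by (rule sum.mono_neutral_left) auto
  ultimately have "\<exists>i\<in>I. \<exists>j\<in>I. i \<noteq> j \<and> val_unit ((coeff p i * u ^ i) / (coeff p j * u ^ j))"
    using p(3) u by (intro vanishing_sum_units) (auto simp: I_def)
  then obtain i j where ij: "i \<in> I" "j \<in> I" "i \<noteq> j" "val_unit ((coeff p i * u ^ i) / (coeff p j * u ^ j))"
    by blast
  have main: "\<exists>n>0. \<exists>c\<in>L. c \<noteq> 0 \<and> val_unit (u ^ n / c)"
    if "i \<in> I" "j \<in> I" "j < i" "val_unit ((coeff p i * u ^ i) / (coeff p j * u ^ j))" for i j
  proof (intro exI[of _ "i - j"] conjI bexI[of _ "coeff p j / coeff p i"])
    have "u ^ i = u ^ (i - j) * u ^ j" using that(3) by (simp flip: power_add)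
    then show "val_unit (u ^ (i - j) / (coeff p j / coeff p i))"
      using that(4) u by (simp add: field_simps)
  qed (use that p(1) in \<open>auto simp: I_def\<close>)
  have "val_unit ((coeff p j * u ^ j) / (coeff p i * u ^ i))"
    using val_unit_inverse[OF ij(4)] by simp
  then show ?thesis
    using main[OF ij(1,2)] main[OF ij(2,1)] ij(3,4) by (metis linorder_neqE_nat)
qed

end

text \<open>
  A subring that is maximal among those containing \<open>1 / x\<close> but not \<open>x\<close> is a valuation ring: if neither
  \<open>z\<close> nor \<open>1 / z\<close> belonged to it, \<open>x\<close> would be a polynomial in \<open>z\<close> and in \<open>1 / z\<close>, and each of these
  relations could be used to lower the degree of the other one.
\<close>

locale maximal_subring = complex_subring +
  fixes x :: complex
  assumes x: "x \<notin> V" "inverse x \<in> V"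
    and maximal: "\<And>W. complex_subring W \<Longrightarrow> V \<subseteq> W \<Longrightarrow> x \<notin> W \<Longrightarrow> W = V"
begin

lemma x_nonzero: "x \<noteq> 0" using x by auto

lemma inverse_diff:
  assumes b: "b \<in> V"
  shows "inverse (x - b) \<in> V"
proof -
  define w where "w = 1 - inverse x * b"
  have w: "w \<in> V" using b x by (simp add: w_def)
  have xw: "x * w = x - b" using x_nonzero by (simp add: w_def field_simps)
  have "w \<noteq> 0" using xw x b by auto
  define W where "W = {v / w ^ k | v k. v \<in> V}"
  have wk: "\<exists>c\<in>V. w ^ k = 1 - inverse x * c" for k
  proof (induction k)
    case 0
    show ?case by (intro bexI[of _ 0]) auto
  next
    case (Suc k)
    then obtain c where c: "c \<in> V" "w ^ k = 1 - inverse x * c" by auto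
    have "w ^ Suc k = 1 - inverse x * (c * w + b)"
      by (simp add: c(2)) (simp add: w_def algebra_simps)
    then show ?case using c w b by (intro bexI[of _ "c * w + b"]) auto
  qed
  have "complex_subring W"
  proof
    show "0 \<in> W" "1 \<in> W" unfolding W_def
      by (rule CollectI, rule exI[of _ 0], rule exI[of _ 0], simp,
          rule CollectI, rule exI[of _ 1], rule exI[of _ 0], simp)
    fix y assume "y \<in> W"
    then obtain v k where y: "y = v / w ^ k" "v \<in> V" by (auto simp: W_def)
    show "- y \<in> W" unfolding W_def y using y(2) by (intro CollectI exI[of _ "- v"] exI[of _ k]) auto
    fix y' assume "y' \<in> W"
    then obtain v' k' where y': "y' = v' / w ^ k'" "v' \<in> V" by (auto simp: W_def)
    show "y * y' \<in> W"
      unfolding W_def y y' using y(2) y'(2)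
      by (intro CollectI exI[of _ "v * v'"] exI[of _ "k + k'"]) (auto simp: power_add)
    show "y + y' \<in> W"
      unfolding W_def y y' using y(2) y'(2) w \<open>w \<noteq> 0\<close>
      by (intro CollectI exI[of _ "v * w ^ k' + v' * w ^ k"] exI[of _ "k + k'"]) (simp add: power_add add_frac_eq)
  qed
  moreover have "V \<subseteq> W"
  proof
    fix v assume "v \<in> V"
    then show "v \<in> W" unfolding W_def by (intro CollectI exI[of _ v] exI[of _ 0]) simp
  qed
  moreover have "x \<notin> W"
  proof
    assume "x \<in> W"
    then obtain v k where v: "x = v / w ^ k" "v \<in> V" by (auto simp: W_def)
    obtain c where c: "c \<in> V" "w ^ k = 1 - inverse x * c" using wk by blast
    have "x * w ^ k = v" using v(1) \<open>w \<noteq> 0\<close> by simp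
    moreover have "x * w ^ k = x - c" using c(2) x_nonzero by (simp add: right_diff_distrib)
    ultimately have "x = v + c" by (simp add: diff_eq_eq)
    moreover have "v + c \<in> V" using v(2) c(1) by simp
    ultimately show False using x(1) by metis
  qed
  ultimately have "W = V" by (rule maximal)
  moreover have "inverse w \<in> W"
    unfolding W_def by (intro CollectI exI[of _ 1] exI[of _ 1]) (simp add: divide_inverse)
  ultimately have "inverse x * inverse w \<in> V" using x by simp
  then show ?thesis using xw by (metis inverse_mult_distrib)
qed

definition rel :: "complex \<Rightarrow> nat \<Rightarrow> bool" where
  "rel z m \<longleftrightarrow> (\<exists>c. (\<forall>i. c i \<in> V) \<and> x = (\<Sum>i\<le>m. c i * z ^ i))"

lemma rel_mono: "rel z m \<Longrightarrow> m \<le> n \<Longrightarrow> rel z n"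
proof -
  assume "rel z m" "m \<le> n"
  then obtain c where c: "\<forall>i. c i \<in> V" "x = (\<Sum>i\<le>m. c i * z ^ i)" by (auto simp: rel_def)
  have "(\<Sum>i\<le>m. c i * z ^ i) = (\<Sum>i\<le>n. (if i \<le> m then c i else 0) * z ^ i)"
    using \<open>m \<le> n\<close> by (intro sum.mono_neutral_cong_left) auto
  then show ?thesis using c unfolding rel_def by (intro exI[of _ "\<lambda>i. if i \<le> m then c i else 0"]) auto
qed

lemma rel_exists: "z \<notin> V \<Longrightarrow> \<exists>m. rel z m"
proof -
  assume "z \<notin> V"
  then have "x \<in> adjoin z" using adjoin[of z] maximal by blast
  then obtain p where "p \<in> polys" "x = poly p z" by (auto simp: adjoin_def)
  then show ?thesis
    unfolding rel_def polys_def by (intro exI[of _ "degree p"] exI[of _ "coeff p"]) (auto simp: poly_altdef)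
qed

lemma rel_descent:
  assumes z: "z \<noteq> 0" and r: "rel z m" "rel (inverse z) m" "m > 0"
  shows "rel z (m - 1)"
proof -
  obtain c where c: "\<And>i. c i \<in> V" "x = (\<Sum>i\<le>m. c i * z ^ i)" using r(1) by (auto simp: rel_def)
  obtain e where e: "\<And>i. e i \<in> V" "x = (\<Sum>i\<le>m. e i * inverse z ^ i)" using r(2) by (auto simp: rel_def)
  define e' where "e' i = e i * inverse (x - e 0)" for i
  have e': "e' i \<in> V" for i using e(1) inverse_diff by (simp add: e'_def)
  have "x - e 0 \<noteq> 0" using e(1)[of 0] x by auto
  have "x - e 0 = (\<Sum>i = 1..m. e i * inverse z ^ i)"
    by (subst e(2)) (simp add: atMost_atLeast0 sum.atLeast_Suc_atMost)
  then have "1 = (\<Sum>i = 1..m. e i * inverse z ^ i) * inverse (x - e 0)"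
    using \<open>x - e 0 \<noteq> 0\<close> by (metis right_inverse)
  also have "\<dots> = (\<Sum>i = 1..m. e' i * inverse z ^ i)"
    unfolding sum_distrib_right e'_def by (simp add: mult_ac)
  finally have one: "1 = (\<Sum>i = 1..m. e' i * inverse z ^ i)" .
  have "z ^ m = z ^ m * (\<Sum>i = 1..m. e' i * inverse z ^ i)" using one by simp
  also have "\<dots> = (\<Sum>i = 1..m. e' i * z ^ (m - i))"
    unfolding sum_distrib_left using z
    by (intro sum.cong) (auto simp: power_diff power_inverse field_simps)
  also have "\<dots> = (\<Sum>i<m. e' (m - i) * z ^ i)"
    by (rule sum.reindex_bij_witness[of _ "\<lambda>i. m - i" "\<lambda>i. m - i"]) auto
  finally have zm: "z ^ m = (\<Sum>i<m. e' (m - i) * z ^ i)" .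
  have "x = (\<Sum>i<m. c i * z ^ i) + c m * z ^ m"
    using c(2) by (simp add: lessThan_Suc_atMost[symmetric])
  also have "\<dots> = (\<Sum>i<m. (c i + c m * e' (m - i)) * z ^ i)"
    unfolding zm by (simp add: sum_distrib_left sum.distrib algebra_simps)
  also have "{..<m} = {..m - 1}" using r(3) by auto
  finally show ?thesis
    unfolding rel_def using c(1) e' by (intro exI[of _ "\<lambda>i. c i + c m * e' (m - i)"]) auto
qed

lemma not_rel_0: "\<not> rel z 0"
  using x by (auto simp: rel_def)

sublocale complex_valuation_ring
proof
  fix z
  show "z \<in> V \<or> inverse z \<in> V"
  proof (rule ccontr)
    assume "\<not> ?thesis"
    then have z: "z \<notin> V" "inverse z \<notin> V" by auto
    then have "z \<noteq> 0" by auto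
    define m where "m = (LEAST m. rel z m)"
    define n where "n = (LEAST m. rel (inverse z) m)"
    have m: "rel z m" "\<And>k. rel z k \<Longrightarrow> m \<le> k"
      unfolding m_def using rel_exists[OF z(1)] by (auto intro: LeastI_ex Least_le)
    have n: "rel (inverse z) n" "\<And>k. rel (inverse z) k \<Longrightarrow> n \<le> k"
      unfolding n_def using rel_exists[OF z(2)] by (auto intro: LeastI_ex Least_le)
    have "m > 0" "n > 0" using m(1) n(1) not_rel_0 by (auto intro: Nat.gr0I)
    show False
    proof (cases "n \<le> m")
      case True
      then have "rel z (m - 1)"
        using rel_descent[OF \<open>z \<noteq> 0\<close> m(1) rel_mono[OF n(1)]] \<open>m > 0\<close> by simp
      then show False using m(2) \<open>m > 0\<close> by fastforce
    next
      case False
      then have "rel z n" using rel_mono[OF m(1)] by simp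
      then have "rel (inverse z) (n - 1)"
        using rel_descent[of "inverse z" n] n(1) \<open>n > 0\<close> \<open>z \<noteq> 0\<close> by simp
      then show False using n(2) \<open>n > 0\<close> by fastforce
    qed
  qed
qed

end

lemma exists_maximal_subring:
  assumes "\<not> algebraic_int x"
  shows "\<exists>V. maximal_subring V x"
proof -
  have x0: "x \<noteq> 0" using assms by auto
  interpret Z: complex_subring "\<int>" by unfold_locales auto
  define V0 where "V0 = Z.adjoin (inverse x)"
  have V0: "complex_subring V0" "inverse x \<in> V0" using Z.adjoin by (auto simp: V0_def)
  have xV0: "x \<notin> V0"
  proof
    assume "x \<in> V0"
    then obtain p where p: "\<And>i. coeff p i \<in> \<int>" "x = poly p (inverse x)"
      by (auto simp: V0_def Z.adjoin_def Z.polys_def)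
    define n where "n = degree p"
    define q where "q = monom 1 (Suc n) - (\<Sum>i\<le>n. monom (coeff p i) (n - i))"
    have "x ^ Suc n = (\<Sum>i\<le>n. coeff p i * x ^ (n - i))"
    proof -
      have "x ^ Suc n = poly p (inverse x) * x ^ n" using p(2) by simp
      also have "\<dots> = (\<Sum>i\<le>n. coeff p i * (inverse x ^ i * x ^ n))"
        by (simp add: poly_altdef n_def sum_distrib_right mult.assoc)
      also have "\<dots> = (\<Sum>i\<le>n. coeff p i * x ^ (n - i))"
        using x0 by (intro sum.cong) (auto simp: power_diff power_inverse field_simps)
      finally show ?thesis .
    qed
    then have "poly q x = 0" by (simp add: q_def poly_sum poly_monom)
    moreover have ci: "coeff q i \<in> \<int>" for i
      using p(1) by (auto simp: q_def coeff_sum intro!: Ints_diff Ints_sum)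
    moreover have "coeff q (Suc n) = 1"
      by (simp add: q_def coeff_sum)
    moreover have "degree q \<le> Suc n"
      by (rule degree_le) (auto simp: q_def coeff_sum)
    then have "degree q = Suc n" using \<open>coeff q (Suc n) = 1\<close> by (metis le_antisym le_degree zero_neq_one)
    ultimately have "algebraic_int x" by (intro algebraic_int.intros[of q]) auto
    then show False using assms by simp
  qed
  define \<A> where "\<A> = {V. complex_subring V \<and> inverse x \<in> V \<and> x \<notin> V}"
  have "\<exists>M\<in>\<A>. \<forall>X\<in>\<A>. M \<subseteq> X \<longrightarrow> X = M"
  proof (rule subset_Zorn_nonempty)
    show "\<A> \<noteq> {}" using V0 xV0 by (auto simp: \<A>_def)
    fix \<C> assume ne: "\<C> \<noteq> {}" and ch: "subset.chain \<A> \<C>"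
    have sub: "complex_subring V" "inverse x \<in> V" "x \<notin> V" if "V \<in> \<C>" for V
      using ch that by (auto simp: subset.chain_def \<A>_def)
    have two: "\<exists>W\<in>\<C>. y \<in> W \<and> z \<in> W" if "y \<in> \<Union>\<C>" "z \<in> \<Union>\<C>" for y z
      using that ch unfolding subset_chain_def by (meson Union_iff subsetD)
    have "complex_subring (\<Union>\<C>)"
    proof
      show "0 \<in> \<Union>\<C>" "1 \<in> \<Union>\<C>"
        using ne sub(1) complex_subring.zero complex_subring.one by blast+
      show "y + z \<in> \<Union>\<C>" if "y \<in> \<Union>\<C>" "z \<in> \<Union>\<C>" for y z
        using two[OF that] sub(1) complex_subring.add by (meson Union_iff)
      show "y * z \<in> \<Union>\<C>" if "y \<in> \<Union>\<C>" "z \<in> \<Union>\<C>" for y z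
        using two[OF that] sub(1) complex_subring.mult by (meson Union_iff)
      show "- y \<in> \<Union>\<C>" if "y \<in> \<Union>\<C>" for y
        using that sub(1) complex_subring.uminus by (meson Union_iff)
    qed
    then show "\<Union>\<C> \<in> \<A>" using ne sub by (auto simp: \<A>_def)
  qed
  then obtain V where V: "V \<in> \<A>" "\<And>X. X \<in> \<A> \<Longrightarrow> V \<subseteq> X \<Longrightarrow> X = V" by blast
  then have "maximal_subring V x"
    unfolding maximal_subring_def maximal_subring_axioms_def \<A>_def by blast
  then show ?thesis by blast
qed

lemma algebraic_int_iff_valuation:
  "algebraic_int x \<longleftrightarrow> (\<forall>V. complex_valuation_ring V \<longrightarrow> x \<in> V)"
proof
  assume all: "\<forall>V. complex_valuation_ring V \<longrightarrow> x \<in> V"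
  show "algebraic_int x"
  proof (rule ccontr)
    assume "\<not> algebraic_int x"
    then obtain V where "maximal_subring V x" using exists_maximal_subring by blast
    then interpret maximal_subring V x .
    show False using all complex_valuation_ring_axioms x(1) by blast
  qed
qed (use complex_valuation_ring.algebraic_int_in in blast)

lemma complex_subring_algebraic_int: "complex_subring {x. algebraic_int x}"
proof -
  have "complex_subring V" if "complex_valuation_ring V" for V
    using that by (simp add: complex_valuation_ring_def)
  then show ?thesis
    unfolding algebraic_int_iff_valuation complex_subring_def by auto
qed

locale valuation_on_field = complex_valuation_ring + L: complex_subfield L for L :: "complex set" +
  fixes \<pi> :: complex
  assumes pi: "\<pi> \<in> V" "\<pi> \<noteq> 0" "inverse \<pi> \<notin> V"
    and commensurable: "\<And>u. u \<in> L \<Longrightarrow> u \<noteq> 0 \<Longrightarrow> \<exists>n>0. \<exists>e::int. val_unit (u ^ n * \<pi> powi e)"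
begin

lemma pi_power_int_in_iff: "\<pi> powi e \<in> V \<longleftrightarrow> e \<ge> 0"
proof
  assume e: "\<pi> powi e \<in> V"
  show "e \<ge> 0"
  proof (rule ccontr)
    assume "\<not> e \<ge> 0"
    then obtain k where k: "e = - int (Suc k)" by (metis int_cases not_le of_nat_0_le_iff)
    have "\<pi> powi e * \<pi> ^ k \<in> V" using e pi by simp
    moreover have "\<pi> powi e * \<pi> ^ k = inverse \<pi>"
      using pi(2) by (simp add: k power_int_minus field_simps del: of_nat_Suc)
    ultimately show False using pi by simp
  qed
qed (use pi in \<open>auto simp: power_int_def\<close>)

lemma val_unit_pi_iff: "val_unit (\<pi> powi e) \<longleftrightarrow> e = 0"
  using pi_power_int_in_iff[of e] pi_power_int_in_iff[of "- e"] pi(2)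
  by (auto simp: val_unit_def power_int_minus)

lemma power_in_iff: "n > 0 \<Longrightarrow> u ^ n \<in> V \<longleftrightarrow> u \<in> V"
proof
  assume n: "n > 0" and un: "u ^ n \<in> V"
  show "u \<in> V"
  proof (rule ccontr)
    assume u: "u \<notin> V"
    then have iu: "inverse u \<in> V" "u \<noteq> 0" using valuation[of u] zero by auto
    have "u ^ n * inverse u ^ (n - 1) \<in> V" using un iu by simp
    moreover have "u ^ n * inverse u ^ (n - 1) = u"
      using iu(2) n by (rule power_mult_inverse_power)
    ultimately show False using u by simp
  qed
qed simp

definition val :: "complex \<Rightarrow> real" where
  "val u = (if u = 0 then 0 else
     (THE r. \<exists>n>0. \<exists>e::int. val_unit (u ^ n * \<pi> powi e) \<and> r = 2 powr (of_int e / of_nat n)))"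

lemma val_eqI:
  assumes u: "u \<noteq> 0" and n: "n > 0" and unit: "val_unit (u ^ n * \<pi> powi e)"
  shows "val u = 2 powr (of_int e / of_nat n)"
proof -
  have "(THE r :: real. \<exists>n>0. \<exists>e::int. val_unit (u ^ n * \<pi> powi e) \<and> r = 2 powr (of_int e / of_nat n)) =
      2 powr (of_int e / of_nat n)"
  proof (rule the_equality)
    fix r :: real assume "\<exists>n>0. \<exists>e::int. val_unit (u ^ n * \<pi> powi e) \<and> r = 2 powr (of_int e / of_nat n)"
    then obtain m f where m: "m > 0" "val_unit (u ^ m * \<pi> powi f)" "r = 2 powr (of_int f / of_nat m)" by blast
    have "val_unit ((u ^ n * \<pi> powi e) ^ m / (u ^ m * \<pi> powi f) ^ n)"
      by (rule val_unit_divide[OF val_unit_power[OF unit] val_unit_power[OF m(2)]])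
    moreover have "(u ^ n * \<pi> powi e) ^ m / (u ^ m * \<pi> powi f) ^ n = \<pi> powi (e * int m - f * int n)"
      using u pi(2) by (simp add: power_mult_distrib power_int_diff power_int_mult flip: power_mult power_int_power)
        (simp add: mult.commute)
    ultimately have "e * int m = f * int n" using val_unit_pi_iff by simp
    then have "real_of_int e * real m = real_of_int f * real n"
      by (metis of_int_mult of_int_of_nat_eq)
    then have "of_int f / real m = of_int e / real n"
      using m(1) n by (simp add: field_simps)
    then show "r = 2 powr (of_int e / of_nat n)"
      using m(3) by simp
  qed (use n unit in blast)
  then show ?thesis using u by (simp add: val_def)
qed

lemma val_ex:
  assumes "u \<in> L" "u \<noteq> 0"
  obtains n e where "n > 0" "val_unit (u ^ n * \<pi> powi e)" "val u = 2 powr (of_int e / of_nat n)"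
proof -
  obtain n e where ne: "n > 0" "val_unit (u ^ n * \<pi> powi e)"
    using commensurable[OF assms] by blast
  then show thesis using that[OF ne val_eqI[OF assms(2) ne]] by blast
qed

lemma val_pos: "u \<in> L \<Longrightarrow> u \<noteq> 0 \<Longrightarrow> val u > 0"
  by (erule (1) val_ex) simp

lemma val_mult:
  assumes "u \<in> L" "w \<in> L" shows "val (u * w) = val u * val w"
proof (cases "u = 0 \<or> w = 0")
  case False
  obtain n e where u: "n > 0" "val_unit (u ^ n * \<pi> powi e)" "val u = 2 powr (of_int e / of_nat n)"
    using val_ex[of u] False assms by auto
  obtain m f where w: "m > 0" "val_unit (w ^ m * \<pi> powi f)" "val w = 2 powr (of_int f / of_nat m)"
    using val_ex[of w] False assms by auto
  have "val_unit ((u ^ n * \<pi> powi e) ^ m * (w ^ m * \<pi> powi f) ^ n)"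
    by (rule val_unit_mult[OF val_unit_power[OF u(2)] val_unit_power[OF w(2)]])
  also have "(u ^ n * \<pi> powi e) ^ m * (w ^ m * \<pi> powi f) ^ n = (u * w) ^ (n * m) * \<pi> powi (e * int m + f * int n)"
    using pi(2) by (simp add: power_mult_distrib power_int_add power_int_mult flip: power_mult power_int_power)
      (simp add: mult_ac)
  finally have "val (u * w) = 2 powr (of_int (e * int m + f * int n) / of_nat (n * m))"
    using False u(1) w(1) by (intro val_eqI) auto
  also have "of_int (e * int m + f * int n) / of_nat (n * m) = (of_int e / of_nat n + of_int f / of_nat m :: real)"
    using u(1) w(1) by (simp add: field_simps)
  finally show ?thesis using u w by (simp add: powr_add)
qed (auto simp: val_def)

lemma val_le_1_iff: "u \<in> L \<Longrightarrow> val u \<le> 1 \<longleftrightarrow> u \<in> V"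
proof (cases "u = 0")
  case False
  assume "u \<in> L"
  then obtain n e where u: "n > 0" "val_unit (u ^ n * \<pi> powi e)" "val u = 2 powr (of_int e / of_nat n)"
    using val_ex[of u] False by auto
  have "val u \<le> 1 \<longleftrightarrow> of_int e / real n \<le> 0"
    unfolding u(3) using powr_le_cancel_iff[of 2 "of_int e / real n" 0] by simp
  also have "\<dots> \<longleftrightarrow> - e \<ge> 0" using u(1) by (simp add: field_simps)
  also have "\<dots> \<longleftrightarrow> \<pi> powi (- e) \<in> V" by (simp add: pi_power_int_in_iff)
  also have "\<dots> \<longleftrightarrow> u ^ n \<in> V"
  proof
    assume "\<pi> powi (- e) \<in> V"
    then have "(u ^ n * \<pi> powi e) * \<pi> powi (- e) \<in> V" using u(2) by (simp add: val_unit_def)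
    moreover have "(u ^ n * \<pi> powi e) * \<pi> powi (- e) = u ^ n"
      using pi(2) by (simp add: power_int_minus)
    ultimately show "u ^ n \<in> V" by (simp only:)
  next
    assume "u ^ n \<in> V"
    then have "u ^ n * inverse (u ^ n * \<pi> powi e) \<in> V" using u(2) by (simp add: val_unit_def)
    moreover have "u ^ n * inverse (u ^ n * \<pi> powi e) = \<pi> powi (- e)"
      using False by (simp add: power_int_minus)
    ultimately show "\<pi> powi (- e) \<in> V" by (simp only:)
  qed
  also have "\<dots> \<longleftrightarrow> u \<in> V" using u(1) by (rule power_in_iff)
  finally show ?thesis .
qed (simp add: val_def)

lemma val_add:
  assumes "u \<in> L" "w \<in> L" shows "val (u + w) \<le> max (val u) (val w)"
proof -
  have main: "val (u + w) \<le> val w" if "u \<in> L" "w \<in> L" "w \<noteq> 0" "u / w \<in> V" for u w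
  proof -
    have "(u / w + 1) * w = u + w" using that(3) by (simp add: distrib_right)
    then have "val (u + w) = val ((u / w + 1) * w)" by simp
    also have "\<dots> = val (u / w + 1) * val w" using that by (intro val_mult) auto
    also have "\<dots> \<le> 1 * val w"
      using that val_le_1_iff[of "u / w + 1"] val_pos[of w] by (intro mult_right_mono) auto
    finally show ?thesis by simp
  qed
  consider "u = 0" | "w = 0" | "u \<noteq> 0" "w \<noteq> 0" "u / w \<in> V" | "u \<noteq> 0" "w \<noteq> 0" "w / u \<in> V"
    using valuation[of "u / w"] by force
  then show ?thesis
  proof cases
    case 3
    then show ?thesis using main[of u w] assms by (simp add: le_max_iff_disj)
  next
    case 4
    then show ?thesis using main[of w u] assms by (simp add: le_max_iff_disj add.commute)
  qed auto
qed

lemma val_nonneg: "u \<in> L \<Longrightarrow> val u \<ge> 0"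
  using val_pos[of u] by (cases "u = 0") (auto simp: val_def)

lemma val_absolute_value: "absolute_value L (restrict val L)"
  unfolding absolute_value_def
proof (intro conjI ballI)
  show "restrict val L x = 0 \<longleftrightarrow> x = 0" if "x \<in> L" for x
    using that val_pos[of x] by (auto simp: val_def)
  show "restrict val L (x + y) \<le> restrict val L x + restrict val L y" if "x \<in> L" "y \<in> L" for x y
    using that val_add[of x y] val_nonneg[of x] val_nonneg[of y] by simp
qed (auto simp: val_nonneg val_mult)

end

context complex_valuation_ring
begin

lemma valuation_on_field_exists:
  assumes alg: "\<And>u. u \<in> L \<Longrightarrow> algebraic u" and L: "complex_subfield L"
    and x: "x \<in> L" "x \<notin> V"
  shows "\<exists>p. prime p \<and> valuation_on_field V L (of_nat p)"
proof -
  interpret L: complex_subfield L by (rule L)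
  have rat: "complex_subfield \<rat>" by unfold_locales auto
  have ratcom: "\<exists>n>0. \<exists>c\<in>\<rat>. c \<noteq> 0 \<and> val_unit (u ^ n / c)" if u: "u \<in> L" "u \<noteq> 0" for u
  proof -
    obtain p where p: "\<And>i. coeff p i \<in> \<int>" "p \<noteq> 0" "poly p u = 0"
      using algebraicE[OF alg[OF u(1)]] by blast
    then show ?thesis using u(2) Ints_subset_Rats by (intro root_commensurable[OF rat]) auto
  qed
  have "\<exists>p. prime p \<and> \<not> val_unit (of_nat p)"
  proof (rule ccontr)
    assume "\<not> ?thesis"
    then have pr: "val_unit (of_nat p)" if "prime p" for p using that by blast
    have nat: "val_unit (of_nat n)" if "n > 0" for n
      using that
    proof (induction n rule: prime_divisors_induct)
      case (factor p n)
      then show ?case using pr val_unit_mult by auto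
    qed auto
    have int: "val_unit (of_int k)" if "k \<noteq> 0" for k
    proof (cases "k \<ge> 0")
      case False
      then have "val_unit (- of_int k)" using nat[of "nat (- k)"] by simp
      then show ?thesis using val_unit_mult[of "- of_int k" "- 1"] by (simp add: val_unit_def)
    qed (use nat[of "nat k"] that in simp)
    have "x \<noteq> 0" using x by auto
    then obtain n c where n: "n > 0" "c \<in> \<rat>" "c \<noteq> 0" "val_unit (x ^ n / c)"
      using ratcom[of x] x by blast
    obtain a b where ab: "c = of_int a / of_int b" "b > 0"
      using n(2) by (auto elim: Rats_cases')
    then have "val_unit c" using n(3) int[of a] int[of b] val_unit_divide by auto
    then have "val_unit (x ^ n / c * c)" using n(4) val_unit_mult by blast
    then have "x ^ n \<in> V" using n(3) by (simp add: val_unit_def)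
    have "inverse x \<in> V" using x valuation[of x] by auto
    then have "x ^ n * inverse x ^ (n - 1) \<in> V" using \<open>x ^ n \<in> V\<close> by simp
    moreover have "x ^ n * inverse x ^ (n - 1) = x"
      using \<open>x \<noteq> 0\<close> n(1) by (rule power_mult_inverse_power)
    ultimately show False using x by simp
  qed
  then obtain p where p: "prime p" "\<not> val_unit (of_nat p)" by blast
  have p0: "(of_nat p :: complex) \<noteq> 0" using p(1) by (auto dest: prime_gt_0_nat)
  have ip: "inverse (of_nat p) \<notin> V" using p p0 by (auto simp: val_unit_def)
  have coprime_unit: "val_unit (of_int m)" if m: "\<not> int p dvd m" for m
  proof (rule ccontr)
    assume nu: "\<not> val_unit (of_int m)"
    have "prime (int p)" using p(1) by simp
    then have "coprime (int p) m" using m by (simp add: prime_imp_coprime)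
    then obtain a b where ab: "a * int p + b * m = 1"
      by (metis bezout_int coprime_imp_gcd_eq_1)
    have "\<not> val_unit (of_int a * of_nat p)" "\<not> val_unit (of_int b * of_int m)"
    proof -
      have gen: "\<not> val_unit (of_int a * y)" if y: "y \<in> V" "\<not> val_unit y" for a y
      proof
        assume u: "val_unit (of_int a * y)"
        then have "y \<noteq> 0" "of_int a * inverse (of_int a * y) \<in> V" by (auto simp: val_unit_def)
        moreover have "of_int a * inverse (of_int a * y) = inverse y" using u by (auto simp: val_unit_def)
        ultimately have "inverse y \<in> V" by (simp only:)
        then show False using y \<open>y \<noteq> 0\<close> by (simp add: val_unit_def)
      qed
      show "\<not> val_unit (of_int a * of_nat p)" "\<not> val_unit (of_int b * of_int m)"
        using gen p nu by auto
    qed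
    then have "\<not> val_unit (of_int a * of_nat p + of_int b * of_int m)"
      by (intro nonunit_add) auto
    moreover have "of_int a * of_nat p + of_int b * of_int m = (1 :: complex)"
      using ab by (metis of_int_1 of_int_add of_int_mult of_int_of_nat_eq)
    ultimately show False by simp
  qed
  have int: "val_unit (of_int m * of_nat p powi (- int (multiplicity (int p) m)))" if m: "m \<noteq> 0" for m
  proof -
    obtain k where k: "m = int p ^ multiplicity (int p) m * k" "\<not> int p dvd k"
      using multiplicity_decompose'[of m "int p"] m prime_gt_1_nat[OF p(1)] by auto
    then have "of_int m = (of_nat p :: complex) ^ multiplicity (int p) m * of_int k"
      by (metis of_int_mult of_int_of_nat_eq of_int_power)
    then have "of_int m * of_nat p powi (- int (multiplicity (int p) m)) = (of_int k :: complex)"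
      using p0 by (simp add: power_int_minus)
    then show ?thesis using coprime_unit[OF k(2)] by simp
  qed
  have "valuation_on_field V L (of_nat p)"
  proof unfold_locales
    show "of_nat p \<in> V" "of_nat p \<noteq> (0 :: complex)" "inverse (of_nat p) \<notin> V"
      using p0 ip by auto
    fix u assume u: "u \<in> L" "u \<noteq> 0"
    then obtain n c where n: "n > 0" "c \<in> \<rat>" "c \<noteq> 0" "val_unit (u ^ n / c)"
      using ratcom by blast
    obtain a b where ab: "c = of_int a / of_int b" "b > 0"
      using n(2) by (auto elim: Rats_cases')
    have "a \<noteq> 0" using ab n(3) by auto
    let ?m = "\<lambda>k. int (multiplicity (int p) k)"
    have "val_unit (u ^ n / c * ((of_int a * of_nat p powi (- ?m a)) / (of_int b * of_nat p powi (- ?m b))))"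
      using ab(2) by (intro val_unit_mult[OF n(4)] val_unit_divide[OF int[OF \<open>a \<noteq> 0\<close>] int]) auto
    also have "u ^ n / c * ((of_int a * of_nat p powi (- ?m a)) / (of_int b * of_nat p powi (- ?m b))) =
        u ^ n * of_nat p powi (?m b - ?m a)"
      using \<open>a \<noteq> 0\<close> ab p0 by (simp add: power_int_minus power_int_diff field_simps)
    finally show "\<exists>n>0. \<exists>e::int. val_unit (u ^ n * of_nat p powi e)" using n(1) by blast
  qed
  then show ?thesis using p(1) by blast
qed

end

section \<open>Eigenvalues of matrices with bounded powers\<close>

definition subexponential :: "complex set \<Rightarrow> nat \<Rightarrow> (nat \<Rightarrow> complex mat set) \<Rightarrow> bool" where
  "subexponential K d G \<longleftrightarrow> (\<forall>a\<in>standard_abs K. \<forall>\<epsilon>>0. \<exists>N. \<forall>m\<ge>N. \<forall>s\<in>G m. \<forall>i<d. \<forall>j<d.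
     a (s $$ (i, j)) \<le> exp (\<epsilon> * real m))"

lemma eigenvalue_pow:
  fixes A :: "complex mat"
  assumes A: "A \<in> carrier_mat n n" and e: "eigenvalue A e"
  shows "eigenvalue (A ^\<^sub>m k) (e ^ k)"
proof -
  obtain v where v: "eigenvector A v e" using e by (auto simp: eigenvalue_def)
  then have "eigenvector (A ^\<^sub>m k) v (e ^ k)"
    using eigenvector_pow[OF A v, of k] A by (auto simp: eigenvector_def)
  then show ?thesis by (auto simp: eigenvalue_def)
qed

lemma eigenvalue_smult:
  fixes A :: "complex mat"
  assumes A: "A \<in> carrier_mat n n" and e: "eigenvalue A e"
  shows "eigenvalue (c \<cdot>\<^sub>m A) (c * e)"
proof -
  obtain v where v: "v \<in> carrier_vec n" "v \<noteq> 0\<^sub>v n" "A *\<^sub>v v = e \<cdot>\<^sub>v v"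
    using e A by (auto simp: eigenvalue_def eigenvector_def)
  have "(c \<cdot>\<^sub>m A) *\<^sub>v v = c \<cdot>\<^sub>v (A *\<^sub>v v)"
    using A v(1) by (intro eq_vecI) auto
  then show ?thesis
    using A v by (auto simp: eigenvalue_def eigenvector_def smult_smult_assoc intro!: exI[of _ v])
qed

lemma set_power_mats:
  assumes "complex_subfield K" "F \<subseteq> mats d K"
  shows "set_power d F n \<subseteq> mats d K"
proof -
  interpret complex_subfield K by fact
  show ?thesis
  proof (induction n)
    case 0
    show ?case by (auto intro!: matsI)
  next
    case (Suc n)
    show ?case
    proof
      fix x assume "x \<in> set_power d F (Suc n)"
      then obtain A B where x: "x = A * B" "A \<in> mats d K" "B \<in> mats d K"
        using Suc assms(2) by auto
      then have dims: "A \<in> carrier_mat d d" "B \<in> carrier_mat d d" by (auto simp: mats_def)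
      show "x \<in> mats d K"
        unfolding x(1)
      proof (rule matsI)
        fix i j assume ij: "i < d" "j < d"
        then have "(A * B) $$ (i, j) = (\<Sum>k<d. A $$ (i, k) * B $$ (k, j))"
          using dims by (auto simp: scalar_prod_def atLeast0LessThan)
        also have "\<dots> \<in> K"
          by (intro sum mult mats_entry[OF x(2)] mats_entry[OF x(3)]) (use ij in auto)
        finally show "(A * B) $$ (i, j) \<in> K" .
      qed (use dims in auto)
    qed
  qed
qed

lemma eigenvalue_algebraic_int:
  assumes K: "number_field K" and F: "F \<subseteq> mats d K"
    and sub: "subexponential K d (set_power d F)" and s: "s \<in> set_power d F n" and e: "eigenvalue s e"
  shows "algebraic_int e"
proof (rule ccontr)
  assume nint: "\<not> algebraic_int e"
  have Ksub: "complex_subfield K"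
    using K by (auto simp: number_field_def intro: complex_subfieldI)
  interpret K: complex_subfield K by (rule Ksub)
  obtain V where V: "maximal_subring V e" using exists_maximal_subring[OF nint] by blast
  interpret maximal_subring V e by (rule V)
  have Fc: "F \<subseteq> carrier_mat d d" using F by (auto simp: mats_def)
  have sK: "s \<in> mats d K" using set_power_mats[OF Ksub F] s by blast
  then have sc: "s \<in> carrier_mat d d" by (simp add: mats_def)
  have d: "d > 0" using eigenvalue_imp_nonzero_dim[OF sc e] .
  interpret VK: complex_subring K by unfold_locales auto
  have "char_poly s \<in> VK.polys"
    using VK.char_poly_in_polys[OF sc] mats_entry[OF sK] by blast
  then have "\<exists>n>0. \<exists>c\<in>K. c \<noteq> 0 \<and> val_unit (e ^ n / c)"
    using degree_monic_char_poly[OF sc] eigenvalue_root_char_poly[OF sc] e x_nonzero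
    by (intro root_commensurable[OF Ksub, of "char_poly s"]) (auto simp: VK.polys_def)
  then obtain r c where r: "r > 0" "c \<in> K" "c \<noteq> 0" "val_unit (e ^ r / c)" by blast
  have cV: "c \<notin> V"
  proof
    assume "c \<in> V"
    moreover have "e ^ r / c \<in> V" using r(4) unfolding val_unit_def by blast
    ultimately have "e ^ r / c * c \<in> V" by (intro mult)
    then have er: "e ^ r \<in> V" using r(3) by simp
    have "e ^ r * inverse e ^ (r - 1) \<in> V" using er x by simp
    then show False using power_mult_inverse_power[OF x_nonzero r(1)] x by simp
  qed
  obtain p where p: "prime p" "valuation_on_field V K (of_nat p)"
    using valuation_on_field_exists[OF number_field_algebraic[OF K] Ksub r(2) cV] by blast
  interpret val: valuation_on_field V K "of_nat p" by (rule p(2))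
  interpret A: valued_subfield K "restrict val.val K"
    by unfold_locales (rule val.val_absolute_value)
  have valc: "val.val c > 1" using cV r(2) val.val_le_1_iff[of c] by simp
  obtain t where t: "t > 0" "restrict (\<lambda>x. restrict val.val K x powr t) K \<in> standard_abs K"
    using A.exists_standard_power[OF number_field_algebraic[OF K] r(2,3)] valc r(2) by auto
  define L where "L = t * ln (val.val c)"
  have L: "L > 0" using t valc by (simp add: L_def)
  define \<epsilon> where "\<epsilon> = L / (2 * real r * real (Suc n))"
  have \<epsilon>: "\<epsilon> > 0" using L r(1) by (simp add: \<epsilon>_def)
  obtain N where N: "\<And>m s i j. m \<ge> N \<Longrightarrow> s \<in> set_power d F m \<Longrightarrow> i < d \<Longrightarrow> j < d \<Longrightarrow>
      restrict (\<lambda>x. restrict val.val K x powr t) K (s $$ (i, j)) \<le> exp (\<epsilon> * real m)"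
    using sub t(2) \<epsilon> unfolding subexponential_def by meson
  have bound: "val.val (u $$ (i, j)) powr t \<le> exp (\<epsilon> * real m)"
    if "m \<ge> N" "u \<in> set_power d F m" "i < d" "j < d" for m u i j
    using N[OF that] mats_entry[OF subsetD[OF set_power_mats[OF Ksub F] that(2)] that(3,4)] by simp
  have one_val: "val.val 1 = 1" using A.abs_1 by simp
  text \<open>For large powers of \<open>s\<close>, divide by an entry of largest absolute value (or by 1).\<close>
  have key: "L * real k \<le> \<epsilon> * real (n * k) * real r" if k: "n * k \<ge> N \<or> n = 0" for k
  proof -
    let ?u = "s ^\<^sub>m k"
    have u: "?u \<in> set_power d F (n * k)" by (rule pow_in_set_power[OF Fc s])
    have uK: "?u \<in> mats d K" using set_power_mats[OF Ksub F] u by blast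
    have uc: "?u \<in> carrier_mat d d" using sc by simp
    define Z where "Z = insert 1 ((\<lambda>(i, j). ?u $$ (i, j)) ` ({..<d} \<times> {..<d}))"
    have Z: "finite Z" "Z \<noteq> {}" by (auto simp: Z_def)
    have ZK: "z \<in> K" if "z \<in> Z" for z using that mats_entry[OF uK] by (auto simp: Z_def)
    obtain z where z: "z \<in> Z" "\<And>y. y \<in> Z \<Longrightarrow> val.val y \<le> val.val z"
      using obtains_MAX[OF Z, of val.val] Z(1) by (metis Max_ge finite_imageI imageI)
    have z1: "val.val z \<ge> 1" using z(2)[of 1] one_val by (simp add: Z_def)
    then have z0: "z \<noteq> 0" by (auto simp: val.val_def)
    have zb: "val.val z powr t \<le> exp (\<epsilon> * real (n * k))"
    proof (cases "z = 1")
      case True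
      then show ?thesis using \<epsilon> one_val by simp
    next
      case False
      then obtain i j where ij: "i < d" "j < d" "z = ?u $$ (i, j)" using z(1) by (auto simp: Z_def)
      show ?thesis
      proof (cases "n = 0")
        case True
        then have "s = 1\<^sub>m d" using s by simp
        then have "?u = 1\<^sub>m d" by (induction k) auto
        then have "z = 0 \<or> z = 1" using ij by auto
        then show ?thesis using False z0 by blast
      next
        case False
        then show ?thesis using bound[OF _ u ij(1,2)] k ij(3) by auto
      qed
    qed
    have divV: "y / z \<in> V" if "y \<in> Z" for y
    proof -
      have "val.val (y / z) * val.val z = val.val y"
        using val.val_mult[of "y / z" z] ZK[OF that] ZK[OF z(1)] z0 by simp
      then have "val.val (y / z) = val.val y / val.val z" using z1 by (simp add: field_simps)
      also have "\<dots> \<le> 1" using z(2)[OF that] z1 by simp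
      finally show ?thesis using val.val_le_1_iff[of "y / z"] ZK[OF that] ZK[OF z(1)] by simp
    qed
    have "inverse z * e ^ k \<in> V"
    proof (rule eigenvalue_in)
      show "inverse z \<cdot>\<^sub>m ?u \<in> carrier_mat d d" using uc by simp
      show "eigenvalue (inverse z \<cdot>\<^sub>m ?u) (inverse z * e ^ k)"
        using eigenvalue_smult[OF uc eigenvalue_pow[OF sc e]] .
      show "(inverse z \<cdot>\<^sub>m ?u) $$ (i, j) \<in> V" if "i < d" "j < d" for i j
      proof -
        have "(inverse z \<cdot>\<^sub>m ?u) $$ (i, j) = ?u $$ (i, j) / z"
          using that sc by (simp add: carrier_matD[OF sc] divide_inverse mult.commute)
        moreover have "?u $$ (i, j) \<in> Z" using that by (auto simp: Z_def)
        ultimately show ?thesis using divV by simp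
      qed
    qed
    moreover have "inverse ((e ^ r / c) ^ k) \<in> V"
      using val_unit_power[OF r(4), of k] unfolding val_unit_def by blast
    ultimately have "(inverse z * e ^ k) ^ r * inverse ((e ^ r / c) ^ k) \<in> V"
      by (rule mult[OF power])
    also have "(inverse z * e ^ k) ^ r * inverse ((e ^ r / c) ^ k) = c ^ k / z ^ r"
      using x_nonzero r(3) z0
      by (simp add: power_mult_distrib power_divide power_inverse field_simps flip: power_mult)
    finally have "val.val (c ^ k / z ^ r) \<le> 1"
      using r(2) ZK[OF z(1)] by (subst val.val_le_1_iff) auto
    moreover have "val.val (c ^ k / z ^ r) = val.val c ^ k / val.val z ^ r"
      using A.abs_divide[of "c ^ k" "z ^ r"] A.abs_power[of c k] A.abs_power[of z r] r(2) ZK[OF z(1)] by simp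
    ultimately have le: "val.val c ^ k \<le> val.val z ^ r" using z1 by (simp add: divide_simps)
    have "(val.val c ^ k) powr t \<le> (val.val z ^ r) powr t"
      using le t(1) valc by (intro powr_mono2) auto
    then have "(val.val c powr t) ^ k \<le> (val.val z powr t) ^ r"
      using valc z1 by (simp add: powr_power_real)
    also have "\<dots> \<le> exp (\<epsilon> * real (n * k)) ^ r"
      using zb by (intro power_mono) auto
    finally have "exp L ^ k \<le> exp (\<epsilon> * real (n * k)) ^ r"
      using valc by (simp add: L_def powr_def)
    then have "exp (L * real k) \<le> exp (\<epsilon> * real (n * k) * real r)"
      by (simp add: exp_of_nat_mult[symmetric] mult_ac)
    then show ?thesis by simp
  qed
  define k where "k = Suc N"
  have "n * k \<ge> N \<or> n = 0" by (cases n) (auto simp: k_def)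
  then have "L * real k \<le> \<epsilon> * real (n * k) * real r" by (rule key)
  also have "\<dots> = (L / 2) * (real n / real (Suc n)) * real k"
    using r(1) by (simp add: \<epsilon>_def)
  also have "\<dots> \<le> (L / 2) * 1 * real k"
    using L by (intro mult_right_mono mult_left_mono) auto
  finally show False using L by (simp add: k_def)
qed

section \<open>Embeddings and the finiteness of traces\<close>

definition embedding :: "complex set \<Rightarrow> (complex \<Rightarrow> complex) \<Rightarrow> bool" where
  "embedding K \<sigma> \<longleftrightarrow> \<sigma> 1 = 1 \<and> (\<forall>x\<in>K. \<forall>y\<in>K. \<sigma> (x + y) = \<sigma> x + \<sigma> y \<and> \<sigma> (x * y) = \<sigma> x * \<sigma> y)"

locale complex_embedding = complex_subfield +
  fixes \<sigma> assumes emb: "embedding K \<sigma>"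
begin

lemma emb_1 [simp]: "\<sigma> 1 = 1"
  and emb_add: "x \<in> K \<Longrightarrow> y \<in> K \<Longrightarrow> \<sigma> (x + y) = \<sigma> x + \<sigma> y"
  and emb_mult: "x \<in> K \<Longrightarrow> y \<in> K \<Longrightarrow> \<sigma> (x * y) = \<sigma> x * \<sigma> y"
  using emb by (auto simp: embedding_def)

lemma emb_0 [simp]: "\<sigma> 0 = 0"
  using emb_add[of 0 0] by simp

lemma emb_uminus: "x \<in> K \<Longrightarrow> \<sigma> (- x) = - \<sigma> x"
  using emb_add[of x "- x"] by (simp add: eq_neg_iff_add_eq_0 add.commute)

lemma emb_nonzero: "x \<in> K \<Longrightarrow> x \<noteq> 0 \<Longrightarrow> \<sigma> x \<noteq> 0"
  using emb_mult[of x "inverse x"] by auto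

lemma emb_sum: "(\<And>i. i \<in> I \<Longrightarrow> f i \<in> K) \<Longrightarrow> \<sigma> (\<Sum>i\<in>I. f i) = (\<Sum>i\<in>I. \<sigma> (f i))"
  by (induction I rule: infinite_finite_induct) (auto simp: emb_add)

lemma emb_power: "x \<in> K \<Longrightarrow> \<sigma> (x ^ n) = \<sigma> x ^ n"
  by (induction n) (auto simp: emb_mult)

lemma emb_of_nat: "\<sigma> (of_nat n) = of_nat n"
  by (induction n) (auto simp: emb_add)

lemma emb_of_int: "\<sigma> (of_int n) = of_int n"
  by (cases n rule: int_cases2) (auto simp: emb_of_nat emb_uminus)

lemma emb_of_rat: "\<sigma> (of_rat q) = of_rat q"
proof -
  obtain m n where q: "q = of_int m / of_int n" "n > 0"
    by (metis quotient_of_denom_pos quotient_of_div surj_pair)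
  have rq: "of_rat q = (of_int m / of_int n :: complex)" using q by (simp add: of_rat_divide)
  then have "(of_rat q :: complex) * of_int n = of_int m" using q(2) by simp
  then have "\<sigma> (of_rat q) * of_int n = of_int m"
    using emb_mult[of "of_rat q" "of_int n"] by (simp add: emb_of_int)
  then have "\<sigma> (of_rat q) = of_int m / of_int n" using q(2) by (simp add: eq_divide_eq)
  then show ?thesis using rq by (simp only:)
qed

lemma emb_algebraic_int: "x \<in> K \<Longrightarrow> algebraic_int x \<Longrightarrow> algebraic_int (\<sigma> x)"
proof (erule algebraic_int.cases)
  fix p y assume x: "x \<in> K" "x = y" and p: "lead_coeff p = 1" "\<forall>i. coeff p i \<in> \<int>" "poly p y = (0 :: complex)"
  have co: "coeff p i \<in> K" "\<sigma> (coeff p i) = coeff p i" for i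
    using p(2)[rule_format, of i] emb_of_int by (auto elim: Ints_cases)
  have "poly p (\<sigma> x) = \<sigma> (poly p x)"
    using x(1) co by (simp add: poly_altdef emb_sum emb_mult emb_power)
  then show "algebraic_int (\<sigma> x)" using p x by (intro algebraic_int.intros[of p]) auto
qed

lemma emb_standard_abs: "restrict (\<lambda>x. cmod (\<sigma> x)) K \<in> standard_abs K"
proof -
  have "absolute_value K (restrict (\<lambda>x. cmod (\<sigma> x)) K)"
    unfolding absolute_value_def
    using emb_nonzero by (auto simp: emb_mult emb_add norm_mult norm_triangle_ineq)
  moreover have "extends_standard (restrict (\<lambda>x. cmod (\<sigma> x)) K)"
  proof -
    have "cmod (of_rat q) = \<bar>of_rat q\<bar>" for q
      by (cases q) (simp add: of_rat_rat norm_divide)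
    then show ?thesis
      unfolding extends_standard_def by (intro disjI1) (simp add: emb_of_rat)
  qed
  ultimately show ?thesis by (simp add: standard_abs_def)
qed

lemma map_mat_emb_mult:
  assumes "A \<in> mats d K" "B \<in> mats d K"
  shows "map_mat \<sigma> (A * B) = map_mat \<sigma> A * map_mat \<sigma> B"
proof (rule eq_matI)
  have dims: "A \<in> carrier_mat d d" "B \<in> carrier_mat d d" using assms by (auto simp: mats_def)
  fix i j assume "i < dim_row (map_mat \<sigma> A * map_mat \<sigma> B)" "j < dim_col (map_mat \<sigma> A * map_mat \<sigma> B)"
  then have ij: "i < d" "j < d" using dims by auto
  have "\<sigma> ((A * B) $$ (i, j)) = \<sigma> (\<Sum>k<d. A $$ (i, k) * B $$ (k, j))"
    using dims ij by (auto simp: scalar_prod_def atLeast0LessThan)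
  also have "\<dots> = (\<Sum>k<d. \<sigma> (A $$ (i, k)) * \<sigma> (B $$ (k, j)))"
  proof (subst emb_sum)
    show "A $$ (i, k) * B $$ (k, j) \<in> K" if "k \<in> {..<d}" for k
      by (intro mult mats_entry[OF assms(1)] mats_entry[OF assms(2)]) (use ij that in auto)
    show "(\<Sum>k<d. \<sigma> (A $$ (i, k) * B $$ (k, j))) = (\<Sum>k<d. \<sigma> (A $$ (i, k)) * \<sigma> (B $$ (k, j)))"
      by (intro sum.cong refl emb_mult mats_entry[OF assms(1)] mats_entry[OF assms(2)]) (use ij in auto)
  qed
  finally show "map_mat \<sigma> (A * B) $$ (i, j) = (map_mat \<sigma> A * map_mat \<sigma> B) $$ (i, j)"
    using dims ij by (auto simp: scalar_prod_def atLeast0LessThan)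
qed (use assms in \<open>auto simp: mats_def\<close>)

lemma map_mat_emb_pow:
  assumes A: "A \<in> mats d K"
  shows "A ^\<^sub>m k \<in> mats d K" "map_mat \<sigma> (A ^\<^sub>m k) = map_mat \<sigma> A ^\<^sub>m k"
proof -
  have dim: "dim_row A = d" using A by (auto simp: mats_def)
  have Ac: "{A} \<subseteq> carrier_mat d d" "{A} \<subseteq> mats d K" using A by (auto simp: mats_def)
  have "A \<in> set_power d {A} 1" using Ac by auto
  then show mem: "A ^\<^sub>m k \<in> mats d K" for k
    using set_power_mats[OF complex_subfield_axioms Ac(2)] pow_in_set_power[OF Ac(1), of A 1 k] by blast
  show "map_mat \<sigma> (A ^\<^sub>m k) = map_mat \<sigma> A ^\<^sub>m k"
  proof (induction k)
    case 0
    show ?case using dim by (intro eq_matI) auto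
  next
    case (Suc k)
    then show ?case using map_mat_emb_mult[OF mem A] by simp
  qed
qed

end

lemma eigenvalue_cmod_le:
  fixes A :: "complex mat"
  assumes A: "A \<in> carrier_mat n n" and B: "\<And>i j. i < n \<Longrightarrow> j < n \<Longrightarrow> cmod (A $$ (i, j)) \<le> B"
    and e: "eigenvalue A e"
  shows "cmod e \<le> real n * B"
proof -
  obtain v where v: "v \<in> carrier_vec n" "v \<noteq> 0\<^sub>v n" "A *\<^sub>v v = e \<cdot>\<^sub>v v"
    using e A by (auto simp: eigenvalue_def eigenvector_def)
  obtain i0 where i0: "i0 < n" "v $ i0 \<noteq> 0"
    using v by (metis carrier_vecD eq_vecI index_zero_vec)
  define M where "M = Max ((\<lambda>i. cmod (v $ i)) ` {..<n})"
  have "M \<in> (\<lambda>i. cmod (v $ i)) ` {..<n}" unfolding M_def using i0 by (intro Max_in) auto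
  then obtain i where i: "i < n" "M = cmod (v $ i)" by auto
  have le: "cmod (v $ j) \<le> M" if "j < n" for j unfolding M_def using that by (intro Max_ge) auto
  have M: "M > 0" using le[OF i0(1)] i0(2) by (meson less_le_trans zero_less_norm_iff)
  have "e * v $ i = (A *\<^sub>v v) $ i" using v i by simp
  also have "\<dots> = (\<Sum>j<n. A $$ (i, j) * v $ j)"
    using A v(1) i(1) by (auto simp: scalar_prod_def atLeast0LessThan intro!: sum.cong)
  finally have "cmod e * M \<le> (\<Sum>j<n. cmod (A $$ (i, j)) * cmod (v $ j))"
    using norm_sum[of "\<lambda>j. A $$ (i, j) * v $ j" "{..<n}"] i(2) by (simp add: norm_mult flip: norm_mult[of e])
  also have "\<dots> \<le> (\<Sum>j<n. B * M)"
    using B[OF i(1)] le by (intro sum_mono mult_mono) (auto intro: order_trans[OF norm_ge_zero])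
  finally show ?thesis using M by simp
qed

lemma zero_smult_vec: "v \<in> carrier_vec n \<Longrightarrow> 0 \<cdot>\<^sub>v v = (0\<^sub>v n :: complex vec)"
  and smult_zero_vec: "c \<cdot>\<^sub>v 0\<^sub>v n = (0\<^sub>v n :: complex vec)"
  and mult_mat_zero_vec: "A \<in> carrier_mat n n \<Longrightarrow> A *\<^sub>v 0\<^sub>v n = (0\<^sub>v n :: complex vec)"
  by (auto intro!: eq_vecI)

definition poly_act :: "complex mat \<Rightarrow> complex vec \<Rightarrow> complex poly \<Rightarrow> complex vec" where
  "poly_act A v p = fold_coeffs (\<lambda>a w. a \<cdot>\<^sub>v v + A *\<^sub>v w) p (0\<^sub>v (dim_vec v))"

context
  fixes A :: "complex mat" and v :: "complex vec" and n :: nat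
  assumes A: "A \<in> carrier_mat n n" and v: "v \<in> carrier_vec n"
begin

lemma poly_act_0 [simp]: "poly_act A v 0 = 0\<^sub>v n"
  using v by (simp add: poly_act_def)

lemma poly_act_pCons [simp]: "poly_act A v (pCons a p) = a \<cdot>\<^sub>v v + A *\<^sub>v poly_act A v p"
proof (cases "a = 0 \<and> p = 0")
  case True
  then show ?thesis by (simp add: zero_smult_vec[OF v] mult_mat_zero_vec[OF A])
next
  case False
  then show ?thesis by (cases "a = 0") (simp_all add: poly_act_def)
qed

lemma poly_act_carrier [simp]: "poly_act A v p \<in> carrier_vec n"
  by (induction p) (use A v in auto)

lemma poly_act_add: "poly_act A v (p + q) = poly_act A v p + poly_act A v q"
proof (induction p q rule: poly_induct2)
  case (pCons a p b q)
  have "A *\<^sub>v (poly_act A v p + poly_act A v q) = A *\<^sub>v poly_act A v p + A *\<^sub>v poly_act A v q"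
    by (rule mult_add_distrib_mat_vec[OF A]) auto
  then show ?case
    using pCons A v by (intro eq_vecI) (auto simp: algebra_simps simp del: index_mult_mat_vec)
qed simp

lemma poly_act_smult: "poly_act A v (Polynomial.smult c p) = c \<cdot>\<^sub>v poly_act A v p"
proof (induction p)
  case 0
  show ?case by (simp add: smult_zero_vec)
next
  case (pCons a p)
  have "A *\<^sub>v (c \<cdot>\<^sub>v poly_act A v p) = c \<cdot>\<^sub>v (A *\<^sub>v poly_act A v p)"
    by (rule mult_mat_vec[OF A]) simp
  then show ?case
    using pCons A v by (intro eq_vecI) (auto simp: algebra_simps simp del: index_mult_mat_vec)
qed

lemma poly_act_monom: "poly_act A v (monom c i) = c \<cdot>\<^sub>v (A ^\<^sub>m i *\<^sub>v v)"
proof (induction i)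
  case 0
  show ?case using A v by (simp add: monom_0 mult_mat_zero_vec)
next
  case (Suc i)
  have c: "A ^\<^sub>m i *\<^sub>v v \<in> carrier_vec n" "A *\<^sub>v (A ^\<^sub>m i *\<^sub>v v) \<in> carrier_vec n"
    using mult_mat_vec_carrier[OF pow_carrier_mat[OF A] v] A by auto
  have "A ^\<^sub>m Suc i *\<^sub>v v = A *\<^sub>v (A ^\<^sub>m i *\<^sub>v v)"
    unfolding pow_mat_Suc_left[OF A] using A v by (intro assoc_mult_mat_vec) auto
  moreover have "A *\<^sub>v (c \<cdot>\<^sub>v (A ^\<^sub>m i *\<^sub>v v)) = c \<cdot>\<^sub>v (A *\<^sub>v (A ^\<^sub>m i *\<^sub>v v))"
    by (rule mult_mat_vec[OF A c(1)])
  ultimately show ?case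
    using Suc c by (simp add: monom_Suc zero_smult_vec[OF v] del: pow_mat.simps)
qed

lemma poly_act_sum_monom:
  "j < n \<Longrightarrow> poly_act A v (\<Sum>i\<le>N. monom (c i) i) $ j = (\<Sum>i\<le>N. c i * (A ^\<^sub>m i *\<^sub>v v) $ j)"
proof (induction N)
  case 0
  then show ?case using A v by (simp add: poly_act_monom)
next
  case (Suc N)
  have "dim_vec (A ^\<^sub>m Suc N *\<^sub>v v) = n" using A by (simp del: pow_mat.simps)
  then show ?case
    using Suc A v by (simp add: poly_act_add poly_act_monom del: pow_mat.simps index_mult_mat_vec)
qed

lemma poly_act_in:
  assumes "0\<^sub>v n \<in> U" "\<And>x y. x \<in> U \<Longrightarrow> y \<in> U \<Longrightarrow> x + y \<in> U"
    "\<And>c x. x \<in> U \<Longrightarrow> c \<cdot>\<^sub>v x \<in> U" "\<And>x. x \<in> U \<Longrightarrow> A *\<^sub>v x \<in> U" "v \<in> U"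
  shows "poly_act A v p \<in> U"
  by (induction p) (use assms in auto)

lemma annihilated_imp_eigenvector:
  assumes "poly_act A v p = 0\<^sub>v n" "p \<noteq> 0" "v \<noteq> 0\<^sub>v n"
  shows "\<exists>q \<mu>. poly_act A v q \<noteq> 0\<^sub>v n \<and> A *\<^sub>v poly_act A v q = \<mu> \<cdot>\<^sub>v poly_act A v q"
  using assms
proof (induction "degree p" arbitrary: p rule: less_induct)
  case less
  show ?case
  proof (cases "degree p = 0")
    case True
    then obtain a where a: "p = [:a:]" "a \<noteq> 0"
      using less.prems(2) by (metis degree_eq_zeroE pCons_0_0)
    then have "a \<cdot>\<^sub>v v = 0\<^sub>v n" using less.prems(1) v by (simp add: mult_mat_zero_vec[OF A])
    then have "v = inverse a \<cdot>\<^sub>v 0\<^sub>v n" using a(2) by (metis left_inverse one_smult_vec smult_smult_assoc)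
    then show ?thesis using less.prems(3) by (simp add: smult_zero_vec)
  next
    case False
    then obtain \<mu> where "poly p \<mu> = 0"
      using fundamental_theorem_of_algebra[of p] by (auto simp: constant_degree)
    then obtain q where q: "p = [:- \<mu>, 1:] * q" by (auto simp: poly_eq_0_iff_dvd)
    have q0: "q \<noteq> 0" using q less.prems(2) by auto
    have deg: "degree q < degree p" unfolding q using q0 by (subst degree_mult_eq) auto
    have "p = Polynomial.smult (- \<mu>) q + pCons 0 q" unfolding q by simp
    then have "0\<^sub>v n = (- \<mu>) \<cdot>\<^sub>v poly_act A v q + (0 \<cdot>\<^sub>v v + A *\<^sub>v poly_act A v q)"
      using less.prems(1) by (simp only: poly_act_add poly_act_smult poly_act_pCons)
    then have vec_eq: "(- \<mu>) \<cdot>\<^sub>v poly_act A v q + (0 \<cdot>\<^sub>v v + A *\<^sub>v poly_act A v q) = 0\<^sub>v n"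
      by simp
    have c: "poly_act A v q \<in> carrier_vec n" "A *\<^sub>v poly_act A v q \<in> carrier_vec n"
      using A poly_act_carrier mult_mat_vec_carrier by blast+
    have ev: "A *\<^sub>v poly_act A v q = \<mu> \<cdot>\<^sub>v poly_act A v q"
    proof (rule eq_vecI)
      fix i assume i': "i < dim_vec (\<mu> \<cdot>\<^sub>v poly_act A v q)"
      then have i: "i < n" using c by simp
      have "- \<mu> * poly_act A v q $ i + (A *\<^sub>v poly_act A v q) $ i = 0"
        using arg_cong[OF vec_eq, of "\<lambda>u. u $ i"] i c carrier_vecD[OF c(1)] carrier_vecD[OF c(2)] carrier_vecD[OF v]
        by (simp del: index_mult_mat_vec dim_mult_mat_vec)
      then have "(A *\<^sub>v poly_act A v q) $ i = \<mu> * poly_act A v q $ i"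
        by (simp add: add_eq_0_iff del: index_mult_mat_vec)
      also have "\<dots> = (\<mu> \<cdot>\<^sub>v poly_act A v q) $ i"
        using i' by simp
      finally show "(A *\<^sub>v poly_act A v q) $ i = (\<mu> \<cdot>\<^sub>v poly_act A v q) $ i" .
    qed (use carrier_vecD[OF c(1)] carrier_vecD[OF c(2)] index_smult_vec(2) in metis)
    show ?thesis
    proof (cases "poly_act A v q = 0\<^sub>v n")
      case True
      then show ?thesis using less.hyps[OF deg] q0 less.prems(3) by blast
    qed (use ev in blast)
  qed
qed

lemma invariant_subspace_eigenvector:
  assumes U: "0\<^sub>v n \<in> U" "\<And>x y. x \<in> U \<Longrightarrow> y \<in> U \<Longrightarrow> x + y \<in> U"
    "\<And>c x. x \<in> U \<Longrightarrow> c \<cdot>\<^sub>v x \<in> U" "\<And>x. x \<in> U \<Longrightarrow> A *\<^sub>v x \<in> U" "v \<in> U" "v \<noteq> 0\<^sub>v n"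
  shows "\<exists>w\<in>U. w \<noteq> 0\<^sub>v n \<and> (\<exists>\<mu>. A *\<^sub>v w = \<mu> \<cdot>\<^sub>v w)"
proof -
  obtain c where c: "\<exists>i\<le>n. c i \<noteq> 0" "\<forall>j<n. (\<Sum>i\<le>n. c i * (A ^\<^sub>m i *\<^sub>v v) $ j) = 0"
    using linear_dependence[of n "\<lambda>i j. (A ^\<^sub>m i *\<^sub>v v) $ j"] by blast
  define p where "p = (\<Sum>i\<le>n. monom (c i) i)"
  have "poly_act A v p = 0\<^sub>v n"
    using poly_act_sum_monom c(2) carrier_vecD[OF poly_act_carrier[of p]]
    by (intro eq_vecI) (auto simp: p_def)
  moreover have "p \<noteq> 0"
  proof
    assume "p = 0"
    then have "coeff p i = 0" for i by simp
    moreover have "coeff p i = c i" if "i \<le> n" for i using that by (simp add: p_def coeff_sum)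
    ultimately show False using c(1) by metis
  qed
  ultimately obtain q \<mu> where "poly_act A v q \<noteq> 0\<^sub>v n" "A *\<^sub>v poly_act A v q = \<mu> \<cdot>\<^sub>v poly_act A v q"
    using annihilated_imp_eigenvector U(6) by blast
  then show ?thesis using poly_act_in[OF U(1-5)] by blast
qed

end

locale number_field_regular = complex_subfield +
  fixes b :: "nat \<Rightarrow> complex" and n :: nat and M :: "complex \<Rightarrow> nat \<Rightarrow> nat \<Rightarrow> rat"
  assumes n: "n > 0" and b: "\<And>i. i < n \<Longrightarrow> b i \<in> K"
    and span: "\<And>x. x \<in> K \<Longrightarrow> \<exists>c. x = (\<Sum>i<n. of_rat (c i) * b i)"
    and indep: "\<And>c. (\<Sum>i<n. of_rat (c i) * b i) = 0 \<Longrightarrow> \<forall>i<n. c i = 0"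
    and M: "\<And>z i. z \<in> K \<Longrightarrow> i < n \<Longrightarrow> z * b i = (\<Sum>j<n. of_rat (M z i j) * b j)"
begin

lemma M_unique:
  assumes "z \<in> K" "i < n" "z * b i = (\<Sum>j<n. of_rat (N j) * b j)" "j < n"
  shows "M z i j = N j"
proof -
  have "(\<Sum>j<n. of_rat (M z i j - N j) * b j) = 0"
    unfolding of_rat_diff left_diff_distrib sum_subtractf M[OF assms(1,2), symmetric] assms(3)[symmetric]
    by simp
  from indep[OF this] show ?thesis using assms(4) by simp
qed

lemma M_add: "y \<in> K \<Longrightarrow> z \<in> K \<Longrightarrow> i < n \<Longrightarrow> j < n \<Longrightarrow> M (y + z) i j = M y i j + M z i j"
proof (rule M_unique)
  assume yz: "y \<in> K" "z \<in> K" "i < n"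
  have "(y + z) * b i = (\<Sum>j<n. of_rat (M y i j) * b j) + (\<Sum>j<n. of_rat (M z i j) * b j)"
    unfolding distrib_right M[OF yz(1,3), symmetric] M[OF yz(2,3), symmetric] ..
  then show "(y + z) * b i = (\<Sum>j<n. of_rat (M y i j + M z i j) * b j)"
    by (simp only: of_rat_add distrib_right sum.distrib)
qed auto

lemma M_1: "i < n \<Longrightarrow> j < n \<Longrightarrow> M 1 i j = (if j = i then 1 else 0)"
proof (rule M_unique)
  assume i: "i < n"
  have "(\<Sum>j<n. of_rat (if j = i then 1 else 0) * b j) = (\<Sum>j<n. if j = i then b j else 0)"
    by (intro sum.cong) auto
  then show "1 * b i = (\<Sum>j<n. of_rat (if j = i then 1 else 0) * b j)" using i by simp
qed auto

lemma M_mult: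
  assumes "y \<in> K" "z \<in> K" "i < n" "j < n"
  shows "M (y * z) i j = (\<Sum>k<n. M z i k * M y k j)"
proof (rule M_unique)
  have "y * z * b i = (\<Sum>k<n. of_rat (M z i k) * (y * b k))"
    using M[OF assms(2,3)] by (simp add: mult.assoc sum_distrib_left mult.left_commute)
  also have "\<dots> = (\<Sum>k<n. \<Sum>j<n. of_rat (M z i k * M y k j) * b j)"
    using M[OF assms(1)] by (simp add: sum_distrib_left of_rat_mult mult.assoc)
  also have "\<dots> = (\<Sum>j<n. of_rat (\<Sum>k<n. M z i k * M y k j) * b j)"
    by (subst sum.swap) (simp add: of_rat_sum sum_distrib_right)
  finally show "y * z * b i = (\<Sum>j<n. of_rat (\<Sum>k<n. M z i k * M y k j) * b j)" .
qed (use assms in auto)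

lemma M_linear:
  assumes z: "z = (\<Sum>l<n. of_rat (q l) * b l)" and "i < n" "j < n"
  shows "M z i j = (\<Sum>l<n. q l * M (b l) i j)"
proof (rule M_unique)
  show "z \<in> K" unfolding z by (intro sum mult of_rat b) auto
  have "z * b i = (\<Sum>l<n. of_rat (q l) * (b l * b i))"
    unfolding z by (simp add: sum_distrib_right mult.assoc)
  also have "\<dots> = (\<Sum>l<n. \<Sum>j<n. of_rat (q l * M (b l) i j) * b j)"
    using M[OF b \<open>i < n\<close>] by (simp add: sum_distrib_left of_rat_mult mult.assoc)
  also have "\<dots> = (\<Sum>j<n. of_rat (\<Sum>l<n. q l * M (b l) i j) * b j)"
    by (subst sum.swap) (simp add: of_rat_sum sum_distrib_right)
  finally show "z * b i = (\<Sum>j<n. of_rat (\<Sum>l<n. q l * M (b l) i j) * b j)" .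
qed (use assms in auto)

definition R :: "complex \<Rightarrow> complex mat" where
  "R z = mat n n (\<lambda>(i, j). of_rat (M z i j))"

lemma R_carrier [simp]: "R z \<in> carrier_mat n n"
  by (simp add: R_def)

lemma R_entry: "i < n \<Longrightarrow> j < n \<Longrightarrow> R z $$ (i, j) = of_rat (M z i j)"
  by (simp add: R_def)

lemma R_mult: "y \<in> K \<Longrightarrow> z \<in> K \<Longrightarrow> R (y * z) = R z * R y"
  by (intro eq_matI)
    (auto simp: R_def M_mult of_rat_sum of_rat_mult scalar_prod_def atLeast0LessThan)

lemma R_commute: "y \<in> K \<Longrightarrow> z \<in> K \<Longrightarrow> R y * R z = R z * R y"
  using R_mult[of y z] R_mult[of z y] by (simp add: mult.commute)

lemma R_add: "y \<in> K \<Longrightarrow> z \<in> K \<Longrightarrow> R (y + z) = R y + R z"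
  by (intro eq_matI) (auto simp: R_def M_add of_rat_add)

lemma R_1: "R 1 = 1\<^sub>m n"
  by (intro eq_matI) (auto simp: R_def M_1)

lemma mult_mat_vec_commute:
  assumes "y \<in> K" "z \<in> K" "v \<in> carrier_vec n" "R y *\<^sub>v v = \<mu> \<cdot>\<^sub>v v"
  shows "R y *\<^sub>v (R z *\<^sub>v v) = \<mu> \<cdot>\<^sub>v (R z *\<^sub>v v)"
proof -
  have "R y *\<^sub>v (R z *\<^sub>v v) = (R z * R y) *\<^sub>v v"
    using assoc_mult_mat_vec[OF R_carrier R_carrier assms(3), of y z] R_commute[OF assms(1,2)] by simp
  also have "\<dots> = R z *\<^sub>v (\<mu> \<cdot>\<^sub>v v)"
    using assoc_mult_mat_vec[OF R_carrier R_carrier assms(3), of z y] assms(4) by simp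
  also have "\<dots> = \<mu> \<cdot>\<^sub>v (R z *\<^sub>v v)"
    by (rule mult_mat_vec[OF R_carrier assms(3)])
  finally show ?thesis .
qed

lemma common_eigenvector:
  assumes x: "x \<in> K" and e: "eigenvalue (R x) e" and m: "m \<le> n"
  shows "\<exists>\<mu>. \<exists>v\<in>carrier_vec n. v \<noteq> 0\<^sub>v n \<and> R x *\<^sub>v v = e \<cdot>\<^sub>v v \<and> (\<forall>i<m. R (b i) *\<^sub>v v = \<mu> i \<cdot>\<^sub>v v)"
  using m
proof (induction m)
  case 0
  then show ?case using e by (auto simp: eigenvalue_def eigenvector_def R_def)
next
  case (Suc m)
  then obtain \<mu> v where v: "v \<in> carrier_vec n" "v \<noteq> 0\<^sub>v n" "R x *\<^sub>v v = e \<cdot>\<^sub>v v"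
    "\<forall>i<m. R (b i) *\<^sub>v v = \<mu> i \<cdot>\<^sub>v v" by auto
  have bm: "b i \<in> K" if "i \<le> m" for i using b Suc.prems that by simp
  define U where "U = {u \<in> carrier_vec n. R x *\<^sub>v u = e \<cdot>\<^sub>v u \<and> (\<forall>i<m. R (b i) *\<^sub>v u = \<mu> i \<cdot>\<^sub>v u)}"
  have R0: "R z *\<^sub>v 0\<^sub>v n = c \<cdot>\<^sub>v 0\<^sub>v n" for z c by (intro eq_vecI) (auto simp: R_def)
  have "\<exists>w\<in>U. w \<noteq> 0\<^sub>v n \<and> (\<exists>\<nu>. R (b m) *\<^sub>v w = \<nu> \<cdot>\<^sub>v w)"
  proof (rule invariant_subspace_eigenvector[OF R_carrier v(1)])
    show "0\<^sub>v n \<in> U" using R0 by (auto simp: U_def)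
    show "v \<in> U" using v by (auto simp: U_def)
    show "y + z \<in> U" if "y \<in> U" "z \<in> U" for y z
      using that by (auto simp: U_def mult_add_distrib_mat_vec[OF R_carrier] smult_add_distrib_vec)
    show "c \<cdot>\<^sub>v y \<in> U" if "y \<in> U" for c y
      using that by (auto simp: U_def mult_mat_vec[OF R_carrier] smult_smult_assoc mult.commute)
    show "R (b m) *\<^sub>v y \<in> U" if "y \<in> U" for y
    proof -
      have "R (b m) *\<^sub>v y \<in> carrier_vec n" using that by (auto simp: U_def intro!: mult_mat_vec_carrier[OF R_carrier])
      then show ?thesis
        using that x bm mult_mat_vec_commute by (auto simp: U_def)
    qed
  qed (rule v(2))
  then obtain w \<nu> where w: "w \<in> U" "w \<noteq> 0\<^sub>v n" "R (b m) *\<^sub>v w = \<nu> \<cdot>\<^sub>v w" by blast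
  then show ?case
    by (intro exI[of _ "\<mu>(m := \<nu>)"] bexI[of _ w]) (auto simp: U_def less_Suc_eq)
qed

theorem eigenvalue_embedding:
  assumes x: "x \<in> K" and e: "eigenvalue (R x) e"
  shows "\<exists>\<sigma>. embedding K \<sigma> \<and> \<sigma> x = e"
proof -
  obtain \<mu> v where v: "v \<in> carrier_vec n" "v \<noteq> 0\<^sub>v n" "R x *\<^sub>v v = e \<cdot>\<^sub>v v"
    "\<forall>i<n. R (b i) *\<^sub>v v = \<mu> i \<cdot>\<^sub>v v"
    using common_eigenvector[OF assms, of n] by auto
  have "\<exists>\<rho>. R z *\<^sub>v v = \<rho> \<cdot>\<^sub>v v" if z: "z \<in> K" for z
  proof -
    obtain q where q: "z = (\<Sum>l<n. of_rat (q l) * b l)" using span[OF z] by blast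
    have "R z *\<^sub>v v = (\<Sum>l<n. of_rat (q l) * \<mu> l) \<cdot>\<^sub>v v"
    proof (rule eq_vecI)
      fix k assume "k < dim_vec ((\<Sum>l<n. of_rat (q l) * \<mu> l) \<cdot>\<^sub>v v)"
      then have k: "k < n" using v(1) by simp
      have Rk: "(R z *\<^sub>v v) $ k = (\<Sum>j<n. of_rat (M z k j) * v $ j)" for z
        using k v(1) by (auto simp: R_def scalar_prod_def atLeast0LessThan intro!: sum.cong)
      have "(R z *\<^sub>v v) $ k = (\<Sum>j<n. \<Sum>l<n. of_rat (q l) * (of_rat (M (b l) k j) * v $ j))"
        unfolding Rk using k
        by (simp add: M_linear[OF q] of_rat_sum of_rat_mult sum_distrib_right mult.assoc)
      also have "\<dots> = (\<Sum>l<n. of_rat (q l) * (R (b l) *\<^sub>v v) $ k)"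
        unfolding Rk by (subst sum.swap) (simp add: sum_distrib_left)
      also have "\<dots> = (\<Sum>l<n. of_rat (q l) * (\<mu> l * v $ k))"
        using v(1,4) k by (intro sum.cong) auto
      finally show "(R z *\<^sub>v v) $ k = ((\<Sum>l<n. of_rat (q l) * \<mu> l) \<cdot>\<^sub>v v) $ k"
        using v(1) k by (simp add: sum_distrib_right mult.assoc)
    qed (use v(1) in \<open>simp add: R_def\<close>)
    then show ?thesis by blast
  qed
  then obtain \<sigma> where \<sigma>: "\<And>z. z \<in> K \<Longrightarrow> R z *\<^sub>v v = \<sigma> z \<cdot>\<^sub>v v" by metis
  obtain k where k: "k < n" "v $ k \<noteq> 0"
    using v(1,2) by (metis carrier_vecD eq_vecI index_zero_vec)
  have uniq: "c = c'" if "c \<cdot>\<^sub>v v = c' \<cdot>\<^sub>v v" for c c'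
    using arg_cong[OF that, of "\<lambda>u. u $ k"] k v(1) by simp
  have "embedding K \<sigma>"
    unfolding embedding_def
  proof (intro conjI ballI)
    have "\<sigma> 1 \<cdot>\<^sub>v v = 1 \<cdot>\<^sub>v v" using \<sigma>[of 1] R_1 v(1) by simp
    then show "\<sigma> 1 = 1" by (rule uniq)
  next
    fix y z assume yz: "y \<in> K" "z \<in> K"
    have "\<sigma> (y + z) \<cdot>\<^sub>v v = (\<sigma> y + \<sigma> z) \<cdot>\<^sub>v v"
      using \<sigma>[of "y + z"] \<sigma>[OF yz(1)] \<sigma>[OF yz(2)] yz v(1)
      by (simp add: R_add add_mult_distrib_mat_vec[OF R_carrier R_carrier] add_smult_distrib_vec)
    then show "\<sigma> (y + z) = \<sigma> y + \<sigma> z" by (rule uniq)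
    have "R (y * z) *\<^sub>v v = R z *\<^sub>v (R y *\<^sub>v v)"
      using R_mult[OF yz] assoc_mult_mat_vec[OF R_carrier R_carrier v(1)] by simp
    also have "\<dots> = \<sigma> y \<cdot>\<^sub>v (\<sigma> z \<cdot>\<^sub>v v)"
      using \<sigma> yz v(1) mult_mat_vec[OF R_carrier v(1), of z "\<sigma> y"] by simp
    finally have "\<sigma> (y * z) \<cdot>\<^sub>v v = (\<sigma> y * \<sigma> z) \<cdot>\<^sub>v v"
      using \<sigma>[of "y * z"] yz by (simp add: smult_smult_assoc)
    then show "\<sigma> (y * z) = \<sigma> y * \<sigma> z" by (rule uniq)
  qed
  moreover have "\<sigma> x = e" using \<sigma>[OF x] v(3) by (intro uniq) simp
  ultimately show ?thesis by blast
qed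

lemma eigenvalue_self: "x \<in> K \<Longrightarrow> eigenvalue (R x) x"
proof -
  assume x: "x \<in> K"
  have "R x *\<^sub>v vec n b = x \<cdot>\<^sub>v vec n b"
    using M[OF x] by (intro eq_vecI) (auto simp: R_def scalar_prod_def atLeast0LessThan)
  moreover have "vec n b \<noteq> 0\<^sub>v n"
  proof
    assume "vec n b = 0\<^sub>v n"
    then have "b i = 0" if "i < n" for i using that by (metis index_vec index_zero_vec(1))
    then have "(\<Sum>i<n. of_rat 1 * b i) = 0" by simp
    then show False using indep[of "\<lambda>_. 1"] n by auto
  qed
  ultimately show ?thesis
    by (auto simp: eigenvalue_def eigenvector_def R_def intro!: exI[of _ "vec n b"])
qed

end

lemma coeff_linear_factors_bound:
  fixes es :: "complex list"
  assumes "\<And>e. e \<in> set es \<Longrightarrow> cmod e \<le> B" "0 \<le> B"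
  shows "cmod (coeff (\<Prod>a\<leftarrow>es. [:- a, 1:]) i) \<le> (1 + B) ^ length es"
  using assms(1)
proof (induction es arbitrary: i)
  case Nil
  then show ?case by (simp add: coeff_1)
next
  case (Cons e es)
  let ?q = "\<Prod>a\<leftarrow>es. [:- a, 1:]"
  have "coeff ([:- e, 1:] * ?q) i = - e * coeff ?q i + (case i of 0 \<Rightarrow> 0 | Suc j \<Rightarrow> coeff ?q j)"
    by (simp add: coeff_pCons split: nat.splits)
  moreover have "cmod (- e * x + y) \<le> cmod (e * x) + cmod y" for x y
    using norm_triangle_ineq[of "- e * x" y] by simp
  ultimately have "cmod (coeff ([:- e, 1:] * ?q) i) \<le> cmod (e * coeff ?q i) + cmod (case i of 0 \<Rightarrow> 0 | Suc j \<Rightarrow> coeff ?q j)"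
    by (simp only:)
  also have "\<dots> \<le> B * (1 + B) ^ length es + (1 + B) ^ length es"
    using Cons assms(2) by (intro add_mono) (auto simp: norm_mult intro!: mult_mono split: nat.splits)
  finally show ?case by (simp add: algebra_simps)
qed

theorem finite_bounded_algebraic_ints:
  assumes K: "number_field K"
  shows "finite {x \<in> K. algebraic_int x \<and> (\<forall>\<sigma>. embedding K \<sigma> \<longrightarrow> cmod (\<sigma> x) \<le> B)}" (is "finite ?T")
proof -
  have Ksub: "complex_subfield K"
    using K by (auto simp: number_field_def intro: complex_subfieldI)
  interpret complex_subfield K by (rule Ksub)
  obtain b :: "nat \<Rightarrow> complex" and n :: nat where b: "n > 0" "\<And>i. i < n \<Longrightarrow> b i \<in> K"
    "\<And>x. x \<in> K \<Longrightarrow> \<exists>c. x = (\<Sum>i<n. of_rat (c i) * b i)"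
    "\<And>c. (\<Sum>i<n. of_rat (c i) * b i) = 0 \<Longrightarrow> \<forall>i<n. c i = 0"
    by (rule number_field_basis[OF K]) (rule that)
  have "\<forall>z i. \<exists>c. z \<in> K \<longrightarrow> i < n \<longrightarrow> z * b i = (\<Sum>j<n. of_rat (c j) * b j)"
    using b(2,3) by (meson mult)
  then obtain M where M: "\<And>z i. z \<in> K \<Longrightarrow> i < n \<Longrightarrow> z * b i = (\<Sum>j<n. of_rat (M z i j) * b j)"
    by metis
  interpret number_field_regular K b n M
    by unfold_locales (fact b M)+
  interpret Q: complex_subring \<rat> by unfold_locales auto
  interpret AI: complex_subring "{x. algebraic_int x}" by (rule complex_subring_algebraic_int)
  define C where "C = (1 + max 0 B) ^ n"
  define D :: "complex set" where "D = of_int ` {z::int. \<bar>of_int z\<bar> \<le> C}"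
  have "{z::int. \<bar>of_int z\<bar> \<le> C} \<subseteq> {- \<lceil>C\<rceil>..\<lceil>C\<rceil>}" by (auto simp: abs_le_iff) linarith+
  then have "finite D" unfolding D_def using finite_subset by (intro finite_imageI) blast
  define P where "P = {p :: complex poly. degree p = n \<and> p \<noteq> 0 \<and> (\<forall>i. coeff p i \<in> D)}"
  have "finite P"
  proof (rule finite_subset)
    show "P \<subseteq> Poly ` {xs. set xs \<subseteq> D \<and> length xs = Suc n}"
    proof
      fix p assume p: "p \<in> P"
      then have "length (coeffs p) = Suc n" "set (coeffs p) \<subseteq> D"
        by (auto simp: P_def length_coeffs_degree coeffs_def)
      moreover have "p = Poly (coeffs p)" by simp
      ultimately show "p \<in> Poly ` {xs. set xs \<subseteq> D \<and> length xs = Suc n}" by blast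
    qed
    show "finite (Poly ` {xs. set xs \<subseteq> D \<and> length xs = Suc n})"
      using finite_lists_length_eq[OF \<open>finite D\<close>] by blast
  qed
  have "?T \<subseteq> (\<Union>p\<in>P. {x. poly p x = 0})"
  proof
    fix x assume x: "x \<in> ?T"
    then have xK: "x \<in> K" and xint: "algebraic_int x" by auto
    obtain es where es: "length es = n" "char_poly (R x) = (\<Prod>a\<leftarrow>es. [:- a, 1:])"
      "\<And>e. e \<in> set es \<longleftrightarrow> eigenvalue (R x) e"
      using mat_trace_pow_eigenvalues[OF R_carrier, of x] by metis
    have e: "algebraic_int e" "cmod e \<le> max 0 B" if ees: "e \<in> set es" for e
    proof -
      obtain \<sigma> where \<sigma>: "embedding K \<sigma>" "\<sigma> x = e"
        using eigenvalue_embedding[OF xK] es(3) ees by blast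
      interpret S: complex_embedding K \<sigma> using \<sigma>(1) by unfold_locales
      show "algebraic_int e" using S.emb_algebraic_int[OF xK xint] \<sigma>(2) by simp
      show "cmod e \<le> max 0 B" using x \<sigma> by (auto simp: le_max_iff_disj)
    qed
    have "(\<Prod>a\<leftarrow>es'. [:- a, 1:]) \<in> AI.polys" if "set es' \<subseteq> set es" for es'
      using that
    proof (induction es')
      case (Cons c es')
      have "[:- c, 1:] \<in> AI.polys"
        using Cons.prems e(1) by (auto simp: AI.polys_def coeff_pCons split: nat.splits)
      moreover have "(\<Prod>a\<leftarrow>es'. [:- a, 1:]) \<in> AI.polys" using Cons by simp
      ultimately show ?case unfolding list.map prod_list.Cons by (rule AI.polys_mult)
    qed (simp add: AI.polys_one)
    then have "char_poly (R x) \<in> AI.polys" using es(2) by simp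
    moreover have "char_poly (R x) \<in> Q.polys"
      by (rule Q.char_poly_in_polys[OF R_carrier]) (simp add: R_entry)
    ultimately have ints: "coeff (char_poly (R x)) i \<in> \<int>" for i
      by (auto simp: AI.polys_def Q.polys_def intro: rational_algebraic_int_is_int)
    have bd: "cmod (coeff (char_poly (R x)) i) \<le> C" for i
      using coeff_linear_factors_bound[of es "max 0 B" i] e(2) es(1,2) by (simp add: C_def)
    have "coeff (char_poly (R x)) i \<in> D" for i
    proof -
      obtain z where z: "coeff (char_poly (R x)) i = of_int z" using ints[of i] by (auto elim: Ints_cases)
      then show ?thesis using bd[of i] by (auto simp: D_def)
    qed
    moreover have "degree (char_poly (R x)) = n" "char_poly (R x) \<noteq> 0"
      using degree_monic_char_poly[OF R_carrier[of x]] by auto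
    ultimately have "char_poly (R x) \<in> P" by (simp add: P_def)
    moreover have "poly (char_poly (R x)) x = 0"
      using eigenvalue_self[OF xK] eigenvalue_root_char_poly[OF R_carrier] by blast
    ultimately show "x \<in> (\<Union>p\<in>P. {x. poly p x = 0})" by blast
  qed
  moreover have "finite (\<Union>p\<in>P. {x. poly p x = 0})"
    using \<open>finite P\<close> by (auto intro!: poly_roots_finite simp: P_def)
  ultimately show ?thesis by (rule finite_subset)
qed

theorem finite_traces:
  assumes K: "number_field K" and F: "F \<subseteq> mats d K"
    and sub: "subexponential K d (set_power d F)"
  shows "finite (mat_trace ` (\<Union>n. set_power d F n))"
proof (rule finite_subset)
  have Ksub: "complex_subfield K"
    using K by (auto simp: number_field_def intro: complex_subfieldI)
  interpret complex_subfield K by (rule Ksub)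
  interpret AI: complex_subring "{x. algebraic_int x}" by (rule complex_subring_algebraic_int)
  have Fc: "F \<subseteq> carrier_mat d d" using F by (auto simp: mats_def)
  let ?T = "{x \<in> K. algebraic_int x \<and> (\<forall>\<sigma>. embedding K \<sigma> \<longrightarrow> cmod (\<sigma> x) \<le> real d)}"
  show "finite ?T" by (rule finite_bounded_algebraic_ints[OF K])
  show "mat_trace ` (\<Union>n. set_power d F n) \<subseteq> ?T"
  proof
    fix x assume "x \<in> mat_trace ` (\<Union>n. set_power d F n)"
    then obtain n s where s: "s \<in> set_power d F n" "x = mat_trace s" by blast
    have sK: "s \<in> mats d K" using set_power_mats[OF Ksub F] s(1) by blast
    then have sc: "s \<in> carrier_mat d d" by (simp add: mats_def)
    have xs: "x = (\<Sum>i<d. s $$ (i, i))" using sc s(2) by (simp add: mat_trace_def)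
    have xK: "x \<in> K" unfolding xs by (intro sum mats_entry[OF sK]) auto
    obtain es where es: "\<And>e. e \<in> set es \<longleftrightarrow> eigenvalue s e" "\<And>k. mat_trace (s ^\<^sub>m k) = (\<Sum>e\<leftarrow>es. e ^ k)"
      using mat_trace_pow_eigenvalues[OF sc] by metis
    have "x = (\<Sum>e\<leftarrow>es. e)" using es(2)[of 1] sc s(2) by simp
    moreover have "(\<Sum>e\<leftarrow>es'. e) \<in> {x. algebraic_int x}" if "set es' \<subseteq> set es" for es'
      using that eigenvalue_algebraic_int[OF K F sub s(1)] es(1)
      by (induction es') (auto intro!: AI.add[simplified])
    ultimately have xint: "algebraic_int x" by simp
    have "cmod (\<sigma> x) \<le> real d" if \<sigma>: "embedding K \<sigma>" for \<sigma>
    proof -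
      interpret S: complex_embedding K \<sigma> using \<sigma> by unfold_locales
      let ?s = "map_mat \<sigma> s"
      have sc': "?s \<in> carrier_mat d d" using sc by simp
      obtain es where es: "length es = d" "\<And>e. e \<in> set es \<longleftrightarrow> eigenvalue ?s e" "\<And>k. mat_trace (?s ^\<^sub>m k) = (\<Sum>e\<leftarrow>es. e ^ k)"
        using mat_trace_pow_eigenvalues[OF sc'] by metis
      have le1: "cmod e \<le> 1" if e: "e \<in> set es" for e
      proof (rule ccontr)
        assume "\<not> cmod e \<le> 1"
        then have L: "ln (cmod e) > 0" by (intro ln_gt_zero) simp
        define \<epsilon> where "\<epsilon> = ln (cmod e) / (2 * real (Suc n))"
        have \<epsilon>: "\<epsilon> > 0" using L by (simp add: \<epsilon>_def)
        obtain N where N: "\<And>m u i j. m \<ge> N \<Longrightarrow> u \<in> set_power d F m \<Longrightarrow> i < d \<Longrightarrow> j < d \<Longrightarrow>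
            restrict (\<lambda>x. cmod (\<sigma> x)) K (u $$ (i, j)) \<le> exp (\<epsilon> * real m)"
          using sub S.emb_standard_abs \<epsilon> unfolding subexponential_def by meson
        have pow: "cmod e ^ k \<le> real d * exp (\<epsilon> * real (n * k))" if k: "n * k \<ge> N \<or> n = 0" for k
        proof -
          have u: "s ^\<^sub>m k \<in> set_power d F (n * k)" by (rule pow_in_set_power[OF Fc s(1)])
          have uc: "s ^\<^sub>m k \<in> carrier_mat d d" using sc by simp
          have "cmod (e ^ k) \<le> real d * exp (\<epsilon> * real (n * k))"
          proof (rule eigenvalue_cmod_le)
            show "?s ^\<^sub>m k \<in> carrier_mat d d" using sc' by simp
            show "eigenvalue (?s ^\<^sub>m k) (e ^ k)" using eigenvalue_pow[OF sc'] es(2) e by blast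
            fix i j assume ij: "i < d" "j < d"
            have ent: "(?s ^\<^sub>m k) $$ (i, j) = \<sigma> ((s ^\<^sub>m k) $$ (i, j))"
              unfolding S.map_mat_emb_pow(2)[OF sK, symmetric] using uc ij by (simp add: carrier_matD[OF uc] carrier_matD[OF sc])
            show "cmod ((?s ^\<^sub>m k) $$ (i, j)) \<le> exp (\<epsilon> * real (n * k))"
            proof (cases "n = 0")
              case True
              then have "s = 1\<^sub>m d" using s(1) by simp
              then have "s ^\<^sub>m k = 1\<^sub>m d" by (induction k) auto
              then have "cmod ((?s ^\<^sub>m k) $$ (i, j)) \<le> 1" unfolding ent using ij by simp
              also have "1 \<le> exp (\<epsilon> * real (n * k))" using \<epsilon> by simp
              finally show ?thesis .
            next
              case False
              then show ?thesis
                using N[OF _ u ij] k mats_entry[OF S.map_mat_emb_pow(1)[OF sK] ij, of k] unfolding ent by simp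
            qed
          qed
          then show ?thesis by (simp add: norm_power)
        qed
        have half: "exp (ln (cmod e) / 2 * real k) \<le> real d" if k: "n * k \<ge> N \<or> n = 0" for k
        proof -
          have "exp (ln (cmod e) * real k) = cmod e ^ k"
            using L by (simp add: exp_of_nat2_mult) (metis exp_ln exp_of_nat2_mult ln_eq_zero_iff less_irrefl zero_less_norm_iff ln_0 norm_eq_zero)
          also have "\<dots> \<le> real d * exp (\<epsilon> * real (n * k))" by (rule pow[OF k])
          also have "\<dots> \<le> real d * exp (ln (cmod e) / 2 * real k)"
          proof -
            have "\<epsilon> * real (n * k) = ln (cmod e) / 2 * real k * (real n / real (Suc n))"
              by (simp add: \<epsilon>_def)
            also have "\<dots> \<le> ln (cmod e) / 2 * real k * 1"
              using L by (intro mult_left_mono) auto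
            finally show ?thesis by (intro mult_left_mono) auto
          qed
          finally have "exp (ln (cmod e) / 2 * real k) * exp (ln (cmod e) / 2 * real k) \<le> real d * exp (ln (cmod e) / 2 * real k)"
            by (simp add: exp_add[symmetric] field_simps)
          then show ?thesis by simp
        qed
        have "eventually (\<lambda>k. exp (ln (cmod e) / 2 * real k) > real d) sequentially"
          using L by real_asymp
        then obtain k0 where k0: "\<And>k. k \<ge> k0 \<Longrightarrow> exp (ln (cmod e) / 2 * real k) > real d"
          by (auto simp: eventually_sequentially)
        define k where "k = max k0 N"
        have "n * k \<ge> N \<or> n = 0" by (cases n) (auto simp: k_def)
        then show False using half[of k] k0[of k] by (simp add: k_def)
      qed
      have "\<sigma> x = (\<Sum>i<d. \<sigma> (s $$ (i, i)))"
        unfolding xs using mats_entry[OF sK] by (intro S.emb_sum) auto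
      also have "\<dots> = mat_trace ?s" using sc by (simp add: mat_trace_def)
      also have "\<dots> = (\<Sum>e\<leftarrow>es. e)" using es(3)[of 1] sc' by simp
      finally have "cmod (\<sigma> x) = cmod (\<Sum>e\<leftarrow>es. e)" by simp
      also have "\<dots> \<le> (\<Sum>e\<leftarrow>es. cmod e)" by (induction es) (auto intro: norm_triangle_le)
      also have "\<dots> \<le> (\<Sum>e\<leftarrow>es. 1)" using le1 by (intro sum_list_mono) auto
      also have "\<dots> = real d" using es(1) by (simp add: sum_list_triv)
      finally show ?thesis .
    qed
    then show "x \<in> ?T" using xK xint by blast
  qed
qed

section \<open>Growth of matrix products\<close>

lemma fekete:
  fixes u :: "nat \<Rightarrow> real"
  assumes nonneg: "\<And>n. 0 \<le> u n" and c: "0 \<le> c" and sub: "\<And>m n. u (m + n) \<le> u m + u n + c"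
  shows "\<exists>L\<ge>0. (\<lambda>n. u n / real n) \<longlonglongrightarrow> L"
proof -
  define w where "w n = u n + c" for n
  have w: "0 \<le> w n" "w (m + n) \<le> w m + w n" for m n
    using nonneg[of n] c sub[of m n] by (auto simp: w_def)
  have mult: "w (q * k + r) \<le> real q * w k + w r" for q k r
  proof (induction q)
    case (Suc q)
    have "w (Suc q * k + r) \<le> w k + w (q * k + r)"
      using w(2)[of k "q * k + r"] by (simp add: add.assoc)
    then show ?case using Suc by (simp add: algebra_simps)
  qed simp
  define L where "L = (INF n\<in>{1..}. w n / real n)"
  have bdd: "bdd_below ((\<lambda>n. w n / real n) ` {1..})"
    using w by (intro bdd_belowI2[of _ 0]) auto
  have L_le: "L \<le> w n / real n" if "n \<ge> 1" for n
    unfolding L_def using that by (intro cINF_lower[OF bdd]) auto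
  have L0: "L \<ge> 0" unfolding L_def using w by (intro cINF_greatest) auto
  have "(\<lambda>n. w n / real n) \<longlonglongrightarrow> L"
  proof (rule LIMSEQ_I)
    fix e :: real assume e: "e > 0"
    have "\<exists>k\<in>{1..}. w k / real k < L + e / 2"
      using e cINF_less_iff[OF _ bdd, of "L + e / 2"] by (auto simp: L_def)
    then obtain k where k: "k \<ge> 1" "w k / real k < L + e / 2" by auto
    define M where "M = Max (w ` {..<k})"
    have M: "w r \<le> M" if "r < k" for r unfolding M_def using that by (intro Max_ge) auto
    have M0: "M \<ge> 0" using M[of 0] w(1)[of 0] k by simp
    obtain N :: nat where N: "real N > 2 * M / e" using reals_Archimedean2 by blast
    have "norm (w n / real n - L) < e" if n: "n \<ge> max 1 N" for n
    proof -
      have n1: "real n \<ge> 1" "real n \<ge> real N" using n by auto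
      have "w n \<le> real (n div k) * w k + w (n mod k)"
        using mult[of "n div k" k "n mod k"] by simp
      also have "\<dots> \<le> real n / real k * w k + M"
        using k w(1)[of k] M[of "n mod k"] of_nat_div_le_of_nat[of n k, where ?'a = real] by (intro add_mono mult_right_mono) auto
      finally have "w n / real n \<le> (real n / real k * w k + M) / real n"
        using n1 by (intro divide_right_mono) auto
      also have "\<dots> = w k / real k + M / real n"
        using n1 by (simp add: field_simps)
      also have "M / real n < e / 2"
      proof -
        have "2 * M < e * real N" using N e by (simp add: field_simps)
        also have "\<dots> \<le> e * real n" using n1 e by (intro mult_left_mono) auto
        finally show ?thesis using n1 by (simp add: field_simps)
      qed
      finally have "w n / real n < L + e" using k by linarith
      then show ?thesis using L_le[of n] n by auto
    qed
    then show "\<exists>N. \<forall>n\<ge>N. norm (w n / real n - L) < e" by blast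
  qed
  moreover have "(\<lambda>n. c / real n) \<longlonglongrightarrow> 0" by real_asymp
  ultimately have "(\<lambda>n. w n / real n - c / real n) \<longlonglongrightarrow> L - 0" by (rule tendsto_diff)
  moreover have "w n / real n - c / real n = u n / real n" for n
    by (simp add: w_def add_divide_distrib)
  ultimately show ?thesis using L0 by auto
qed

lemma log_plus_nonneg [simp]: "0 \<le> log_plus x"
  by (simp add: log_plus_def)

lemma log_plus_le_iff: "0 \<le> x \<Longrightarrow> 0 \<le> y \<Longrightarrow> log_plus x \<le> y \<longleftrightarrow> x \<le> exp y"
proof (cases "x = 0")
  case False
  assume "0 \<le> x" "0 \<le> y"
  then show ?thesis using False ln_le_cancel_iff[of x "exp y"] by (simp add: log_plus_def)
qed (simp add: log_plus_def)

lemma log_plus_exp: "0 \<le> x \<Longrightarrow> x \<le> exp (log_plus x)"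
  using log_plus_le_iff[of x "log_plus x"] by simp

lemma log_plus_mono: "0 \<le> x \<Longrightarrow> x \<le> y \<Longrightarrow> log_plus x \<le> log_plus y"
  using log_plus_exp[of y] by (simp add: log_plus_le_iff)

lemma log_plus_mult: "0 \<le> x \<Longrightarrow> 0 \<le> y \<Longrightarrow> log_plus (x * y) \<le> log_plus x + log_plus y"
  using log_plus_exp[of x] log_plus_exp[of y]
  by (subst log_plus_le_iff) (auto simp: exp_add intro!: mult_mono)

lemma log_plus_eq_0: "0 \<le> x \<Longrightarrow> x \<le> 1 \<Longrightarrow> log_plus x = 0"
  using log_plus_le_iff[of x 0] log_plus_nonneg[of x] by simp

context valued_subfield
begin

definition mat_norm :: "nat \<Rightarrow> complex mat \<Rightarrow> real" where
  "mat_norm d X = Max (insert 0 ((\<lambda>(i, j). a (X $$ (i, j))) ` ({..<d} \<times> {..<d})))"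

lemma mat_norm_nonneg [simp]: "0 \<le> mat_norm d X"
  by (simp add: mat_norm_def)

lemma entry_le_mat_norm: "i < d \<Longrightarrow> j < d \<Longrightarrow> a (X $$ (i, j)) \<le> mat_norm d X"
  unfolding mat_norm_def by (intro Max_ge) auto

lemma mat_norm_leI:
  assumes "0 \<le> B" "\<And>i j. i < d \<Longrightarrow> j < d \<Longrightarrow> a (X $$ (i, j)) \<le> B"
  shows "mat_norm d X \<le> B"
  unfolding mat_norm_def using assms by (subst Max_le_iff) auto

lemma mats_mult:
  assumes "X \<in> mats d K" "Y \<in> mats d K" shows "X * Y \<in> mats d K"
proof -
  have "X * (Y * 1\<^sub>m d) \<in> set_power d {X, Y} (Suc (Suc 0))" by auto
  moreover have "set_power d {X, Y} (Suc (Suc 0)) \<subseteq> mats d K"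
    using assms by (intro set_power_mats[OF complex_subfield_axioms]) auto
  moreover have "Y * 1\<^sub>m d = Y" using assms by (auto simp: mats_def)
  ultimately show ?thesis by auto
qed

lemma mats_one: "1\<^sub>m d \<in> mats d K"
  by (rule matsI) auto

lemma mats_minus: "X \<in> mats d K \<Longrightarrow> Y \<in> mats d K \<Longrightarrow> X - Y \<in> mats d K"
proof (rule matsI)
  assume XY: "X \<in> mats d K" "Y \<in> mats d K"
  show "X - Y \<in> carrier_mat d d" using mats_subset_carrier[OF XY(2)] by auto
  show "(X - Y) $$ (i, j) \<in> K" if "i < d" "j < d" for i j
    using that mats_entry[OF XY(1) that] mats_entry[OF XY(2) that] carrier_matD[OF mats_subset_carrier[OF XY(2)]]
    by simp
qed

lemma mat_prod_mats: "set xs \<subseteq> mats d K \<Longrightarrow> mat_prod d xs \<in> mats d K"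
  by (induction xs) (auto simp: mats_one mats_mult)

lemma mat_norm_add:
  assumes "X \<in> mats d K" "Y \<in> mats d K"
  shows "mat_norm d (X + Y) \<le> mat_norm d X + mat_norm d Y"
proof (rule mat_norm_leI)
  fix i j assume ij: "i < d" "j < d"
  have "a ((X + Y) $$ (i, j)) = a (X $$ (i, j) + Y $$ (i, j))"
    using ij carrier_matD[OF mats_subset_carrier[OF assms(2)]] by simp
  also have "\<dots> \<le> a (X $$ (i, j)) + a (Y $$ (i, j))"
    using ij mats_entry assms by (intro abs_add) blast+
  also have "\<dots> \<le> mat_norm d X + mat_norm d Y"
    using ij entry_le_mat_norm by (intro add_mono) auto
  finally show "a ((X + Y) $$ (i, j)) \<le> mat_norm d X + mat_norm d Y" .
qed simp

lemma norm_const_ge_one: "d \<ge> 1 \<Longrightarrow> norm_const d \<ge> 1"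
  using mult_mono[of 1 "real d" 1 "real d"] by (auto simp: norm_const_def)

lemma mat_norm_mult:
  assumes d: "d \<ge> 1" and X: "X \<in> mats d K" and Y: "Y \<in> mats d K"
  shows "mat_norm d (X * Y) \<le> norm_const d * mat_norm d X * mat_norm d Y"
proof (rule mat_norm_leI)
  let ?B = "mat_norm d X * mat_norm d Y"
  show "0 \<le> norm_const d * mat_norm d X * mat_norm d Y"
    using norm_const_ge_one[OF d] by simp
  fix i j assume ij: "i < d" "j < d"
  have entry: "(X * Y) $$ (i, j) = (\<Sum>k<d. X $$ (i, k) * Y $$ (k, j))"
    using ij mats_subset_carrier[OF X] mats_subset_carrier[OF Y] by (auto simp: scalar_prod_def atLeast0LessThan)
  have inK: "X $$ (i, k) * Y $$ (k, j) \<in> K" if "k < d" for k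
    using ij that mats_entry[OF X] mats_entry[OF Y] by simp
  have le: "a (X $$ (i, k) * Y $$ (k, j)) \<le> ?B" if "k < d" for k
    using ij that mats_entry[OF X ij(1) that] mats_entry[OF Y that ij(2)] entry_le_mat_norm
    by (simp add: abs_mult mult_mono)
  show "a ((X * Y) $$ (i, j)) \<le> norm_const d * mat_norm d X * mat_norm d Y"
  proof (cases "ultrametric K a")
    case True
    then show ?thesis
      unfolding entry norm_const_def using inK le by (auto intro!: ultrametric_sum)
  next
    case False
    have "a ((X * Y) $$ (i, j)) \<le> (\<Sum>k<d. a (X $$ (i, k) * Y $$ (k, j)))"
      unfolding entry using inK by (intro abs_sum) auto
    also have "\<dots> \<le> (\<Sum>k<d. ?B)" using le by (intro sum_mono) auto
    also have "\<dots> = real d * ?B" by simp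
    also have "\<dots> \<le> real d * real d * ?B"
      using d mult_mono[of 1 "real d" "real d * ?B" "real d * ?B"] by (simp add: mult.assoc)
    finally show ?thesis using False by (simp add: norm_const_def mult.assoc)
  qed
qed

text \<open>
  If all products of \<open>d\<close> elements of \<open>U\<close> vanish, then \<open>X\<close> can be renormed so that right multiplication by an
  element of \<open>U\<close> has norm at most \<open>\<delta>\<close>: take the maximum of \<open>\<delta>\<^sup>-\<^sup>j \<parallel>X u\<^sub>1 \<dots> u\<^sub>j\<parallel>\<close> over \<open>j < d\<close>.
\<close>

definition scaled_norm :: "nat \<Rightarrow> complex mat set \<Rightarrow> real \<Rightarrow> complex mat \<Rightarrow> real" where
  "scaled_norm d U \<delta> X =
     Max ((\<lambda>xs. mat_norm d (X * mat_prod d xs) / \<delta> ^ length xs) ` {xs. set xs \<subseteq> U \<and> length xs < d})"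

context
  fixes d :: nat and U :: "complex mat set" and \<delta> :: real
  assumes d: "d \<ge> 1" and U: "finite U" "U \<subseteq> mats d K" and \<delta>: "\<delta> > 0"
    and nil: "\<And>xs. set xs \<subseteq> U \<Longrightarrow> length xs = d \<Longrightarrow> mat_prod d xs = 0\<^sub>m d d"
begin

lemma finite_short_lists: "finite {xs. set xs \<subseteq> U \<and> length xs < d}"
  by (rule finite_subset[OF _ finite_lists_length_le[OF U(1), of d]]) auto

lemma scaled_norm_ge:
  "set xs \<subseteq> U \<Longrightarrow> length xs < d \<Longrightarrow> mat_norm d (X * mat_prod d xs) / \<delta> ^ length xs \<le> scaled_norm d U \<delta> X"
  unfolding scaled_norm_def using finite_short_lists by (intro Max_ge) auto

lemma scaled_norm_leI:
  assumes "\<And>xs. set xs \<subseteq> U \<Longrightarrow> length xs < d \<Longrightarrow> mat_norm d (X * mat_prod d xs) / \<delta> ^ length xs \<le> B"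
  shows "scaled_norm d U \<delta> X \<le> B"
proof -
  have "{xs. set xs \<subseteq> U \<and> length xs < d} \<noteq> {}" using d by (auto intro: exI[of _ "[]"])
  then show ?thesis
    unfolding scaled_norm_def using finite_short_lists assms by (subst Max_le_iff) auto
qed

lemma mat_norm_le_scaled_norm: "X \<in> mats d K \<Longrightarrow> mat_norm d X \<le> scaled_norm d U \<delta> X"
  using scaled_norm_ge[of "[]" X] d mats_subset_carrier[of X d K] by simp

lemma scaled_norm_step:
  assumes X: "X \<in> mats d K" and u: "u \<in> U"
  shows "scaled_norm d U \<delta> (X + X * u) \<le> (1 + \<delta>) * scaled_norm d U \<delta> X"
proof (rule scaled_norm_leI)
  fix xs assume xs: "set xs \<subseteq> U" "length xs < d"
  let ?P = "mat_prod d xs"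
  have uK: "u \<in> mats d K" using u U by blast
  have P: "?P \<in> mats d K" using xs U by (intro mat_prod_mats) auto
  note c = mats_subset_carrier[OF X] mats_subset_carrier[OF uK] mats_subset_carrier[OF P]
  have s0: "0 \<le> scaled_norm d U \<delta> X"
    using mat_norm_le_scaled_norm[OF X] mat_norm_nonneg[of d X] by linarith
  have "(X + X * u) * ?P = X * ?P + (X * u) * ?P"
    using c by (intro add_mult_distrib_mat[of _ d d]) auto
  also have "(X * u) * ?P = X * mat_prod d (u # xs)"
    using assoc_mult_mat[OF c] by simp
  finally have "mat_norm d ((X + X * u) * ?P) \<le> mat_norm d (X * ?P) + mat_norm d (X * mat_prod d (u # xs))"
    using mat_norm_add[of "X * ?P" d "X * mat_prod d (u # xs)"] X P uK by (simp add: mats_mult)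
  then have "mat_norm d ((X + X * u) * ?P) / \<delta> ^ length xs \<le>
      mat_norm d (X * ?P) / \<delta> ^ length xs + mat_norm d (X * mat_prod d (u # xs)) / \<delta> ^ length xs"
    using \<delta> by (simp add: add_divide_distrib[symmetric] divide_right_mono)
  also have "\<dots> \<le> scaled_norm d U \<delta> X + \<delta> * scaled_norm d U \<delta> X"
  proof (rule add_mono)
    show "mat_norm d (X * ?P) / \<delta> ^ length xs \<le> scaled_norm d U \<delta> X" using xs by (rule scaled_norm_ge)
    show "mat_norm d (X * mat_prod d (u # xs)) / \<delta> ^ length xs \<le> \<delta> * scaled_norm d U \<delta> X"
    proof (cases "Suc (length xs) < d")
      case True
      then have "mat_norm d (X * mat_prod d (u # xs)) / \<delta> ^ length (u # xs) \<le> scaled_norm d U \<delta> X"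
        using xs u by (intro scaled_norm_ge) auto
      then show ?thesis using \<delta> by (simp add: field_simps del: mat_prod_Cons)
    next
      case False
      then have "mat_prod d (u # xs) = 0\<^sub>m d d" using xs u by (intro nil) auto
      then have "X * mat_prod d (u # xs) = 0\<^sub>m d d" using c(1) by simp
      moreover have "mat_norm d (0\<^sub>m d d) \<le> 0" by (rule mat_norm_leI) auto
      ultimately have "mat_norm d (X * mat_prod d (u # xs)) \<le> 0" by simp
      then have "mat_norm d (X * mat_prod d (u # xs)) / \<delta> ^ length xs \<le> 0"
        using \<delta> by (simp add: divide_nonpos_pos)
      also have "0 \<le> \<delta> * scaled_norm d U \<delta> X" using \<delta> s0 by simp
      finally show ?thesis .
    qed
  qed
  finally show "mat_norm d ((X + X * u) * ?P) / \<delta> ^ length xs \<le> (1 + \<delta>) * scaled_norm d U \<delta> X"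
    by (simp add: distrib_right)
qed

lemma scaled_norm_prod:
  assumes hs: "set hs \<subseteq> mats d K" "(\<lambda>h. h - 1\<^sub>m d) ` set hs \<subseteq> U" and X: "X \<in> mats d K"
  shows "scaled_norm d U \<delta> (X * mat_prod d hs) \<le> (1 + \<delta>) ^ length hs * scaled_norm d U \<delta> X"
  using hs X
proof (induction hs arbitrary: X)
  case Nil
  then show ?case using mats_subset_carrier[of X d K] by simp
next
  case (Cons h hs)
  have h: "h \<in> mats d K" "h - 1\<^sub>m d \<in> U" using Cons.prems by auto
  note c = mats_subset_carrier[OF Cons.prems(3)] mats_subset_carrier[OF h(1)]
  have "X * h = X + X * (h - 1\<^sub>m d)"
    using mat_distribs(2)[OF c(2) one_carrier_mat c(1)] c by (intro eq_matI) auto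
  then have step: "scaled_norm d U \<delta> (X * h) \<le> (1 + \<delta>) * scaled_norm d U \<delta> X"
    using scaled_norm_step[OF Cons.prems(3) h(2)] by simp
  have Pc: "mat_prod d hs \<in> carrier_mat d d"
    using mats_subset_carrier[OF mat_prod_mats[of hs d]] Cons.prems(1) by simp
  have "X * mat_prod d (h # hs) = (X * h) * mat_prod d hs"
    using assoc_mult_mat[OF c Pc] by simp
  also have "scaled_norm d U \<delta> \<dots> \<le> (1 + \<delta>) ^ length hs * scaled_norm d U \<delta> (X * h)"
    using Cons h by (intro Cons.IH) (auto simp: mats_mult)
  also have "\<dots> \<le> (1 + \<delta>) ^ length hs * ((1 + \<delta>) * scaled_norm d U \<delta> X)"
    using step \<delta> by (intro mult_left_mono) auto
  finally show ?case by (simp add: mult_ac)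
qed

end

lemma unipotent_product_growth:
  assumes d: "d \<ge> 1" and E: "finite E" "E \<subseteq> mats d K" and T: "finite T" "T \<subseteq> mats d K"
    and nil: "\<And>xs. set xs \<subseteq> (\<lambda>h. h - 1\<^sub>m d) ` E \<Longrightarrow> length xs = d \<Longrightarrow> mat_prod d xs = 0\<^sub>m d d"
    and \<delta>: "\<delta> > 0"
  obtains B where "B \<ge> 1"
    "\<And>hs c. set hs \<subseteq> E \<Longrightarrow> c \<in> T \<Longrightarrow> mat_norm d (mat_prod d hs * c) \<le> B * (1 + \<delta>) ^ length hs"
proof -
  let ?U = "(\<lambda>h. h - 1\<^sub>m d) ` E"
  have U: "finite ?U" "?U \<subseteq> mats d K" using E mats_one by (auto intro!: mats_minus)
  define M where "M = Max (insert 0 (mat_norm d ` T))"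
  have M: "mat_norm d c \<le> M" if "c \<in> T" for c unfolding M_def using that T by (intro Max_ge) auto
  have M0: "0 \<le> M" unfolding M_def using T by (intro Max_ge) auto
  define S where "S = scaled_norm d ?U \<delta> (1\<^sub>m d)"
  have S0: "0 \<le> S"
    using mat_norm_le_scaled_norm[OF d U \<delta> nil mats_one] mat_norm_nonneg[of d "1\<^sub>m d"] unfolding S_def by linarith
  define B where "B = norm_const d * S * M + 1"
  note nc = norm_const_ge_one[OF d]
  show thesis
  proof (rule that[of B])
    show "B \<ge> 1" using nc S0 M0 by (simp add: B_def)
    fix hs c assume hs: "set hs \<subseteq> E" and c: "c \<in> T"
    have hsK: "set hs \<subseteq> mats d K" using hs E by auto
    have P: "mat_prod d hs \<in> mats d K" using hsK by (rule mat_prod_mats)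
    have one: "1\<^sub>m d * mat_prod d hs = mat_prod d hs" using mats_subset_carrier[OF P] by simp
    have "mat_norm d (mat_prod d hs) \<le> scaled_norm d ?U \<delta> (mat_prod d hs)"
      by (rule mat_norm_le_scaled_norm[OF d U \<delta> nil P])
    also have "\<dots> \<le> (1 + \<delta>) ^ length hs * S"
      using scaled_norm_prod[OF d U \<delta> nil hsK _ mats_one] hs unfolding one S_def by blast
    finally have PS: "mat_norm d (mat_prod d hs) \<le> (1 + \<delta>) ^ length hs * S" .
    have "mat_norm d (mat_prod d hs * c) \<le> norm_const d * mat_norm d (mat_prod d hs) * mat_norm d c"
      using c T P by (intro mat_norm_mult[OF d]) auto
    also have "\<dots> \<le> norm_const d * ((1 + \<delta>) ^ length hs * S) * M"
      using PS M[OF c] nc S0 \<delta> by (intro mult_mono mult_nonneg_nonneg) auto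
    also have "\<dots> = (norm_const d * S * M) * (1 + \<delta>) ^ length hs" by (simp add: mult_ac)
    also have "\<dots> \<le> B * (1 + \<delta>) ^ length hs"
      using \<delta> unfolding B_def by (intro mult_right_mono) auto
    finally show "mat_norm d (mat_prod d hs * c) \<le> B * (1 + \<delta>) ^ length hs" .
  qed
qed

section \<open>Local growth rates\<close>

definition entry_norm :: "nat \<Rightarrow> complex mat set \<Rightarrow> real" where
  "entry_norm d G = Max (insert 0 (mat_norm d ` G))"

context
  fixes d :: nat and F :: "complex mat set"
  assumes d: "d \<ge> 1" and F: "finite F" "F \<subseteq> mats d K"
begin

lemma power_mats: "set_power d F n \<subseteq> mats d K"
  by (rule set_power_mats[OF complex_subfield_axioms F(2)])

lemma entry_norm_nonneg [simp]: "0 \<le> entry_norm d (set_power d F n)"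
  using finite_set_power[OF F(1)] by (simp add: entry_norm_def)

lemma mat_norm_le_entry_norm: "X \<in> set_power d F n \<Longrightarrow> mat_norm d X \<le> entry_norm d (set_power d F n)"
  unfolding entry_norm_def using finite_set_power[OF F(1)] by (intro Max_ge) auto

lemma entry_norm_leI:
  "0 \<le> B \<Longrightarrow> (\<And>X. X \<in> set_power d F n \<Longrightarrow> mat_norm d X \<le> B) \<Longrightarrow> entry_norm d (set_power d F n) \<le> B"
  unfolding entry_norm_def using finite_set_power[OF F(1)] by (subst Max_le_iff) auto

lemma set_norm_bounds:
  shows "0 \<le> set_norm K a d (set_power d F n)"
    and "entry_norm d (set_power d F n) \<le> set_norm K a d (set_power d F n)"
    and "set_norm K a d (set_power d F n) \<le> norm_const d * entry_norm d (set_power d F n)"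
proof -
  let ?o = "\<lambda>X. op_norm K a d (map_mat (to_completion K a) X)"
  note fin = finite_set_power[OF F(1), of d n]
  show nn: "0 \<le> set_norm K a d (set_power d F n)"
    unfolding set_norm_def using fin by (intro Max_ge) auto
  show "entry_norm d (set_power d F n) \<le> set_norm K a d (set_power d F n)"
  proof (rule entry_norm_leI[OF nn], rule mat_norm_leI[OF nn])
    fix X i j assume X: "X \<in> set_power d F n" and ij: "i < d" "j < d"
    then have XK: "X \<in> mats d K" using power_mats by blast
    have "a (X $$ (i, j)) \<le> ?o X"
      using op_norm_bounds(2)[OF d XK entry_le_mat_norm ij] by simp
    also have "\<dots> \<le> set_norm K a d (set_power d F n)"
      unfolding set_norm_def using X fin by (intro Max_ge) auto
    finally show "a (X $$ (i, j)) \<le> set_norm K a d (set_power d F n)" .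
  qed
  have "?o X \<le> norm_const d * entry_norm d (set_power d F n)" if X: "X \<in> set_power d F n" for X
  proof -
    have XK: "X \<in> mats d K" using power_mats X by blast
    show ?thesis
    proof (rule op_norm_bounds(1)[OF d XK])
      show "a (X $$ (i, j)) \<le> entry_norm d (set_power d F n)" if "i < d" "j < d" for i j
        using entry_le_mat_norm[OF that, of X] mat_norm_le_entry_norm[OF X] by linarith
    qed
  qed
  then show "set_norm K a d (set_power d F n) \<le> norm_const d * entry_norm d (set_power d F n)"
    unfolding set_norm_def using fin norm_const_ge_one[OF d] by (subst Max_le_iff) auto
qed

lemma entry_norm_mult:
  "entry_norm d (set_power d F (m + n)) \<le>
    norm_const d * entry_norm d (set_power d F m) * entry_norm d (set_power d F n)"
proof (rule entry_norm_leI)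
  let ?e = "\<lambda>n. entry_norm d (set_power d F n)"
  show "0 \<le> norm_const d * ?e m * ?e n" using norm_const_ge_one[OF d] by simp
  fix X assume "X \<in> set_power d F (m + n)"
  moreover have "F \<subseteq> carrier_mat d d" using F(2) by (auto simp: mats_def)
  ultimately obtain A B where X: "X = A * B" "A \<in> set_power d F m" "B \<in> set_power d F n"
    using set_power_add(2) by blast
  then have AB: "A \<in> mats d K" "B \<in> mats d K" using power_mats by blast+
  have "mat_norm d X \<le> norm_const d * mat_norm d A * mat_norm d B"
    unfolding X(1) by (rule mat_norm_mult[OF d AB])
  also have "\<dots> \<le> norm_const d * ?e m * ?e n"
    using mat_norm_le_entry_norm[OF X(2)] mat_norm_le_entry_norm[OF X(3)] norm_const_ge_one[OF d]
    by (intro mult_mono mult_nonneg_nonneg) auto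
  finally show "mat_norm d X \<le> norm_const d * ?e m * ?e n" .
qed

lemma growth_rate_exists:
  "\<exists>L\<ge>0. (\<lambda>n. log_plus (set_norm K a d (set_power d F n)) / real n) \<longlonglongrightarrow> L"
proof -
  let ?e = "\<lambda>n. entry_norm d (set_power d F n)"
  let ?s = "\<lambda>n. set_norm K a d (set_power d F n)"
  define c where "c = log_plus (norm_const d)"
  note nc = norm_const_ge_one[OF d]
  have "\<exists>L\<ge>0. (\<lambda>n. log_plus (?e n) / real n) \<longlonglongrightarrow> L"
  proof (rule fekete[of _ c])
    fix m n
    have "log_plus (?e (m + n)) \<le> log_plus (norm_const d * ?e m * ?e n)"
      using entry_norm_mult by (intro log_plus_mono) auto
    also have "\<dots> \<le> log_plus (norm_const d * ?e m) + log_plus (?e n)"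
      using nc by (intro log_plus_mult) auto
    also have "log_plus (norm_const d * ?e m) \<le> c + log_plus (?e m)"
      unfolding c_def using nc by (intro log_plus_mult) auto
    finally show "log_plus (?e (m + n)) \<le> log_plus (?e m) + log_plus (?e n) + c" by simp
  qed (auto simp: c_def)
  then obtain L where L: "L \<ge> 0" "(\<lambda>n. log_plus (?e n) / real n) \<longlonglongrightarrow> L" by blast
  have "(\<lambda>n. c / real n) \<longlonglongrightarrow> 0" by real_asymp
  then have up: "(\<lambda>n. log_plus (?e n) / real n + c / real n) \<longlonglongrightarrow> L"
    using tendsto_add[OF L(2)] by fastforce
  have "(\<lambda>n. log_plus (?s n) / real n) \<longlonglongrightarrow> L"
  proof (rule tendsto_sandwich[OF _ _ L(2) up])
    show "eventually (\<lambda>n. log_plus (?e n) / real n \<le> log_plus (?s n) / real n) sequentially"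
      using set_norm_bounds(2) by (intro always_eventually allI divide_right_mono log_plus_mono) auto
    have "log_plus (?s n) \<le> log_plus (?e n) + c" for n
    proof -
      have "log_plus (?s n) \<le> log_plus (norm_const d * ?e n)"
        using set_norm_bounds by (intro log_plus_mono)
      also have "\<dots> \<le> c + log_plus (?e n)"
        unfolding c_def using nc by (intro log_plus_mult) auto
      finally show ?thesis by simp
    qed
    then show "eventually (\<lambda>n. log_plus (?s n) / real n \<le> log_plus (?e n) / real n + c / real n) sequentially"
      by (intro always_eventually allI) (simp add: add_divide_distrib[symmetric] divide_right_mono)
  qed
  then show ?thesis using L(1) by blast
qed

lemma log_plus_set_norm_zero:
  assumes u: "ultrametric K a" and le1: "\<And>f i j. f \<in> F \<Longrightarrow> i < d \<Longrightarrow> j < d \<Longrightarrow> a (f $$ (i, j)) \<le> 1"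
  shows "log_plus (set_norm K a d (set_power d F n)) = 0"
proof -
  have "mat_norm d X \<le> 1" if "X \<in> set_power d F n" for X n
    using that
  proof (induction n arbitrary: X)
    case 0
    then show ?case by (intro mat_norm_leI) auto
  next
    case (Suc n)
    then obtain A B where X: "X = A * B" "A \<in> F" "B \<in> set_power d F n" by auto
    then have "mat_norm d X \<le> norm_const d * mat_norm d A * mat_norm d B"
      using F(2) power_mats by (auto intro!: mat_norm_mult[OF d])
    also have "\<dots> \<le> 1 * 1 * 1"
      using Suc.IH[OF X(3)] le1[OF X(2)] u
      by (intro mult_mono) (auto simp: norm_const_def intro: mat_norm_leI)
    finally show ?case by simp
  qed
  then have "entry_norm d (set_power d F n) \<le> 1" by (intro entry_norm_leI) auto
  then have "set_norm K a d (set_power d F n) \<le> 1"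
    using set_norm_bounds(3)[of n] u by (simp add: norm_const_def)
  then show ?thesis using set_norm_bounds(1) by (intro log_plus_eq_0)
qed

lemma vanishing_growth_entries:
  assumes lim: "(\<lambda>n. log_plus (set_norm K a d (set_power d F n)) / real n) \<longlonglongrightarrow> 0" and \<epsilon>: "\<epsilon> > 0"
  shows "\<exists>N. \<forall>m\<ge>N. \<forall>X\<in>set_power d F m. \<forall>i<d. \<forall>j<d. a (X $$ (i, j)) \<le> exp (\<epsilon> * real m)"
proof -
  obtain N where N: "\<And>m. m \<ge> N \<Longrightarrow> log_plus (set_norm K a d (set_power d F m)) / real m < \<epsilon>"
    using order_tendstoD(2)[OF lim \<epsilon>] by (auto simp: eventually_sequentially)
  have "a (X $$ (i, j)) \<le> exp (\<epsilon> * real m)"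
    if m: "m \<ge> Suc N" and X: "X \<in> set_power d F m" and ij: "i < d" "j < d" for m X i j
  proof -
    have "a (X $$ (i, j)) \<le> set_norm K a d (set_power d F m)"
      using entry_le_mat_norm[OF ij, of X] mat_norm_le_entry_norm[OF X] set_norm_bounds(2)[of m] by linarith
    also have "\<dots> \<le> exp (log_plus (set_norm K a d (set_power d F m)))"
      by (intro log_plus_exp set_norm_bounds)
    also have "\<dots> \<le> exp (\<epsilon> * real m)"
      using N[of m] m by (simp add: field_simps)
    finally show ?thesis .
  qed
  then show ?thesis by blast
qed

lemma growth_rate_le:
  assumes lim: "(\<lambda>n. log_plus (set_norm K a d (set_power d F n)) / real n) \<longlonglongrightarrow> L"
    and \<delta>: "\<delta> > 0" and B: "B \<ge> 1"
    and le: "\<And>n X. X \<in> set_power d F n \<Longrightarrow> mat_norm d X \<le> B * (1 + \<delta>) ^ n"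
  shows "L \<le> ln (1 + \<delta>)"
proof -
  define c where "c = ln (norm_const d * B)"
  have nB: "norm_const d * B \<ge> 1"
    using norm_const_ge_one[OF d] B mult_mono[of 1 "norm_const d" 1 B] by simp
  have bound: "log_plus (set_norm K a d (set_power d F n)) / real n \<le> c / real n + ln (1 + \<delta>)" if n: "n \<ge> 1" for n
  proof -
    have "entry_norm d (set_power d F n) \<le> B * (1 + \<delta>) ^ n"
      using B \<delta> le by (intro entry_norm_leI) auto
    then have "norm_const d * entry_norm d (set_power d F n) \<le> norm_const d * (B * (1 + \<delta>) ^ n)"
      using norm_const_ge_one[OF d] by (intro mult_left_mono) auto
    then have "set_norm K a d (set_power d F n) \<le> norm_const d * B * (1 + \<delta>) ^ n"
      using set_norm_bounds(3)[of n] by (simp add: mult.assoc)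
    also have "\<dots> = exp (c + real n * ln (1 + \<delta>))"
      using nB \<delta> by (simp add: c_def exp_add exp_of_nat_mult)
    finally have "log_plus (set_norm K a d (set_power d F n)) \<le> c + real n * ln (1 + \<delta>)"
      using nB \<delta> set_norm_bounds(1)[of n] by (subst log_plus_le_iff) (auto simp: c_def)
    then have "log_plus (set_norm K a d (set_power d F n)) / real n \<le> (c + real n * ln (1 + \<delta>)) / real n"
      by (rule divide_right_mono) simp
    then show ?thesis using n by (simp add: add_divide_distrib)
  qed
  have "(\<lambda>n. c / real n + ln (1 + \<delta>)) \<longlonglongrightarrow> ln (1 + \<delta>)" by real_asymp
  then show ?thesis
    using bound by (intro tendsto_le[OF _ _ lim]) (auto simp: eventually_sequentially)
qed

end

end

lemma (in complex_subfield) det_in: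
  assumes "A \<in> carrier_mat n n" "\<And>i j. i < n \<Longrightarrow> j < n \<Longrightarrow> A $$ (i, j) \<in> K"
  shows "det A \<in> K"
proof -
  have "signof p * (\<Prod>i = 0..<n. A $$ (i, p i)) \<in> K" if p: "p permutes {0..<n}" for p
  proof -
    have "A $$ (i, p i) \<in> K" if "i \<in> {0..<n}" for i
      using permutes_in_image[OF p, of i] that assms(2)[of i "p i"] by simp
    then have "(\<Prod>i = 0..<n. A $$ (i, p i)) \<in> K" by (rule prod)
    then show ?thesis by (cases p rule: sign_cases) auto
  qed
  then show ?thesis unfolding det_def'[OF assms(1)] by (intro sum) auto
qed

lemma (in complex_subfield) inverse_mats:
  assumes A: "A \<in> mats n K" and B: "B \<in> carrier_mat n n" and AB: "A * B = 1\<^sub>m n" and BA: "B * A = 1\<^sub>m n"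
  shows "B \<in> mats n K"
proof -
  have Ac: "A \<in> carrier_mat n n" using A by (rule mats_subset_carrier)
  have detA: "det A \<in> K" using Ac mats_entry[OF A] by (rule det_in)
  have "det A * det B = 1" using det_mult[OF Ac B] AB by simp
  then have nz: "det A \<noteq> 0" by auto
  note adj = adj_mat[OF Ac]
  have "adj_mat A = B * A * adj_mat A" using adj(1) BA by simp
  also have "\<dots> = B * (det A \<cdot>\<^sub>m 1\<^sub>m n)" using assoc_mult_mat[OF B Ac adj(1)] adj(2) by simp
  also have "\<dots> = det A \<cdot>\<^sub>m B" using mult_smult_distrib[OF B one_carrier_mat, of "det A"] B by simp
  finally have eq: "adj_mat A = det A \<cdot>\<^sub>m B" .
  show ?thesis
  proof (rule matsI[OF B])
    fix i j assume ij: "i < n" "j < n"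
    have "mat_delete A j i \<in> carrier_mat (n - 1) (n - 1)" using Ac by (auto intro: mat_delete_carrier)
    moreover have "mat_delete A j i $$ (k, l) \<in> K" if "k < n - 1" "l < n - 1" for k l
      using that ij Ac by (auto simp: mat_delete_def intro!: mats_entry[OF A])
    ultimately have "det (mat_delete A j i) \<in> K" by (rule det_in)
    then have "adj_mat A $$ (i, j) \<in> K" using ij Ac by (simp add: adj_mat_def cofactor_def)
    then have "det A * B $$ (i, j) \<in> K" using ij B eq by simp
    then have "(det A * B $$ (i, j)) / det A \<in> K" using detA by (rule divide)
    then show "B $$ (i, j) \<in> K" using nz by simp
  qed
qed

lemma (in valued_subfield) generate_mats:
  assumes F: "F \<subseteq> carrier (GL d UNIV)" "F \<subseteq> mats d K"
  shows "generate (GL d UNIV) F \<subseteq> mats d K"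
proof
  fix g assume "g \<in> generate (GL d UNIV) F"
  then show "g \<in> mats d K"
  proof induction
    case one
    then show ?case using mats_one by (simp add: GL_def units_of_def)
  next
    case (incl h)
    then show ?case using F by blast
  next
    case (inv h)
    then have "h \<in> carrier (GL d UNIV)" "h \<in> mats d K" using F by auto
    then obtain B where B: "B \<in> carrier_mat d d" "B * h = 1\<^sub>m d" "h * B = 1\<^sub>m d"
      by (auto simp: mem_GL_UNIV)
    have "B \<in> mats d UNIV" using B(1) by (simp add: mats_def)
    then have "inv\<^bsub>GL d UNIV\<^esub> h = B" using B \<open>h \<in> carrier (GL d UNIV)\<close> by (intro GL_inv)
    then show ?case using inverse_mats[OF \<open>h \<in> mats d K\<close> B(1,3,2)] by simp
  next
    case (eng g h)
    then show ?case using mats_mult by (simp add: GL_def units_of_def)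
  qed
qed

section \<open>The normalized height\<close>

lemma standard_abs_valued_subfield:
  assumes "number_field K" "a \<in> standard_abs K"
  shows "valued_subfield K a"
proof -
  interpret complex_subfield K
    using assms by (auto simp: number_field_def intro: complex_subfieldI)
  show ?thesis using assms(2) by unfold_locales (simp add: standard_abs_def)
qed

lemma number_field_dim_pos: "number_field K \<Longrightarrow> ring.dim \<CC> \<rat> K > 0"
  by (rule number_field_basis) auto

lemma height_eq_finite_sum:
  assumes K: "number_field K" and d: "d \<ge> 1" and F: "finite F" "F \<subseteq> mats d K"
  obtains P where "finite P" "P \<subseteq> standard_abs K"
    and "\<And>a n. a \<in> standard_abs K - P \<Longrightarrow> log_plus (set_norm K a d (set_power d F n)) = 0"
    and "\<And>n. height K d (set_power d F n) = 1 / real (ring.dim \<CC> \<rat> K) *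
      (\<Sum>a\<in>P. real (local_degree K a) * log_plus (set_norm K a d (set_power d F n)))"
proof -
  interpret complex_subfield K
    using K by (auto simp: number_field_def intro: complex_subfieldI)
  define P where "P = {a \<in> standard_abs K. \<forall>q. a (of_rat q) = \<bar>of_rat q\<bar>} \<union>
    (\<Union>(f, i, j)\<in>F \<times> {..<d} \<times> {..<d}. {a \<in> standard_abs K. a (f $$ (i, j)) > 1})"
  have finP: "finite P"
    unfolding P_def
  proof (rule finite_UnI[OF finite_archimedean[OF K]], rule finite_UN_I)
    show "finite (F \<times> {..<d} \<times> {..<d})" using F by simp
    fix x assume "x \<in> F \<times> {..<d} \<times> {..<d}"
    then obtain f i j where x: "x = (f, i, j)" "f \<in> F" "i < d" "j < d" by auto
    then have "f $$ (i, j) \<in> K" using F(2) mats_entry by blast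
    then show "finite (case x of (f, i, j) \<Rightarrow> {a \<in> standard_abs K. a (f $$ (i, j)) > 1})"
      using finite_standard_abs_gt_one[OF K] x(1) by simp
  qed
  have PS: "P \<subseteq> standard_abs K" by (auto simp: P_def)
  have zero: "log_plus (set_norm K a d (set_power d F n)) = 0" if a: "a \<in> standard_abs K - P" for a n
  proof -
    interpret A: valued_subfield K a using standard_abs_valued_subfield[OF K] a by blast
    have "a \<in> standard_abs K" using a by blast
    then have "ultrametric K a"
    proof (cases rule: standard_abs_cases)
      case arch
      then show ?thesis using a by (auto simp: P_def)
    next
      case (padic p)
      then show ?thesis using A.standard_padic_ultrametric by blast
    qed
    moreover have "a (f $$ (i, j)) \<le> 1" if "f \<in> F" "i < d" "j < d" for f i j
      using a that by (force simp: P_def not_less)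
    ultimately show ?thesis by (intro A.log_plus_set_norm_zero[OF d F])
  qed
  have "height K d (set_power d F n) = 1 / real (ring.dim \<CC> \<rat> K) *
      (\<Sum>a\<in>P. real (local_degree K a) * log_plus (set_norm K a d (set_power d F n)))" for n
  proof -
    let ?f = "\<lambda>a. real (local_degree K a) * log_plus (set_norm K a d (set_power d F n))"
    have "(\<Sum>\<^sub>\<infinity>v\<in>places K. ?f (place_abs v)) = (\<Sum>\<^sub>\<infinity>a\<in>standard_abs K. ?f a)"
      by (rule infsum_reindex_bij_betw[OF bij_betw_place_abs[OF number_field_algebraic[OF K]]])
    also have "\<dots> = (\<Sum>\<^sub>\<infinity>a\<in>P. ?f a)"
      using PS zero by (intro infsum_cong_neutral) auto
    also have "\<dots> = (\<Sum>a\<in>P. ?f a)" using finP by simp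
    finally show ?thesis by (simp add: height_def)
  qed
  then show thesis using that finP PS zero by blast
qed

lemma normalized_height_eq_0_iff:
  assumes K: "number_field K" and d: "d \<ge> 1" and F: "finite F" "F \<subseteq> mats d K"
  shows "normalized_height K d F = 0 \<longleftrightarrow>
    (\<forall>a\<in>standard_abs K. (\<lambda>n. log_plus (set_norm K a d (set_power d F n)) / real n) \<longlonglongrightarrow> 0)"
proof -
  let ?g = "\<lambda>a n. log_plus (set_norm K a d (set_power d F n))"
  let ?D = "real (ring.dim \<CC> \<rat> K)"
  have "\<exists>L\<ge>0. (\<lambda>n. ?g a n / real n) \<longlonglongrightarrow> L" if "a \<in> standard_abs K" for a
    using valued_subfield.growth_rate_exists[OF standard_abs_valued_subfield[OF K that] d F] .
  then obtain L where L: "\<And>a. a \<in> standard_abs K \<Longrightarrow> L a \<ge> 0"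
    "\<And>a. a \<in> standard_abs K \<Longrightarrow> (\<lambda>n. ?g a n / real n) \<longlonglongrightarrow> L a"
    by metis
  obtain P where P: "finite P" "P \<subseteq> standard_abs K"
    and zero: "\<And>a n. a \<in> standard_abs K - P \<Longrightarrow> ?g a n = 0"
    and height: "\<And>n. height K d (set_power d F n) = 1 / ?D * (\<Sum>a\<in>P. real (local_degree K a) * ?g a n)"
    by (rule height_eq_finite_sum[OF K d F]) blast
  have "(\<lambda>n. 1 / ?D * (\<Sum>a\<in>P. real (local_degree K a) * (?g a n / real n))) \<longlonglongrightarrow>
      1 / ?D * (\<Sum>a\<in>P. real (local_degree K a) * L a)"
    using L(2) P(2) by (intro tendsto_intros) auto
  moreover have "1 / ?D * (\<Sum>a\<in>P. real (local_degree K a) * (?g a n / real n)) =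
      height K d (set_power d F n) / real n" for n
    by (simp add: height sum_divide_distrib mult.commute)
  ultimately have "normalized_height K d F = 1 / ?D * (\<Sum>a\<in>P. real (local_degree K a) * L a)"
    unfolding normalized_height_def by (auto intro: limI)
  then have "normalized_height K d F = 0 \<longleftrightarrow> (\<Sum>a\<in>P. real (local_degree K a) * L a) = 0"
    using number_field_dim_pos[OF K] by simp
  also have "\<dots> \<longleftrightarrow> (\<forall>a\<in>P. real (local_degree K a) * L a = 0)"
    using P L(1) by (intro sum_nonneg_eq_0_iff) auto
  also have "\<dots> \<longleftrightarrow> (\<forall>a\<in>P. L a = 0)"
  proof (rule ball_cong)
    fix a assume "a \<in> P"
    then have "local_degree K a > 0"
      using valued_subfield.local_degree_pos[OF standard_abs_valued_subfield[OF K] K] P(2) by blast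
    then show "real (local_degree K a) * L a = 0 \<longleftrightarrow> L a = 0" by simp
  qed simp
  also have "\<dots> \<longleftrightarrow> (\<forall>a\<in>standard_abs K. (\<lambda>n. ?g a n / real n) \<longlonglongrightarrow> 0)"
  proof
    assume L0: "\<forall>a\<in>P. L a = 0"
    show "\<forall>a\<in>standard_abs K. (\<lambda>n. ?g a n / real n) \<longlonglongrightarrow> 0"
    proof
      fix a assume a: "a \<in> standard_abs K"
      show "(\<lambda>n. ?g a n / real n) \<longlonglongrightarrow> 0"
      proof (cases "a \<in> P")
        case True
        then show ?thesis using L(2)[OF a] L0 by simp
      next
        case False
        then show ?thesis using zero[of a] a by simp
      qed
    qed
  next
    assume "\<forall>a\<in>standard_abs K. (\<lambda>n. ?g a n / real n) \<longlonglongrightarrow> 0"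
    then show "\<forall>a\<in>P. L a = 0" using L(2) P(2) LIMSEQ_unique by blast
  qed
  finally show ?thesis .
qed

lemma virtually_unipotent_imp_growth_zero:
  assumes K: "number_field K" and d: "d \<ge> 1" and F: "finite F" "F \<subseteq> mats d K" "F \<subseteq> carrier (GL d UNIV)"
    and vu: "virtually_unipotent d UNIV (generate (GL d UNIV) F)" and a: "a \<in> standard_abs K"
  shows "(\<lambda>n. log_plus (set_norm K a d (set_power d F n)) / real n) \<longlonglongrightarrow> 0"
proof -
  interpret valued_subfield K a by (rule standard_abs_valued_subfield[OF K a])
  obtain T E where fin: "finite T" "finite E" and sub: "T \<subseteq> generate (GL d UNIV) F" "E \<subseteq> generate (GL d UNIV) F"
    and nil: "\<And>xs. set xs \<subseteq> (\<lambda>h. h - 1\<^sub>m d) ` E \<Longrightarrow> length xs = d \<Longrightarrow> mat_prod d xs = 0\<^sub>m d d"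
    and fac: "\<And>n g. g \<in> set_power d F n \<Longrightarrow>
      \<exists>hs c. length hs = n \<and> set hs \<subseteq> E \<and> c \<in> T \<and> g = mat_prod d hs * c"
    by (rule virtually_unipotent_factorization[OF F(3,1) vu]) blast
  have TE: "T \<subseteq> mats d K" "E \<subseteq> mats d K" using sub generate_mats[OF F(3,2)] by auto
  obtain L where L: "L \<ge> 0" "(\<lambda>n. log_plus (set_norm K a d (set_power d F n)) / real n) \<longlonglongrightarrow> L"
    using growth_rate_exists[OF d F(1,2)] by blast
  have "L \<le> \<delta>" if \<delta>: "\<delta> > 0" for \<delta>
  proof -
    obtain B where B: "B \<ge> 1"
      "\<And>hs c. set hs \<subseteq> E \<Longrightarrow> c \<in> T \<Longrightarrow> mat_norm d (mat_prod d hs * c) \<le> B * (1 + \<delta>) ^ length hs"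
      by (rule unipotent_product_growth[OF d fin(2) TE(2) fin(1) TE(1) nil \<delta>]) blast+
    have "mat_norm d X \<le> B * (1 + \<delta>) ^ n" if X: "X \<in> set_power d F n" for n X
      using fac[OF X] B(2) by auto
    then have "L \<le> ln (1 + \<delta>)" by (rule growth_rate_le[OF d F(1,2) L(2) \<delta> B(1)])
    also have "\<dots> \<le> \<delta>" using \<delta> by (intro ln_add_one_self_le_self) simp
    finally show ?thesis .
  qed
  then have "L \<le> 0" by (rule field_le_epsilon[of L 0, simplified])
  then show ?thesis using L by simp
qed

theorem proposition3p2:
  fixes d :: nat and F :: "complex mat set" and K :: "complex set"
  assumes "d \<ge> 1"
    and "finite F"
    and "F \<subseteq> carrier (GL d Qbar)"
    and "number_field K"
    and "F \<subseteq> mats d K"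
  shows "normalized_height K d F = 0 \<longleftrightarrow>
    virtually_unipotent d Qbar (generate (GL d Qbar) F)"
proof -
  note d = assms(1) and K = assms(4) and F = assms(2,5)
  have FG: "F \<subseteq> carrier (GL d UNIV)" using assms(3) carrier_GL_mono[of Qbar UNIV d] by blast
  have "normalized_height K d F = 0 \<longleftrightarrow> virtually_unipotent d UNIV (generate (GL d UNIV) F)"
  proof
    assume "normalized_height K d F = 0"
    then have lim: "(\<lambda>n. log_plus (set_norm K a d (set_power d F n)) / real n) \<longlonglongrightarrow> 0"
      if "a \<in> standard_abs K" for a
      using that normalized_height_eq_0_iff[OF K d F] by blast
    have "subexponential K d (set_power d F)"
      unfolding subexponential_def
    proof (intro ballI allI impI)
      fix a and \<epsilon> :: real assume a: "a \<in> standard_abs K" and \<epsilon>: "\<epsilon> > 0"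
      show "\<exists>N. \<forall>m\<ge>N. \<forall>s\<in>set_power d F m. \<forall>i<d. \<forall>j<d. a (s $$ (i, j)) \<le> exp (\<epsilon> * real m)"
        by (rule valued_subfield.vanishing_growth_entries[OF standard_abs_valued_subfield[OF K a] d F lim[OF a] \<epsilon>])
    qed
    then show "virtually_unipotent d UNIV (generate (GL d UNIV) F)"
      using finite_traces[OF K F(2)] by (intro finite_traces_imp_virtually_unipotent[OF FG])
  next
    assume "virtually_unipotent d UNIV (generate (GL d UNIV) F)"
    then show "normalized_height K d F = 0"
      using normalized_height_eq_0_iff[OF K d F] virtually_unipotent_imp_growth_zero[OF K d F FG] by blast
  qed
  then show ?thesis
    by (simp add: virtually_unipotent_UNIV[of d Qbar] generate_GL_UNIV[OF assms(3)])
qed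

end
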